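(* Let $a\in C^\infty(\mathbb S)$ be positive with $\int_0^{2\pi}a^{-1}d\theta=2\pi$, and let $\alpha\in C^\infty([0,\infty),C^\infty(\mathbb S))$ with $\alpha_0=a$, every $\alpha_\tau$ positive, solve $\frac{\partial\alpha_\tau}{\partial\tau}=-\alpha_\tau(\Lambda\alpha_\tau)+(\mathcal H\alpha_\tau)(D\alpha_\tau)$ for $\tau\ge0$. Let $c=\{c_k\}_{k\ge0}$ be positive reals with $c_0\ge\hat a_0$, $c_1\ge\zeta_a(-1)$, $c_{m+1}\ge\zeta_a(-2m)$ ($m\ge1$). Then: (1) for all $k,m\in\mathbb N$, $\sup_{\tau\in[0,\infty)}\big\|\partial^k\alpha_\tau/\partial\tau^k\big\|_{C^m(\mathbb S)}\le C_{k,m}$ with a constant $C_{k,m}$ depending only on $k,m$ and $c_0,\dots,c_{k+m+2}$; (2) $\alpha_\tau\to\mathbf 1$ in $C^\infty(\mathbb S)$ as $\tau\to+\infty$.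
   Context: $u=\sum\hat u_ke^{ik\theta}$. $D=-i\,d/d\theta$, $\Lambda e^{in\theta}=|n|e^{in\theta}$, $\mathcal H\mathbf 1=0$, $\mathcal He^{in\theta}=\mathrm{sgn}(n)e^{in\theta}$ ($n\ne0$). For positive $b$ with $\int b^{-1}=2\pi$, $\zeta_b$ is the meromorphic continuation of $\sum_{k\ge1}\lambda_k(b)^{-s}$ ($\Re s>1$) over the positive eigenvalues $\lambda_k(b)$ of $b^{1/2}\Lambda b^{1/2}$. $\mathbf 1$ is the constant function $1$; $C^\infty(\mathbb S)$ carries its Fréchet topology. *)

theory Defs
  imports "HOL-Complex_Analysis.Complex_Analysis"
begin

text \<open>Functions on the circle S are represented as 2pi-periodic functions real => real.\<close>

definition smooth_S :: "(real \<Rightarrow> real) \<Rightarrow> bool" where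
  "smooth_S f \<longleftrightarrow> (\<forall>x. f (x + 2*pi) = f x) \<and>
     (\<forall>j x. ((deriv ^^ j) f) differentiable (at x))"

definition Cm_norm :: "nat \<Rightarrow> (real \<Rightarrow> real) \<Rightarrow> real" where
  "Cm_norm m f = (\<Sum>j\<le>m. (SUP x\<in>{0..2*pi}. \<bar>(deriv ^^ j) f x\<bar>))"

definition fcoeff :: "(real \<Rightarrow> real) \<Rightarrow> int \<Rightarrow> complex" where
  "fcoeff u k = integral {0..2*pi} (\<lambda>t. complex_of_real (u t) * cis (- (of_int k * t))) / (2 * pi)"

text \<open>Fourier multipliers: D = -i d/dtheta, Lambda = |D|, Hilbert transform H.\<close>
definition Dop :: "(real \<Rightarrow> real) \<Rightarrow> real \<Rightarrow> complex" where
  "Dop u t = infsum (\<lambda>k::int. of_int k * fcoeff u k * cis (of_int k * t)) UNIV"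

definition Lambda :: "(real \<Rightarrow> real) \<Rightarrow> real \<Rightarrow> complex" where
  "Lambda u t = infsum (\<lambda>k::int. of_int \<bar>k\<bar> * fcoeff u k * cis (of_int k * t)) UNIV"

definition Hilb :: "(real \<Rightarrow> real) \<Rightarrow> real \<Rightarrow> complex" where
  "Hilb u t = infsum (\<lambda>k::int. of_int (sgn k) * fcoeff u k * cis (of_int k * t)) UNIV"

text \<open>Eigenfunctions of b^{1/2} Lambda b^{1/2} (smooth by ellipticity).\<close>
definition eigfun :: "(real \<Rightarrow> real) \<Rightarrow> real \<Rightarrow> (real \<Rightarrow> real) \<Rightarrow> bool" where
  "eigfun b l u \<longleftrightarrow> smooth_S u \<and> (\<exists>t. u t \<noteq> 0) \<and>
     (\<forall>t. complex_of_real (sqrt (b t)) * Lambda (\<lambda>x. sqrt (b x) * u x) t = complex_of_real (l * u t))"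

definition lin_indep_fun :: "nat \<Rightarrow> (nat \<Rightarrow> real \<Rightarrow> real) \<Rightarrow> bool" where
  "lin_indep_fun n u \<longleftrightarrow> (\<forall>c::nat\<Rightarrow>real. (\<forall>t. (\<Sum>i<n. c i * u i t) = 0) \<longrightarrow> (\<forall>i<n. c i = 0))"

definition eig_mult :: "(real \<Rightarrow> real) \<Rightarrow> real \<Rightarrow> nat" where
  "eig_mult b l = (GREATEST n. \<exists>u. (\<forall>i<n. eigfun b l (u i)) \<and> lin_indep_fun n u)"

definition is_eig :: "(real \<Rightarrow> real) \<Rightarrow> real \<Rightarrow> bool" where
  "is_eig b l \<longleftrightarrow> (\<exists>u. eigfun b l u)"

definition zeta_series :: "(real \<Rightarrow> real) \<Rightarrow> complex \<Rightarrow> complex" where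
  "zeta_series b s = infsum (\<lambda>l. of_nat (eig_mult b l) * (complex_of_real l) powr (- s))
                        {l. l > 0 \<and> is_eig b l}"

text \<open>Value at s0 of the (meromorphic) continuation of zeta_series from Re s > 1:
  the value at s0 of any holomorphic function on a connected open set containing
  the half plane and s0 that agrees with the series on the half plane.\<close>
definition zeta :: "(real \<Rightarrow> real) \<Rightarrow> complex \<Rightarrow> complex" where
  "zeta b s0 = (THE z. \<exists>U f. open U \<and> connected U \<and> {s. Re s > 1} \<subseteq> U \<and> s0 \<in> U \<and>
       f holomorphic_on U \<and> (\<forall>s. Re s > 1 \<longrightarrow> f s = zeta_series b s) \<and> f s0 = z)"

text \<open>alpha in C^infty([0,infty), C^infty(S)), with dalpha k the k-th tau-derivative:
  each dalpha k tau is smooth on S and difference quotients converge in every C^m norm.\<close>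
definition tau_derivs :: "(real \<Rightarrow> real \<Rightarrow> real) \<Rightarrow> (nat \<Rightarrow> real \<Rightarrow> real \<Rightarrow> real) \<Rightarrow> bool" where
  "tau_derivs alpha dalpha \<longleftrightarrow> dalpha 0 = alpha \<and>
     (\<forall>k \<tau>. \<tau> \<ge> 0 \<longrightarrow> smooth_S (dalpha k \<tau>)) \<and>
     (\<forall>k m \<tau>. \<tau> \<ge> 0 \<longrightarrow>
        ((\<lambda>h. Cm_norm m (\<lambda>t. (dalpha k (\<tau> + h) t - dalpha k \<tau> t) / h - dalpha (Suc k) \<tau> t))
          \<longlongrightarrow> 0) (at 0 within {h. \<tau> + h \<ge> 0}))"

end

theory Submission
 imports Defs "HOL-Library.Real_Mod"
begin

text \<open>
 Let \<open>s' = \<rho> = 1/a\<close>. In the orthonormal basis \<open>e\<^sub>n = cis (n * s)\<close> of \<open>L\<^sup>2(\<rho> dt)\<close> the operator \<open>a\<Lambda>\<close> is \<open>|n|\<close> plus a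
 rapidly decaying matrix, so its eigenvalues are rapidly close to the integers \<open>0,1,1,2,2,...\<close>. As \<open>\<zeta>\<^sub>R(-2m) = 0\<close>, the value
 \<open>\<zeta>\<^sub>a(-2m)\<close> is the sum of the differences of the \<open>2m\<close>-th powers, and convexity of \<open>x\<^sup>m\<close> bounds it from below by
 \<open>2m\<close> times the sum over \<open>n \<ge> 1\<close> of \<open>n\<^bsup>2m-2\<^esup> (\<parallel>a\<Lambda>e\<^sub>n\<parallel>\<^sup>2 - n\<^sup>2)\<close>. For \<open>m = 1\<close> this sum equals a multiple of the
 sum of \<open>jk |a\<^bsub>j+k\<^esub>|\<^sup>2\<close> over \<open>j, k \<ge> 1\<close>, hence controls \<open>a\<close> in \<open>H\<^bsup>3/2\<^esup>\<close> and, by an Osgood argument and \<open>\<integral>1/a = 2\<pi>\<close>, also \<open>min a\<close>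
 from below; with that, \<open>m \<ge> 2\<close> controls \<open>a\<close> in \<open>H\<^bsup>m+1/2\<^esup>\<close> inductively.

 The flow preserves \<open>\<integral>1/\<alpha>\<close>. In Fourier coefficients, the energy with weights \<open>(4n\<^sup>3 - n) n\<^bsup>2N\<^esup>\<close> is dissipated at a rate
 given by a kernel that is a sum of rank one kernels times the Toeplitz matrix of \<open>\<alpha>\<close>; so it decays like
 \<open>exp (- 2 \<delta> \<tau>)\<close> with \<open>\<delta>\<close> a lower bound of \<open>\<alpha>\<close>. Thus all bounds hold uniformly in \<open>\<tau>\<close>, and \<open>\<alpha>\<close> converges to
 a constant, which is 1. Time derivatives are estimated by the Leibniz rule in Wiener norms.\<close>

section \<open>Smooth functions on the circle\<close>

definition vder :: "(real \<Rightarrow> 'a::real_normed_vector) \<Rightarrow> real \<Rightarrow> 'a" where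
 "vder f = (\<lambda>t. vector_derivative f (at t))"

definition smooth :: "(real \<Rightarrow> 'a::real_normed_vector) \<Rightarrow> bool" where
 "smooth f \<longleftrightarrow> (\<forall>j t. (vder ^^ j) f differentiable (at t))"

lemma vder_eqI: "(\<And>t. (f has_vector_derivative f' t) (at t)) \<Longrightarrow> vder f = f'"
 by (auto simp: vder_def fun_eq_iff vector_derivative_at)

lemma vders_Suc: "(vder ^^ Suc j) f = (vder ^^ j) (vder f)"
 by (simp add: funpow_Suc_right del: funpow.simps)

lemma has_vector_derivative_iff_quotient:
 "(f has_vector_derivative D) (at t within S) \<longleftrightarrow> ((\<lambda>x. (f x - f t) /\<^sub>R (x - t)) \<longlongrightarrow> D) (at t within S)"
proof -
 have "norm (((f x - f t) - (x - t) *\<^sub>R D) /\<^sub>R norm (x - t)) = norm ((f x - f t) /\<^sub>R (x - t) - D)" if "x \<noteq> t" for x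
 proof -
  have "(f x - f t) /\<^sub>R (x - t) - D = ((f x - f t) - (x - t) *\<^sub>R D) /\<^sub>R (x - t)"
   using that by (simp add: scaleR_diff_right)
  thus ?thesis by simp
 qed
 hence "((\<lambda>x. norm (((f x - f t) - (x - t) *\<^sub>R D) /\<^sub>R norm (x - t))) \<longlongrightarrow> 0) (at t within S)
  \<longleftrightarrow> ((\<lambda>x. norm ((f x - f t) /\<^sub>R (x - t) - D)) \<longlongrightarrow> 0) (at t within S)"
  by (intro tendsto_cong eventually_at_filter[THEN iffD2] always_eventually) auto
 thus ?thesis unfolding has_vector_derivative_def has_derivative_at_within tendsto_norm_zero_iff
  by (simp add: bounded_linear_scaleR_left LIM_zero_iff)
qed

lemma smooth_coinduct:
 assumes "P f" and step: "\<And>f. P f \<Longrightarrow> \<exists>f'. P f' \<and> (\<forall>t. (f has_vector_derivative f' t) (at t))"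
 shows "smooth f"
proof -
 have "P ((vder ^^ j) f)" for j
 proof (induction j)
  case (Suc j)
  thus ?case using step[OF Suc] vder_eqI by (metis comp_apply funpow.simps(2))
 qed (use assms in simp)
 thus ?thesis unfolding smooth_def using step differentiableI_vector by blast
qed

lemma smooth_has_vder: "smooth f \<Longrightarrow> (f has_vector_derivative vder f t) (at t)"
 unfolding smooth_def vder_def by (metis funpow_0 vector_derivative_works)

lemma smooth_vder: "smooth f \<Longrightarrow> smooth (vder f)"
 unfolding smooth_def by (metis comp_apply funpow_Suc_right)

lemma smooth_vders: "smooth f \<Longrightarrow> smooth ((vder ^^ j) f)"
 by (induction j) (auto intro: smooth_vder)

lemma smoothI:
 assumes "\<And>t. (f has_vector_derivative f' t) (at t)" "smooth f'"
 shows "smooth f"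
 by (rule smooth_coinduct[of "\<lambda>g. smooth g \<or> g = f"]) (use assms smooth_has_vder smooth_vder in blast)+

lemma smooth_cont: "smooth f \<Longrightarrow> continuous_on S f"
 by (meson continuous_at_imp_continuous_on has_vector_derivative_continuous smooth_has_vder)

lemma smooth_bounded_linear:
 assumes "bounded_linear L" "smooth f"
 shows "smooth (\<lambda>t. L (f t))" "vder (\<lambda>t. L (f t)) = (\<lambda>t. L (vder f t))"
proof -
 have deriv: "((\<lambda>t. L (g t)) has_vector_derivative L (vder g t)) (at t)" if "smooth g" for g t
  using bounded_linear.has_vector_derivative[OF assms(1) smooth_has_vder[OF that]] .
 show "smooth (\<lambda>t. L (f t))"
  by (rule smooth_coinduct[of "\<lambda>h. \<exists>g. smooth g \<and> h = (\<lambda>t. L (g t))"])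
   (use assms deriv smooth_vder in blast)+
 show "vder (\<lambda>t. L (f t)) = (\<lambda>t. L (vder f t))" by (rule vder_eqI) (rule deriv[OF assms(2)])
qed

lemma vders_bounded_linear:
 assumes "bounded_linear L" "smooth f"
 shows "(vder ^^ j) (\<lambda>t. L (f t)) = (\<lambda>t. L ((vder ^^ j) f t))"
 by (induction j) (auto simp: smooth_bounded_linear(2)[OF assms(1) smooth_vders[OF assms(2)]])

text \<open>Smoothness up to closure: if every member of \<open>B\<close> has a derivative that is built from
 members of \<open>B\<close> by ring operations, exponentials and powers, then everything so built is smooth.\<close>

inductive smooth_closure :: "(real \<Rightarrow> complex) set \<Rightarrow> (real \<Rightarrow> complex) \<Rightarrow> bool" for B where
 base: "f \<in> B \<Longrightarrow> smooth_closure B f"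
| const: "smooth_closure B (\<lambda>_. c)"
| add: "smooth_closure B f \<Longrightarrow> smooth_closure B g \<Longrightarrow> smooth_closure B (\<lambda>t. f t + g t)"
| mult: "smooth_closure B f \<Longrightarrow> smooth_closure B g \<Longrightarrow> smooth_closure B (\<lambda>t. f t*g t)"
| exp: "smooth_closure B f \<Longrightarrow> smooth_closure B (\<lambda>t. exp (f t))"
| powr: "smooth_closure B f \<Longrightarrow> (\<forall>t. f t \<notin> \<real>\<^sub>\<le>\<^sub>0) \<Longrightarrow> smooth_closure B (\<lambda>t. f t powr c)"

lemma smooth_closure_has_derivative:
 assumes B: "\<And>f. f \<in> B \<Longrightarrow> \<exists>f'. smooth_closure B f' \<and> (\<forall>t. (f has_vector_derivative f' t) (at t))"
  and f: "smooth_closure B f"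
 shows "\<exists>f'. smooth_closure B f' \<and> (\<forall>t. (f has_vector_derivative f' t) (at t))"
 using f
proof induction
 case (base f) thus ?case by (rule B)
next
 case (const c)
 show ?case by (rule exI[of _ "\<lambda>_. 0"]) (auto intro: smooth_closure.const)
next
 case (add f g)
 then obtain f' g' where "smooth_closure B f'" "smooth_closure B g'"
  "\<And>t. (f has_vector_derivative f' t) (at t)" "\<And>t. (g has_vector_derivative g' t) (at t)" by blast
 thus ?case by (intro exI[of _ "\<lambda>t. f' t + g' t"]) (auto intro: smooth_closure.add has_vector_derivative_add)
next
 case (mult f g)
 then obtain f' g' where "smooth_closure B f'" "smooth_closure B g'"
  "\<And>t. (f has_vector_derivative f' t) (at t)" "\<And>t. (g has_vector_derivative g' t) (at t)" by blast
 thus ?case by (intro exI[of _ "\<lambda>t. f t*g' t + f' t*g t"])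
   (auto intro!: smooth_closure.add smooth_closure.mult has_vector_derivative_mult mult.hyps)
next
 case (exp f)
 then obtain f' where f': "smooth_closure B f'" "\<And>t. (f has_vector_derivative f' t) (at t)" by blast
 have "((\<lambda>t. exp (f t)) has_vector_derivative f' t*exp (f t)) (at t)" for t
  using field_vector_diff_chain_at[OF f'(2) DERIV_exp] by (simp add: o_def)
 thus ?case using f' exp
  by (intro exI[of _ "\<lambda>t. f' t*exp (f t)"]) (auto intro: smooth_closure.mult smooth_closure.exp)
next
 case (powr f c)
 then obtain f' where f': "smooth_closure B f'" "\<And>t. (f has_vector_derivative f' t) (at t)" by blast
 have "((\<lambda>t. f t powr c) has_vector_derivative f' t*(c*f t powr (c - 1))) (at t)" for t
  using field_vector_diff_chain_at[OF f'(2) has_field_derivative_powr] powr by (simp add: o_def)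
 thus ?case using f' powr by (intro exI[of _ "\<lambda>t. f' t*(c*f t powr (c - 1))"])
   (auto intro!: smooth_closure.mult smooth_closure.powr smooth_closure.const)
qed

lemma smooth_closure_smooth:
 assumes "\<And>f. f \<in> B \<Longrightarrow> \<exists>f'. smooth_closure B f' \<and> (\<forall>t. (f has_vector_derivative f' t) (at t))"
  and "smooth_closure B f"
 shows "smooth f"
 by (rule smooth_coinduct[of "smooth_closure B", OF assms(2)]) (rule smooth_closure_has_derivative[OF assms(1)])

lemma smooth_closure_Collect: "smooth_closure {f. smooth f} f \<Longrightarrow> smooth f"
 by (rule smooth_closure_smooth[of "{f. smooth f}"])
  (use smooth_has_vder smooth_vder in \<open>blast intro: smooth_closure.base\<close>)+

lemma smooth_const [simp, intro]: "smooth (\<lambda>_. c)"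
 by (rule smooth_coinduct[of "\<lambda>f. \<exists>c. f = (\<lambda>_. c)"]) (auto intro!: exI[of _ "\<lambda>_. 0"])

lemma smooth_complex:
 fixes f g :: "real \<Rightarrow> complex"
 assumes "smooth f"
 shows smooth_mult_complex: "smooth g \<Longrightarrow> smooth (\<lambda>t. f t*g t)"
  and smooth_exp: "smooth (\<lambda>t. exp (f t))"
  and smooth_powr_complex: "(\<And>t. f t \<notin> \<real>\<^sub>\<le>\<^sub>0) \<Longrightarrow> smooth (\<lambda>t. f t powr c)"
 using assms by (auto intro!: smooth_closure_Collect intro: smooth_closure.intros)

lemma smooth_add:
 assumes "smooth f" "smooth g"
 shows "smooth (\<lambda>t. f t + g t)" "vder (\<lambda>t. f t + g t) = (\<lambda>t. vder f t + vder g t)"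
proof -
 show "smooth (\<lambda>t. f t + g t)"
  by (rule smooth_coinduct[of "\<lambda>h. \<exists>f g. smooth f \<and> smooth g \<and> h = (\<lambda>t. f t + g t)"])
   (use assms in \<open>blast intro: smooth_vder has_vector_derivative_add smooth_has_vder\<close>)+
 show "vder (\<lambda>t. f t + g t) = (\<lambda>t. vder f t + vder g t)"
  by (intro vder_eqI has_vector_derivative_add smooth_has_vder assms)
qed

lemma smooth_of_real_iff: "smooth (\<lambda>t. complex_of_real (f t)) \<longleftrightarrow> smooth f"
 using smooth_bounded_linear(1)[OF bounded_linear_Re, of "\<lambda>t. complex_of_real (f t)"]
  smooth_bounded_linear(1)[OF bounded_linear_of_real, of f] by auto

lemma smooth_mult_real:
 fixes f g :: "real \<Rightarrow> real"
 assumes "smooth f" "smooth g" shows "smooth (\<lambda>t. f t*g t)"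
 using smooth_mult_complex[of "\<lambda>t. complex_of_real (f t)" "\<lambda>t. complex_of_real (g t)"] assms
  smooth_of_real_iff[of "\<lambda>t. f t*g t"] by (simp add: smooth_of_real_iff)

lemma smooth_powr_real:
 fixes f :: "real \<Rightarrow> real"
 assumes "smooth f" "\<And>t. f t > 0" shows "smooth (\<lambda>t. f t powr c)"
proof -
 have "smooth (\<lambda>t. complex_of_real (f t) powr of_real c)"
  using assms by (intro smooth_powr_complex) (auto simp: smooth_of_real_iff complex_nonpos_Reals_iff not_le)
 also have "(\<lambda>t. complex_of_real (f t) powr of_real c) = (\<lambda>t. complex_of_real (f t powr c))"
  using assms(2) by (auto simp: powr_of_real less_imp_le)
 finally show ?thesis by (simp only: smooth_of_real_iff)
qed

lemma smooth_cmult: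
 fixes f :: "real \<Rightarrow> complex" assumes "smooth f"
 shows "smooth (\<lambda>t. c * f t)" "vder (\<lambda>t. c * f t) = (\<lambda>t. c * vder f t)"
 using smooth_bounded_linear[OF bounded_linear_mult_right[of c] assms] by auto

lemma smooth_uminus: "smooth f \<Longrightarrow> smooth (\<lambda>t. - f t)"
 using smooth_bounded_linear(1)[OF bounded_linear_minus[OF bounded_linear_ident]] .

lemma smooth_sum:
 assumes "finite A" "\<And>i. i \<in> A \<Longrightarrow> smooth (f i)"
 shows "smooth (\<lambda>t. \<Sum>i\<in>A. f i t)" "vder (\<lambda>t. \<Sum>i\<in>A. f i t) = (\<lambda>t. \<Sum>i\<in>A. vder (f i) t)"
proof -
 have "smooth (\<lambda>t. \<Sum>i\<in>A. f i t) \<and> vder (\<lambda>t. \<Sum>i\<in>A. f i t) = (\<lambda>t. \<Sum>i\<in>A. vder (f i) t)"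
  using assms
 proof (induction A rule: finite_induct)
  case empty
  show ?case using vder_eqI[of "\<lambda>_. 0" "\<lambda>_. 0"] by simp
 qed (simp add: smooth_add)
 thus "smooth (\<lambda>t. \<Sum>i\<in>A. f i t)" "vder (\<lambda>t. \<Sum>i\<in>A. f i t) = (\<lambda>t. \<Sum>i\<in>A. vder (f i) t)" by auto
qed

definition periodic :: "(real \<Rightarrow> 'a) \<Rightarrow> bool" where
 "periodic f \<longleftrightarrow> (\<forall>t. f (t + 2*pi) = f t)"

lemma periodic_vder:
 assumes "periodic f" shows "periodic (vder f)"
proof -
 have "(f has_vector_derivative D) (at (t + 2*pi)) \<longleftrightarrow> (f has_vector_derivative D) (at t)" for D t
 proof -
  have "(f has_vector_derivative D) (at (t + 2*pi)) \<longleftrightarrow> ((\<lambda>x. f (x + 2*pi)) has_vector_derivative D) (at t)"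
   unfolding has_vector_derivative_def has_derivative_at by (simp add: algebra_simps)
  thus ?thesis using assms by (simp add: periodic_def)
 qed
 thus ?thesis by (simp add: periodic_def vder_def vector_derivative_def)
qed

lemma periodic_int:
 assumes "periodic f" shows "f (t + 2*pi * of_int n) = f t"
proof -
 have nat: "f (t + 2*pi * of_nat n) = f t" for n t
 proof (induction n)
  case (Suc n)
  have "f (t + 2*pi * of_nat (Suc n)) = f ((t + 2*pi * of_nat n) + 2*pi)" by (simp add: algebra_simps)
  thus ?case using Suc assms by (simp add: periodic_def)
 qed simp
 show ?thesis using nat[of t "nat n"] nat[of "t + 2*pi * of_int n" "nat (-n)"] by (cases "n \<ge> 0") auto
qed

lemma periodic_reduce:
 obtains x n where "0 \<le> x" "x < 2*pi" "t = x + 2*pi * of_int n"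
proof
 let ?n = "\<lfloor>t/(2*pi)\<rfloor>"
 show "0 \<le> t - 2*pi*?n" "t - 2*pi*?n < 2*pi"
  using floor_divide_lower[of "2*pi" t] floor_divide_upper[of "2*pi" t] by (auto simp: algebra_simps)
 show "t = t - 2*pi*?n + 2*pi*?n" by simp
qed

lemma periodic_bounded:
 fixes f :: "real \<Rightarrow> 'a::real_normed_vector"
 assumes "periodic f" "continuous_on UNIV f"
 obtains B where "B \<ge> 0" "\<And>t. norm (f t) \<le> B"
proof -
 have "compact (f ` {0..2*pi})" by (intro compact_continuous_image compact_Icc continuous_on_subset[OF assms(2)]) auto
 then obtain B where B: "\<And>t. t \<in> {0..2*pi} \<Longrightarrow> norm (f t) \<le> B"
  using compact_imp_bounded bounded_iff by (metis image_eqI)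
 have "norm (f t) \<le> B" for t
  using periodic_reduce[of t] B periodic_int[OF assms(1)] by (metis atLeastAtMost_iff less_imp_le)
 thus ?thesis using that by (metis norm_ge_zero order_trans)
qed

definition circle_smooth :: "(real \<Rightarrow> 'a::real_normed_vector) \<Rightarrow> bool" where
 "circle_smooth f \<longleftrightarrow> smooth f \<and> periodic f"

named_theorems circle_smooth_intros

lemma deriv_eq_vder: "(deriv :: (real \<Rightarrow> real) \<Rightarrow> _) = vder"
 by (auto simp: fun_eq_iff deriv_def vder_def vector_derivative_def has_real_derivative_iff_has_vector_derivative)

lemma smooth_S_iff: "smooth_S f \<longleftrightarrow> circle_smooth f"
 by (auto simp: smooth_S_def circle_smooth_def periodic_def smooth_def deriv_eq_vder)

lemma circle_smoothD: "circle_smooth f \<Longrightarrow> smooth f" "circle_smooth f \<Longrightarrow> periodic f"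
 by (simp_all add: circle_smooth_def)

lemma circle_smooth_cont: "circle_smooth f \<Longrightarrow> continuous_on S f"
 by (simp add: circle_smooth_def smooth_cont)

lemma circle_smooth_bounded:
 assumes "circle_smooth f" obtains B where "B \<ge> 0" "\<And>t. norm (f t) \<le> B"
 using periodic_bounded[OF circle_smoothD(2) circle_smooth_cont] assms by metis

lemma circle_smooth_bounded_linear: "bounded_linear L \<Longrightarrow> circle_smooth f \<Longrightarrow> circle_smooth (\<lambda>t. L (f t))"
 by (simp add: circle_smooth_def periodic_def smooth_bounded_linear)

lemmas circle_smooth_linear_images [circle_smooth_intros] =
 circle_smooth_bounded_linear[OF bounded_linear_Re] circle_smooth_bounded_linear[OF bounded_linear_cnj]

lemma circle_smooth_ops [circle_smooth_intros]:
 shows circle_smooth_const: "circle_smooth (\<lambda>_. c)"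
  and circle_smooth_vder: "circle_smooth f \<Longrightarrow> circle_smooth (vder f)"
  and circle_smooth_vders: "circle_smooth f \<Longrightarrow> circle_smooth ((vder ^^ j) f)"
  and circle_smooth_add: "circle_smooth f \<Longrightarrow> circle_smooth g \<Longrightarrow> circle_smooth (\<lambda>t. f t + g t)"
  and circle_smooth_diff: "circle_smooth f \<Longrightarrow> circle_smooth g \<Longrightarrow> circle_smooth (\<lambda>t. f t - g t)"
  and circle_smooth_sum: "(\<And>i. i \<in> A \<Longrightarrow> circle_smooth (h i)) \<Longrightarrow> circle_smooth (\<lambda>t. \<Sum>i\<in>A. h i t)"
proof -
 show "circle_smooth (\<lambda>_. c)" by (simp add: circle_smooth_def periodic_def)
 show V: "circle_smooth f \<Longrightarrow> circle_smooth (vder f)" for f :: "real \<Rightarrow> 'b"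
  by (simp add: circle_smooth_def smooth_vder periodic_vder)
 show "circle_smooth f \<Longrightarrow> circle_smooth ((vder ^^ j) f)" by (induction j) (auto intro: V)
 show "circle_smooth f \<Longrightarrow> circle_smooth g \<Longrightarrow> circle_smooth (\<lambda>t. f t + g t)"
  by (simp add: circle_smooth_def periodic_def smooth_add)
 show "circle_smooth f \<Longrightarrow> circle_smooth g \<Longrightarrow> circle_smooth (\<lambda>t. f t - g t)"
  using smooth_add(1)[OF _ smooth_uminus, of f g] by (simp add: circle_smooth_def periodic_def)
 show "(\<And>i. i \<in> A \<Longrightarrow> circle_smooth (h i)) \<Longrightarrow> circle_smooth (\<lambda>t. \<Sum>i\<in>A. h i t)"
  by (cases "finite A") (auto simp: circle_smooth_def periodic_def intro!: smooth_sum)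
qed

lemma circle_smooth_mult [circle_smooth_intros]:
 shows circle_smooth_mult_complex: "circle_smooth f \<Longrightarrow> circle_smooth g \<Longrightarrow> circle_smooth (\<lambda>t. f t*g t :: complex)"
  and circle_smooth_mult_real: "circle_smooth f' \<Longrightarrow> circle_smooth g' \<Longrightarrow> circle_smooth (\<lambda>t. f' t*g' t :: real)"
  and circle_smooth_of_real: "circle_smooth f' \<Longrightarrow> circle_smooth (\<lambda>t. complex_of_real (f' t))"
 by (simp_all add: circle_smooth_def periodic_def smooth_mult_complex smooth_mult_real smooth_of_real_iff)

lemma circle_smooth_powr:
 fixes f :: "real \<Rightarrow> real"
 assumes "circle_smooth f" "\<And>t. f t > 0"
 shows circle_smooth_sqrt: "circle_smooth (\<lambda>t. sqrt (f t))"
  and circle_smooth_inverse: "circle_smooth (\<lambda>t. 1/f t)"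
 using smooth_powr_real[of f "1/2"] smooth_powr_real[of f "-1"] assms
 by (simp_all add: circle_smooth_def periodic_def powr_half_sqrt powr_minus_divide less_imp_le)

section \<open>Means over a period\<close>

definition mean :: "(real \<Rightarrow> 'a::banach) \<Rightarrow> 'a" where
 "mean f = (1/(2*pi)) *\<^sub>R integral {0..2*pi} f"

lemma mean_cong: "(\<And>t. f t = g t) \<Longrightarrow> mean f = mean g"
 by (metis ext)

lemma integrable_period: "continuous_on UNIV f \<Longrightarrow> f integrable_on {0..2*pi::real}"
 for f :: "real \<Rightarrow> 'a::banach"
 by (rule integrable_continuous_real) (auto intro: continuous_on_subset)

lemma mean_bounded_linear:
 "bounded_linear L \<Longrightarrow> continuous_on UNIV f \<Longrightarrow> mean (\<lambda>t. L (f t)) = L (mean f)"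
 using integral_linear[OF integrable_period[of f], of L]
 by (simp add: mean_def o_def bounded_linear.linear linear_cmul)

lemma mean_add: "continuous_on UNIV f \<Longrightarrow> continuous_on UNIV g \<Longrightarrow> mean (\<lambda>t. f t + g t) = mean f + mean g"
 by (simp add: mean_def integral_add integrable_period scaleR_add_right)

lemma mean_diff: "continuous_on UNIV f \<Longrightarrow> continuous_on UNIV g \<Longrightarrow> mean (\<lambda>t. f t - g t) = mean f - mean g"
 by (simp add: mean_def integral_diff integrable_period scaleR_diff_right)

lemma mean_cmult:
 fixes f :: "real \<Rightarrow> 'a::{real_normed_algebra,banach}"
 shows "continuous_on UNIV f \<Longrightarrow> mean (\<lambda>t. c*f t) = c*mean f"
 by (rule mean_bounded_linear[OF bounded_linear_mult_right])

lemma mean_sum: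
 "(\<And>i. i \<in> A \<Longrightarrow> continuous_on UNIV (f i)) \<Longrightarrow> mean (\<lambda>t. \<Sum>i\<in>A. f i t) = (\<Sum>i\<in>A. mean (f i))"
 by (cases "finite A") (simp_all add: mean_def integral_sum integrable_period scaleR_sum_right)

lemma mean_const [simp]: "mean (\<lambda>_. c) = c"
 by (simp add: mean_def)

lemma norm_mean_le:
 assumes "continuous_on UNIV f" "\<And>t. norm (f t) \<le> B"
 shows "norm (mean f) \<le> B"
proof -
 have "norm (integral {0..2*pi} f) \<le> integral {0..2*pi} (\<lambda>_::real. B)"
  by (rule integral_norm_bound_integral) (use assms integrable_period in auto)
 thus ?thesis by (simp add: mean_def field_simps)
qed

lemma mean_mono:
 fixes f g :: "real \<Rightarrow> real"
 assumes "continuous_on UNIV f" "continuous_on UNIV g" "\<And>t. f t \<le> g t"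
 shows "mean f \<le> mean g"
 unfolding mean_def using assms by (auto intro!: divide_right_mono integral_le integrable_period)

lemma mean_nonneg:
 fixes f :: "real \<Rightarrow> real"
 assumes "continuous_on UNIV f" "\<And>t. 0 \<le> f t"
 shows "0 \<le> mean f"
 using mean_mono[of "\<lambda>_. 0" f] assms by simp

lemma mean_of_real: "continuous_on UNIV f \<Longrightarrow> mean (\<lambda>t. complex_of_real (f t)) = of_real (mean f)"
 by (rule mean_bounded_linear[OF bounded_linear_of_real])

lemma mean_derivative:
 assumes "\<And>t. (f has_vector_derivative f' t) (at t)" "periodic f"
 shows "mean f' = 0"
proof -
 have "(f' has_integral (f (2*pi) - f 0)) {0..2*pi}"
  by (rule fundamental_theorem_of_calculus) (use assms in \<open>auto intro: has_vector_derivative_at_within\<close>)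
 moreover have "f (2*pi) = f 0" using assms(2) by (metis add_0 periodic_def)
 ultimately show ?thesis by (simp add: mean_def integral_unique)
qed

lemma mean_has_sum:
 fixes f :: "'i \<Rightarrow> real \<Rightarrow> 'a::banach"
 assumes c: "\<And>n. continuous_on UNIV (f n)" and M: "\<And>n t. norm (f n t) \<le> M n" "M summable_on UNIV"
  and g: "\<And>t. ((\<lambda>n. f n t) has_sum g t) UNIV"
 shows "((\<lambda>n. mean (f n)) has_sum mean g) UNIV"
proof -
 have "uniform_limit {0..2*pi} (\<lambda>X t. \<Sum>n\<in>X. f n t) g (finite_subsets_at_top UNIV)"
  by (rule Weierstrass_m_test_general'[of _ _ _ M]) (use M g in auto)
 then obtain I J where I: "\<And>X. ((\<lambda>t. \<Sum>n\<in>X. f n t) has_integral I X) {0..2*pi}"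
  and J: "(g has_integral J) {0..2*pi}" "(I \<longlongrightarrow> J) (finite_subsets_at_top UNIV)"
  by (rule uniform_limit_integral) (auto intro!: continuous_on_sum continuous_on_subset[OF c])
 have "(1/(2*pi)) *\<^sub>R I X = (\<Sum>n\<in>X. mean (f n))" for X
  using I[of X] mean_sum[of X f] c by (simp add: mean_def integral_unique)
 moreover have "((\<lambda>X. (1/(2*pi)) *\<^sub>R I X) \<longlongrightarrow> mean g) (finite_subsets_at_top UNIV)"
  using J by (auto simp: mean_def integral_unique intro!: tendsto_intros)
 ultimately show ?thesis by (simp add: has_sum_def)
qed

section \<open>Sums over the integers\<close>

definition wt :: "int \<Rightarrow> real" where "wt n = 1 + \<bar>n\<bar>"

lemma wt_ge_1: "wt n \<ge> 1" by (simp add: wt_def)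

lemma wt_pos [simp]: "wt n > 0" using wt_ge_1[of n] by linarith

lemma wt_nonneg [simp]: "wt n \<ge> 0" by (simp add: less_imp_le)

lemma wt_nonzero [simp]: "wt n \<noteq> 0" using wt_pos[of n] by linarith

lemma wt_minus [simp]: "wt (- n) = wt n" by (simp add: wt_def)

lemma wt_power_ge_1: "wt n^L \<ge> 1" using wt_ge_1 by (rule one_le_power)

lemma wt_power_mono: "L \<le> M \<Longrightarrow> wt n^L \<le> wt n^M" by (intro power_increasing wt_ge_1)

lemma wt_le_double_abs: "n \<noteq> 0 \<Longrightarrow> wt n \<le> 2 * of_int \<bar>n\<bar>" by (simp add: wt_def)

lemma summable_inverse_Suc_square: "summable (\<lambda>n. 1/real (Suc n)^2)"
 using inverse_power_summable[of 2, where 'a = real] summable_Suc_iff[of "\<lambda>n. inverse (real n^2)"]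
 by (simp add: inverse_eq_divide)

lemma summable_wt: "(\<lambda>n. 1/wt n^2) summable_on UNIV"
proof -
 have s: "(\<lambda>n. 1/real (Suc n)^2) summable_on UNIV"
  by (rule summable_nonneg_imp_summable_on[OF summable_inverse_Suc_square]) simp
 have "(\<lambda>n. 1/wt n^2) summable_on range int" "(\<lambda>n. 1/wt n^2) summable_on range (\<lambda>n. - int n)"
  by (subst summable_on_reindex; use s in \<open>simp add: o_def inj_def wt_def add.commute\<close>)+
 moreover have "UNIV = range int \<union> range (\<lambda>n. - int n)"
  using int_cases2 by (auto simp: image_iff) metis
 ultimately show ?thesis using summable_on_union by metis
qed

definition wt_sum :: real where "wt_sum = (\<Sum>\<^sub>\<infinity>n. 1/wt n^2)"

lemma wt_sum_nonneg: "wt_sum \<ge> 0" unfolding wt_sum_def by (rule infsum_nonneg) simp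

lemma has_sum_wt: "((\<lambda>n. c*(1/wt n^2)) has_sum c*wt_sum) UNIV"
 unfolding wt_sum_def by (intro has_sum_cmult_right has_sum_infsum summable_wt)

lemma summable_on_wt: "(\<lambda>n. c*(1/wt n^2)) summable_on A"
 using has_sum_imp_summable[OF has_sum_wt] summable_on_subset_banach by blast

lemma summable_on_abs_real_iff: "(\<lambda>x. \<bar>f x :: real\<bar>) summable_on A \<longleftrightarrow> f summable_on A"
 using summable_on_iff_abs_summable_on_real[of f A] by simp

lemma wt_dominated:
 assumes "\<And>n. \<bar>f n :: real\<bar> \<le> c*(1/wt n^2)"
 shows "f summable_on UNIV" "\<bar>infsum f UNIV\<bar> \<le> c*wt_sum"
proof -
 show s: "f summable_on UNIV"
  by (rule summable_on_abs_real_iff[THEN iffD1], rule summable_on_comparison_test[OF summable_on_wt[of c]])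
   (use assms in auto)
 have "\<bar>infsum f UNIV\<bar> \<le> infsum (\<lambda>n. \<bar>f n\<bar>) UNIV"
  using norm_infsum_bound[of f UNIV] s by (simp add: summable_on_abs_real_iff)
 also have "... \<le> c*wt_sum"
  by (rule has_sum_mono[OF has_sum_infsum has_sum_wt]) (use s assms in \<open>auto simp: summable_on_abs_real_iff\<close>)
 finally show "\<bar>infsum f UNIV\<bar> \<le> c*wt_sum" .
qed

lemma summable_rapid:
 assumes C: "\<And>n. \<bar>c n\<bar>*wt n^(L + 2) \<le> C"
 shows "(\<lambda>n. \<bar>c n\<bar>*wt n^L) summable_on UNIV"
proof (rule summable_on_comparison_test)
 show "(\<lambda>n. C*(1/wt n^2)) summable_on UNIV" by (rule summable_on_wt)
 show "\<bar>c n\<bar>*wt n^L \<le> C*(1/wt n^2)" for n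
  using C[of n] by (simp add: pos_le_divide_eq power_add power2_eq_square mult_ac)
qed auto

lemma has_sum_uminus_int: "((\<lambda>n. f (- n)) has_sum S) UNIV \<longleftrightarrow> (f has_sum S) (UNIV :: int set)"
 using has_sum_reindex[of uminus UNIV f S] by (simp add: o_def)

lemma has_sum_single: "(\<And>m. m \<noteq> n \<Longrightarrow> f m = 0) \<Longrightarrow> (f has_sum f n) UNIV"
 by (rule has_sum_finite_neutralI[of "{n}"]) auto

lemma infsum_single: "(\<Sum>\<^sub>\<infinity>m. if m = n then f m else 0) = (f n :: real)"
 using has_sum_single[of n "\<lambda>m. if m = n then f m else 0"] by (simp add: infsumI)

lemma summable_on_Times_product:
 fixes A :: "'a \<Rightarrow> real" and B :: "'b \<Rightarrow> real"
 assumes "A summable_on X" "B summable_on Y" "\<And>x. x \<in> X \<Longrightarrow> A x \<ge> 0" "\<And>y. y \<in> Y \<Longrightarrow> B y \<ge> 0"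
 shows "(\<lambda>(x,y). A x*B y) summable_on X \<times> Y"
proof (rule summable_on_SigmaI)
 show "((\<lambda>y. case (x, y) of (x, y) \<Rightarrow> A x*B y) has_sum A x*infsum B Y) Y" for x
  using assms(2) by (auto intro!: has_sum_cmult_right)
 show "(\<lambda>x. A x*infsum B Y) summable_on X" by (rule summable_on_cmult_left[OF assms(1)])
qed (use assms in auto)

lemma filterlim_exhaust:
 assumes "\<And>P::nat. finite (F P)" "\<And>P. F P \<subseteq> A" "\<And>x. x \<in> A \<Longrightarrow> \<forall>\<^sub>F P in sequentially. x \<in> F P"
 shows "filterlim F (finite_subsets_at_top A) sequentially"
 unfolding filterlim_finite_subsets_at_top
proof clarify
 fix X assume "finite X" "X \<subseteq> A"
 hence "\<forall>\<^sub>F P in sequentially. \<forall>x\<in>X. x \<in> F P" using assms(3) by (intro eventually_ball_finite) auto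
 thus "\<forall>\<^sub>F P in sequentially. finite (F P) \<and> X \<subseteq> F P \<and> F P \<subseteq> A"
  by eventually_elim (use assms in auto)
qed

lemma has_sum_exhaust:
 assumes "(f has_sum S) A" "\<And>P::nat. finite (F P)" "\<And>P. F P \<subseteq> A"
  and "\<And>x. x \<in> A \<Longrightarrow> \<forall>\<^sub>F P in sequentially. x \<in> F P"
 shows "(\<lambda>P. sum f (F P)) \<longlonglongrightarrow> S"
 by (rule filterlim_compose[OF assms(1)[unfolded has_sum_def] filterlim_exhaust]) (use assms in auto)

lemma eventually_ge_nat_int: "\<forall>\<^sub>F N in sequentially. x \<le> int N"
 using eventually_ge_at_top[of "nat x"] by eventually_elim linarith

lemma filterlim_symmetric_interval: "filterlim (\<lambda>N. {- int N..int N}) (finite_subsets_at_top UNIV) sequentially"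
proof (rule filterlim_exhaust)
 show "\<forall>\<^sub>F N in sequentially. x \<in> {- int N..int N}" for x
  using eventually_ge_nat_int[of "\<bar>x\<bar>"] by eventually_elim auto
qed auto

lemma tendsto_symmetric_sum: "(f has_sum S) UNIV \<Longrightarrow> (\<lambda>N. \<Sum>n\<in>{- int N..int N}. f n) \<longlonglongrightarrow> S"
 unfolding has_sum_def by (rule filterlim_compose[OF _ filterlim_symmetric_interval])

lemma tendsto_positive_sum: "(f has_sum S) {1..} \<Longrightarrow> (\<lambda>N. \<Sum>n\<in>{1..int N}. f n) \<longlonglongrightarrow> S"
 by (rule has_sum_exhaust) (auto intro: eventually_mono[OF eventually_ge_nat_int])

lemma sum_symmetric:
 fixes f :: "int \<Rightarrow> 'a::comm_monoid_add"
 assumes "K \<ge> 0" shows "(\<Sum>k\<in>{-K..K}. f k) = f 0 + (\<Sum>k\<in>{1..K}. f k + f (- k))"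
proof -
 have "{-K..K} = insert 0 ({1..K} \<union> {-K..-1})" using assms by auto
 hence "(\<Sum>k\<in>{-K..K}. f k) = f 0 + ((\<Sum>k\<in>{1..K}. f k) + (\<Sum>k\<in>{-K..-1}. f k))"
  by (simp add: sum.union_disjoint)
 also have "(\<Sum>k\<in>{-K..-1}. f k) = (\<Sum>k\<in>{1..K}. f (- k))"
  by (rule sum.reindex_bij_witness[of _ uminus uminus]) auto
 finally show ?thesis by (simp add: sum.distrib)
qed

lemma has_vector_derivative_has_sum:
 fixes f :: "int \<Rightarrow> real \<Rightarrow> 'a::banach"
 assumes F: "\<And>t. ((\<lambda>n. f n t) has_sum F t) UNIV" and f: "\<And>n t. (f n has_vector_derivative f' n t) (at t)"
  and M: "\<And>n t. norm (f' n t) \<le> M n" "M summable_on UNIV" and G: "\<And>t. ((\<lambda>n. f' n t) has_sum G t) UNIV"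
 shows "(F has_vector_derivative G t) (at t)"
proof -
 let ?S = "\<lambda>f (N::nat) t. \<Sum>n\<in>{- int N..int N}. f n t"
 have "uniform_limit UNIV (\<lambda>X t. \<Sum>n\<in>X. f' n t) G (finite_subsets_at_top UNIV)"
  by (rule Weierstrass_m_test_general'[of _ _ _ M]) (use M G in auto)
 hence unif: "uniform_limit UNIV (?S f') G sequentially"
  by (rule filterlim_compose[OF _ filterlim_symmetric_interval])
 have "\<exists>g. \<forall>t\<in>UNIV. (\<lambda>N. ?S f N t) \<longlonglongrightarrow> g t \<and> (g has_derivative (\<lambda>h. h *\<^sub>R G t)) (at t within UNIV)"
 proof (rule has_derivative_sequence)
  show "(?S f N has_derivative (\<lambda>h. h *\<^sub>R ?S f' N t)) (at t within UNIV)" for N t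
   unfolding has_vector_derivative_def[symmetric] by (intro has_vector_derivative_sum f)
  show "(\<lambda>N. ?S f N 0) \<longlonglongrightarrow> F 0" by (rule tendsto_symmetric_sum[OF F])
  fix e :: real assume "e > 0"
  with unif have "\<forall>\<^sub>F N in sequentially. \<forall>t. norm (?S f' N t - G t) < e" by (auto simp: uniform_limit_iff dist_norm)
  thus "\<forall>\<^sub>F N in sequentially. \<forall>t\<in>UNIV. \<forall>h. norm (h *\<^sub>R ?S f' N t - h *\<^sub>R G t) \<le> e*norm h"
   by eventually_elim (simp add: mult.commute[of e] mult_left_mono less_imp_le flip: scaleR_diff_right)
 qed auto
 then obtain g where g: "\<And>t. (\<lambda>N. ?S f N t) \<longlonglongrightarrow> g t" "\<And>t. (g has_vector_derivative G t) (at t)"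
  by (auto simp: has_vector_derivative_def)
 have "g = F" using LIMSEQ_unique[OF g(1) tendsto_symmetric_sum[OF F]] by auto
 thus ?thesis using g(2) by simp
qed

section \<open>Fourier series with respect to a phase\<close>

text \<open>The system \<open>cis (n * s t)\<close> is orthonormal for the weight \<open>s' = \<rho>\<close>; the phase \<open>s t = t\<close> gives
 ordinary Fourier series, and \<open>\<rho> = 1/a\<close> the eigenfunctions of \<open>a D\<close>.\<close>

locale phase =
 fixes s \<rho> :: "real \<Rightarrow> real"
 assumes circle_smooth_rho: "circle_smooth \<rho>" and rho_pos: "\<And>t. \<rho> t > 0"
  and s_deriv: "\<And>t. (s has_vector_derivative \<rho> t) (at t)" and s_shift: "\<And>t. s (t + 2*pi) = s t + 2*pi"
begin

definition e :: "int \<Rightarrow> real \<Rightarrow> complex" where "e n t = cis (of_int n * s t)"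

definition cf :: "(real \<Rightarrow> complex) \<Rightarrow> int \<Rightarrow> complex" where
 "cf F n = mean (\<lambda>t. F t*e (-n) t*\<rho> t)"

lemma e_eq_exp: "e n = (\<lambda>t. exp (\<i> * of_int n * s t))"
 by (simp add: e_def cis_conv_exp fun_eq_iff algebra_simps)

lemma has_vder_e: "(e n has_vector_derivative \<i> * of_int n * \<rho> t * e n t) (at t)"
proof -
 have "((\<lambda>t. \<i> * of_int n * complex_of_real (s t)) has_vector_derivative \<i> * of_int n * \<rho> t) (at t)"
  by (intro has_vector_derivative_mult_right bounded_linear.has_vector_derivative[OF bounded_linear_of_real] s_deriv)
 from field_vector_diff_chain_at[OF this DERIV_exp] show ?thesis by (simp add: e_eq_exp o_def)
qed

lemma circle_smooth_e [circle_smooth_intros]: "circle_smooth (e n)"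
proof -
 have "smooth s" using smoothI[OF s_deriv circle_smoothD(1)[OF circle_smooth_rho]] .
 hence "smooth (e n)" unfolding e_eq_exp by (intro smooth_exp smooth_cmult(1)) (simp add: smooth_of_real_iff)
 moreover have "cis (of_int n * (s t + 2*pi)) = cis (of_int n * s t) * cis (2*pi * of_int n)" for t
  by (simp add: cis_mult algebra_simps)
 ultimately show ?thesis by (simp add: circle_smooth_def periodic_def e_def s_shift cis_multiple_2pi)
qed

lemma vder_e: "vder (e n) = (\<lambda>t. \<i> * of_int n * \<rho> t * e n t)"
 by (rule vder_eqI) (rule has_vder_e)

lemma norm_e [simp]: "norm (e n t) = 1" by (simp add: e_def)

lemma e_mult: "e n t*e m t = e (n + m) t"
 by (simp add: e_def cis_mult algebra_simps)

lemma e_0 [simp]: "e 0 t = 1" by (simp add: e_def)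

lemma cnj_e [simp]: "cnj (e n t) = e (- n) t" by (simp add: e_def cis_cnj)

lemma continuous_e [continuous_intros]: "continuous_on S (e n)"
 and continuous_rho [continuous_intros]: "continuous_on S \<rho>"
 using circle_smooth_e circle_smooth_rho circle_smooth_cont by blast+

lemma mean_rho: "mean \<rho> = 1"
proof -
 have "(\<rho> has_integral (s (2*pi) - s 0)) {0..2*pi}"
  by (rule fundamental_theorem_of_calculus) (auto intro: has_vector_derivative_at_within s_deriv)
 thus ?thesis using s_shift[of 0] by (simp add: mean_def integral_unique)
qed

lemma mean_e_rho: "mean (\<lambda>t. e n t*\<rho> t) = (if n = 0 then 1 else 0)"
proof (cases "n = 0")
 case True
 thus ?thesis using mean_of_real[OF continuous_rho] mean_rho by simp
next
 case False
 have "0 = mean (\<lambda>t. \<i> * of_int n * \<rho> t * e n t)"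
  using mean_derivative[OF has_vder_e circle_smoothD(2)[OF circle_smooth_e]] by simp
 also have "... = mean (\<lambda>t. (\<i> * of_int n) * (e n t * \<rho> t))" by (simp add: mult_ac)
 also have "... = (\<i> * of_int n) * mean (\<lambda>t. e n t * \<rho> t)" by (rule mean_cmult) (intro continuous_intros)
 finally show ?thesis using False by simp
qed

lemma cf_add: "continuous_on UNIV F \<Longrightarrow> continuous_on UNIV G \<Longrightarrow> cf (\<lambda>t. F t + G t) n = cf F n + cf G n"
 unfolding cf_def by (subst mean_add[symmetric]) (auto intro!: continuous_intros mean_cong simp: algebra_simps)

lemma cf_diff: "continuous_on UNIV F \<Longrightarrow> continuous_on UNIV G \<Longrightarrow> cf (\<lambda>t. F t - G t) n = cf F n - cf G n"
 unfolding cf_def by (subst mean_diff[symmetric]) (auto intro!: continuous_intros mean_cong simp: algebra_simps)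

lemma cf_sum:
 "(\<And>i. i \<in> A \<Longrightarrow> continuous_on UNIV (F i)) \<Longrightarrow> cf (\<lambda>t. \<Sum>i\<in>A. F i t) n = (\<Sum>i\<in>A. cf (F i) n)"
 unfolding cf_def sum_distrib_right by (rule mean_sum) (auto intro!: continuous_intros)

lemma cf_cmult: "continuous_on UNIV F \<Longrightarrow> cf (\<lambda>t. c*F t) n = c*cf F n"
 unfolding cf_def by (subst mean_cmult[symmetric]) (auto intro!: continuous_intros mean_cong simp: algebra_simps)

lemma cf_cnj: "continuous_on UNIV F \<Longrightarrow> cf (\<lambda>t. cnj (F t)) n = cnj (cf F (-n))"
 unfolding cf_def
 by (subst mean_bounded_linear[OF bounded_linear_cnj, symmetric]) (auto intro!: continuous_intros mean_cong)

lemma cf_e_mult: "cf (\<lambda>t. e m t*F t) n = cf F (n - m)"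
proof -
 have "e m t*F t*e (-n) t = F t*e (-(n - m)) t" for t using e_mult[of m t "-n"] by (simp add: mult_ac)
 thus ?thesis by (simp only: cf_def)
qed

lemma cf_trig_sum:
 assumes "finite A" shows "cf (\<lambda>t. \<Sum>n\<in>A. h n*e n t) k = (if k \<in> A then h k else 0)"
proof -
 have "e n t*(e (- k) t*z) = e (n - k) t*z" for n t z by (simp add: e_mult flip: mult.assoc)
 hence "cf (\<lambda>t. \<Sum>n\<in>A. h n*e n t) k = mean (\<lambda>t. \<Sum>n\<in>A. h n*(e (n - k) t*\<rho> t))"
  by (simp only: cf_def sum_distrib_right mult.assoc)
 also have "... = (\<Sum>n\<in>A. h n*(if n = k then 1 else 0))"
  by (subst mean_sum) (auto intro!: continuous_intros sum.cong simp: mean_cmult mean_e_rho continuous_intros)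
 finally show ?thesis using assms by (simp add: if_distrib[of "(*) _"] cong: if_cong)
qed

lemma cf_const: "cf (\<lambda>_. c) n = (if n = 0 then c else 0)"
 using cf_trig_sum[of "{0}" "\<lambda>_. c" n] by simp

lemma cf_e: "cf (e m) n = (if m = n then 1 else 0)"
 using cf_trig_sum[of "{m}" "\<lambda>_. 1" n] by auto

lemma mean_pairing_trig_sum:
 assumes "continuous_on UNIV G"
 shows "mean (\<lambda>t. G t*cnj (\<Sum>n\<in>A. h n*e n t)*\<rho> t) = (\<Sum>n\<in>A. cf G n*cnj (h n))"
proof -
 have "mean (\<lambda>t. G t*cnj (\<Sum>n\<in>A. h n*e n t)*\<rho> t) = mean (\<lambda>t. \<Sum>n\<in>A. cnj (h n)*(G t*e (-n) t*\<rho> t))"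
  by (intro mean_cong) (simp add: sum_distrib_left sum_distrib_right algebra_simps)
 also have "... = (\<Sum>n\<in>A. cnj (h n)*cf G n)"
  unfolding cf_def by (subst mean_sum) (auto intro!: continuous_intros assms sum.cong mean_cmult)
 finally show ?thesis by (simp add: mult.commute)
qed

lemma Parseval_trig_sum:
 assumes "finite A"
 shows "mean (\<lambda>t. (norm (\<Sum>n\<in>A. h n*e n t))^2*\<rho> t) = (\<Sum>n\<in>A. (norm (h n))^2)"
proof -
 let ?S = "\<lambda>t. \<Sum>n\<in>A. h n*e n t"
 have "complex_of_real (mean (\<lambda>t. (norm (?S t))^2*\<rho> t)) = mean (\<lambda>t. complex_of_real ((norm (?S t))^2*\<rho> t))"
  by (rule mean_of_real[symmetric]) (intro continuous_intros)
 also have "... = mean (\<lambda>t. ?S t*cnj (?S t)*\<rho> t)" by (simp only: of_real_mult complex_norm_square)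
 also have "... = (\<Sum>n\<in>A. cf ?S n*cnj (h n))" by (rule mean_pairing_trig_sum) (intro continuous_intros)
 also have "... = (\<Sum>n\<in>A. complex_of_real ((norm (h n))^2))"
  by (intro sum.cong) (simp_all only: cf_trig_sum[OF assms] complex_norm_square if_True)
 finally show ?thesis by (simp only: of_real_sum[symmetric] of_real_eq_iff)
qed

lemma Bessel:
 assumes G: "continuous_on UNIV G" and A: "finite A"
 shows "(\<Sum>n\<in>A. (norm (cf G n))^2) \<le> mean (\<lambda>t. (norm (G t))^2*\<rho> t)"
proof -
 define S where "S = (\<lambda>t. \<Sum>n\<in>A. cf G n*e n t)"
 have S: "continuous_on UNIV S" unfolding S_def by (intro continuous_intros)
 have "mean (\<lambda>t. Re (G t*cnj (S t)*\<rho> t)) = Re (mean (\<lambda>t. G t*cnj (S t)*\<rho> t))"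
  by (intro mean_bounded_linear[OF bounded_linear_Re] continuous_intros G S)
 also have "... = (\<Sum>n\<in>A. (norm (cf G n))^2)"
  unfolding S_def mean_pairing_trig_sum[OF G] by (simp add: complex_norm_square[symmetric] del: of_real_power)
 finally have GS: "mean (\<lambda>t. Re (G t*cnj (S t)*\<rho> t)) = (\<Sum>n\<in>A. (norm (cf G n))^2)" .
 have "0 \<le> mean (\<lambda>t. (norm (G t - S t))^2*\<rho> t)"
  by (rule mean_nonneg) (auto intro!: continuous_intros G S simp: less_imp_le rho_pos)
 also have "... = mean (\<lambda>t. (norm (G t))^2*\<rho> t - 2*Re (G t*cnj (S t)*\<rho> t) + (norm (S t))^2*\<rho> t)"
  by (intro mean_cong) (simp only: cmod_power2, simp add: power2_eq_square algebra_simps)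
 also have "... = mean (\<lambda>t. (norm (G t))^2*\<rho> t) - 2*mean (\<lambda>t. Re (G t*cnj (S t)*\<rho> t)) + mean (\<lambda>t. (norm (S t))^2*\<rho> t)"
  by (subst mean_add, (intro continuous_intros G S)+, subst mean_diff, (intro continuous_intros G S)+,
   subst mean_cmult, (intro continuous_intros G S)+, rule refl)
 finally show ?thesis using Parseval_trig_sum[OF A, of "cf G"] unfolding GS by (simp add: S_def)
qed

lemma Riemann_Lebesgue:
 assumes G: "continuous_on UNIV G" and f: "inj f"
 shows "(\<lambda>N::nat. cf G (f N)) \<longlonglongrightarrow> 0"
proof -
 have "summable (\<lambda>N. (norm (cf G (f N)))^2)"
 proof (rule summableI_nonneg_bounded)
  fix n
  have "(\<Sum>i<n. (norm (cf G (f i)))^2) = (\<Sum>m\<in>f ` {..<n}. (norm (cf G m))^2)"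
   by (subst sum.reindex) (use f in \<open>auto intro: inj_on_subset\<close>)
  also have "... \<le> mean (\<lambda>t. (norm (G t))^2*\<rho> t)" by (rule Bessel[OF G]) auto
  finally show "(\<Sum>i<n. (norm (cf G (f i)))^2) \<le> mean (\<lambda>t. (norm (G t))^2*\<rho> t)" .
 qed auto
 hence "(\<lambda>N. (norm (cf G (f N)))^2) \<longlonglongrightarrow> 0" by (rule summable_LIMSEQ_zero)
 hence "(\<lambda>N. sqrt ((norm (cf G (f N)))^2)) \<longlonglongrightarrow> sqrt 0" by (intro tendsto_intros)
 thus ?thesis by (simp add: tendsto_norm_zero_iff)
qed

definition phase_deriv :: "(real \<Rightarrow> complex) \<Rightarrow> real \<Rightarrow> complex" where
 "phase_deriv F = (\<lambda>t. complex_of_real (1/\<rho> t) * vder F t)"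

lemma circle_smooth_phase_deriv: "circle_smooth F \<Longrightarrow> circle_smooth (phase_deriv F)"
 unfolding phase_deriv_def
 by (intro circle_smooth_intros circle_smooth_inverse circle_smooth_rho rho_pos)

lemma cf_phase_deriv:
 assumes "circle_smooth F"
 shows "cf (phase_deriv F) n = \<i> * of_int n * cf F n"
proof -
 have cont: "continuous_on UNIV F" "continuous_on UNIV (phase_deriv F)"
  using assms circle_smooth_phase_deriv circle_smooth_cont by blast+
 have "0 = mean (\<lambda>t. F t * (\<i> * of_int (-n) * \<rho> t * e (-n) t) + vder F t * e (-n) t)"
  by (rule mean_derivative[of "\<lambda>t. F t*e (-n) t", symmetric])
   (intro has_vector_derivative_mult has_vder_e smooth_has_vder circle_smoothD circle_smooth_intros assms)+
 also have "... = mean (\<lambda>t. - (\<i> * of_int n) * (F t * e (-n) t * \<rho> t) + phase_deriv F t * e (-n) t * \<rho> t)"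
  by (intro mean_cong) (use rho_pos in \<open>simp add: phase_deriv_def less_imp_neq[symmetric]\<close>)
 also have "... = - (\<i> * of_int n) * cf F n + cf (phase_deriv F) n"
  unfolding cf_def by (subst mean_add, (intro continuous_intros cont)+, subst mean_cmult, (intro continuous_intros cont)+, rule refl)
 finally show ?thesis by simp
qed

lemma norm_cf_le:
 assumes "continuous_on UNIV F" "\<And>t. norm (F t) \<le> B" shows "norm (cf F n) \<le> B"
proof -
 have "norm (cf F n) \<le> mean (\<lambda>t. B*\<rho> t)"
 proof -
  have "norm (cf F n) \<le> mean (\<lambda>t. norm (F t*e (-n) t*\<rho> t))"
   unfolding cf_def mean_def by (auto intro!: divide_right_mono integral_norm_bound_integral integrable_period continuous_intros assms)
  also have "... \<le> mean (\<lambda>t. B*\<rho> t)" using assms(2) rho_pos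
   by (intro mean_mono continuous_intros assms) (simp add: norm_mult less_imp_le mult_right_mono)
  finally show ?thesis .
 qed
 also have "... = B" by (simp add: mean_cmult continuous_rho mean_rho)
 finally show ?thesis .
qed

lemma cf_decay:
 assumes "circle_smooth F"
 shows "\<exists>C\<ge>0. \<forall>n. norm (cf F n)*wt n^L \<le> C"
 using assms
proof (induction L arbitrary: F)
 case 0
 obtain B where "B \<ge> 0" "\<And>t. norm (F t) \<le> B" using circle_smooth_bounded[OF 0] by blast
 thus ?case using norm_cf_le[OF circle_smooth_cont[OF 0]] by (intro exI[of _ B]) auto
next
 case (Suc L)
 obtain C where C: "C \<ge> 0" "\<And>n. norm (cf (phase_deriv F) n)*wt n^L \<le> C"
  using Suc.IH[OF circle_smooth_phase_deriv] Suc.prems by blast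
 have "norm (cf F n)*wt n^Suc L \<le> 2*C + norm (cf F 0)" for n
 proof (cases "n = 0")
  case False
  have "norm (cf F n) * wt n^Suc L \<le> norm (cf F n) * ((2 * of_int \<bar>n\<bar>) * wt n^L)"
   using wt_le_double_abs[OF False] by (intro mult_left_mono) (auto intro!: mult_right_mono)
  also have "... = 2*(norm (cf (phase_deriv F) n)*wt n^L)" by (simp add: cf_phase_deriv Suc.prems norm_mult)
  also have "... \<le> 2*C" using C(2)[of n] by simp
  finally show ?thesis using norm_ge_zero[of "cf F 0"] by linarith
 qed (use C in \<open>auto simp: wt_def\<close>)
 thus ?case using C by (intro exI[of _ "2*C + norm (cf F 0)"]) auto
qed

lemma cf_summable:
 assumes "circle_smooth F"
 shows "(\<lambda>n. norm (cf F n)*wt n^L) summable_on UNIV"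
proof -
 obtain C where "\<And>n. norm (cf F n)*wt n^(L + 2) \<le> C" using cf_decay[OF assms] by blast
 from summable_rapid[of "\<lambda>n. norm (cf F n)" L C] this show ?thesis by simp
qed

lemma s_mono: "x < y \<Longrightarrow> s x < s y"
 using DERIV_pos_imp_increasing s_deriv rho_pos has_real_derivative_iff_has_vector_derivative by metis

lemma e_1_eq_imp:
 assumes "e 1 t = e 1 t0" shows "\<exists>n. t = t0 + 2*pi * of_int n"
proof -
 have "cis (s t - s t0) = 1" using assms by (simp add: e_def cis_divide[symmetric])
 then obtain n where "s t - s t0 = 2*pi * of_int n" by (auto simp: cis_eq_1_iff mult_ac)
 moreover have "s (t0 + 2*pi * of_int n) - (t0 + 2*pi * of_int n) = s t0 - t0"
  by (rule periodic_int) (simp add: periodic_def s_shift)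
 ultimately have "s t = s (t0 + 2*pi * of_int n)" by simp
 thus ?thesis using s_mono by (metis less_irrefl linorder_cases)
qed

text \<open>Dividing \<open>F - F t0\<close> by \<open>e 1 / e 1 t0 - 1\<close> leaves a continuous function \<open>G\<close>, in terms of which
 the symmetric partial sums telescope.\<close>

lemma partial_sums_telescope:
 assumes G: "continuous_on UNIV G" and F: "\<And>t. F t = c + (e 1 t*e (-1) t0 - 1)*G t"
 shows "(\<lambda>N. \<Sum>n\<in>{- int N..int N}. cf F n*e n t0) \<longlonglongrightarrow> c"
proof -
 define x where "x = (\<lambda>n. cf G n*e n t0)"
 have step: "cf F n*e n t0 = (if n = 0 then c else 0) + (x (n - 1) - x n)" for n
 proof -
  have "cf F n = cf (\<lambda>t. c + (e (-1) t0*(e 1 t*G t) - G t)) n"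
   by (rule arg_cong[of _ _ "\<lambda>F. cf F n"]) (simp add: F fun_eq_iff algebra_simps)
  also have "... = (if n = 0 then c else 0) + (e (-1) t0*cf G (n - 1) - cf G n)"
   by (simp add: cf_add cf_diff cf_cmult cf_const cf_e_mult G continuous_intros)
  finally show ?thesis using e_mult[of "-1" t0 n] by (auto simp: x_def ring_distribs mult_ac)
 qed
 have "(\<Sum>n\<in>{- int N..int N}. cf F n*e n t0) = c + x (- int N - 1) - x (int N)" for N
 proof (induction N)
  case 0 thus ?case using step[of 0] by simp
 next
  case (Suc N)
  have "{- 1 - int N..1 + int N} = insert (- 1 - int N) (insert (1 + int N) {- int N..int N})" by auto
  moreover have "x (- int N - 1) = x (- 1 - int N)" by (rule arg_cong[of _ _ x]) simp
  ultimately show ?case using Suc by (simp add: step)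
 qed
 moreover have x0: "(\<lambda>N. x (f N)) \<longlonglongrightarrow> 0" if "inj f" for f :: "nat \<Rightarrow> int"
  using tendsto_norm_zero[OF Riemann_Lebesgue[OF G that]]
  by (subst tendsto_norm_zero_iff[symmetric]) (simp add: x_def norm_mult)
 moreover have "(\<lambda>N. c + x (- int N - 1) - x (int N)) \<longlonglongrightarrow> c + 0 - 0"
  by (intro tendsto_intros x0) (auto simp: inj_def)
 ultimately show ?thesis by simp
qed

end

lemma continuous_on_derivative_quotient:
 fixes F E :: "real \<Rightarrow> complex"
 assumes F: "\<And>t. (F has_vector_derivative F' t) (at t)" and E: "\<And>t. (E has_vector_derivative E' t) (at t)"
  and zero: "\<And>t. E t = 0 \<Longrightarrow> F t = 0" and E'0: "\<And>t. E t = 0 \<Longrightarrow> E' t \<noteq> 0"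
 shows "continuous_on UNIV (\<lambda>t. if E t = 0 then F' t / E' t else F t / E t)" (is "continuous_on _ ?G")
proof -
 have cont: "isCont F t" "isCont E t" for t using F E has_vector_derivative_continuous by blast+
 have "isCont ?G t" for t
 proof (cases "E t = 0")
  case False
  have "\<forall>\<^sub>F x in nhds t. E x \<noteq> 0"
   using tendsto_imp_eventually_ne[OF isContD[OF cont(2)] False] False by (simp add: eventually_nhds_conv_at)
  hence "\<forall>\<^sub>F x in nhds t. ?G x = F x / E x" by eventually_elim simp
  moreover have "isCont (\<lambda>x. F x / E x) t" using cont False by (intro continuous_intros) auto
  ultimately show ?thesis by (subst isCont_cong) auto
 next
  case True
  have Eq: "((\<lambda>x. (E x - E t) /\<^sub>R (x - t)) \<longlongrightarrow> E' t) (at t)" using E[of t] by (simp add: has_vector_derivative_iff_quotient)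
  have "((\<lambda>x. ((F x - F t) /\<^sub>R (x - t)) / ((E x - E t) /\<^sub>R (x - t))) \<longlongrightarrow> F' t / E' t) (at t)"
   using F[of t] Eq E'0[OF True] by (intro tendsto_divide) (auto simp: has_vector_derivative_iff_quotient)
  moreover have "\<forall>\<^sub>F x in at t. ((F x - F t) /\<^sub>R (x - t)) / ((E x - E t) /\<^sub>R (x - t)) = ?G x"
   using tendsto_imp_eventually_ne[OF Eq E'0[OF True]]
   by eventually_elim (use True zero in \<open>auto simp: scaleR_conv_of_real\<close>)
  ultimately show ?thesis using True by (simp add: isCont_def Lim_transform_eventually)
 qed
 thus ?thesis by (simp add: continuous_on_eq_continuous_at)
qed

context phase
begin

lemma Fourier_inversion:
 assumes F: "circle_smooth F"
 shows "((\<lambda>n. cf F n*e n t0) has_sum F t0) UNIV"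
proof -
 define E E' where "E = (\<lambda>t. e 1 t*e (-1) t0 - 1)" and "E' = (\<lambda>t. \<i>*\<rho> t*e 1 t*e (-1) t0)"
 have "((\<lambda>t. e 1 t*e (-1) t0) has_vector_derivative E' t) (at t)" for t
  unfolding E'_def using has_vector_derivative_mult_left[OF has_vder_e[of 1 t], of "e (-1) t0"] by simp
 hence E: "(E has_vector_derivative E' t) (at t)" for t
  unfolding E_def by (simp add: has_vector_derivative_diff_const)
 have e1: "e 1 t0*e (-1) t0 = 1" by (simp add: e_mult)
 have FE: "F t - F t0 = 0" if "E t = 0" for t
 proof -
  have "e 1 t*(e 1 t0*e (-1) t0) = e 1 t0" using that by (simp add: E_def)
  hence "e 1 t = e 1 t0" unfolding e1 by simp
  then obtain n where "t = t0 + 2*pi * of_int n" using e_1_eq_imp by blast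
  thus ?thesis by (simp add: periodic_int circle_smoothD F)
 qed
 have "E' t \<noteq> 0" for t using rho_pos[of t] norm_e[of 1 t] norm_e[of "-1" t0] by (auto simp: E'_def simp del: norm_e)
 hence "continuous_on UNIV (\<lambda>t. if E t = 0 then vder F t / E' t else (F t - F t0) / E t)"
  using smooth_has_vder[OF circle_smoothD(1)[OF F]] E FE
  by (intro continuous_on_derivative_quotient) (auto simp: has_vector_derivative_diff_const)
 moreover have "F t = F t0 + (e 1 t*e (-1) t0 - 1)*(if E t = 0 then vder F t / E' t else (F t - F t0) / E t)" for t
  using FE[of t] by (auto simp: E_def)
 ultimately have lim: "(\<lambda>N. \<Sum>n\<in>{- int N..int N}. cf F n*e n t0) \<longlonglongrightarrow> F t0" by (rule partial_sums_telescope)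
 have "(\<lambda>n. norm (cf F n*e n t0)) summable_on UNIV" using cf_summable[OF F, of 0] by (simp add: norm_mult)
 hence sum: "((\<lambda>n. cf F n*e n t0) has_sum (\<Sum>\<^sub>\<infinity>n. cf F n*e n t0)) UNIV"
  by (rule has_sum_infsum[OF abs_summable_summable])
 show ?thesis using LIMSEQ_unique[OF tendsto_symmetric_sum[OF sum] lim] sum by simp
qed

lemma mean_series:
 assumes c: "(\<lambda>n. norm (c n)) summable_on UNIV" and F: "\<And>t. ((\<lambda>n. c n*e n t) has_sum F t) UNIV"
  and G: "continuous_on UNIV G" "periodic G"
 shows "((\<lambda>n. c n*mean (\<lambda>t. e n t*G t)) has_sum mean (\<lambda>t. F t*G t)) UNIV"
proof -
 obtain B where B: "\<And>t. norm (G t) \<le> B" using periodic_bounded[OF G(2,1)] by blast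
 have "((\<lambda>n. mean (\<lambda>t. c n*(e n t*G t))) has_sum mean (\<lambda>t. F t*G t)) UNIV"
 proof (rule mean_has_sum)
  show "norm (c n*(e n t*G t)) \<le> norm (c n)*B" for n t using B[of t] by (simp add: norm_mult mult_left_mono)
  show "(\<lambda>n. norm (c n)*B) summable_on UNIV" using c by (rule summable_on_cmult_left)
  show "((\<lambda>n. c n*(e n t*G t)) has_sum F t*G t) UNIV" for t
   using has_sum_cmult_left[OF F] by (simp add: mult.assoc)
 qed (intro continuous_intros G)
 thus ?thesis by (simp add: mean_cmult continuous_intros G)
qed

lemma Parseval:
 assumes F: "circle_smooth F" and G: "continuous_on UNIV G" "periodic G"
 shows "((\<lambda>n. cf F n*cnj (cf G n)) has_sum mean (\<lambda>t. F t*cnj (G t)*\<rho> t)) UNIV"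
proof -
 have "((\<lambda>n. cf F n*mean (\<lambda>t. e n t*(cnj (G t)*\<rho> t))) has_sum mean (\<lambda>t. F t*(cnj (G t)*\<rho> t))) UNIV"
 proof (rule mean_series)
  show "(\<lambda>n. norm (cf F n)) summable_on UNIV" using cf_summable[OF F, of 0] by simp
  show "((\<lambda>n. cf F n*e n t) has_sum F t) UNIV" for t by (rule Fourier_inversion[OF F])
 qed (use G circle_smoothD(2)[OF circle_smooth_rho] in \<open>auto simp: periodic_def intro!: continuous_intros\<close>)
 moreover have "mean (\<lambda>t. e n t*(cnj (G t)*\<rho> t)) = cnj (cf G n)" for n
  unfolding cf_def by (subst mean_bounded_linear[OF bounded_linear_cnj, symmetric])
   (auto intro!: continuous_intros G mean_cong)
 ultimately show ?thesis by (simp add: mult.assoc)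
qed

lemma cf_eq_0_imp: "circle_smooth F \<Longrightarrow> (\<And>n. cf F n = 0) \<Longrightarrow> F t = 0"
 using Fourier_inversion[of F t] has_sum_unique[OF _ has_sum_0_simp] by simp

lemma cf_series:
 assumes c: "(\<lambda>n. norm (c n)) summable_on UNIV" and F: "\<And>t. ((\<lambda>n. c n*e n t) has_sum F t) UNIV"
 shows "cf F m = c m"
proof -
 have "((\<lambda>n. c n*mean (\<lambda>t. e n t*(e (-m) t*\<rho> t))) has_sum mean (\<lambda>t. F t*(e (-m) t*\<rho> t))) UNIV"
  by (intro mean_series[OF c F] continuous_intros circle_smoothD(2) circle_smooth_intros circle_smooth_rho)
 moreover have "mean (\<lambda>t. e n t*(e (-m) t*\<rho> t)) = (if n = m then 1 else 0)" for n
  using mean_e_rho[of "n - m"] by (auto simp: mult.assoc[symmetric] e_mult)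
 ultimately have "((\<lambda>n. c n*(if n = m then 1 else 0)) has_sum cf F m) UNIV" by (simp add: cf_def mult.assoc)
 moreover have "((\<lambda>n. c n*(if n = m then 1 else 0)) has_sum c m) UNIV"
  using has_sum_single[of m "\<lambda>n. c n*(if n = m then 1 else 0)"] by simp
 ultimately show ?thesis by (rule has_sum_unique)
qed

definition rapid_series :: "(int \<Rightarrow> complex) \<Rightarrow> (real \<Rightarrow> complex) \<Rightarrow> bool" where
 "rapid_series c F \<longleftrightarrow> (\<forall>L. \<exists>C. \<forall>n. norm (c n)*wt n^L \<le> C) \<and> (\<forall>t. ((\<lambda>n. c n*e n t) has_sum F t) UNIV)"

lemma rapid_summable:
 assumes "\<And>L. \<exists>C. \<forall>n. norm (c n)*wt n^L \<le> C"
 shows "(\<lambda>n. norm (c n)) summable_on UNIV"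
proof -
 obtain C where "\<And>n. norm (c n)*wt n^(0 + 2) \<le> C" using assms by blast
 from summable_rapid[of "\<lambda>n. norm (c n)" 0 C] this show ?thesis by simp
qed

lemma rapid_series_exists:
 assumes "\<And>L. \<exists>C. \<forall>n. norm (c n)*wt n^L \<le> C"
 shows "rapid_series c (\<lambda>t. \<Sum>\<^sub>\<infinity>n. c n*e n t)"
proof -
 have "((\<lambda>n. c n*e n t) has_sum (\<Sum>\<^sub>\<infinity>n. c n*e n t)) UNIV" for t
  using rapid_summable[OF assms] by (intro has_sum_infsum[OF abs_summable_summable]) (simp add: norm_mult)
 thus ?thesis using assms by (simp add: rapid_series_def)
qed

lemma rapid_series_derivative:
 assumes "rapid_series c F"
 obtains d G where "rapid_series d G" "\<And>t. (F has_vector_derivative G t*\<rho> t) (at t)"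
proof -
 define d where "d = (\<lambda>n. \<i> * of_int n * c n)"
 have F: "((\<lambda>n. c n*e n t) has_sum F t) UNIV" for t using assms by (simp add: rapid_series_def)
 have "\<exists>C. \<forall>n. norm (d n)*wt n^L \<le> C" for L
 proof -
  obtain C where C: "\<And>n. norm (c n)*wt n^Suc L \<le> C" using assms unfolding rapid_series_def by blast
  have "norm (d n)*wt n^L = norm (c n)*(of_int \<bar>n\<bar>*wt n^L)" for n by (simp add: d_def norm_mult)
  also have "... n \<le> norm (c n)*wt n^Suc L" for n
   unfolding power_Suc by (intro mult_left_mono mult_right_mono) (auto simp: wt_def)
  finally have "norm (d n)*wt n^L \<le> norm (c n)*wt n^Suc L" for n .
  thus ?thesis using C order_trans by blast
 qed
 note d = rapid_summable[OF this] rapid_series_exists[OF this]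
 obtain B where B: "\<And>t. norm (\<rho> t) \<le> B" using circle_smooth_bounded[OF circle_smooth_rho] by blast
 let ?G = "\<lambda>t. \<Sum>\<^sub>\<infinity>n. d n*e n t"
 have "(F has_vector_derivative ?G t*\<rho> t) (at t)" for t
 proof (rule has_vector_derivative_has_sum[OF F])
  show "((\<lambda>t. c n*e n t) has_vector_derivative d n*e n t*\<rho> t) (at t)" for n t
   using has_vector_derivative_mult_right[OF has_vder_e[of n t], of "c n"] by (simp add: d_def mult_ac)
  show "norm (d n*e n t*\<rho> t) \<le> norm (d n)*B" for n t using B[of t] by (simp add: norm_mult mult_left_mono)
  show "(\<lambda>n. norm (d n)*B) summable_on UNIV" by (rule summable_on_cmult_left[OF d(1)])
  show "((\<lambda>n. d n*e n t*\<rho> t) has_sum ?G t*\<rho> t) UNIV" for t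
   by (rule has_sum_cmult_left) (use d(2) in \<open>simp add: rapid_series_def\<close>)
 qed
 thus ?thesis using that d(2) by blast
qed

lemma circle_smooth_rapid_series:
 assumes "rapid_series c F"
 shows "circle_smooth F"
proof -
 define R where "R = {F. \<exists>c. rapid_series c F} \<union> {f. smooth f}"
 have "smooth F"
 proof (rule smooth_closure_smooth[of R])
  fix f assume "f \<in> R"
  then consider "smooth f" | c where "rapid_series c f" by (auto simp: R_def)
  thus "\<exists>f'. smooth_closure R f' \<and> (\<forall>t. (f has_vector_derivative f' t) (at t))"
  proof cases
   case 1
   thus ?thesis using smooth_has_vder smooth_vder
    by (intro exI[of _ "vder f"]) (auto simp: R_def intro!: smooth_closure.base)
  next
   case 2
   obtain d g where g: "rapid_series d g" "\<And>t. (f has_vector_derivative g t*\<rho> t) (at t)"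
    using rapid_series_derivative[OF 2] by blast
   have "smooth_closure R (\<lambda>t. g t*\<rho> t)" by (intro smooth_closure.mult smooth_closure.base)
     (use g(1) circle_smoothD(1)[OF circle_smooth_rho] in \<open>auto simp: R_def smooth_of_real_iff\<close>)
   thus ?thesis using g(2) by blast
  qed
 qed (use assms in \<open>auto simp: R_def intro: smooth_closure.base\<close>)
 moreover have "periodic F" unfolding periodic_def
 proof
  fix t
  have F: "((\<lambda>n. c n*e n t) has_sum F t) UNIV" for t using assms by (simp add: rapid_series_def)
  have "e n (t + 2*pi) = e n t" for n using circle_smoothD(2)[OF circle_smooth_e] by (simp add: periodic_def)
  thus "F (t + 2*pi) = F t" using F[of "t + 2*pi"] has_sum_unique[OF _ F[of t]] by simp
 qed
 ultimately show ?thesis by (simp add: circle_smooth_def)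
qed

end

section \<open>The Riemann zeta function\<close>

lemma holomorphic_suminf:
 fixes u :: "nat \<Rightarrow> complex \<Rightarrow> complex"
 assumes "open S" and hol: "\<And>n. u n holomorphic_on S"
  and bound: "\<And>x. x \<in> S \<Longrightarrow> \<exists>d>0. \<exists>M. cball x d \<subseteq> S \<and> summable M \<and>
   (\<forall>\<^sub>F n in sequentially. \<forall>y\<in>cball x d. norm (u n y) \<le> M n)"
 shows "(\<lambda>s. \<Sum>n. u n s) holomorphic_on S"
proof (rule holomorphic_uniform_sequence[OF \<open>open S\<close>])
 show "(\<lambda>s. \<Sum>i<n. u i s) holomorphic_on S" for n using hol by (intro holomorphic_intros)
 fix x assume "x \<in> S"
 then obtain d M where d: "d > 0" "cball x d \<subseteq> S" "summable M"
  "\<forall>\<^sub>F n in sequentially. \<forall>y\<in>cball x d. norm (u n y) \<le> M n" using bound by blast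
 from Weierstrass_m_test_ev[OF d(4,3)] d(1,2)
 show "\<exists>d>0. cball x d \<subseteq> S \<and> uniform_limit (cball x d) (\<lambda>n s. \<Sum>i<n. u i s) (\<lambda>s. \<Sum>n. u n s) sequentially"
  by blast
qed

definition zeta_sum :: "complex \<Rightarrow> complex" where
 "zeta_sum s = (\<Sum>n. of_nat (Suc n) powr - s)"

lemma norm_nat_powr: "norm (of_nat (Suc n) powr (- s)) = real (Suc n) powr (- Re s)" for s :: complex
 using norm_powr_real_powr[of "real (Suc n)" "- s"] by simp

lemma summable_Suc_powr: "\<sigma> > 1 \<Longrightarrow> summable (\<lambda>n. real (Suc n) powr (- \<sigma>))"
 using summable_real_powr_iff[of "-\<sigma>"] summable_Suc_iff[of "\<lambda>n. real n powr (-\<sigma>)"] by simp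

lemma zeta_sum_summable: "Re s > 1 \<Longrightarrow> summable (\<lambda>n. norm (of_nat (Suc n) powr (- s)))"
 unfolding norm_nat_powr by (rule summable_Suc_powr)

lemma has_sum_suminf: "summable (\<lambda>n. norm (f n)) \<Longrightarrow> (f has_sum suminf f) UNIV" for f :: "nat \<Rightarrow> complex"
 by (rule norm_summable_imp_has_sum[OF _ summable_sums[OF summable_norm_cancel]])

lemma zeta_sum_has_sum: "Re s > 1 \<Longrightarrow> ((\<lambda>n. of_nat (Suc n) powr (- s)) has_sum zeta_sum s) UNIV"
 unfolding zeta_sum_def by (rule has_sum_suminf[OF zeta_sum_summable])

lemma zeta_sum_holomorphic: "zeta_sum holomorphic_on {s. Re s > 1}"
 unfolding zeta_sum_def[abs_def]
proof (rule holomorphic_suminf)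
 fix x assume "x \<in> {s. Re s > 1}"
 define d where "d = (Re x - 1) / 2"
 have d: "d > 0" using \<open>x \<in> _\<close> by (simp add: d_def)
 have ball: "Re y \<ge> 1 + d" if "y \<in> cball x d" for y
  using that abs_Re_le_cmod[of "x - y"] by (simp add: dist_norm d_def field_simps abs_le_iff)
 show "\<exists>d>0. \<exists>M. cball x d \<subseteq> {s. Re s > 1} \<and> summable M \<and>
  (\<forall>\<^sub>F n in sequentially. \<forall>y\<in>cball x d. norm (of_nat (Suc n) powr - y) \<le> M n)"
 proof (intro exI[of _ d] conjI exI[of _ "\<lambda>n. real (Suc n) powr (- (1 + d))"] always_eventually allI ballI)
  show "cball x d \<subseteq> {s. Re s > 1}" using ball d by fastforce
  show "summable (\<lambda>n. real (Suc n) powr - (1 + d))" using d by (intro summable_Suc_powr) auto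
  fix n y assume "y \<in> cball x d"
  thus "norm (of_nat (Suc n) powr - y) \<le> real (Suc n) powr - (1 + d)"
   unfolding norm_nat_powr using ball[of y] by (intro powr_mono) auto
 qed (rule d)
qed (auto intro!: holomorphic_intros open_halfspace_Re_gt)

lemma norm_zeta_sum_le:
 assumes "Re s \<ge> 2" shows "norm (zeta_sum s) \<le> (\<Sum>n. real (Suc n) powr (- 2))"
proof -
 have "norm (zeta_sum s) \<le> (\<Sum>n. norm (of_nat (Suc n) powr (- s)))"
  unfolding zeta_sum_def by (rule summable_norm) (use zeta_sum_summable assms in auto)
 also have "... \<le> (\<Sum>n. real (Suc n) powr (- 2))"
  by (rule suminf_le) (use zeta_sum_summable summable_Suc_powr[of 2] assms in
   \<open>auto simp: norm_nat_powr intro!: powr_mono simp del: of_nat_Suc\<close>)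
 finally show ?thesis .
qed

definition half_coeff :: "nat \<Rightarrow> complex \<Rightarrow> complex" where
 "half_coeff j s = pochhammer (s - 1) (2*j) / (fact (2*j + 1)*4^j)"

definition half_bound :: "real \<Rightarrow> nat \<Rightarrow> real" where
 "half_bound K j = pochhammer K (2*j + 1) / (fact (2*j + 1)*4^j)"

lemma half_coeff_mult: "half_coeff j s*(s + of_nat (2*j) - 1) = pochhammer (s - 1) (2*j + 1) / (fact (2*j + 1)*4^j)"
 by (simp add: half_coeff_def pochhammer_Suc algebra_simps)

lemma norm_pochhammer_le: "norm (z::complex) \<le> K \<Longrightarrow> norm (pochhammer z n) \<le> pochhammer K n"
proof (induction n)
 case (Suc n)
 have "norm (z + of_nat n) \<le> K + real n" using Suc.prems norm_triangle_ineq[of z "of_nat n"] by simp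
 thus ?case using Suc unfolding pochhammer_Suc norm_mult
  by (intro mult_mono) (auto intro: order_trans[OF norm_ge_zero])
qed simp

lemma norm_half_coeff_le:
 "norm (s - 1) \<le> K \<Longrightarrow> norm (half_coeff j s*(s + of_nat (2*j) - 1)) \<le> half_bound K j"
 unfolding half_coeff_mult half_bound_def norm_divide norm_mult norm_power norm_fact
 using norm_pochhammer_le[of "s - 1" K "2*j + 1"] by (simp add: divide_right_mono del: fact_Suc)

lemma pochhammer_nonneg_real: "K \<ge> 0 \<Longrightarrow> pochhammer (K::real) n \<ge> 0"
 by (induction n) (auto simp: pochhammer_Suc)

lemma half_bound_nonneg: "K \<ge> 0 \<Longrightarrow> half_bound K j \<ge> 0"
 unfolding half_bound_def using pochhammer_nonneg_real[of K "2*j + 1"] by simp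

lemma summable_half_bound:
 assumes "K \<ge> 0" shows "summable (half_bound K)"
proof -
 let ?f = "\<lambda>n. pochhammer K n / fact n*(1/2)^n"
 have "(- K gchoose n)*(- (1/2))^n = ?f n" for n
 proof -
  have "(- 1)^n*(- (1/2))^n = (1/2 :: real)^n" by (subst power_mult_distrib[symmetric]) simp
  thus ?thesis unfolding gbinomial_pochhammer minus_minus by (metis mult.assoc mult.commute times_divide_eq_right)
 qed
 with gen_binomial_real[of "- (1/2)" "- K"] have "summable ?f" by (simp add: sums_iff)
 hence "?f summable_on UNIV" using pochhammer_nonneg_real[OF assms] by (intro summable_nonneg_imp_summable_on) auto
 hence "?f summable_on range (\<lambda>j. 2*j + 1)" by (rule summable_on_subset_banach) auto
 hence "(?f \<circ> (\<lambda>j. 2*j + 1)) summable_on UNIV"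
  by (subst summable_on_reindex[symmetric]) (auto simp: inj_def)
 hence "summable (\<lambda>j. 2*?f (2*j + 1))" by (intro summable_mult summable_on_imp_summable) (simp add: o_def mult_ac)
 also have "(\<lambda>j. 2*?f (2*j + 1)) = half_bound K"
  by (auto simp: half_bound_def fun_eq_iff power_mult power_divide)
 finally show ?thesis .
qed

lemma powr_half_shift_sums:
 assumes N: "N \<ge> 1"
 shows "(\<lambda>j. half_coeff j s*(s + of_nat (2*j) - 1)*complex_of_real N powr (- s - of_nat (2*j)))
  sums (complex_of_real (N - 1/2) powr (1 - s) - complex_of_real (N + 1/2) powr (1 - s))"
proof -
 define b where "b = (\<lambda>i. ((1 - s) gchoose i) * of_real N powr ((1 - s) - of_nat i))"
 let ?D = "\<lambda>i. complex_of_real (- 1/2)^i - of_real (1/2)^i"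
 have "(\<lambda>i. b i * of_real (- 1/2)^i - b i * of_real (1/2)^i)
  sums (of_real (N + (- 1/2)) powr (1 - s) - of_real (N + 1/2) powr (1 - s))"
  unfolding b_def using N by (intro sums_diff gen_binomial_complex'') auto
 hence all: "(\<lambda>i. b i*?D i) sums (of_real (N - 1/2) powr (1 - s) - of_real (N + 1/2) powr (1 - s))"
  by (simp add: algebra_simps)
 have "(\<lambda>j. b (2*j + 1)*?D (2*j + 1)) sums (of_real (N - 1/2) powr (1 - s) - of_real (N + 1/2) powr (1 - s))"
 proof (rule sums_mono_reindex[THEN iffD2, OF _ _ all])
  show "strict_mono (\<lambda>j::nat. 2*j + 1)" by (simp add: strict_mono_def)
  fix i :: nat assume "i \<notin> range (\<lambda>j. 2*j + 1)"
  hence "even i" by (metis oddE rangeI)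
  thus "b i*?D i = 0" by (simp add: power_divide)
 qed
 moreover have "b (2*j + 1)*?D (2*j + 1)
  = half_coeff j s * (s + of_nat (2*j) - 1) * of_real N powr (- s - of_nat (2*j))" for j
 proof -
  have "?D (2*j + 1) = - (1/4^j)" by (simp add: power_divide power_mult)
  moreover have "((1 - s) gchoose (2*j + 1)) = - (pochhammer (s - 1) (2*j + 1) / fact (2*j + 1))"
   unfolding gbinomial_pochhammer by simp
  moreover have "(1 - s) - of_nat (2*j + 1) = - s - of_nat (2*j)" by simp
  ultimately show ?thesis unfolding half_coeff_mult b_def by (simp only:) simp
 qed
 ultimately show ?thesis by (simp only:)
qed

text \<open>Expanding \<open>(n \<plusminus> 1/2)\<^bsup>1-s\<^esup>\<close> around \<open>n\<close> and summing over \<open>n\<close> telescopes.\<close>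

lemma zeta_sum_half_identity:
 assumes s: "Re s > 1"
 shows "(\<lambda>j. half_coeff j s*((s + of_nat (2*j) - 1)*zeta_sum (s + of_nat (2*j)))) sums 2 powr (s - 1)"
proof -
 define T where "T = (\<lambda>n. complex_of_real (real n + 1/2) powr (1 - s))"
 define f where "f = (\<lambda>(n,j). half_coeff j s * (s + of_nat (2*j) - 1) * of_nat (Suc n) powr (- s - of_nat (2*j)))"
 define K where "K = norm (s - 1)"
 have bound: "norm (f (n,j)) \<le> real (Suc n) powr (- Re s)*half_bound K j" for n j
 proof -
  have "norm (complex_of_nat (Suc n) powr (- s - of_nat (2*j))) = real (Suc n) powr (- Re (s + of_nat (2*j)))"
   using norm_nat_powr[of n "s + of_nat (2*j)"] by (simp add: algebra_simps)
  also have "... \<le> real (Suc n) powr (- Re s)" by (intro powr_mono) auto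
  finally show ?thesis unfolding f_def prod.case norm_mult[of "_*_"]
   using norm_half_coeff_le[of s K j] by (subst mult.commute) (intro mult_mono; simp add: K_def)
 qed
 have "(\<lambda>(n,j). real (Suc n) powr (- Re s)*half_bound K j) summable_on UNIV \<times> UNIV"
  using summable_Suc_powr[OF s] summable_half_bound[of K] half_bound_nonneg[of K]
  by (intro summable_on_Times_product summable_nonneg_imp_summable_on) (auto simp: K_def)
 hence "(\<lambda>x. norm (f x)) summable_on UNIV \<times> UNIV"
  by (rule Infinite_Sum.abs_summable_on_comparison_test') (use bound in auto)
 hence sf: "f summable_on UNIV \<times> UNIV" by (rule abs_summable_summable)
 have row: "((\<lambda>j. f (n, j)) has_sum T n - T (Suc n)) UNIV" for n
 proof -
  have "(\<lambda>j. f (n,j)) sums (T n - T (Suc n))"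
   using powr_half_shift_sums[of "real (Suc n)" s] by (simp add: f_def T_def algebra_simps)
  moreover have "(\<lambda>j. f (n,j)) summable_on UNIV"
   using summable_on_SigmaD1[of "\<lambda>n j. f (n,j)" UNIV "\<lambda>_. UNIV" n] sf by simp
  ultimately show ?thesis using has_sum_imp_sums has_sum_infsum sums_unique2 by metis
 qed
 have "(\<lambda>n. T n - T (Suc n)) sums infsum f (UNIV \<times> UNIV)"
  by (rule has_sum_imp_sums[OF has_sum_SigmaD[OF has_sum_infsum[OF sf] row]])
 moreover have "(\<lambda>n. T n - T (Suc n)) sums (T 0 - 0)"
 proof (rule telescope_sums')
  have "(\<lambda>n. (real n + 1/2) powr (1 - Re s)) \<longlonglongrightarrow> 0" using s by real_asymp
  thus "T \<longlonglongrightarrow> 0"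
   by (subst tendsto_norm_zero_iff[symmetric]) (simp add: T_def norm_powr_real_powr del: of_real_add)
 qed
 moreover have "T 0 = 2 powr (s - 1)"
  using Ln_of_real[of 2] by (simp add: T_def powr_def Ln_of_real[of "1/2", simplified] ln_div algebra_simps)
 ultimately have "infsum f (UNIV \<times> UNIV) = 2 powr (s - 1)" using sums_unique2 by fastforce
 hence swap: "((\<lambda>(j,n). f (n,j)) has_sum 2 powr (s - 1)) (UNIV \<times> UNIV)"
  using has_sum_infsum[OF sf] has_sum_swap[where f = f and A = UNIV and B = UNIV] by simp
 have col: "((\<lambda>n. f (n, j)) has_sum half_coeff j s*((s + of_nat (2*j) - 1)*zeta_sum (s + of_nat (2*j)))) UNIV" for j
  using has_sum_cmult_right[OF zeta_sum_has_sum[of "s + of_nat (2*j)"], of "half_coeff j s*(s + of_nat (2*j) - 1)"] s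
  by (simp add: f_def mult.assoc)
 show ?thesis by (rule has_sum_imp_sums, rule has_sum_SigmaD[OF swap]) (simp add: col del: of_nat_mult)
qed

fun xi_approx :: "nat \<Rightarrow> complex \<Rightarrow> complex" where
 "xi_approx 0 s = (s - 1)*zeta_sum s"
| "xi_approx (Suc J) s = 2 powr (s - 1) - (\<Sum>j. half_coeff (Suc j) s*xi_approx J (s + of_nat (2*Suc j)))"

lemma xi_approx_step: "Re s > 1 - 2*real J \<Longrightarrow> xi_approx (Suc J) s = xi_approx J s"
proof (induction J arbitrary: s)
 case 0
 let ?t = "\<lambda>j. half_coeff j s*((s + of_nat (2*j) - 1)*zeta_sum (s + of_nat (2*j)))"
 have "(\<lambda>j. ?t (Suc j)) sums (2 powr (s - 1) - ?t 0)"
  by (subst sums_Suc_iff) (use zeta_sum_half_identity 0 in simp)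
 thus ?case by (simp add: sums_iff half_coeff_def)
next
 case (Suc J)
 have "xi_approx (Suc J) (s + of_nat (2*Suc j)) = xi_approx J (s + of_nat (2*Suc j))" for j
  by (rule Suc.IH) (use Suc.prems in simp)
 thus ?case by (simp only: xi_approx.simps(2))
qed

lemma xi_approx_eq:
 assumes "Re s > 1 - 2*real J" "J \<le> J'" shows "xi_approx J' s = xi_approx J s"
 using assms(2)
proof (induction rule: dec_induct)
 case (step n)
 have "Re s > 1 - 2*real n" using assms(1) step.hyps by (smt (verit) of_nat_mono)
 from xi_approx_step[OF this] step.IH show ?case by simp
qed simp

lemma norm_xi_term_le:
 assumes "norm (s - 1) \<le> K" "Re s + 2*real (Suc j) \<ge> 2"
 shows "norm (half_coeff (Suc j) s*xi_approx J (s + of_nat (2*Suc j))) \<le> half_bound K (Suc j)*(\<Sum>n. real (Suc n) powr (- 2))"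
proof -
 have "xi_approx J (s + of_nat (2*Suc j)) = xi_approx 0 (s + of_nat (2*Suc j))"
  by (rule xi_approx_eq) (use assms in auto)
 hence "half_coeff (Suc j) s*xi_approx J (s + of_nat (2*Suc j))
  = half_coeff (Suc j) s*(s + of_nat (2*Suc j) - 1)*zeta_sum (s + of_nat (2*Suc j))" by simp
 also have "norm ... \<le> half_bound K (Suc j)*(\<Sum>n. real (Suc n) powr (- 2))"
  unfolding norm_mult[of "_*_"] using assms norm_half_coeff_le[of s K "Suc j"]
  by (intro mult_mono norm_zeta_sum_le half_bound_nonneg) (auto intro: order_trans[OF norm_ge_zero])
 finally show ?thesis .
qed

lemma xi_approx_holomorphic: "xi_approx J holomorphic_on {s. Re s > 1 - 2*real J}"
proof (induction J)
 case 0
 thus ?case using zeta_sum_holomorphic by (auto intro!: holomorphic_intros)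
next
 case (Suc J)
 let ?S = "{s. Re s > 1 - 2*real (Suc J)}"
 let ?u = "\<lambda>j s. half_coeff (Suc j) s*xi_approx J (s + of_nat (2*Suc j))"
 have "(\<lambda>s. \<Sum>j. ?u j s) holomorphic_on ?S"
 proof (rule holomorphic_suminf)
  show "open ?S" by (rule open_halfspace_Re_gt)
  fix j
  have "(xi_approx J \<circ> (\<lambda>s. s + of_nat (2*Suc j))) holomorphic_on ?S"
   by (rule holomorphic_on_compose_gen[OF _ Suc.IH]) (auto intro!: holomorphic_intros)
  thus "?u j holomorphic_on ?S" unfolding half_coeff_def pochhammer_prod o_def by (intro holomorphic_intros) auto
 next
  fix x assume "x \<in> ?S"
  then obtain d where d: "d > 0" "cball x d \<subseteq> ?S" using open_contains_cball open_halfspace_Re_gt by metis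
  define K where "K = norm (x - 1) + d"
  have K: "norm (y - 1) \<le> K" if "y \<in> cball x d" for y
   using that norm_triangle_ineq[of "x - 1" "y - x"] by (simp add: K_def dist_norm norm_minus_commute)
  let ?M = "\<lambda>j. half_bound K (Suc j)*(\<Sum>n. real (Suc n) powr (- 2))"
  have "norm (?u n y) \<le> ?M n" if "n \<ge> J + 1" "y \<in> cball x d" for n y
   using that d by (intro norm_xi_term_le K) auto
  moreover have "summable ?M"
   using summable_half_bound[of K] d by (intro summable_mult2) (simp add: summable_Suc_iff K_def)
  ultimately show "\<exists>d>0. \<exists>M. cball x d \<subseteq> ?S \<and> summable M \<and> (\<forall>\<^sub>F n in sequentially. \<forall>y\<in>cball x d. norm (?u n y) \<le> M n)"
   using d by (intro exI[of _ d] exI[of _ ?M] conjI eventually_sequentiallyI[of "J + 1"]) auto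
 qed
 thus ?case unfolding xi_approx.simps(2)[abs_def] by (auto intro!: holomorphic_intros)
qed

text \<open>The entire function \<open>(s - 1) \<zeta>(s)\<close>.\<close>

definition xi :: "complex \<Rightarrow> complex" where
 "xi s = xi_approx (nat \<lceil>\<bar>Re s\<bar>\<rceil> + 1) s"

lemma xi_eq_approx:
 assumes J: "Re s > 1 - 2*real J" shows "xi s = xi_approx J s"
proof -
 let ?R = "nat \<lceil>\<bar>Re s\<bar>\<rceil> + 1"
 have "Re s > 1 - 2*real ?R" using real_nat_ceiling_ge[of "\<bar>Re s\<bar>"] by (smt (verit) of_nat_add of_nat_1)
 thus ?thesis unfolding xi_def using xi_approx_eq[OF J, of ?R] xi_approx_eq[of ?R s J] by (metis nle_le)
qed

lemma half_plane_exhaustion: "\<exists>J. Re s > 1 - 2*real J"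
 using reals_Archimedean2[of "(1 - Re s)/2"] by (auto simp: field_simps)

lemma xi_holomorphic: "xi holomorphic_on UNIV"
proof -
 have "xi field_differentiable at s" for s
 proof -
  obtain J where J: "Re s > 1 - 2*real J" using half_plane_exhaustion by blast
  have "xi holomorphic_on {s. Re s > 1 - 2*real J}"
   using xi_approx_holomorphic xi_eq_approx by (metis (mono_tags, lifting) holomorphic_cong mem_Collect_eq)
  thus ?thesis using J holomorphic_on_imp_differentiable_at[OF _ open_halfspace_Re_gt] by blast
 qed
 thus ?thesis by (simp add: holomorphic_on_def field_differentiable_at_within)
qed

lemma xi_eq_zeta_sum: "Re s > 1 \<Longrightarrow> xi s = (s - 1)*zeta_sum s"
 using xi_eq_approx[of 0 s] by simp

lemma xi_recurrence: "xi s = 2 powr (s - 1) - (\<Sum>j. half_coeff (Suc j) s*xi (s + of_nat (2*Suc j)))"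
proof -
 obtain J where J: "Re s > 1 - 2*real J" using half_plane_exhaustion by blast
 have "xi (s + of_nat (2*Suc j)) = xi_approx J (s + of_nat (2*Suc j))" for j by (rule xi_eq_approx) (use J in simp)
 moreover have "xi s = xi_approx (Suc J) s" by (rule xi_eq_approx) (use J in simp)
 ultimately show ?thesis by (simp only: xi_approx.simps(2))
qed

lemma xi_0: "xi 0 = 1/2"
proof -
 have "half_coeff (Suc j) 0 = 0" for j by (simp add: half_coeff_def pochhammer_rec)
 thus ?thesis using xi_recurrence[of 0] by (simp add: powr_minus_divide)
qed

lemma half_coeff_neg_even:
 defines "s \<equiv> \<lambda>m. - of_nat (2*m) :: complex"
 shows "half_coeff m (s m) = 1/4^m" "j > m \<Longrightarrow> half_coeff j (s m) = 0"
proof -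
 have arg: "s m - 1 = - of_nat (2*m + 1)" by (simp add: s_def)
 show "j > m \<Longrightarrow> half_coeff j (s m) = 0"
  unfolding half_coeff_def arg by (subst pochhammer_of_nat_eq_0_iff[THEN iffD2]) auto
 have "pochhammer (s m - 1) (2*m) = (-1)^(2*m)*pochhammer (of_nat (2*m + 1) - of_nat (2*m) + 1) (2*m)"
  unfolding arg using pochhammer_minus[of "of_nat (2*m + 1) :: complex" "2*m"] by simp
 also have "... = pochhammer 2 (2*m)" by simp
 also have "... = fact (2*m + 1)"
  using pochhammer_rec[of "1::complex" "2*m"] by (simp add: pochhammer_fact[symmetric] del: fact_Suc)
 finally show "half_coeff m (s m) = 1/4^m" by (simp add: half_coeff_def del: fact_Suc)
qed

lemma xi_neg_even: "m \<ge> 1 \<Longrightarrow> xi (- of_nat (2*m)) = 0"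
proof (induction m rule: less_induct)
 case (less m)
 let ?s = "- of_nat (2*m) :: complex"
 have "half_coeff (Suc j) ?s*xi (?s + of_nat (2*Suc j)) = 0" if "j \<noteq> m - 1" for j
 proof (cases "Suc j > m")
  case False
  hence lt: "Suc j < m" using that less.prems by linarith
  hence "?s + of_nat (2*Suc j) = - of_nat (2*(m - Suc j))" by (simp add: of_nat_diff)
  thus ?thesis using less.IH[of "m - Suc j"] lt by simp
 qed (simp add: half_coeff_neg_even(2) del: of_nat_mult)
 hence "(\<Sum>j. half_coeff (Suc j) ?s*xi (?s + of_nat (2*Suc j)))
  = (\<Sum>j\<in>{m - 1}. half_coeff (Suc j) ?s*xi (?s + of_nat (2*Suc j)))" by (intro suminf_finite) auto
 also have "... = half_coeff m ?s*xi 0" using less.prems by (simp add: of_nat_diff algebra_simps)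
 also have "... = 1/4^m/2" by (simp only: half_coeff_neg_even(1) xi_0) simp
 finally have sum: "(\<Sum>j. half_coeff (Suc j) ?s*xi (?s + of_nat (2*Suc j))) = 1/4^m/2" .
 have "?s - 1 = - of_nat (2*m + 1)" by simp
 hence "(2::complex) powr (?s - 1) = 1/2^(2*m + 1)"
  by (simp only:) (subst powr_minus, simp add: powr_nat' divide_inverse del: of_nat_Suc power_Suc)
 thus ?case using xi_recurrence[of ?s] sum by (simp add: power_mult)
qed

section \<open>Quadratic forms with compact resolvent\<close>

locale eigenbasis =
 fixes V :: "'a::real_inner set" and q :: "'a \<Rightarrow> 'a \<Rightarrow> real" and u :: "nat \<Rightarrow> 'a" and l :: "nat \<Rightarrow> real"
 assumes u_in: "\<And>n. u n \<in> V" and orthonormal: "\<And>m n. inner (u m) (u n) = (if m = n then 1 else 0)"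
  and incseq_l: "incseq l" and l_at_top: "filterlim l at_top sequentially"
  and eigenvector: "\<And>n y. y \<in> V \<Longrightarrow> q (u n) y = l n*inner (u n) y"
  and Parseval_eigenbasis: "\<And>y. y \<in> V \<Longrightarrow> (\<lambda>j. (inner y (u j))^2) sums (norm y)^2"

locale compact_form =
 fixes V :: "'a::real_inner set" and q :: "'a \<Rightarrow> 'a \<Rightarrow> real" and c :: real
 assumes V: "subspace V"
  and q_add: "\<And>x y z. x \<in> V \<Longrightarrow> y \<in> V \<Longrightarrow> z \<in> V \<Longrightarrow> q (x + y) z = q x z + q y z"
  and q_scale: "\<And>r x z. x \<in> V \<Longrightarrow> z \<in> V \<Longrightarrow> q (r *\<^sub>R x) z = r*q x z"
  and q_sym: "\<And>x y. x \<in> V \<Longrightarrow> y \<in> V \<Longrightarrow> q x y = q y x"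
  and q_lower: "\<And>x. x \<in> V \<Longrightarrow> q x x \<ge> - c*(norm x)^2"
  and infinite_dim: "\<And>F. finite F \<Longrightarrow> \<exists>x\<in>V. x \<noteq> 0 \<and> (\<forall>y\<in>F. inner x y = 0)"
  and compact: "\<And>X b. (\<And>i::nat. X i \<in> V) \<Longrightarrow> (\<And>i. norm (X i) \<le> 1) \<Longrightarrow> (\<lambda>i. q (X i) (X i)) \<longlonglongrightarrow> b \<Longrightarrow>
   \<exists>r x. strict_mono r \<and> x \<in> V \<and> (X \<circ> r) \<longlonglongrightarrow> x \<and> q x x \<le> b"
begin

lemma q_add_right: "x \<in> V \<Longrightarrow> y \<in> V \<Longrightarrow> z \<in> V \<Longrightarrow> q z (x + y) = q z x + q z y"
 using q_add q_sym V by (metis subspace_add)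

lemma q_scale_right: "x \<in> V \<Longrightarrow> z \<in> V \<Longrightarrow> q z (r *\<^sub>R x) = r*q z x"
 using q_scale q_sym V by (metis subspace_scale)

lemma q_sum_right:
 "finite A \<Longrightarrow> (\<And>i. i \<in> A \<Longrightarrow> f i \<in> V) \<Longrightarrow> z \<in> V \<Longrightarrow> q z (\<Sum>i\<in>A. f i) = (\<Sum>i\<in>A. q z (f i))"
proof (induction A rule: finite_induct)
 case empty
 have "q z (0 *\<^sub>R z) = 0*q z z" using q_scale_right[of z z 0] empty by blast
 thus ?case by simp
qed (simp add: q_add_right subspace_sum[OF V])

definition is_min :: "'a set \<Rightarrow> 'a \<Rightarrow> bool" where
 "is_min F x \<longleftrightarrow> x \<in> V \<and> norm x = 1 \<and> (\<forall>f\<in>F. inner x f = 0) \<and>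
  (\<forall>y\<in>V. (\<forall>f\<in>F. inner y f = 0) \<longrightarrow> q x x*(norm y)^2 \<le> q y y)"

lemma minimizing_sequence:
 assumes ne: "S \<noteq> {}" and bd: "bdd_below (Q ` S)" and Q: "\<And>x. x \<in> S \<Longrightarrow> x \<in> V \<and> norm x = 1 \<and> Q x = q x x"
 obtains X x where "\<And>i::nat. X i \<in> S" "X \<longlonglongrightarrow> x" "x \<in> V" "q x x \<le> Inf (Q ` S)"
proof -
 define m where "m = Inf (Q ` S)"
 have "\<exists>x\<in>S. Q x < m + 1/real (Suc i)" for i
  using cInf_lessD[of "Q ` S" "m + 1/real (Suc i)"] ne by (auto simp: m_def)
 then obtain X where X: "\<And>i. X i \<in> S" "\<And>i. Q (X i) < m + 1/real (Suc i)" by metis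
 have "(\<lambda>i. q (X i) (X i)) \<longlonglongrightarrow> m"
 proof (rule tendsto_sandwich[of "\<lambda>_. m" _ _ "\<lambda>i. m + 1/real (Suc i)"])
  show "(\<lambda>i. m + 1/real (Suc i)) \<longlonglongrightarrow> m" by real_asymp
  have "m \<le> q (X i) (X i)" for i using X(1) Q cInf_lower[OF imageI[OF X(1)] bd] by (simp add: m_def)
  thus "\<forall>\<^sub>F i in sequentially. m \<le> q (X i) (X i)" by simp
  have "q (X i) (X i) \<le> m + 1/real (Suc i)" for i using X(2)[of i] Q[OF X(1)] by simp
  thus "\<forall>\<^sub>F i in sequentially. q (X i) (X i) \<le> m + 1/real (Suc i)" by simp
 qed simp
 then obtain r x where "(X \<circ> r) \<longlonglongrightarrow> x" "x \<in> V" "q x x \<le> m"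
  using compact[of X] X(1) Q by (metis order_refl)
 thus ?thesis using that[of "X \<circ> r" x] X(1) by (simp add: m_def)
qed

lemma ex_min:
 assumes "finite F" shows "\<exists>x. is_min F x"
proof -
 define W where "W = {y \<in> V. \<forall>f\<in>F. inner y f = 0}"
 define S where "S = {y \<in> W. norm y = 1}"
 let ?Q = "\<lambda>y. q y y"
 have unit: "(1/norm y) *\<^sub>R y \<in> S" "?Q ((1/norm y) *\<^sub>R y) = q y y / (norm y)^2" if "y \<in> W" "y \<noteq> 0" for y
  using that V by (auto simp: W_def S_def subspace_scale q_scale q_scale_right power2_eq_square)
 have bd: "bdd_below (?Q ` S)"
  by (rule bdd_belowI2[of _ "- c"]) (use q_lower in \<open>force simp: S_def W_def\<close>)
 obtain X x where X: "\<And>i::nat. X i \<in> S" "X \<longlonglongrightarrow> x" "x \<in> V" "q x x \<le> Inf (?Q ` S)"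
 proof (rule minimizing_sequence[OF _ bd])
  show "S \<noteq> {}" using infinite_dim[OF assms] unit(1) unfolding W_def by blast
 qed (auto simp: S_def W_def)
 have "norm x = 1" using LIMSEQ_unique[OF tendsto_norm[OF X(2)], of 1] X(1) by (simp add: S_def)
 moreover have "inner x f = 0" if "f \<in> F" for f
  using LIMSEQ_unique[OF tendsto_inner[OF X(2) tendsto_const], of f 0] X(1) that by (simp add: S_def W_def)
 moreover have "q x x*(norm y)^2 \<le> q y y" if "y \<in> W" for y
 proof (cases "y = 0")
  case True
  thus ?thesis using q_scale[of y y 0] that by (simp add: W_def)
 next
  case False
  have "q x x \<le> ?Q ((1/norm y) *\<^sub>R y)"
   using X(4) cInf_lower[OF imageI[OF unit(1)[OF that False]] bd] by linarith
  thus ?thesis using unit(2)[OF that False] False by (simp add: pos_le_divide_eq)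
 qed
 ultimately show ?thesis using X(3) by (auto simp: is_min_def W_def)
qed

lemma min_orthogonality:
 assumes x: "is_min F x" and y: "y \<in> V" "\<forall>f\<in>F. inner y f = 0"
 shows "q x y = q x x*inner x y"
proof -
 have xV: "x \<in> V" "norm x = 1" using x by (auto simp: is_min_def)
 define d where "d = q x y - q x x*inner x y"
 define e where "e = q y y - q x x*(norm y)^2"
 have e: "e \<ge> 0" using x y by (auto simp: e_def is_min_def)
 have quadratic: "0 \<le> 2*t*d + t^2*e" for t
 proof -
  have "x + t *\<^sub>R y \<in> V" "\<forall>f\<in>F. inner (x + t *\<^sub>R y) f = 0"
   using x y V by (auto simp: is_min_def subspace_add subspace_scale inner_add_left)
  hence "q x x*(norm (x + t *\<^sub>R y))^2 \<le> q (x + t *\<^sub>R y) (x + t *\<^sub>R y)" using x by (auto simp: is_min_def)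
  also have "... = q x x + 2*t*q x y + t^2*q y y" using xV y V q_sym[of x y]
   by (simp add: q_add q_add_right q_scale q_scale_right subspace_add subspace_scale power2_eq_square algebra_simps)
  also have "(norm (x + t *\<^sub>R y))^2 = 1 + 2*t*inner x y + t^2*(norm y)^2"
   using xV(2) unfolding power2_norm_eq_inner norm_eq_1
   by (simp add: inner_add_left inner_add_right inner_commute power2_eq_square algebra_simps)
  finally show ?thesis by (simp add: d_def e_def algebra_simps)
 qed
 have "0 \<le> 2*(- d/(e + 1))*d + (- d/(e + 1))^2*e" by (rule quadratic)
 also have "... = - (d^2*(e + 2)) / (e + 1)^2"
  using e by (simp add: divide_simps power2_eq_square) (simp add: algebra_simps)
 finally have "d^2*(e + 2) \<le> 0" using e by (simp add: divide_le_0_iff zero_le_divide_iff)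
 thus ?thesis using e by (simp add: mult_le_0_iff d_def)
qed

lemma ex_minimizers: "\<exists>u. \<forall>n::nat. is_min (u ` {..<n}) (u n)"
proof (rule dependent_wf_choice[of less_than])
 fix f g :: "nat \<Rightarrow> 'a" and n r assume "\<And>z. (z, n) \<in> less_than \<Longrightarrow> f z = g z"
 hence "f ` {..<n} = g ` {..<n}" by auto
 thus "is_min (f ` {..<n}) r = is_min (g ` {..<n}) r" by simp
qed (auto intro: ex_min)

end

locale compact_form_minimizers = compact_form +
 fixes u :: "nat \<Rightarrow> 'a"
 assumes u: "\<And>n::nat. is_min (u ` {..<n}) (u n)"
begin

definition l :: "nat \<Rightarrow> real" where "l n = q (u n) (u n)"

definition proj :: "nat \<Rightarrow> 'a \<Rightarrow> 'a" where "proj n y = (\<Sum>j<n. inner y (u j) *\<^sub>R u j)"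

lemma u_in: "u n \<in> V" using u by (auto simp: is_min_def)

lemma u_orthonormal: "inner (u m) (u n) = (if m = n then 1 else 0)"
proof -
 have "inner (u m) (u n) = 0" if "m < n" for m n using u[of n] that by (auto simp: is_min_def inner_commute)
 from this[of m n] this[of n m] u[of n] show ?thesis
  by (auto simp: is_min_def norm_eq_1 inner_commute dest: linorder_cases)
qed

lemma proj_in: "proj n y \<in> V" unfolding proj_def using V u_in by (intro subspace_sum subspace_scale)

lemma inner_proj: "inner (proj n y) (u j) = (if j < n then inner y (u j) else 0)"
 by (simp add: proj_def inner_sum_left u_orthonormal if_distrib[of "(*) _"] cong: if_cong)

lemma residual_orthogonal: "j < n \<Longrightarrow> inner (y - proj n y) (u j) = 0"
 by (simp add: inner_diff_left inner_proj)

lemma l_le: "y \<in> V \<Longrightarrow> (\<And>j. j < n \<Longrightarrow> inner y (u j) = 0) \<Longrightarrow> l n*(norm y)^2 \<le> q y y"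
 using u[of n] by (auto simp: is_min_def l_def)

lemma incseq_l: "incseq l"
proof (rule incseq_SucI)
 fix n
 have "l n*(norm (u (Suc n)))^2 \<le> l (Suc n)"
  unfolding l_def[of "Suc n"] by (rule l_le[OF u_in]) (simp add: u_orthonormal)
 thus "l n \<le> l (Suc n)" using u[of "Suc n"] by (simp add: is_min_def)
qed

lemma q_proj: "z \<in> V \<Longrightarrow> q z (proj n y) = (\<Sum>j<n. inner y (u j)*q z (u j))"
 unfolding proj_def using V u_in by (subst q_sum_right) (auto simp: subspace_scale q_scale_right)

lemma eigenvector: "y \<in> V \<Longrightarrow> q (u n) y = l n*inner (u n) y"
proof (induction n arbitrary: y rule: less_induct)
 case (less n)
 have R: "y - proj n y \<in> V" using V less.prems proj_in by (rule subspace_diff)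
 have "inner y (u j)*q (u n) (u j) = 0" if "j < n" for j
  using less.IH[OF that u_in, of n] that q_sym[OF u_in u_in, of n j] by (simp add: u_orthonormal)
 hence "q (u n) (proj n y) = 0" unfolding q_proj[OF u_in] by (intro sum.neutral) auto
 moreover have "q (u n) (y - proj n y) = l n*inner (u n) (y - proj n y)"
  unfolding l_def by (rule min_orthogonality[OF u R]) (auto simp: residual_orthogonal)
 moreover have "inner (u n) (proj n y) = 0" using inner_proj[of n y n] by (simp add: inner_commute)
 ultimately show ?case using q_add_right[OF R proj_in u_in, of n n y] by (simp add: inner_diff_right)
qed

lemma l_at_top: "filterlim l at_top sequentially"
proof (rule ccontr)
 assume "\<not> filterlim l at_top sequentially"
 then obtain B where B: "\<not> (\<forall>\<^sub>F n in sequentially. B \<le> l n)" by (auto simp: filterlim_at_top)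
 have "l n \<le> B" for n
 proof (rule ccontr)
  assume "\<not> l n \<le> B"
  hence "\<forall>\<^sub>F m in sequentially. B \<le> l m"
   using incseq_l by (intro eventually_sequentiallyI[of n]) (smt (verit) incseqD)
  thus False using B by blast
 qed
 then obtain b where "l \<longlonglongrightarrow> b" using incseq_convergent[OF incseq_l, of B] by blast
 then obtain r x where r: "strict_mono r" "(u \<circ> r) \<longlonglongrightarrow> x"
  using compact[of u b] u_in u unfolding l_def by (metis is_min_def order_refl)
 hence "Cauchy (u \<circ> r)" by (intro LIMSEQ_imp_Cauchy)
 then obtain M where M: "\<And>m n. m \<ge> M \<Longrightarrow> n \<ge> M \<Longrightarrow> norm ((u \<circ> r) m - (u \<circ> r) n) < 1"
  unfolding Cauchy_iff by (metis zero_less_one)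
 have "r M \<noteq> r (Suc M)" using r(1) by (metis less_irrefl lessI strict_monoD)
 hence "(norm (u (r M) - u (r (Suc M))))^2 = 2"
  by (simp add: power2_norm_eq_inner inner_diff_left inner_diff_right u_orthonormal)
 moreover have "(norm (u (r M) - u (r (Suc M))))^2 < 1"
  using M[of M "Suc M"] by (simp add: power_less_one_iff abs_square_less_1)
 ultimately show False by simp
qed

lemma norm_residual: "(norm (y - proj n y))^2 = (norm y)^2 - (\<Sum>j<n. (inner y (u j))^2)"
proof -
 have "inner (y - proj n y) (proj n y) = 0"
  unfolding proj_def[of n y] inner_sum_right using residual_orthogonal[of _ n y] by (intro sum.neutral) (simp add: proj_def)
 hence "(norm (y - proj n y))^2 = inner y y - inner (proj n y) y"
  by (simp add: power2_norm_eq_inner inner_diff_right inner_diff_left)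
 also have "inner (proj n y) y = (\<Sum>j<n. (inner y (u j))^2)"
  by (simp add: proj_def inner_sum_left inner_sum_right inner_commute power2_eq_square)
 finally show ?thesis by (simp add: power2_norm_eq_inner)
qed

lemma q_residual:
 assumes y: "y \<in> V"
 shows "q (y - proj n y) (y - proj n y) = q y y - (\<Sum>j<n. l j*(inner y (u j))^2)"
proof -
 define R where "R = y - proj n y"
 have R: "R \<in> V" "y = R + proj n y" using V y proj_in by (auto simp: R_def intro: subspace_diff)
 have q_proj_eq: "q z (proj n y) = (\<Sum>j<n. inner y (u j)*(l j*inner (u j) z))" if "z \<in> V" for z
  using q_proj[OF that, of n y] eigenvector[OF that] q_sym[OF that u_in] by simp
 have "q R (proj n y) = 0" unfolding q_proj_eq[OF R(1)] using residual_orthogonal[of _ n y]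
  by (intro sum.neutral) (simp add: R_def inner_commute)
 moreover have "q y y = q R R + 2*q R (proj n y) + q (proj n y) (proj n y)"
  using R(1) proj_in[of n y] q_sym[OF R(1) proj_in] V by (subst (1 2) R(2)) (simp add: q_add q_add_right subspace_add)
 moreover have "q y (proj n y) = q R (proj n y) + q (proj n y) (proj n y)"
  using q_add[OF R(1) proj_in proj_in, of n y n y] R(2) by simp
 moreover have "q y (proj n y) = (\<Sum>j<n. l j*(inner y (u j))^2)"
  unfolding q_proj_eq[OF y] by (simp add: inner_commute power2_eq_square mult_ac)
 ultimately show ?thesis by (simp add: R_def)
qed

lemma l_lower: "l j \<ge> - \<bar>c\<bar>"
 using q_lower[OF u_in, of j] u[of j] by (auto simp: l_def is_min_def)

lemma Parseval:
 assumes y: "y \<in> V" shows "(\<lambda>j. (inner y (u j))^2) sums (norm y)^2"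
proof -
 define C where "C = q y y + \<bar>c\<bar>*(norm y)^2"
 have bound: "l n*(norm (y - proj n y))^2 \<le> C" for n
 proof -
  have "l n*(norm (y - proj n y))^2 \<le> q (y - proj n y) (y - proj n y)"
   using residual_orthogonal V y proj_in by (intro l_le subspace_diff) auto
  also have "... \<le> q y y - (\<Sum>j<n. - \<bar>c\<bar>*(inner y (u j))^2)"
   unfolding q_residual[OF y] by (intro diff_left_mono sum_mono mult_right_mono l_lower) auto
  also have "... = q y y + \<bar>c\<bar>*(\<Sum>j<n. (inner y (u j))^2)" by (simp add: sum_distrib_left sum_negf)
  also have "... \<le> C"
   using norm_residual[of y n] zero_le_power2[of "norm (y - proj n y)"] by (simp add: C_def mult_left_mono)
  finally show ?thesis .
 qed
 have "(\<lambda>n. (norm (y - proj n y))^2) \<longlonglongrightarrow> 0"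
 proof (rule tendsto_sandwich[of "\<lambda>_. 0" _ _ "\<lambda>n. C/l n"])
  have "\<forall>\<^sub>F n in sequentially. l n > 0" using l_at_top by (simp add: filterlim_at_top_dense)
  thus "\<forall>\<^sub>F n in sequentially. (norm (y - proj n y))^2 \<le> C/l n"
   by eventually_elim (use bound in \<open>simp add: field_simps\<close>)
  show "(\<lambda>n. C/l n) \<longlonglongrightarrow> 0" by (rule real_tendsto_divide_at_top[OF tendsto_const l_at_top])
 qed auto
 hence "(\<lambda>n. (norm y)^2 - (norm (y - proj n y))^2) \<longlonglongrightarrow> (norm y)^2 - 0" by (intro tendsto_intros)
 thus ?thesis by (simp add: sums_def norm_residual)
qed

end

theorem (in compact_form) spectral: "\<exists>u l. eigenbasis V q u l"
proof -
 obtain u where "\<And>n::nat. is_min (u ` {..<n}) (u n)" using ex_minimizers by blast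
 then interpret compact_form_minimizers V q c u by unfold_locales
 have "eigenbasis V q u l" by unfold_locales (use u_in u_orthonormal incseq_l l_at_top eigenvector Parseval in auto)
 thus ?thesis by blast
qed

section \<open>Square summable sequences\<close>

typedef ell2 = "{x :: int \<Rightarrow> real. (\<lambda>n. (x n)^2) summable_on UNIV}"
 morphisms coord ell2
 by (rule exI[of _ "\<lambda>_. 0"]) simp

lemma coord_summable: "(\<lambda>n. (coord x n)^2) summable_on UNIV" using coord[of x] by simp

lemma coord_ell2: "(\<lambda>n. (x n)^2) summable_on UNIV \<Longrightarrow> coord (ell2 x) = x" by (simp add: ell2_inverse)

lemma ell2_eqI: "(\<And>n. coord x n = coord y n) \<Longrightarrow> x = y"
 by (simp add: coord_inject[symmetric] fun_eq_iff)

lemma square_summable_add: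
 fixes x y :: "'i \<Rightarrow> real"
 assumes "(\<lambda>n. (x n)^2) summable_on UNIV" "(\<lambda>n. (y n)^2) summable_on UNIV"
 shows "(\<lambda>n. (x n + y n)^2) summable_on UNIV"
proof (rule summable_on_comparison_test)
 show "(\<lambda>n. 2*(x n)^2 + 2*(y n)^2) summable_on UNIV" by (intro summable_on_add summable_on_cmult_right assms)
 show "(x n + y n)^2 \<le> 2*(x n)^2 + 2*(y n)^2" for n
  using zero_le_power2[of "x n - y n"] by (simp add: power2_eq_square algebra_simps)
qed auto

lemma square_summable_mult:
 fixes x y :: "'i \<Rightarrow> real"
 assumes "(\<lambda>n. (x n)^2) summable_on UNIV" "(\<lambda>n. (y n)^2) summable_on UNIV"
 shows "(\<lambda>n. x n*y n) summable_on UNIV"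
proof (rule summable_on_abs_real_iff[THEN iffD1], rule summable_on_comparison_test)
 show "(\<lambda>n. (x n)^2 + (y n)^2) summable_on UNIV" by (intro summable_on_add assms)
 show "\<bar>x n*y n\<bar> \<le> (x n)^2 + (y n)^2" for n
  using sum_squares_bound[of "\<bar>x n\<bar>" "\<bar>y n\<bar>"] mult_nonneg_nonneg[of "\<bar>x n\<bar>" "\<bar>y n\<bar>"] unfolding abs_mult power2_abs
  by linarith
qed auto

instantiation ell2 :: real_vector
begin
definition "0 = ell2 (\<lambda>_. 0)"
definition "x + y = ell2 (\<lambda>n. coord x n + coord y n)"
definition "- x = ell2 (\<lambda>n. - coord x n)"
definition "x - y = ell2 (\<lambda>n. coord x n - coord y n)"
definition "scaleR r x = ell2 (\<lambda>n. r*coord x n)"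

lemma coord_simps [simp]:
 "coord 0 n = 0" "coord (x + y) n = coord x n + coord y n" "coord (- x) n = - coord x n"
 "coord (x - y) n = coord x n - coord y n" "coord (scaleR r x) n = r*coord x n"
 unfolding zero_ell2_def plus_ell2_def uminus_ell2_def minus_ell2_def scaleR_ell2_def
 using square_summable_add[OF coord_summable[of x] coord_summable[of y]]
  square_summable_add[OF coord_summable[of x], of "\<lambda>n. - coord y n"] coord_summable
  summable_on_cmult_right[OF coord_summable[of x], of "r^2"]
 by (simp_all add: coord_ell2 power_mult_distrib)

instance by standard (auto intro!: ell2_eqI simp: algebra_simps)
end

instantiation ell2 :: real_inner
begin
definition "inner x y = (\<Sum>\<^sub>\<infinity>n. coord x n*coord y n)"
definition "norm (x::ell2) = sqrt (inner x x)"
definition "sgn (x::ell2) = x /\<^sub>R norm x"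
definition "dist x y = norm (x - y :: ell2)"
definition [code del]: "(uniformity :: (ell2 \<times> ell2) filter) = (INF e\<in>{0<..}. principal {(x, y). dist x y < e})"
definition [code del]: "open (U :: ell2 set) \<longleftrightarrow> (\<forall>x\<in>U. eventually (\<lambda>(x', y). x' = x \<longrightarrow> y \<in> U) uniformity)"

lemma summable_coord_mult: "(\<lambda>n. coord x n*coord y n) summable_on UNIV"
 by (intro square_summable_mult coord_summable)

instance
proof
 fix x y z :: ell2 and r :: real
 show "inner x y = inner y x" by (simp add: inner_ell2_def mult.commute)
 show "inner (x + y) z = inner x z + inner y z"
  by (simp add: inner_ell2_def ring_distribs infsum_add summable_coord_mult)
 show "inner (r *\<^sub>R x) y = r*inner x y" by (simp add: inner_ell2_def mult.assoc infsum_cmult_right')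
 show "0 \<le> inner x x" by (simp add: inner_ell2_def infsum_nonneg)
 show "inner x x = 0 \<longleftrightarrow> x = 0"
 proof
  assume "inner x x = 0"
  hence "coord x n*coord x n = 0" for n
   using nonneg_infsum_le_0D[of "\<lambda>n. coord x n*coord x n" UNIV n] summable_coord_mult[of x x]
   by (auto simp: inner_ell2_def)
  thus "x = 0" by (intro ell2_eqI) simp
 qed (simp add: inner_ell2_def)
 show "norm x = sqrt (inner x x)" by (simp add: norm_ell2_def)
qed (auto simp: sgn_ell2_def dist_ell2_def uniformity_ell2_def open_ell2_def)
end

lemma has_sum_inner: "((\<lambda>n. coord x n*coord y n) has_sum inner x y) UNIV"
 unfolding inner_ell2_def by (rule has_sum_infsum[OF summable_coord_mult])

lemma has_sum_norm_square: "((\<lambda>n. (coord x n)^2) has_sum (norm x)^2) UNIV"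
 using has_sum_inner[of x x] unfolding power2_norm_eq_inner by (simp add: power2_eq_square)

lemma coord_le_norm: "\<bar>coord x n\<bar> \<le> norm x"
 using finite_sum_le_has_sum[OF has_sum_norm_square, of "{n}" x] by (simp add: abs_le_square_iff[symmetric])

definition unit_vec :: "int \<Rightarrow> ell2" where "unit_vec n = ell2 (\<lambda>m. if m = n then 1 else 0)"

lemma coord_unit_vec: "coord (unit_vec n) m = (if m = n then 1 else 0)"
 unfolding unit_vec_def by (subst coord_ell2) (auto intro!: finite_nonzero_values_imp_summable_on)

lemma inner_unit_vec: "inner x (unit_vec n) = coord x n"
 using infsum_single[of n "coord x"] by (simp add: inner_ell2_def coord_unit_vec if_distrib[of "(*) _"] cong: if_cong)

lemma nontrivial_relation_exists:
 fixes B :: "'i \<Rightarrow> 'a \<Rightarrow> real"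
 assumes "finite K" "finite I" "card K < card I"
 shows "\<exists>d. (\<exists>i\<in>I. d i \<noteq> 0) \<and> (\<forall>k\<in>K. (\<Sum>i\<in>I. d i*B i k) = 0)"
 using assms
proof (induction K arbitrary: I rule: finite_induct)
 case empty
 thus ?case by (intro exI[of _ "\<lambda>_. 1"]) (auto simp: card_gt_0_iff)
next
 case (insert k K)
 hence "card K < card I" by simp
 then obtain d j where d: "j \<in> I" "d j \<noteq> 0" "\<forall>k\<in>K. (\<Sum>i\<in>I. d i*B i k) = 0"
  using insert.IH[OF insert.prems(1)] by blast
 have "card K < card (I - {j})" using insert d(1) by simp
 then obtain d' where d': "\<exists>i\<in>I - {j}. d' i \<noteq> 0" "\<forall>k\<in>K. (\<Sum>i\<in>I - {j}. d' i*B i k) = 0"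
  using insert.IH[of "I - {j}"] insert.prems(1) by blast
 define e where "e i = (if i = j then 0 else d' i)" for i
 have e: "(\<Sum>i\<in>I. e i*B i k) = (\<Sum>i\<in>I - {j}. d' i*B i k)" for k
  using sum.remove[OF insert.prems(1) d(1), of "\<lambda>i. e i*B i k"] by (simp add: e_def)
 show ?case
 proof (cases "(\<Sum>i\<in>I. e i*B i k) = 0")
  case True
  thus ?thesis using d' e by (intro exI[of _ e]) (auto simp: e_def)
 next
  case False
  let ?z = "\<lambda>i. (\<Sum>i\<in>I. e i*B i k)*d i - (\<Sum>i\<in>I. d i*B i k)*e i"
  have "(\<Sum>i\<in>I. ?z i*B i k') = (\<Sum>i\<in>I. e i*B i k)*(\<Sum>i\<in>I. d i*B i k') - (\<Sum>i\<in>I. d i*B i k)*(\<Sum>i\<in>I. e i*B i k')" for k'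
   by (simp add: left_diff_distrib sum_subtractf sum_distrib_left mult.assoc)
  hence "\<forall>k'\<in>insert k K. (\<Sum>i\<in>I. ?z i*B i k') = 0" using d(3) d'(2) by (simp add: e mult.commute)
  moreover have "?z j \<noteq> 0" using False d(2) by (simp add: e_def)
  ultimately show ?thesis using d(1) by (intro exI[of _ ?z]) auto
 qed
qed

lemma pointwise_convergent_subseq:
 fixes X :: "nat \<Rightarrow> int \<Rightarrow> real"
 assumes "\<And>i n. \<bar>X i n\<bar> \<le> 1"
 obtains r l where "strict_mono r" "\<And>n. (\<lambda>i. X (r i) n) \<longlonglongrightarrow> l n"
proof -
 have "compactin (product_topology (\<lambda>_. euclidean) UNIV) (PiE UNIV (\<lambda>_::int. {-1..1::real}))"
  by (subst compactin_PiE) auto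
 hence "seq_compact (PiE UNIV (\<lambda>_::int. {-1..1::real}))"
  by (intro compact_imp_seq_compact) (simp add: euclidean_product_topology)
 moreover have "X i \<in> PiE UNIV (\<lambda>_::int. {-1..1::real})" for i
  using assms by (auto simp: PiE_def extensional_def abs_le_iff minus_le_iff)
 ultimately obtain l r where r: "strict_mono r" "(X \<circ> r) \<longlonglongrightarrow> l" unfolding seq_compact_def by metis
 have "(\<lambda>i. X (r i) n) \<longlonglongrightarrow> l n" for n
  using continuous_on_tendsto_compose[OF continuous_on_product_coordinates[of n] r(2)] by simp
 thus ?thesis using that r(1) by blast
qed

lemma norm_square_le_low_part:
 assumes B: "\<And>F. finite F \<Longrightarrow> (\<Sum>n\<in>F. of_int \<bar>n\<bar>*(coord x n)^2) \<le> B" and N: "N > 0"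
 shows "(norm x)^2 \<le> (\<Sum>n\<in>{- int N..int N}. (coord x n)^2) + B/real N"
proof (rule has_sum_le_finite_sums[OF has_sum_norm_square])
 fix G :: "int set" assume G: "finite G"
 let ?F = "{- int N..int N}"
 have "(\<Sum>n\<in>G. (coord x n)^2) \<le> (\<Sum>n\<in>?F \<union> (G - ?F). (coord x n)^2)" by (rule sum_mono2) (auto simp: G)
 also have "... = (\<Sum>n\<in>?F. (coord x n)^2) + (\<Sum>n\<in>G - ?F. (coord x n)^2)"
  by (rule sum.union_disjoint) (auto simp: G)
 also have "(\<Sum>n\<in>G - ?F. (coord x n)^2) \<le> (\<Sum>n\<in>G - ?F. of_int \<bar>n\<bar>*(coord x n)^2/real N)"
 proof (rule sum_mono)
  fix n assume "n \<in> G - ?F"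
  hence "real N \<le> of_int \<bar>n\<bar>" by auto
  from mult_right_mono[OF this, of "(coord x n)^2"] show "(coord x n)^2 \<le> of_int \<bar>n\<bar>*(coord x n)^2/real N"
   using N by (simp add: field_simps)
 qed
 also have "... \<le> B/real N" unfolding sum_divide_distrib[symmetric] using B[of "G - ?F"] G by (intro divide_right_mono) auto
 finally show "(\<Sum>n\<in>G. (coord x n)^2) \<le> (\<Sum>n\<in>?F. (coord x n)^2) + B/real N" by simp
qed

lemma norm_convergent_if_coord_convergent:
 assumes coord: "\<And>n. (\<lambda>i. coord (X i) n) \<longlonglongrightarrow> coord x n"
  and X: "\<And>i F. finite F \<Longrightarrow> (\<Sum>n\<in>F. of_int \<bar>n\<bar>*(coord (X i) n)^2) \<le> B"
  and x: "\<And>F. finite F \<Longrightarrow> (\<Sum>n\<in>F. of_int \<bar>n\<bar>*(coord x n)^2) \<le> B"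
 shows "X \<longlonglongrightarrow> x"
proof -
 have "(\<Sum>n\<in>F. of_int \<bar>n\<bar>*(coord (X i - x) n)^2) \<le> 4*B" if F: "finite F" for i F
 proof -
  have "(\<Sum>n\<in>F. of_int \<bar>n\<bar>*(coord (X i - x) n)^2) \<le> (\<Sum>n\<in>F. 2*(of_int \<bar>n\<bar>*(coord (X i) n)^2) + 2*(of_int \<bar>n\<bar>*(coord x n)^2))"
  proof (rule sum_mono)
   show "of_int \<bar>n\<bar>*(coord (X i - x) n)^2 \<le> 2*(of_int \<bar>n\<bar>*(coord (X i) n)^2) + 2*(of_int \<bar>n\<bar>*(coord x n)^2)" for n
    using mult_nonneg_nonneg[OF _ zero_le_power2, of "of_int \<bar>n\<bar>" "coord (X i) n + coord x n"]
    by (simp add: power2_eq_square algebra_simps)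
  qed
  thus ?thesis using X[OF F, of i] x[OF F] by (simp add: sum.distrib flip: sum_distrib_left)
 qed
 note tail = norm_square_le_low_part[OF this]
 let ?S = "\<lambda>N i. \<Sum>n\<in>{- int N..int N}. (coord (X i - x) n)^2"
 have "\<forall>\<^sub>F i in sequentially. (norm (X i - x))^2 < e" if e: "e > 0" for e
 proof -
  obtain N where N: "real N > 8*B/e" "N > 0"
   using reals_Archimedean2[of "max (8*B/e) 1"] by (auto simp: of_nat_0_less_iff)
  have "?S N \<longlonglongrightarrow> (\<Sum>n\<in>{- int N..int N}. (coord x n - coord x n)^2)"
   unfolding coord_simps by (intro tendsto_intros coord)
  hence "\<forall>\<^sub>F i in sequentially. ?S N i < e/2" by (rule order_tendstoD(2)) (use e in simp)
  thus ?thesis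
  proof (rule eventually_mono)
   fix i assume "?S N i < e/2"
   moreover have "4*B/real N < e/2" using N e by (simp add: field_simps)
   ultimately show "(norm (X i - x))^2 < e" using tail[OF _ N(2), of i] by linarith
  qed
 qed
 hence "(\<lambda>i. (norm (X i - x))^2) \<longlonglongrightarrow> 0" by (intro tendstoI) (simp add: dist_real_def)
 hence "(\<lambda>i. sqrt ((norm (X i - x))^2)) \<longlonglongrightarrow> sqrt 0" by (intro tendsto_intros)
 thus ?thesis by (simp add: tendsto_norm_zero_iff LIM_zero_iff)
qed

definition ell2_half :: "ell2 set" where "ell2_half = {x. (\<lambda>n. of_int \<bar>n\<bar>*(coord x n)^2) summable_on UNIV}"

lemma summable_on_half:
 "x \<in> ell2_half \<Longrightarrow> y \<in> ell2_half \<Longrightarrow> (\<lambda>n. of_int \<bar>n\<bar>*coord x n*coord y n) summable_on UNIV"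
 using square_summable_mult[of "\<lambda>n. sqrt \<bar>n\<bar>*coord x n" "\<lambda>n. sqrt \<bar>n\<bar>*coord y n"]
 by (simp add: ell2_half_def power_mult_distrib mult_ac)

lemma subspace_ell2_half: "subspace ell2_half"
 unfolding subspace_def
proof safe
 fix x y assume "x \<in> ell2_half" "y \<in> ell2_half"
 thus "x + y \<in> ell2_half"
  using square_summable_add[of "\<lambda>n. sqrt \<bar>n\<bar>*coord x n" "\<lambda>n. sqrt \<bar>n\<bar>*coord y n"]
  by (simp add: ell2_half_def power_mult_distrib flip: distrib_left)
next
 fix c x assume "x \<in> ell2_half"
 hence "(\<lambda>n. c^2*(of_int \<bar>n\<bar>*(coord x n)^2)) summable_on UNIV"
  unfolding ell2_half_def by (intro summable_on_cmult_right) auto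
 thus "c *\<^sub>R x \<in> ell2_half" by (simp add: ell2_half_def power_mult_distrib mult_ac)
qed (simp add: ell2_half_def)

lemma unit_vec_in_half: "unit_vec n \<in> ell2_half"
 by (auto simp: ell2_half_def coord_unit_vec intro!: finite_nonzero_values_imp_summable_on)

lemma ell2_half_infinite_dim:
 assumes F: "finite F" shows "\<exists>x\<in>ell2_half. x \<noteq> 0 \<and> (\<forall>y\<in>F. inner x y = 0)"
proof -
 let ?I = "{0..int (card F)}"
 obtain d where d: "\<exists>i\<in>?I. d i \<noteq> 0" "\<forall>y\<in>F. (\<Sum>i\<in>?I. d i*coord y i) = 0"
  using nontrivial_relation_exists[OF F, of ?I "\<lambda>i y. coord y i"] by (auto simp: nat_add_distrib)
 define x where "x = (\<Sum>i\<in>?I. d i *\<^sub>R unit_vec i)"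
 have inner: "inner y x = (\<Sum>i\<in>?I. d i*coord y i)" for y by (simp add: x_def inner_sum_right inner_unit_vec)
 have coord: "coord x n = (if n \<in> ?I then d n else 0)" for n
  using inner[of "unit_vec n"] by (simp add: inner_unit_vec[of x] inner_commute[of "unit_vec n"] coord_unit_vec if_distrib cong: if_cong)
 have "finite {n. of_int \<bar>n\<bar>*(coord x n)^2 \<noteq> 0}" by (rule finite_subset[of _ ?I]) (auto simp: coord)
 hence "x \<in> ell2_half" unfolding ell2_half_def by (simp add: finite_nonzero_values_imp_summable_on)
 moreover have "x \<noteq> 0" using d(1) coord by (metis coord_simps(1))
 ultimately show ?thesis using d(2) inner by (auto simp: inner_commute)
qed

lemma ell2_half_if_decay:
 assumes x: "\<And>m. \<bar>x m\<bar> \<le> C/wt m^2"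
 shows "coord (ell2 x) = x" "ell2 x \<in> ell2_half"
proof -
 have sq: "wt n*(x n)^2 \<le> C^2*(1/wt n^2)" for n
 proof -
  have "wt n*(x n)^2 \<le> wt n^2*(C/wt n^2)^2"
   using power_mono[OF x[of n], of 2] wt_power_mono[of 1 2 n] by (intro mult_mono) auto
  thus ?thesis by (simp add: field_simps power2_eq_square)
 qed
 have dominated: "(x n)^2 \<le> wt n*(x n)^2" "of_int \<bar>n\<bar>*(x n)^2 \<le> wt n*(x n)^2" for n
  using mult_right_mono[OF wt_ge_1[of n], of "(x n)^2"] by (auto simp: wt_def intro!: mult_right_mono)
 have "\<bar>(x n)^2\<bar> \<le> C^2*(1/wt n^2)" "\<bar>of_int \<bar>n\<bar>*(x n)^2\<bar> \<le> C^2*(1/wt n^2)" for n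
  using order_trans[OF dominated(1) sq, of n] order_trans[OF dominated(2) sq, of n] by auto
 from wt_dominated(1)[OF this(1)] wt_dominated(1)[OF this(2)]
 show "coord (ell2 x) = x" "ell2 x \<in> ell2_half" by (auto simp: coord_ell2 ell2_half_def)
qed

lemma ell2_if_coord_limit:
 assumes lim: "\<And>n. (\<lambda>i. coord (X i) n) \<longlonglongrightarrow> l n" and X: "\<And>i::nat. norm (X i) \<le> 1"
 obtains x where "coord x = l"
proof -
 have "(\<Sum>n\<in>F. (l n)^2) \<le> 1" if F: "finite F" for F
 proof (rule tendsto_upperbound)
  show "(\<lambda>i. \<Sum>n\<in>F. (coord (X i) n)^2) \<longlonglongrightarrow> (\<Sum>n\<in>F. (l n)^2)" by (intro tendsto_intros lim)
  have "(\<Sum>n\<in>F. (coord (X i) n)^2) \<le> 1" for i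
  proof -
   have "(\<Sum>n\<in>F. (coord (X i) n)^2) \<le> (norm (X i))^2"
    by (rule finite_sum_le_has_sum[OF has_sum_norm_square]) (use F in auto)
   also have "... \<le> 1" using X[of i] by (simp add: power_le_one)
   finally show ?thesis .
  qed
  thus "\<forall>\<^sub>F i in sequentially. (\<Sum>n\<in>F. (coord (X i) n)^2) \<le> 1" by simp
 qed auto
 hence "(\<lambda>n. (l n)^2) summable_on UNIV"
  by (intro nonneg_bdd_above_summable_on) (auto intro!: bdd_aboveI[of _ 1])
 thus ?thesis using that coord_ell2 by blast
qed

section \<open>Rapidly decaying perturbations of the diagonal matrix with entries \<open>|n|\<close>\<close>

definition rapid :: "(int \<Rightarrow> int \<Rightarrow> real) \<Rightarrow> bool" where
 "rapid T \<longleftrightarrow> (\<forall>L. \<exists>C. \<forall>n m. \<bar>T n m\<bar> \<le> C/(wt n^L*wt m^L))"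

definition matvec :: "(int \<Rightarrow> int \<Rightarrow> real) \<Rightarrow> (int \<Rightarrow> real) \<Rightarrow> int \<Rightarrow> real" where
 "matvec T x n = (\<Sum>\<^sub>\<infinity>m. T n m*x m)"

lemma rapidD:
 assumes "rapid T"
 obtains C where "C \<ge> 0" "\<And>n m. \<bar>T n m\<bar> \<le> C/wt n^K/wt m^L"
proof -
 obtain C where C: "\<And>n m. \<bar>T n m\<bar> \<le> C/(wt n^max K L*wt m^max K L)" using assms unfolding rapid_def by blast
 have "C \<ge> 0" using order_trans[OF abs_ge_zero C[of 0 0]] by (simp add: wt_def)
 moreover have "\<bar>T n m\<bar> \<le> C/wt n^K/wt m^L" for n m
 proof -
  have "C/(wt n^max K L*wt m^max K L) \<le> C/(wt n^K*wt m^L)"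
   using \<open>C \<ge> 0\<close> by (intro divide_left_mono mult_mono wt_power_mono mult_pos_pos) auto
  thus ?thesis using C[of n m] by simp
 qed
 ultimately show ?thesis using that by blast
qed

lemma matvec_bound:
 assumes T: "\<And>m. \<bar>T n m\<bar> \<le> C/wt m^2" and x: "\<And>m. \<bar>x m\<bar> \<le> B"
 shows "(\<lambda>m. T n m*x m) summable_on UNIV" "\<bar>matvec T x n\<bar> \<le> C*B*wt_sum"
proof -
 have "\<bar>T n m*x m\<bar> \<le> C*B*(1/wt m^2)" for m
  using mult_mono[OF T x, of m m] order_trans[OF abs_ge_zero T[of m]] by (simp add: abs_mult)
 from wt_dominated[OF this] show "(\<lambda>m. T n m*x m) summable_on UNIV" "\<bar>matvec T x n\<bar> \<le> C*B*wt_sum"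
  by (simp_all add: matvec_def)
qed

lemma rapid_matvec_bound:
 assumes "rapid T" shows "\<exists>C\<ge>0. \<forall>x B n. (\<forall>m. \<bar>x m\<bar> \<le> B) \<longrightarrow> \<bar>matvec T x n\<bar> \<le> C*B/wt n^L"
proof -
 obtain C where C: "C \<ge> 0" "\<And>n m. \<bar>T n m\<bar> \<le> C/wt n^L/wt m^2" using rapidD[OF assms, of L 2] by blast
 have "\<bar>matvec T x n\<bar> \<le> (C*wt_sum)*B/wt n^L" if "\<forall>m. \<bar>x m\<bar> \<le> B" for x B n
  using matvec_bound(2)[OF C(2), of x B] that by (simp add: mult_ac)
 thus ?thesis using C(1) wt_sum_nonneg by (intro exI[of _ "C*wt_sum"]) auto
qed

lemma rapid_matvec_summable:
 assumes "rapid T" "\<And>m. \<bar>x m\<bar> \<le> B" shows "(\<lambda>m. T n m*x m) summable_on UNIV"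
proof -
 obtain C where C: "\<And>n m. \<bar>T n m\<bar> \<le> C/wt n^0/wt m^2" using rapidD[OF assms(1)] by metis
 thus ?thesis by (intro matvec_bound(1)[OF _ assms(2), of T n C]) simp
qed

lemma matvec_adjoint:
 assumes T: "rapid T" "\<And>n m. T n m = T m n" and x: "\<And>m. \<bar>x m\<bar> \<le> B" and y: "\<And>m. \<bar>y m\<bar> \<le> B'"
 shows "(\<lambda>n. matvec T x n*y n) summable_on UNIV"
  "(\<Sum>\<^sub>\<infinity>n. matvec T x n*y n) = (\<Sum>\<^sub>\<infinity>m. x m*matvec T y m)"
proof -
 obtain C where C: "C \<ge> 0" "\<And>n m. \<bar>T n m\<bar> \<le> C/wt n^2/wt m^2" using rapidD[OF T(1), of 2 2] by blast
 have B: "B \<ge> 0" "B' \<ge> 0" using x[of 0] y[of 0] by linarith+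
 have s: "(\<lambda>(n, m). T n m*x m*y n) summable_on UNIV \<times> UNIV"
 proof (rule abs_summable_summable, rule Infinite_Sum.abs_summable_on_comparison_test')
  show "(\<lambda>(n, m). (C*B*B'*(1/wt n^2))*(1/wt m^2)) summable_on UNIV \<times> UNIV"
   using C B by (intro summable_on_Times_product summable_on_wt summable_wt) auto
  fix z :: "int \<times> int"
  obtain n m where z: "z = (n, m)" by (cases z)
  have "\<bar>T n m\<bar>*\<bar>x m\<bar>*\<bar>y n\<bar> \<le> C/wt n^2/wt m^2*B*B'" using C B x y by (intro mult_mono) auto
  thus "norm (case z of (n, m) \<Rightarrow> T n m*x m*y n) \<le> (case z of (n, m) \<Rightarrow> (C*B*B'*(1/wt n^2))*(1/wt m^2))"
   by (simp add: z abs_mult field_simps)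
 qed
 have inner_sums: "infsum (\<lambda>m. T n m*x m*y n) UNIV = matvec T x n*y n"
  "infsum (\<lambda>n. T n m*x m*y n) UNIV = x m*matvec T y m" for n m
  unfolding matvec_def T(2)[of _ m] by (simp_all add: infsum_cmult_left' infsum_cmult_right'[symmetric] mult_ac)
 show "(\<Sum>\<^sub>\<infinity>n. matvec T x n*y n) = (\<Sum>\<^sub>\<infinity>m. x m*matvec T y m)"
  using infsum_swap_banach[OF s] by (simp add: inner_sums)
 show "(\<lambda>n. matvec T x n*y n) summable_on UNIV" using summable_on_Sigma_banach[OF s] by (simp add: inner_sums)
qed

locale rapid_perturbation =
 fixes R :: "int \<Rightarrow> int \<Rightarrow> real"
 assumes R_sym: "\<And>n m. R n m = R m n" and rapid_R: "rapid R"
begin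

definition R_form :: "ell2 \<Rightarrow> ell2 \<Rightarrow> real" where
 "R_form x y = (\<Sum>\<^sub>\<infinity>n. matvec R (coord x) n*coord y n)"

definition q :: "ell2 \<Rightarrow> ell2 \<Rightarrow> real" where
 "q x y = (\<Sum>\<^sub>\<infinity>n. of_int \<bar>n\<bar>*coord x n*coord y n) + R_form x y"

lemma matvec_R_add: "matvec R (coord (x + y)) n = matvec R (coord x) n + matvec R (coord y) n"
 unfolding matvec_def
 by (subst infsum_add[OF rapid_matvec_summable[OF rapid_R coord_le_norm] rapid_matvec_summable[OF rapid_R coord_le_norm], symmetric])
  (simp add: ring_distribs)

lemma matvec_R_scale: "matvec R (coord (c *\<^sub>R x)) n = c*matvec R (coord x) n"
 unfolding matvec_def by (subst infsum_cmult_right'[symmetric]) (simp add: mult_ac)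

lemma R_form_summable: "(\<lambda>n. matvec R (coord x) n*coord y n) summable_on UNIV"
 by (rule matvec_adjoint(1)[OF rapid_R R_sym coord_le_norm coord_le_norm])

lemma R_form_sym: "R_form x y = R_form y x"
 unfolding R_form_def using matvec_adjoint(2)[OF rapid_R R_sym coord_le_norm[of x] coord_le_norm[of y]]
 by (simp add: mult.commute)

lemma R_form_add: "R_form (x + y) z = R_form x z + R_form y z"
 unfolding R_form_def matvec_R_add by (simp add: ring_distribs infsum_add R_form_summable)

lemma R_form_scale: "R_form (r *\<^sub>R x) z = r*R_form x z"
 unfolding R_form_def matvec_R_scale by (simp add: mult.assoc infsum_cmult_right')

lemma R_form_bound: "\<exists>c\<ge>0. \<forall>x y. \<bar>R_form x y\<bar> \<le> c*norm x*norm y"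
proof -
 obtain C where C: "C \<ge> 0" "\<And>x B n. (\<And>m. \<bar>x m\<bar> \<le> B) \<Longrightarrow> \<bar>matvec R x n\<bar> \<le> C*B/wt n^2"
  using rapid_matvec_bound[OF rapid_R, of 2] by blast
 have "\<bar>R_form x y\<bar> \<le> (C*wt_sum)*norm x*norm y" for x y
 proof -
  have "\<bar>matvec R (coord x) n*coord y n\<bar> \<le> (C*norm x*norm y)*(1/wt n^2)" for n
   using mult_mono[OF C(2)[OF coord_le_norm[of x]] coord_le_norm[of y n], of n] C(1) by (simp add: abs_mult)
  from wt_dominated(2)[OF this] show ?thesis by (simp add: R_form_def mult_ac)
 qed
 thus ?thesis using C(1) wt_sum_nonneg by (intro exI[of _ "C*wt_sum"]) auto
qed

lemma bounded_bilinear_R_form: "bounded_bilinear R_form"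
proof
 show "\<exists>K. \<forall>a b. norm (R_form a b) \<le> norm a*norm b*K" using R_form_bound by (metis mult.assoc mult.commute real_norm_def)
 show "R_form x (y + z) = R_form x y + R_form x z" for x y z
  using R_form_add[of y z x] by (simp add: R_form_sym[of x])
 show "R_form x (r *\<^sub>R y) = r *\<^sub>R R_form x y" for x y r
  using R_form_scale[of r y x] by (simp add: R_form_sym[of x])
qed (simp_all add: R_form_add R_form_scale)

lemma q_self: "q x x = (\<Sum>\<^sub>\<infinity>n. of_int \<bar>n\<bar>*(coord x n)^2) + R_form x x"
 by (simp add: q_def power2_eq_square mult.assoc)

lemma q_diagonal_part_le:
 assumes "x \<in> ell2_half" "finite F" shows "(\<Sum>n\<in>F. of_int \<bar>n\<bar>*(coord x n)^2) \<le> q x x - R_form x x"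
 using finite_sum_le_infsum[of "\<lambda>n. of_int \<bar>n\<bar>*(coord x n)^2" UNIV F] assms by (simp add: q_self ell2_half_def)

lemma q_compact:
 assumes X: "\<And>i::nat. X i \<in> ell2_half" "\<And>i. norm (X i) \<le> 1" "(\<lambda>i. q (X i) (X i)) \<longlonglongrightarrow> b"
 shows "\<exists>r x. strict_mono r \<and> x \<in> ell2_half \<and> (X \<circ> r) \<longlonglongrightarrow> x \<and> q x x \<le> b"
proof -
 let ?D = "\<lambda>x n. of_int \<bar>n\<bar>*(coord x n)^2"
 obtain c where c: "c \<ge> 0" "\<And>x y. \<bar>R_form x y\<bar> \<le> c*norm x*norm y" using R_form_bound by blast
 have R_le: "\<bar>R_form (X i) (X i)\<bar> \<le> c" for i
  using order_trans[OF c(2) mult_mono[OF mult_left_mono[OF X(2) c(1)] X(2)]] c(1) by simp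
 have "bounded (range (\<lambda>i. q (X i) (X i)))" using X(3) convergent_imp_bounded by blast
 then obtain B where B: "\<And>i. \<bar>q (X i) (X i)\<bar> \<le> B" by (auto simp: bounded_iff)
 have D_le: "(\<Sum>n\<in>F. ?D (X i) n) \<le> B + c" if "finite F" for F i
  using q_diagonal_part_le[OF X(1) that, of i] B[of i] R_le[of i] by (simp add: abs_le_iff)
 obtain r l where r: "strict_mono r" "\<And>n. (\<lambda>i. coord (X (r i)) n) \<longlonglongrightarrow> l n"
  using pointwise_convergent_subseq[of "\<lambda>i. coord (X i)"] coord_le_norm X(2) order_trans by metis
 obtain x where x: "coord x = l" using ell2_if_coord_limit[OF r(2) X(2)] by blast
 have lim: "(\<lambda>i. \<Sum>n\<in>F. ?D (X (r i)) n) \<longlonglongrightarrow> (\<Sum>n\<in>F. ?D x n)" if "finite F" for F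
  unfolding x by (intro tendsto_intros r)
 have Dx_le: "(\<Sum>n\<in>F. ?D x n) \<le> B + c" if "finite F" for F
  by (rule tendsto_upperbound[OF lim[OF that]]) (use D_le[OF that] in auto)
 have conv: "(\<lambda>i. X (r i)) \<longlonglongrightarrow> x"
  by (rule norm_convergent_if_coord_convergent[OF _ D_le Dx_le]) (use r(2) in \<open>auto simp: x\<close>)
 have xV: "x \<in> ell2_half" unfolding ell2_half_def mem_Collect_eq
  by (rule nonneg_bdd_above_summable_on) (use Dx_le in \<open>auto intro!: bdd_aboveI[of _ "B + c"]\<close>)
 have "(\<Sum>\<^sub>\<infinity>n. ?D x n) \<le> b - R_form x x"
 proof (rule infsum_le_finite_sums)
  fix F :: "int set" assume F: "finite F"
  show "(\<Sum>n\<in>F. ?D x n) \<le> b - R_form x x"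
  proof (rule LIMSEQ_le[OF lim[OF F]])
   show "(\<lambda>i. q (X (r i)) (X (r i)) - R_form (X (r i)) (X (r i))) \<longlonglongrightarrow> b - R_form x x"
    using LIMSEQ_subseq_LIMSEQ[OF X(3) r(1)] bounded_bilinear.tendsto[OF bounded_bilinear_R_form conv conv]
    by (intro tendsto_diff) (auto simp: o_def)
  qed (use q_diagonal_part_le[OF X(1) F] in auto)
 qed (use xV in \<open>simp add: ell2_half_def\<close>)
 hence "q x x \<le> b" by (simp add: q_self)
 thus ?thesis using r(1) xV conv by (auto simp: o_def)
qed

theorem q_eigenbasis: "\<exists>u l. eigenbasis ell2_half q u l"
proof -
 obtain c where c: "\<And>x y. \<bar>R_form x y\<bar> \<le> c*norm x*norm y" using R_form_bound by blast
 have "compact_form ell2_half q c"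
 proof
  fix x y z and r :: real assume V: "x \<in> ell2_half" "z \<in> ell2_half"
  show "q (r *\<^sub>R x) z = r*q x z"
   by (simp add: q_def R_form_scale distrib_left infsum_cmult_right'[symmetric] mult_ac)
  assume y: "y \<in> ell2_half"
  show "q (x + y) z = q x z + q y z"
   using V y by (simp add: q_def R_form_add ring_distribs infsum_add summable_on_half[simplified])
 next
  show "q x y = q y x" for x y unfolding q_def R_form_sym[of x y] by (simp add: mult_ac)
 next
  fix x
  have "(\<Sum>\<^sub>\<infinity>n. of_int \<bar>n\<bar>*(coord x n)^2) \<ge> 0" by (rule infsum_nonneg) auto
  thus "- c*(norm x)^2 \<le> q x x" using c[of x x] by (simp add: q_self power2_eq_square abs_le_iff mult.assoc)
 qed (use subspace_ell2_half ell2_half_infinite_dim q_compact in auto)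
 thus ?thesis by (rule compact_form.spectral)
qed

end

lemma infsum_split:
 fixes f :: "'a \<Rightarrow> 'b::banach"
 assumes "f summable_on UNIV"
 shows "infsum f UNIV = infsum f A + infsum f (- A)"
 using infsum_Un_disjoint[of f A "- A"] summable_on_subset_banach[OF assms] by simp

lemma infsum_tail_tendsto_0:
 fixes f :: "'a \<Rightarrow> real"
 assumes f: "f summable_on UNIV" and F: "filterlim F (finite_subsets_at_top UNIV) sequentially" "\<And>N. finite (F N)"
 shows "(\<lambda>N. infsum f (- F N)) \<longlonglongrightarrow> 0"
proof -
 have "(\<lambda>N. sum f (F N)) \<longlonglongrightarrow> infsum f UNIV"
  by (rule filterlim_compose[OF has_sum_infsum[OF f, unfolded has_sum_def] F(1)])
 hence "(\<lambda>N. infsum f UNIV - sum f (F N)) \<longlonglongrightarrow> infsum f UNIV - infsum f UNIV" by (intro tendsto_intros)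
 moreover have "infsum f UNIV - sum f (F N) = infsum f (- F N)" for N using infsum_split[OF f, of "F N"] F(2) by simp
 ultimately show ?thesis by simp
qed

lemma infsum_sum_swap:
 fixes f :: "'a \<Rightarrow> 'b \<Rightarrow> real"
 assumes "finite A" "\<And>i. i \<in> A \<Longrightarrow> f i summable_on B"
 shows "(\<Sum>i\<in>A. infsum (f i) B) = infsum (\<lambda>x. \<Sum>i\<in>A. f i x) B" "(\<lambda>x. \<Sum>i\<in>A. f i x) summable_on B"
proof -
 have "((\<lambda>x. \<Sum>i\<in>A. f i x) has_sum (\<Sum>i\<in>A. infsum (f i) B)) B"
  using assms by (induction A rule: finite_induct) (auto intro!: has_sum_add)
 thus "(\<Sum>i\<in>A. infsum (f i) B) = infsum (\<lambda>x. \<Sum>i\<in>A. f i x) B" "(\<lambda>x. \<Sum>i\<in>A. f i x) summable_on B"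
  by (auto simp: has_sum_iff)
qed

lemma power_tangent:
 fixes x y :: real
 assumes "x \<ge> 0" "y \<ge> 0" shows "x^Suc k \<ge> y^Suc k + real (Suc k)*y^k*(x - y)"
proof -
 have "x^Suc k - y^Suc k - real (Suc k)*y^k*(x - y) \<ge> 0"
 proof (induction k)
  case (Suc k)
  have "x^Suc (Suc k) - y^Suc (Suc k) - real (Suc (Suc k))*y^Suc k*(x - y)
    = x*(x^Suc k - y^Suc k - real (Suc k)*y^k*(x - y)) + real (Suc k)*y^k*(x - y)^2"
   by (simp add: algebra_simps power2_eq_square)
  also have "... \<ge> 0" using Suc assms by (intro add_nonneg_nonneg mult_nonneg_nonneg) auto
  finally show ?case .
 qed simp
 thus ?thesis by simp
qed

lemma one_plus_power_le: "(1 + x)^j \<le> 2^j*(1 + x^j)" if "x \<ge> (0::real)"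
proof -
 have "(1 + x)^j \<le> (2*max 1 x)^j" using that by (intro power_mono) auto
 also have "... = 2^j*(max 1 x)^j" by (rule power_mult_distrib)
 also have "(max 1 x)^j \<le> 1 + x^j" using that by (cases "x \<le> 1") (auto simp: max_def)
 finally show ?thesis by simp
qed

locale rapid_spectrum = rapid_perturbation R + eigenbasis ell2_half "rapid_perturbation.q R" u l for R u l
begin

definition U :: "nat \<Rightarrow> int \<Rightarrow> real" where "U k = coord (u k)"

definition A :: "(int \<Rightarrow> real) \<Rightarrow> int \<Rightarrow> real" where "A x n = of_int \<bar>n\<bar>*x n + matvec R x n"

definition row :: "int \<Rightarrow> ell2" where "row n = ell2 (R n)"

definition column :: "int \<Rightarrow> ell2" where "column n = of_int \<bar>n\<bar> *\<^sub>R unit_vec n + row n"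

definition resid :: "nat \<Rightarrow> real" where "resid k = (\<Sum>\<^sub>\<infinity>n. (matvec R (U k) n)^2)"

lemma A_U: "A (U k) n = l k*U k n"
proof -
 have "q (u k) (unit_vec n) = A (U k) n"
  using infsum_single[of n "\<lambda>m. of_int \<bar>m\<bar>*U k m"] infsum_single[of n "matvec R (U k)"]
  by (simp add: q_def R_form_def A_def coord_unit_vec U_def if_distrib[of "(*) _"] cong: if_cong)
 thus ?thesis using eigenvector[OF unit_vec_in_half, of k n] by (simp add: inner_unit_vec U_def)
qed

lemma matvec_R_U: "matvec R (U k) n = (l k - of_int \<bar>n\<bar>)*U k n"
 using A_U[of k n] by (simp add: A_def left_diff_distrib)

lemma norm_u: "norm (u k) = 1" using orthonormal[of k k] by (simp add: norm_eq_1)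

lemma U_le_1: "\<bar>U k n\<bar> \<le> 1" using coord_le_norm[of "u k" n] norm_u by (simp add: U_def)

lemma has_sum_U_row: "((\<lambda>n. (U k n)^2) has_sum 1) UNIV"
 using has_sum_norm_square[of "u k"] by (simp add: U_def norm_u)

lemma has_sum_Parseval: "y \<in> ell2_half \<Longrightarrow> ((\<lambda>k. (inner y (u k))^2) has_sum (norm y)^2) UNIV"
 by (rule sums_nonneg_imp_has_sum[OF Parseval_eigenbasis]) auto

lemma has_sum_U_column: "((\<lambda>k. (U k n)^2) has_sum 1) UNIV"
proof -
 have "norm (unit_vec n) = 1" by (simp add: norm_eq_1 inner_unit_vec coord_unit_vec)
 thus ?thesis using has_sum_Parseval[OF unit_vec_in_half, of n]
  by (simp add: inner_commute[of "unit_vec n"] inner_unit_vec U_def)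
qed

lemma row: "coord (row n) = R n" "row n \<in> ell2_half"
proof -
 obtain C where C: "\<And>n m. \<bar>R n m\<bar> \<le> C/wt n^0/wt m^2" using rapidD[OF rapid_R] by metis
 from ell2_half_if_decay[of "R n" C] C show "coord (row n) = R n" "row n \<in> ell2_half" by (simp_all add: row_def)
qed

lemma inner_row: "inner (row n) (u k) = matvec R (U k) n"
 by (simp add: matvec_def inner_ell2_def row U_def)

lemma row_norm: "\<exists>C. \<forall>n. (norm (row n))^2 \<le> C*(1/wt n^L)"
proof -
 obtain C where C: "C \<ge> 0" "\<And>n m. \<bar>R n m\<bar> \<le> C/wt n^L/wt m^1" using rapidD[OF rapid_R, of L 1] by blast
 have "(norm (row n))^2 \<le> (C^2*wt_sum)*(1/wt n^L)" for n
 proof -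
  have "(R n m)^2 \<le> C^2/wt n^L*(1/wt m^2)" for m
  proof -
   have "(R n m)^2 \<le> (C/wt n^L/wt m)^2" using power_mono[OF C(2)[of n m], of 2] by simp
   also have "... = C^2/wt n^(2*L)*(1/wt m^2)" by (simp add: power_divide power_mult_distrib mult.commute flip: power_mult)
   also have "... \<le> C^2/wt n^L*(1/wt m^2)"
    by (intro mult_right_mono divide_left_mono wt_power_mono mult_pos_pos) auto
   finally show ?thesis .
  qed
  hence "(norm (row n))^2 \<le> C^2/wt n^L*wt_sum"
   using has_sum_mono[OF has_sum_norm_square[of "row n"] has_sum_wt[of "C^2/wt n^L"]] by (simp add: row(1))
  thus ?thesis by (simp add: mult_ac)
 qed
 thus ?thesis by blast
qed

lemma row_norm_summable: "(\<lambda>n. (norm (row n))^2) summable_on UNIV"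
proof -
 obtain C where C: "\<And>n. (norm (row n))^2 \<le> C*(1/wt n^2)" using row_norm by blast
 show ?thesis by (rule summable_on_comparison_test[OF summable_on_wt[of C]]) (use C in auto)
qed

lemma row_Bessel: "finite K \<Longrightarrow> (\<Sum>k\<in>K. (matvec R (U k) n)^2) \<le> (norm (row n))^2"
 using finite_sum_le_has_sum[OF has_sum_Parseval[OF row(2)]] by (simp add: inner_row)

lemma matvec_R_U_summable: "(\<lambda>n. (matvec R (U k) n)^2) summable_on UNIV"
 by (rule summable_on_comparison_test[OF row_norm_summable]) (use row_Bessel[of "{k}"] in auto)

lemma resid_nonneg: "resid k \<ge> 0" unfolding resid_def by (rule infsum_nonneg) auto

lemma finite_sum_le_resid: "finite F \<Longrightarrow> (\<Sum>n\<in>F. (matvec R (U k) n)^2) \<le> resid k"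
 unfolding resid_def by (rule finite_sum_le_infsum[OF matvec_R_U_summable]) auto

lemma resid_summable: "resid summable_on UNIV"
proof (rule nonneg_bdd_above_summable_on)
 show "bdd_above (sum resid ` {F. F \<subseteq> UNIV \<and> finite F})"
 proof (rule bdd_aboveI)
  fix x assume "x \<in> sum resid ` {F. F \<subseteq> UNIV \<and> finite F}"
  then obtain F where F: "finite F" "x = sum resid F" by auto
  have "x = (\<Sum>\<^sub>\<infinity>n. \<Sum>k\<in>F. (matvec R (U k) n)^2)" unfolding F resid_def
   by (rule infsum_sum_swap(1)) (use F matvec_R_U_summable in auto)
  also have "... \<le> (\<Sum>\<^sub>\<infinity>n. (norm (row n))^2)"
   by (intro infsum_mono infsum_sum_swap(2) row_norm_summable matvec_R_U_summable row_Bessel F)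
  finally show "x \<le> (\<Sum>\<^sub>\<infinity>n. (norm (row n))^2)" .
 qed
qed (rule resid_nonneg)

subsection \<open>Counting eigenvalues\<close>

definition low :: "nat \<Rightarrow> nat set" where "low N = {k. l k < real N + 1/2}"

lemma finite_low: "finite (low N)"
proof -
 have "\<forall>\<^sub>F k in sequentially. l k \<ge> real N + 1/2" using l_at_top by (simp add: filterlim_at_top)
 then obtain k0 where "\<And>k. k \<ge> k0 \<Longrightarrow> l k \<ge> real N + 1/2" by (auto simp: eventually_sequentially)
 hence "low N \<subseteq> {..<k0}" by (force simp: low_def not_less[symmetric])
 thus ?thesis by (rule finite_subset) auto
qed

lemma low_eq: "low N = {..<card (low N)}"
proof -
 have down: "j \<in> low N" if "k \<in> low N" "j \<le> k" for j k
  using that incseqD[OF incseq_l, of j k] by (auto simp: low_def)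
 define c where "c = (LEAST k. k \<notin> low N)"
 have "\<exists>k. k \<notin> low N" using finite_low by (meson ex_new_if_finite infinite_UNIV_nat)
 hence c: "c \<notin> low N" unfolding c_def by (rule LeastI_ex)
 have "low N = {..<c}"
  using c down not_less_Least[of _ "\<lambda>k. k \<notin> low N"] by (auto simp: c_def[symmetric] not_less) (metis not_less)
 thus ?thesis by simp
qed

lemma low_iff: "k \<in> low N \<longleftrightarrow> k < card (low N)" using low_eq[of N] by blast

lemma filterlim_low: "filterlim low (finite_subsets_at_top UNIV) sequentially"
proof (rule filterlim_exhaust)
 fix k :: nat
 show "\<forall>\<^sub>F N in sequentially. k \<in> low N"
  using eventually_ge_nat_int[of "\<lceil>l k\<rceil>"] by eventually_elim (simp add: low_def, linarith)
qed (auto simp: finite_low)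

lemma off_diagonal_bound:
 assumes "k \<in> low N \<longleftrightarrow> n \<notin> {- int N..int N}"
 shows "(U k n)^2 \<le> 4*(matvec R (U k) n)^2"
proof -
 have gap: "1/2 \<le> \<bar>l k - of_int \<bar>n\<bar>\<bar>"
 proof (cases "k \<in> low N")
  case True
  hence "\<bar>n\<bar> \<ge> int N + 1" using assms by auto
  hence "of_int \<bar>n\<bar> \<ge> real N + 1" by linarith
  thus ?thesis using True by (simp add: low_def)
 next
  case False
  hence "\<bar>n\<bar> \<le> int N" using assms by auto
  hence "of_int \<bar>n\<bar> \<le> real N" by linarith
  thus ?thesis using False by (simp add: low_def)
 qed
 have "\<bar>U k n\<bar> \<le> \<bar>2*matvec R (U k) n\<bar>"
  using mult_right_mono[OF gap, of "\<bar>U k n\<bar>"] by (simp add: matvec_R_U abs_mult)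
 hence "(U k n)^2 \<le> (2*matvec R (U k) n)^2" by (simp only: abs_le_square_iff)
 thus ?thesis by (simp add: power_mult_distrib)
qed

lemma high_part_bound:
 fixes N
 assumes w: "\<And>k. w k \<ge> 0" "(\<lambda>k. w k*resid k) summable_on UNIV"
 defines "I \<equiv> {- int N..int N}"
 shows "n \<in> I \<Longrightarrow> (\<lambda>k. w k*(U k n)^2) summable_on - low N"
  "(\<Sum>n\<in>I. \<Sum>\<^sub>\<infinity>k\<in>- low N. w k*(U k n)^2) \<le> 4*(\<Sum>\<^sub>\<infinity>k\<in>- low N. w k*resid k)"
proof -
 let ?r = "\<lambda>k n. matvec R (U k) n"
 have resid_on: "(\<lambda>k. w k*resid k) summable_on - low N" by (rule summable_on_subset_banach[OF w(2)]) auto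
 have weighted: "(\<lambda>k. w k*(?r k n)^2) summable_on - low N" for n
  by (rule summable_on_comparison_test[OF resid_on])
   (use w finite_sum_le_resid[of "{n}"] in \<open>auto intro!: mult_left_mono\<close>)
 have entry_le: "w k*(U k n)^2 \<le> 4*(w k*(?r k n)^2)" if "n \<in> I" "k \<in> - low N" for n k
  using off_diagonal_bound[of k N n] that w(1)[of k] mult_left_mono[of "(U k n)^2" "4*(?r k n)^2" "w k"]
  by (simp add: I_def)
 show U_on: "(\<lambda>k. w k*(U k n)^2) summable_on - low N" if "n \<in> I" for n
  by (rule summable_on_comparison_test[OF summable_on_cmult_right[OF weighted[of n], of 4]]) (use w entry_le that in auto)
 have "(\<Sum>n\<in>I. \<Sum>\<^sub>\<infinity>k\<in>- low N. w k*(U k n)^2) \<le> (\<Sum>n\<in>I. \<Sum>\<^sub>\<infinity>k\<in>- low N. 4*(w k*(?r k n)^2))"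
  by (intro sum_mono infsum_mono U_on summable_on_cmult_right weighted entry_le)
 also have "... = 4*(\<Sum>n\<in>I. \<Sum>\<^sub>\<infinity>k\<in>- low N. w k*(?r k n)^2)"
  by (simp add: infsum_cmult_right' sum_distrib_left)
 also have "(\<Sum>n\<in>I. \<Sum>\<^sub>\<infinity>k\<in>- low N. w k*(?r k n)^2) = (\<Sum>\<^sub>\<infinity>k\<in>- low N. \<Sum>n\<in>I. w k*(?r k n)^2)"
  by (rule infsum_sum_swap(1)) (use weighted in \<open>auto simp: I_def\<close>)
 also have "... \<le> (\<Sum>\<^sub>\<infinity>k\<in>- low N. w k*resid k)" using finite_sum_le_resid[of I] w(1)
  by (intro infsum_mono infsum_sum_swap(2) weighted resid_on)
   (auto simp: I_def sum_distrib_left[symmetric] intro!: mult_left_mono)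
 finally show "(\<Sum>n\<in>I. \<Sum>\<^sub>\<infinity>k\<in>- low N. w k*(U k n)^2) \<le> 4*(\<Sum>\<^sub>\<infinity>k\<in>- low N. w k*resid k)"
  by simp
qed

lemma low_part_bound:
 fixes N
 defines "I \<equiv> {- int N..int N}"
 shows "(\<Sum>k\<in>low N. \<Sum>\<^sub>\<infinity>n\<in>- I. (U k n)^2) \<le> 4*(\<Sum>\<^sub>\<infinity>n\<in>- I. (norm (row n))^2)"
proof -
 let ?r = "\<lambda>k n. 4*(matvec R (U k) n)^2"
 have r_on: "?r k summable_on - I" for k
  by (intro summable_on_cmult_right summable_on_subset_banach[OF matvec_R_U_summable]) auto
 have "(\<Sum>k\<in>low N. \<Sum>\<^sub>\<infinity>n\<in>- I. (U k n)^2) \<le> (\<Sum>k\<in>low N. \<Sum>\<^sub>\<infinity>n\<in>- I. ?r k n)"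
  by (intro sum_mono infsum_mono r_on summable_on_subset_banach[OF has_sum_imp_summable[OF has_sum_U_row]]
   off_diagonal_bound[of _ N]) (auto simp: I_def)
 also have "... = (\<Sum>\<^sub>\<infinity>n\<in>- I. \<Sum>k\<in>low N. ?r k n)"
  by (rule infsum_sum_swap(1)) (use finite_low r_on in auto)
 also have "... \<le> (\<Sum>\<^sub>\<infinity>n\<in>- I. 4*(norm (row n))^2)" using row_Bessel[OF finite_low]
  by (intro infsum_mono infsum_sum_swap(2) finite_low r_on summable_on_cmult_right
   summable_on_subset_banach[OF row_norm_summable]) (auto simp: sum_distrib_left[symmetric])
 finally show ?thesis by (simp add: infsum_cmult_right')
qed

text \<open>The square array of the \<open>(U k n)\<^sup>2\<close> has unit row and column sums, so summing it over the
 rows \<open>k \<in> low N\<close> and over the columns \<open>|n| \<le> N\<close> compares the numbers of both, up to the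
 off-diagonal parts, which tend to \<open>0\<close>.\<close>

lemma eventually_card_low: "\<forall>\<^sub>F N in sequentially. card (low N) = 2*N + 1"
proof -
 define low_tail where "low_tail N = 4*(\<Sum>\<^sub>\<infinity>n\<in>- {- int N..int N}. (norm (row n))^2)" for N
 define high_tail where "high_tail N = 4*(\<Sum>\<^sub>\<infinity>k\<in>- low N. resid k)" for N
 have "low_tail \<longlonglongrightarrow> 4*0" "high_tail \<longlonglongrightarrow> 4*0"
  unfolding low_tail_def[abs_def] high_tail_def[abs_def]
  by (intro tendsto_mult tendsto_const infsum_tail_tendsto_0 row_norm_summable filterlim_symmetric_interval
   resid_summable filterlim_low finite_low finite_atLeastAtMost_int)+
 hence "\<forall>\<^sub>F N in sequentially. low_tail N < 1" "\<forall>\<^sub>F N in sequentially. high_tail N < 1"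
  by (auto simp: order_tendsto_iff)
 thus ?thesis
 proof eventually_elim
  case (elim N)
  let ?I = "{- int N..int N}"
  define a where "a = (\<Sum>k\<in>low N. \<Sum>\<^sub>\<infinity>n\<in>- ?I. (U k n)^2)"
  define b where "b = (\<Sum>n\<in>?I. \<Sum>\<^sub>\<infinity>k\<in>- low N. (U k n)^2)"
  have "a \<ge> 0" "b \<ge> 0" unfolding a_def b_def by (auto intro!: sum_nonneg infsum_nonneg)
  moreover have "a \<le> low_tail N" unfolding a_def low_tail_def by (rule low_part_bound)
  moreover have "b \<le> high_tail N"
   using high_part_bound(2)[of "\<lambda>_. 1" N] resid_summable by (simp add: b_def high_tail_def)
  moreover have "(\<Sum>n\<in>?I. (U k n)^2) + (\<Sum>\<^sub>\<infinity>n\<in>- ?I. (U k n)^2) = 1" for k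
   using infsum_split[OF has_sum_imp_summable[OF has_sum_U_row[of k]], of ?I] infsumI[OF has_sum_U_row[of k]] by simp
  hence "real (card (low N)) = (\<Sum>k\<in>low N. \<Sum>n\<in>?I. (U k n)^2) + a"
   by (simp add: a_def sum.distrib[symmetric])
  moreover have "(\<Sum>k\<in>low N. (U k n)^2) + (\<Sum>\<^sub>\<infinity>k\<in>- low N. (U k n)^2) = 1" for n
   using infsum_split[OF has_sum_imp_summable[OF has_sum_U_column[of n]], of "low N"] infsumI[OF has_sum_U_column[of n]]
   by (simp add: finite_low)
  hence "real (2*N + 1) = (\<Sum>n\<in>?I. \<Sum>k\<in>low N. (U k n)^2) + b"
   by (simp add: b_def sum.distrib[symmetric])
  moreover have "(\<Sum>n\<in>?I. \<Sum>k\<in>low N. (U k n)^2) = (\<Sum>k\<in>low N. \<Sum>n\<in>?I. (U k n)^2)" by (rule sum.swap)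
  ultimately have "\<bar>real (card (low N)) - real (2*N + 1)\<bar> < 1" using elim by linarith
  thus ?case by linarith
 qed
qed

subsection \<open>Decay of the perturbation along eigenvectors\<close>

lemma rapid_A:
 assumes T: "rapid T" shows "rapid (\<lambda>n. A (T n))"
 unfolding rapid_def
proof
 fix L
 obtain C where C: "C \<ge> 0" "\<And>n m. \<bar>T n m\<bar> \<le> C/wt n^L/wt m^(L + 1)" using rapidD[OF T, of L "L + 1"] by blast
 obtain D where D: "\<And>x B m. (\<And>p. \<bar>x p\<bar> \<le> B) \<Longrightarrow> \<bar>matvec R x m\<bar> \<le> D*B/wt m^L"
  using rapid_matvec_bound[OF rapid_R, of L] by blast
 have "\<bar>A (T n) m\<bar> \<le> (C + D*C)/(wt n^L*wt m^L)" for n m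
 proof -
  have "\<bar>T n p\<bar> \<le> C/wt n^L" for p
  proof -
   have "C/wt n^L/wt p^(L + 1) \<le> C/wt n^L/1"
    using C(1) wt_power_ge_1[of p "L + 1"] by (intro divide_left_mono) auto
   thus ?thesis using C(2)[of n p] by simp
  qed
  hence "\<bar>matvec R (T n) m\<bar> \<le> D*(C/wt n^L)/wt m^L" by (rule D)
  moreover have "\<bar>of_int \<bar>m\<bar>*T n m\<bar> \<le> wt m*(C/wt n^L/wt m^(L + 1))"
   unfolding abs_mult by (intro mult_mono C) (auto simp: wt_def)
  ultimately show ?thesis by (simp add: A_def add_divide_distrib)
 qed
 thus "\<exists>C. \<forall>n m. \<bar>A (T n) m\<bar> \<le> C/(wt n^L*wt m^L)" by blast
qed

lemma matvec_A:
 assumes T: "rapid T" shows "matvec (\<lambda>n. A (T n)) (U k) n = l k*matvec T (U k) n"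
proof -
 obtain C where C: "C \<ge> 0" "\<And>n m. \<bar>T n m\<bar> \<le> C/wt n^0/wt m^3" using rapidD[OF T, of 0 3] by blast
 have T_le: "\<bar>T n m\<bar> \<le> C" for m
 proof -
  have "C/wt m^3 \<le> C/1" using C(1) wt_power_ge_1 by (intro divide_left_mono) auto
  thus ?thesis using C(2)[of n m] by simp
 qed
 have "\<bar>of_int \<bar>m\<bar>*T n m\<bar> \<le> C/wt m^2" for m
 proof -
  have "\<bar>of_int \<bar>m\<bar>*T n m\<bar> \<le> wt m*(C/wt m^3)"
   using C(2)[of n m] unfolding abs_mult by (intro mult_mono) (auto simp: wt_def)
  thus ?thesis by (simp add: power2_eq_square power3_eq_cube)
 qed
 from matvec_bound(1)[of "\<lambda>n m. of_int \<bar>m\<bar>*T n m", OF this U_le_1]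
 have diagonal: "(\<lambda>m. of_int \<bar>m\<bar>*T n m*U k m) summable_on UNIV" .
 note adjoint = matvec_adjoint[OF rapid_R R_sym T_le U_le_1[of k]]
 have "matvec (\<lambda>n. A (T n)) (U k) n = (\<Sum>\<^sub>\<infinity>m. of_int \<bar>m\<bar>*T n m*U k m) + (\<Sum>\<^sub>\<infinity>m. T n m*matvec R (U k) m)"
  unfolding matvec_def[of "\<lambda>n. A (T n)"] A_def distrib_right infsum_add[OF diagonal adjoint(1)] adjoint(2) ..
 also have "... = (\<Sum>\<^sub>\<infinity>m. T n m*A (U k) m)"
  using matvec_adjoint(1)[OF rapid_R R_sym U_le_1[of k] T_le]
  by (subst infsum_add[OF diagonal, symmetric]) (simp_all add: A_def algebra_simps)
 also have "... = l k*matvec T (U k) n"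
  unfolding A_U matvec_def by (subst infsum_cmult_right'[symmetric]) (simp add: mult_ac)
 finally show ?thesis .
qed

lemma matvec_decay: "rapid T \<Longrightarrow> \<exists>C\<ge>0. \<forall>k n. \<bar>l k\<bar>^j*\<bar>matvec T (U k) n\<bar> \<le> C/wt n^L"
proof (induction j arbitrary: T)
 case 0
 obtain C where "C \<ge> 0" "\<And>x B n. (\<And>m. \<bar>x m\<bar> \<le> B) \<Longrightarrow> \<bar>matvec T x n\<bar> \<le> C*B/wt n^L"
  using rapid_matvec_bound[OF 0] by blast
 from this(1) this(2)[OF U_le_1] show ?case by auto
next
 case (Suc j)
 obtain C where C: "C \<ge> 0" "\<And>k n. \<bar>l k\<bar>^j*\<bar>matvec (\<lambda>n. A (T n)) (U k) n\<bar> \<le> C/wt n^L"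
  using Suc.IH[OF rapid_A[OF Suc.prems]] by blast
 have "\<bar>l k\<bar>^Suc j*\<bar>matvec T (U k) n\<bar> \<le> C/wt n^L" for k n
  using C(2)[of k n] unfolding matvec_A[OF Suc.prems] by (simp add: abs_mult mult_ac)
 thus ?case using C by blast
qed

lemma matvec_R_U_decay: "\<exists>C\<ge>0. \<forall>k n. (1 + \<bar>l k\<bar>)^j*\<bar>matvec R (U k) n\<bar> \<le> C/wt n^L"
proof -
 obtain C where C: "C \<ge> 0" "\<And>k n. \<bar>l k\<bar>^j*\<bar>matvec R (U k) n\<bar> \<le> C/wt n^L"
  using matvec_decay[OF rapid_R, of j] by blast
 obtain D where D: "D \<ge> 0" "\<And>k n. \<bar>l k\<bar>^0*\<bar>matvec R (U k) n\<bar> \<le> D/wt n^L"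
  using matvec_decay[OF rapid_R, of 0] by blast
 have "(1 + \<bar>l k\<bar>)^j*\<bar>matvec R (U k) n\<bar> \<le> (2^j*(C + D))/wt n^L" for k n
 proof -
  have "(1 + \<bar>l k\<bar>)^j*\<bar>matvec R (U k) n\<bar> \<le> 2^j*(1 + \<bar>l k\<bar>^j)*\<bar>matvec R (U k) n\<bar>"
   by (intro mult_right_mono one_plus_power_le) auto
  also have "... = 2^j*(\<bar>matvec R (U k) n\<bar> + \<bar>l k\<bar>^j*\<bar>matvec R (U k) n\<bar>)" by (simp add: algebra_simps)
  also have "... \<le> 2^j*(D/wt n^L + C/wt n^L)" using C(2)[of k n] D(2)[of k n] by (intro mult_left_mono add_mono) auto
  finally show ?thesis by (simp add: add_divide_distrib algebra_simps)
 qed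
 thus ?thesis using C D by (intro exI[of _ "2^j*(C + D)"]) auto
qed

lemma resid_decay: "\<exists>C. \<forall>k. (1 + \<bar>l k\<bar>)^(2*j)*resid k \<le> C"
proof -
 obtain C where C: "\<And>k n. (1 + \<bar>l k\<bar>)^j*\<bar>matvec R (U k) n\<bar> \<le> C/wt n^1" using matvec_R_U_decay[of j 1] by blast
 have "(1 + \<bar>l k\<bar>)^(2*j)*resid k \<le> C^2*wt_sum" for k
 proof (rule has_sum_mono)
  show "((\<lambda>n. (1 + \<bar>l k\<bar>)^(2*j)*(matvec R (U k) n)^2) has_sum (1 + \<bar>l k\<bar>)^(2*j)*resid k) UNIV"
   unfolding resid_def by (intro has_sum_cmult_right has_sum_infsum matvec_R_U_summable)
  show "((\<lambda>n. C^2*(1/wt n^2)) has_sum C^2*wt_sum) UNIV" by (rule has_sum_wt)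
  fix n
  have "((1 + \<bar>l k\<bar>)^j*\<bar>matvec R (U k) n\<bar>)^2 \<le> (C/wt n)^2" using C[of k n] by (intro power_mono) auto
  thus "(1 + \<bar>l k\<bar>)^(2*j)*(matvec R (U k) n)^2 \<le> C^2*(1/wt n^2)"
   by (simp add: power_mult_distrib power_divide mult.commute flip: power_mult)
 qed
 thus ?thesis by blast
qed

lemma U_rapid: "\<exists>C. \<forall>n. \<bar>U k n\<bar>*wt n^L \<le> C"
proof -
 obtain C where C: "C \<ge> 0" "\<And>n. \<bar>matvec R (U k) n\<bar> \<le> C/wt n^L" using matvec_R_U_decay[of 0 L] by auto
 have "\<bar>U k n\<bar>*wt n^L \<le> C + (2 + \<bar>l k\<bar>)^L" for n
 proof (cases "of_int \<bar>n\<bar> \<ge> \<bar>l k\<bar> + 1")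
  case True
  hence "1*\<bar>U k n\<bar> \<le> \<bar>matvec R (U k) n\<bar>"
   unfolding matvec_R_U abs_mult by (intro mult_right_mono) linarith+
  also have "... \<le> C/wt n^L" by (rule C)
  finally have "\<bar>U k n\<bar>*wt n^L \<le> C" by (simp add: pos_le_divide_eq)
  thus ?thesis by (simp add: add_increasing2)
 next
  case False
  hence "\<bar>U k n\<bar>*wt n^L \<le> 1*(2 + \<bar>l k\<bar>)^L"
   using U_le_1[of k n] by (intro mult_mono power_mono) (auto simp: wt_def)
  thus ?thesis using C by simp
 qed
 thus ?thesis by blast
qed

definition \<mu> :: "nat \<Rightarrow> real" where "\<mu> k = real ((k + 1) div 2)"

lemma eventually_l_in_mu_interval: "\<forall>\<^sub>F k in sequentially. \<mu> k - 1/2 \<le> l k \<and> l k < \<mu> k + 1/2"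
proof -
 obtain N0 where N0: "\<And>N. N \<ge> N0 \<Longrightarrow> card (low N) = 2*N + 1"
  using eventually_card_low by (auto simp: eventually_sequentially)
 have "\<mu> k - 1/2 \<le> l k \<and> l k < \<mu> k + 1/2" if k: "k \<ge> 2*N0 + 1" for k
 proof -
  define N where "N = (k + 1) div 2"
  have N: "N \<ge> N0 + 1" "k < 2*N + 1" "k \<ge> 2*(N - 1) + 1" using k by (auto simp: N_def)
  have "k \<in> low N" "k \<notin> low (N - 1)" unfolding low_iff using N0[of N] N0[of "N - 1"] N by simp_all
  moreover have "\<mu> k = real N" by (simp add: \<mu>_def N_def)
  ultimately show ?thesis using N(1) by (simp add: low_def of_nat_diff)
 qed
 thus ?thesis by (auto simp: eventually_sequentially)
qed

lemma mu_distance_le_resid: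
 assumes "\<mu> k - 1/2 \<le> l k" "l k < \<mu> k + 1/2" shows "(l k - \<mu> k)^2 \<le> resid k"
proof -
 define N where "N = (k + 1) div 2"
 have mu: "\<mu> k = real N" by (simp add: \<mu>_def N_def)
 have "(l k - \<mu> k)^2*(U k n)^2 \<le> (matvec R (U k) n)^2" for n
 proof -
  have "\<bar>l k - \<mu> k\<bar> \<le> \<bar>l k - of_int \<bar>n\<bar>\<bar>"
  proof (cases "\<bar>n\<bar> = int N")
   case False
   hence "\<bar>n\<bar> \<ge> int N + 1 \<or> \<bar>n\<bar> \<le> int N - 1" by linarith
   hence "of_int \<bar>n\<bar> \<ge> real N + 1 \<or> of_int \<bar>n\<bar> \<le> real N - 1" by linarith
   thus ?thesis using assms unfolding mu by linarith
  qed (simp add: mu)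
  hence "(l k - \<mu> k)^2 \<le> (l k - of_int \<bar>n\<bar>)^2" by (simp add: abs_le_square_iff)
  thus ?thesis by (simp add: matvec_R_U power_mult_distrib mult_right_mono)
 qed
 hence "(l k - \<mu> k)^2*1 \<le> resid k" unfolding resid_def
  by (intro has_sum_mono[OF has_sum_cmult_right[OF has_sum_U_row] has_sum_infsum[OF matvec_R_U_summable]])
 thus ?thesis by simp
qed

lemma l_growth: "\<exists>c>0. \<forall>k. 1 + \<bar>l k\<bar> \<ge> c*real (Suc k)"
proof -
 obtain k0 where k0: "\<And>k. k \<ge> k0 \<Longrightarrow> \<mu> k - 1/2 \<le> l k"
  using eventually_l_in_mu_interval by (auto simp: eventually_sequentially)
 have "1 + \<bar>l k\<bar> \<ge> (1/(2*real (Suc k0)))*real (Suc k)" for k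
 proof (cases "k \<ge> k0")
  case True
  have "real (Suc k) \<le> real (2*((k + 1) div 2) + 1)" unfolding of_nat_le_iff by presburger
  hence "real (Suc k)/2 \<le> \<mu> k + 1/2" unfolding \<mu>_def by simp
  hence "real (Suc k)/2 \<le> 1 + \<bar>l k\<bar>" using k0[OF True] by linarith
  moreover have "(1/(2*real (Suc k0)))*real (Suc k) \<le> (1/2)*real (Suc k)"
   by (intro mult_right_mono) (auto simp: field_simps)
  ultimately show ?thesis by linarith
 next
  case False
  hence "(1/(2*real (Suc k0)))*real (Suc k) \<le> 1" by (auto simp: field_simps)
  thus ?thesis by linarith
 qed
 thus ?thesis by (intro exI[of _ "1/(2*real (Suc k0))"]) auto
qed

lemma l_near_mu: "\<exists>C. \<forall>k. \<bar>l k - \<mu> k\<bar>*real (Suc k)^j \<le> C"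
proof -
 obtain k0 where k0: "\<And>k. k \<ge> k0 \<Longrightarrow> (l k - \<mu> k)^2 \<le> resid k"
  using eventually_l_in_mu_interval mu_distance_le_resid by (auto simp: eventually_sequentially)
 obtain c where c: "c > 0" "\<And>k. 1 + \<bar>l k\<bar> \<ge> c*real (Suc k)" using l_growth by blast
 obtain D where D: "\<And>k. (1 + \<bar>l k\<bar>)^(2*j)*resid k \<le> D" using resid_decay by blast
 define C where "C = Max ((\<lambda>k. \<bar>l k - \<mu> k\<bar>*real (Suc k)^j) ` {..k0})"
 have "\<bar>l k - \<mu> k\<bar>*real (Suc k)^j \<le> max C (sqrt D/c^j)" for k
 proof (cases "k \<le> k0")
  case True
  hence "\<bar>l k - \<mu> k\<bar>*real (Suc k)^j \<le> C" unfolding C_def by (intro Max_ge) auto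
  thus ?thesis by simp
 next
  case False
  have "((c*real (Suc k))^j*\<bar>l k - \<mu> k\<bar>)^2 \<le> ((1 + \<bar>l k\<bar>)^j*\<bar>l k - \<mu> k\<bar>)^2"
   using c by (intro power_mono mult_right_mono) auto
  also have "... = (1 + \<bar>l k\<bar>)^(2*j)*(l k - \<mu> k)^2" by (simp add: power_mult_distrib mult.commute flip: power_mult)
  also have "... \<le> (1 + \<bar>l k\<bar>)^(2*j)*resid k" using k0[of k] False by (intro mult_left_mono) auto
  also have "... \<le> D" by (rule D)
  finally have "(c*real (Suc k))^j*\<bar>l k - \<mu> k\<bar> \<le> sqrt D" by (rule real_le_rsqrt)
  hence "\<bar>l k - \<mu> k\<bar>*real (Suc k)^j \<le> sqrt D/c^j" using c by (simp add: field_simps power_mult_distrib del: of_nat_Suc)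
  thus ?thesis by simp
 qed
 thus ?thesis by blast
qed

lemma weighted_resid_summable: "(\<lambda>k. (1 + \<bar>l k\<bar>)^j*resid k) summable_on UNIV"
proof -
 obtain c where c: "c > 0" "\<And>k. 1 + \<bar>l k\<bar> \<ge> c*real (Suc k)" using l_growth by blast
 obtain D where D: "\<And>k. (1 + \<bar>l k\<bar>)^(2*(j + 2))*resid k \<le> D" using resid_decay by blast
 show ?thesis
 proof (rule summable_on_comparison_test)
  show "(\<lambda>k. D/c^2*(1/real (Suc k)^2)) summable_on UNIV"
   using summable_nonneg_imp_summable_on[OF summable_inverse_Suc_square] by (intro summable_on_cmult_right) auto
  fix k
  have "(c*real (Suc k))^2*((1 + \<bar>l k\<bar>)^j*resid k) \<le> (1 + \<bar>l k\<bar>)^(j + 4)*((1 + \<bar>l k\<bar>)^j*resid k)"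
  proof (intro mult_right_mono)
   have "(c*real (Suc k))^2 \<le> (1 + \<bar>l k\<bar>)^2" using c by (intro power_mono) auto
   also have "... \<le> (1 + \<bar>l k\<bar>)^(j + 4)" by (intro power_increasing) auto
   finally show "(c*real (Suc k))^2 \<le> (1 + \<bar>l k\<bar>)^(j + 4)" .
  qed (auto simp: resid_nonneg)
  also have "... = (1 + \<bar>l k\<bar>)^(2*(j + 2))*resid k"
  proof -
   have "j + 4 + j = 2*(j + 2)" by simp
   thus ?thesis by (simp only: mult.assoc[symmetric] power_add[symmetric])
  qed
  also have "... \<le> D" by (rule D)
  finally show "(1 + \<bar>l k\<bar>)^j*resid k \<le> D/c^2*(1/real (Suc k)^2)"
   using c by (simp add: field_simps power_mult_distrib del: of_nat_Suc)
 qed (auto simp: resid_nonneg)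
qed

subsection \<open>A lower bound for the regularised traces\<close>

lemma column_in_half: "column n \<in> ell2_half"
 unfolding column_def
 by (intro subspace_add[OF subspace_ell2_half] subspace_scale[OF subspace_ell2_half] unit_vec_in_half row(2))

lemma coord_column: "coord (column n) m = (if m = n then of_int \<bar>n\<bar> else 0) + R n m"
 by (simp add: column_def row(1) coord_unit_vec)

lemma has_sum_column: "((\<lambda>k. (l k)^2*(U k n)^2) has_sum (norm (column n))^2) UNIV"
proof -
 have "inner (column n) (u k) = l k*U k n" for k using A_U[of k n]
  by (simp add: column_def inner_add_left inner_row inner_commute[of "unit_vec n"] inner_unit_vec U_def A_def)
 thus ?thesis using has_sum_Parseval[OF column_in_half, of n] by (simp add: power_mult_distrib)
qed

definition excess :: "int \<Rightarrow> real" where "excess n = (norm (column n))^2 - (of_int n)^2"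

lemma excess_eq: "excess n = 2 * of_int \<bar>n\<bar> * R n n + (norm (row n))^2"
proof -
 have "(norm (column n))^2 = (of_int n)^2 * (norm (unit_vec n))^2 + 2 * of_int \<bar>n\<bar> * R n n + (norm (row n))^2"
  unfolding power2_norm_eq_inner
  by (simp add: column_def inner_add_left inner_add_right inner_unit_vec inner_commute[of "unit_vec n"] row(1)
   power2_eq_square algebra_simps)
 thus ?thesis by (simp add: excess_def power2_norm_eq_inner inner_unit_vec coord_unit_vec)
qed

lemma excess_rapid: "\<exists>C. \<forall>n. \<bar>excess n\<bar>*wt n^L \<le> C"
proof -
 obtain C where C: "\<And>n m. \<bar>R n m\<bar> \<le> C/wt n^L/wt m^1" using rapidD[OF rapid_R, of L 1] by blast
 obtain D where D: "\<And>n. (norm (row n))^2 \<le> D*(1/wt n^L)" using row_norm by blast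
 have "\<bar>excess n\<bar> \<le> (2*C + D)/wt n^L" for n
 proof -
  have "\<bar>2 * of_int \<bar>n\<bar> * R n n\<bar> \<le> 2 * wt n * (C/wt n^L/wt n^1)"
   unfolding abs_mult by (intro mult_mono C) (auto simp: wt_def)
  hence "\<bar>2 * of_int \<bar>n\<bar> * R n n\<bar> \<le> 2 * C/wt n^L" by simp
  moreover have "(norm (row n))^2 \<le> D/wt n^L" using D[of n] by simp
  moreover have "(norm (row n))^2 \<ge> 0" by simp
  ultimately show ?thesis unfolding excess_eq add_divide_distrib by linarith
 qed
 thus ?thesis by (auto simp: pos_le_divide_eq)
qed

lemma excess_summable: "(\<lambda>n. (of_int n)^(2*p)*excess n) summable_on UNIV"
proof -
 obtain C where C: "\<And>n. \<bar>excess n\<bar>*wt n^(2*p + 2) \<le> C" using excess_rapid by blast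
 show ?thesis
 proof (rule summable_on_abs_real_iff[THEN iffD1], rule summable_on_comparison_test[OF summable_rapid[OF C]])
  show "\<bar>(of_int n)^(2*p)*excess n\<bar> \<le> \<bar>excess n\<bar>*wt n^(2*p)" for n
   unfolding abs_mult power_abs by (subst mult.commute, intro mult_left_mono power_mono) (auto simp: wt_def)
 qed auto
qed

lemma sum_mu: "(\<Sum>k<2*N + 1. (\<mu> k)^(2*Suc p)) = (\<Sum>n\<in>{- int N..int N}. (of_int n)^(2*Suc p))"
proof (induction N)
 case 0
 show ?case by (simp add: \<mu>_def)
next
 case (Suc N)
 have "{1..int (Suc N)} = insert (int (Suc N)) {1..int N}" by auto
 hence "(\<Sum>n\<in>{- int (Suc N)..int (Suc N)}. (of_int n :: real)^(2*Suc p))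
   = (\<Sum>n\<in>{- int N..int N}. (of_int n)^(2*Suc p)) + 2*(real (Suc N))^(2*Suc p)"
  by (subst (1 2) sum_symmetric) (simp_all add: power_mult)
 moreover have "(\<Sum>k<2*Suc N + 1. (\<mu> k)^(2*Suc p)) = (\<Sum>k<2*N + 1. (\<mu> k)^(2*Suc p)) + 2*(real (Suc N))^(2*Suc p)"
  by (simp add: \<mu>_def)
 ultimately show ?case using Suc by simp
qed

lemma high_power_bound:
 assumes "n \<in> {- int N..int N}" "k \<in> - low N"
 shows "(of_int n)^(2*p)*(of_int n)^2 \<le> (1 + \<bar>l k\<bar>)^(2*Suc p)"
  "(of_int n)^(2*p)*(l k)^2 \<le> (1 + \<bar>l k\<bar>)^(2*Suc p)"
proof -
 have "\<bar>n\<bar> \<le> int N" using assms by auto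
 hence "\<bar>of_int n\<bar> \<le> real N" by linarith
 moreover have "real N \<le> l k" using assms by (simp add: low_def)
 ultimately have n_le: "\<bar>of_int n\<bar> \<le> 1 + \<bar>l k\<bar>" by linarith
 have "\<bar>of_int n\<bar>^(2*p)*\<bar>x\<bar>^2 \<le> (1 + \<bar>l k\<bar>)^(2*p)*(1 + \<bar>l k\<bar>)^2" if "\<bar>x\<bar> \<le> 1 + \<bar>l k\<bar>" for x
  using n_le that by (intro mult_mono power_mono) auto
 from this[OF n_le] this[of "l k"]
 show "(of_int n)^(2*p)*(of_int n)^2 \<le> (1 + \<bar>l k\<bar>)^(2*Suc p)"
  "(of_int n)^(2*p)*(l k)^2 \<le> (1 + \<bar>l k\<bar>)^(2*Suc p)"
  by (simp_all add: power_even_abs power2_eq_square mult_ac)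
qed

lemma high_weight_summable:
 "n \<in> {- int N..int N} \<Longrightarrow> (\<lambda>k. (1 + \<bar>l k\<bar>)^j*(U k n)^2) summable_on - low N"
 by (rule high_part_bound(1)) (auto intro: weighted_resid_summable)

text \<open>Convexity of \<open>x\<^sup>p\<^sup>+\<^sup>1\<close> at \<open>x = n\<^sup>2\<close>, averaged over the weights \<open>(U k n)\<^sup>2\<close>.\<close>

lemma column_truncation_bound:
 fixes N p and n :: int
 defines "H \<equiv> (\<Sum>\<^sub>\<infinity>k\<in>- low N. (1 + \<bar>l k\<bar>)^(2*Suc p)*(U k n)^2)"
 assumes n: "n \<in> {- int N..int N}"
 shows "(of_int n)^(2*Suc p) + real (Suc p)*((of_int n)^(2*p)*excess n) - (real (Suc p) + 1)*H
  \<le> (\<Sum>k\<in>low N. (l k)^(2*Suc p)*(U k n)^2)"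
proof -
 define x where "x = (of_int n :: real)^2"
 define y where "y = (of_int n :: real)^(2*p)"
 define t where "t = (\<Sum>\<^sub>\<infinity>k\<in>- low N. (U k n)^2)"
 define z where "z = (\<Sum>\<^sub>\<infinity>k\<in>- low N. (l k)^2*(U k n)^2)"
 have nonneg: "x \<ge> 0" "y \<ge> 0" "t \<ge> 0" by (auto simp: x_def y_def t_def intro!: infsum_nonneg)
 note U_col = has_sum_imp_summable[OF has_sum_U_column[of n]] and l_col = has_sum_imp_summable[OF has_sum_column[of n]]
 have low_sums: "(\<Sum>k\<in>low N. (U k n)^2) = 1 - t" "(\<Sum>k\<in>low N. (l k)^2*(U k n)^2) = excess n + x - z"
  using infsum_split[OF U_col, of "low N"] infsum_split[OF l_col, of "low N"]
   infsumI[OF has_sum_U_column[of n]] infsumI[OF has_sum_column[of n]]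
  by (simp_all add: finite_low t_def z_def x_def excess_def)
 have "x^p = y" by (simp add: x_def y_def power_mult)
 hence tangent: "y*x + real (Suc p)*y*((l k)^2 - x) \<le> (l k)^(2*Suc p)" for k
  using power_tangent[of "(l k)^2" x p] nonneg(1) unfolding power_mult by (simp only: power_Suc2 zero_le_power2)
 have term_le: "y*x*(U k n)^2 \<le> (1 + \<bar>l k\<bar>)^(2*Suc p)*(U k n)^2"
  "y*((l k)^2*(U k n)^2) \<le> (1 + \<bar>l k\<bar>)^(2*Suc p)*(U k n)^2" if "k \<in> - low N" for k
  unfolding mult.assoc[of y "(l k)^2", symmetric]
  by (intro mult_right_mono high_power_bound[OF n that, of p, folded x_def y_def] zero_le_power2)+
 have tails: "y*x*t \<le> H" "y*z \<le> H" unfolding H_def t_def z_def infsum_cmult_right'[symmetric]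
  by (intro infsum_mono term_le summable_on_cmult_right high_weight_summable[OF n] subset_UNIV
   summable_on_subset_banach[OF U_col] summable_on_subset_banach[OF l_col], assumption)+
 from tails(2) have "real (Suc p)*(y*z) \<le> real (Suc p)*H" by (intro mult_left_mono) auto
 moreover note tails(1)
 moreover have "real (Suc p)*(y*x*t) \<ge> 0" using nonneg by (intro mult_nonneg_nonneg) auto
 moreover have "(\<Sum>k\<in>low N. (y*x + real (Suc p)*y*((l k)^2 - x))*(U k n)^2)
   \<le> (\<Sum>k\<in>low N. (l k)^(2*Suc p)*(U k n)^2)" by (intro sum_mono mult_right_mono tangent) auto
 moreover have "(\<Sum>k\<in>low N. (y*x + real (Suc p)*y*((l k)^2 - x))*(U k n)^2)
   = y*x*(\<Sum>k\<in>low N. (U k n)^2)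
    + real (Suc p)*y*((\<Sum>k\<in>low N. (l k)^2*(U k n)^2) - x*(\<Sum>k\<in>low N. (U k n)^2))"
  by (simp only: sum_distrib_left sum_subtractf[symmetric] sum.distrib[symmetric]) (simp add: algebra_simps)
 moreover have "(of_int n)^(2*Suc p) = y*x" by (simp add: x_def y_def power2_eq_square)
 ultimately show ?thesis unfolding low_sums y_def[symmetric] by (simp add: algebra_simps)
qed

lemma truncated_trace_bound:
 assumes N: "card (low N) = 2*N + 1"
 shows "(\<Sum>n\<in>{- int N..int N}. real (Suc p)*((of_int n)^(2*p)*excess n))
   - (real (Suc p) + 1)*(4*(\<Sum>\<^sub>\<infinity>k\<in>- low N. (1 + \<bar>l k\<bar>)^(2*Suc p)*resid k))
  \<le> (\<Sum>k<2*N + 1. (l k)^(2*Suc p) - (\<mu> k)^(2*Suc p))"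
proof -
 let ?I = "{- int N..int N}" and ?v = "\<lambda>n::int. (of_int n :: real)^(2*Suc p)"
  and ?c = "\<lambda>n. real (Suc p)*((of_int n)^(2*p)*excess n)"
 let ?H = "\<lambda>n. \<Sum>\<^sub>\<infinity>k\<in>- low N. (1 + \<bar>l k\<bar>)^(2*Suc p)*(U k n)^2"
 have "(\<Sum>n\<in>?I. ?v n + ?c n - (real (Suc p) + 1)*?H n) \<le> (\<Sum>n\<in>?I. \<Sum>k\<in>low N. (l k)^(2*Suc p)*(U k n)^2)"
  by (rule sum_mono) (rule column_truncation_bound)
 also have "... = (\<Sum>k\<in>low N. (l k)^(2*Suc p)*(\<Sum>n\<in>?I. (U k n)^2))"
  by (subst sum.swap) (simp add: sum_distrib_left)
 also have "... \<le> (\<Sum>k\<in>low N. (l k)^(2*Suc p)*1)"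
  by (intro sum_mono mult_left_mono finite_sum_le_has_sum[OF has_sum_U_row] zero_le_even_power) auto
 finally have "(\<Sum>n\<in>?I. ?v n) + (\<Sum>n\<in>?I. ?c n) - (real (Suc p) + 1)*(\<Sum>n\<in>?I. ?H n) \<le> (\<Sum>k\<in>low N. (l k)^(2*Suc p))"
  by (simp add: sum.distrib sum_subtractf sum_distrib_left)
 moreover have "(real (Suc p) + 1)*(\<Sum>n\<in>?I. ?H n)
   \<le> (real (Suc p) + 1)*(4*(\<Sum>\<^sub>\<infinity>k\<in>- low N. (1 + \<bar>l k\<bar>)^(2*Suc p)*resid k))"
  by (intro mult_left_mono high_part_bound(2) weighted_resid_summable) auto
 moreover have "low N = {..<2*N + 1}" using low_eq[of N] unfolding N .
 hence "(\<Sum>k<2*N + 1. (l k)^(2*Suc p) - (\<mu> k)^(2*Suc p)) = (\<Sum>k\<in>low N. (l k)^(2*Suc p)) - (\<Sum>n\<in>?I. ?v n)"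
  by (simp only: sum_subtractf sum_mu)
 ultimately show ?thesis by linarith
qed

theorem trace_lower_bound:
 assumes S: "(\<lambda>k. (l k)^(2*Suc p) - (\<mu> k)^(2*Suc p)) sums S"
 shows "real (Suc p)*(\<Sum>\<^sub>\<infinity>n. (of_int n)^(2*p)*excess n) \<le> S"
proof (rule tendsto_le[OF sequentially_bot _ _ eventually_mono[OF eventually_card_low truncated_trace_bound]])
 have "strict_mono (\<lambda>N::nat. 2*N + 1)" by (simp add: strict_mono_def)
 from LIMSEQ_subseq_LIMSEQ[OF S[unfolded sums_def] this]
 show "(\<lambda>N. \<Sum>k<2*N + 1. (l k)^(2*Suc p) - (\<mu> k)^(2*Suc p)) \<longlonglongrightarrow> S" by (simp add: o_def)
 have "(\<lambda>N. (\<Sum>n\<in>{- int N..int N}. real (Suc p)*((of_int n)^(2*p)*excess n))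
   - (real (Suc p) + 1)*(4*(\<Sum>\<^sub>\<infinity>k\<in>- low N. (1 + \<bar>l k\<bar>)^(2*Suc p)*resid k)))
  \<longlonglongrightarrow> real (Suc p)*(\<Sum>\<^sub>\<infinity>n. (of_int n)^(2*p)*excess n) - (real (Suc p) + 1)*(4*0)"
  by (intro tendsto_diff tendsto_mult tendsto_const tendsto_symmetric_sum has_sum_cmult_right has_sum_infsum
   excess_summable infsum_tail_tendsto_0 weighted_resid_summable filterlim_low finite_low)
 thus "(\<lambda>N. (\<Sum>n\<in>{- int N..int N}. real (Suc p)*((of_int n)^(2*p)*excess n))
   - (real (Suc p) + 1)*(4*(\<Sum>\<^sub>\<infinity>k\<in>- low N. (1 + \<bar>l k\<bar>)^(2*Suc p)*resid k)))
  \<longlonglongrightarrow> real (Suc p)*(\<Sum>\<^sub>\<infinity>n. (of_int n)^(2*p)*excess n)" by simp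
qed

end

section \<open>Continuation of zeta functions of nearly integral sequences\<close>

lemma powr_bound_near:
 assumes x: "1/2 \<le> x" "x \<le> 2*M" and M: "M \<ge> 1" and p: "\<bar>p\<bar> \<le> real K"
 shows "x powr p \<le> (2*M)^K"
proof -
 have "x powr p \<le> (2*M) powr \<bar>p\<bar>"
 proof (cases "p \<ge> 0")
  case True
  thus ?thesis using x by (auto intro: powr_mono2)
 next
  case False
  have "x powr p \<le> (1/2) powr p" using False x by (intro powr_mono2') auto
  also have "... = 2 powr (- p)" by (simp add: powr_def ln_div)
  also have "... \<le> (2*M) powr (- p)" using M False by (intro powr_mono2) auto
  finally show ?thesis using False by simp
 qed
 also have "... \<le> (2*M) powr real K" using M p by (intro powr_mono) auto
 finally show ?thesis using M by (simp add: powr_realpow)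
qed

lemma powr_difference_bound:
 fixes L M :: real and s :: complex
 assumes M: "M \<ge> 1" and L: "\<bar>L - M\<bar> \<le> 1/2" and K: "norm s \<le> real K"
 shows "norm (of_real L powr (- s) - of_real M powr (- s)) \<le> real K*(2*M)^(K + 1)*\<bar>L - M\<bar>"
proof -
 let ?S = "closed_segment (complex_of_real M) (of_real L)"
 have segment: "\<exists>x. z = of_real x \<and> 1/2 \<le> x \<and> x \<le> 2*M" if "z \<in> ?S" for z
 proof -
  from that obtain x where x: "x \<in> closed_segment M L" "z = of_real x" by (auto simp: closed_segment_of_real)
  have "1/2 \<le> min M L" "max M L \<le> 2*M" using M L by (auto simp: abs_if split: if_splits)
  thus ?thesis using x by (auto simp: closed_segment_eq_real_ivl split: if_splits)
 qed
 have "norm (of_real L powr (- s) - of_real M powr (- s)) \<le> (real K*(2*M)^(K + 1))*norm (complex_of_real L - of_real M)"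
 proof (rule field_differentiable_bound[OF convex_closed_segment])
  fix z assume "z \<in> ?S"
  then obtain x where x: "z = of_real x" "1/2 \<le> x" "x \<le> 2*M" using segment by blast
  have "z \<notin> \<real>\<^sub>\<le>\<^sub>0" using x by (auto simp: complex_nonpos_Reals_iff)
  thus "((\<lambda>z. z powr (- s)) has_field_derivative (- s)*z powr (- s - 1)) (at z within ?S)"
   by (rule has_field_derivative_at_within[OF has_field_derivative_powr])
  have "norm (z powr (- s - 1)) = x powr (- Re s - 1)" using x by (simp add: norm_powr_real_powr)
  also have "... \<le> (2*M)^(K + 1)"
   using K abs_Re_le_cmod[of s] by (intro powr_bound_near x M) (simp add: abs_le_iff)
  finally show "norm ((- s)*z powr (- s - 1)) \<le> real K*(2*M)^(K + 1)"
   unfolding norm_mult using K by (intro mult_mono) auto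
 qed auto
 thus ?thesis by (simp flip: of_real_diff)
qed

text \<open>The model sequence \<open>M\<close> runs through \<open>1, 1, 2, 2, 3, 3, ...\<close>.\<close>

locale nearly_integral =
 fixes L :: "nat \<Rightarrow> real"
 assumes L_pos: "\<And>k. L k > 0"
  and near: "\<And>j. \<exists>C. \<forall>k. \<bar>L k - real ((k + 2) div 2)\<bar>*real (Suc k)^j \<le> C"
begin

definition M :: "nat \<Rightarrow> real" where "M k = real ((k + 2) div 2)"

definition powr_diff :: "complex \<Rightarrow> nat \<Rightarrow> complex" where
 "powr_diff s k = of_real (L k) powr (- s) - of_real (M k) powr (- s)"

definition diff_series :: "complex \<Rightarrow> complex" where "diff_series s = (\<Sum>k. powr_diff s k)"

lemma M_bounds: "M k \<ge> 1" "M k \<le> real (Suc k)"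
proof -
 have "1 \<le> (k + 2) div 2" "(k + 2) div 2 \<le> Suc k" by presburger+
 thus "M k \<ge> 1" "M k \<le> real (Suc k)" unfolding M_def by (metis of_nat_1 of_nat_le_iff, metis of_nat_le_iff)
qed

lemma eventually_near_half: "\<forall>\<^sub>F k in sequentially. \<bar>L k - M k\<bar> \<le> 1/2"
proof -
 obtain C where C: "\<And>k. \<bar>L k - M k\<bar>*real (Suc k) \<le> C" using near[of 1] unfolding M_def by auto
 have "(\<lambda>k. C/real (Suc k)) \<longlonglongrightarrow> 0" by (rule LIMSEQ_Suc[OF lim_const_over_n])
 hence "\<forall>\<^sub>F k in sequentially. C/real (Suc k) < 1/2" by (rule order_tendstoD) simp
 thus ?thesis
 proof eventually_elim
  case (elim k)
  have "\<bar>L k - M k\<bar> \<le> C/real (Suc k)" using C[of k] by (simp add: pos_le_divide_eq del: of_nat_Suc)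
  thus ?case using elim by linarith
 qed
qed

lemma powr_diff_bound:
 "\<exists>C. \<forall>\<^sub>F k in sequentially. \<forall>s. norm s \<le> real K \<longrightarrow> norm (powr_diff s k) \<le> C*(1/real (Suc k)^2)"
proof -
 obtain C where C: "\<And>k. \<bar>L k - M k\<bar>*real (Suc k)^(K + 3) \<le> C" using near[of "K + 3"] unfolding M_def by blast
 show ?thesis
 proof (rule exI[of _ "real K*2^(K + 1)*C"], use eventually_near_half in eventually_elim, intro allI impI)
  fix k s assume half: "\<bar>L k - M k\<bar> \<le> 1/2" and s: "norm (s::complex) \<le> real K"
  define x where "x = real (Suc k)"
  have x: "x > 0" by (simp add: x_def)
  have "norm (powr_diff s k) \<le> real K*(2*M k)^(K + 1)*\<bar>L k - M k\<bar>"
   unfolding powr_diff_def by (rule powr_difference_bound[OF M_bounds(1) half s])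
  also have "... \<le> real K*(2*x)^(K + 1)*\<bar>L k - M k\<bar>"
   using M_bounds[of k] by (intro mult_right_mono mult_left_mono power_mono) (auto simp: x_def)
  also have "... = real K*2^(K + 1)*(\<bar>L k - M k\<bar>*x^(K + 3))*(1/x^2)"
   using x by (simp add: power_mult_distrib power_add field_simps power2_eq_square power3_eq_cube)
  also have "... \<le> real K*2^(K + 1)*C*(1/x^2)" using C[of k] by (intro mult_right_mono mult_left_mono) (auto simp: x_def)
  finally show "norm (powr_diff s k) \<le> real K*2^(K + 1)*C*(1/real (Suc k)^2)" by (simp only: x_def)
 qed
qed

lemma powr_diff_summable: "summable (\<lambda>k. norm (powr_diff s k))"
proof -
 obtain K :: nat where K: "norm s \<le> real K" using real_arch_simple by blast
 obtain C where "\<forall>\<^sub>F k in sequentially. \<forall>s. norm s \<le> real K \<longrightarrow> norm (powr_diff s k) \<le> C*(1/real (Suc k)^2)"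
  using powr_diff_bound by blast
 thus ?thesis using K by (intro summable_comparison_test_ev[OF _ summable_mult[OF summable_inverse_Suc_square, of C]])
   (auto elim: eventually_mono)
qed

lemma has_sum_powr_diff: "(powr_diff s has_sum diff_series s) UNIV"
 unfolding diff_series_def by (rule has_sum_suminf[OF powr_diff_summable])

lemma diff_series_holomorphic: "diff_series holomorphic_on UNIV"
 unfolding diff_series_def[abs_def]
proof (rule holomorphic_suminf)
 fix x :: complex
 obtain K :: nat where K: "norm x + 1 \<le> real K" using real_arch_simple by blast
 obtain C where C: "\<forall>\<^sub>F k in sequentially. \<forall>s. norm s \<le> real K \<longrightarrow> norm (powr_diff s k) \<le> C*(1/real (Suc k)^2)"
  using powr_diff_bound by blast
 have "norm y \<le> real K" if "y \<in> cball x 1" for y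
  using that K norm_triangle_ineq[of x "y - x"] by (simp add: dist_norm norm_minus_commute)
 thus "\<exists>d>0. \<exists>M'. cball x d \<subseteq> UNIV \<and> summable M' \<and> (\<forall>\<^sub>F n in sequentially. \<forall>y\<in>cball x d. norm (powr_diff y n) \<le> M' n)"
  using C by (intro exI[of _ 1] conjI exI[of _ "\<lambda>k. C*(1/real (Suc k)^2)"] summable_mult summable_inverse_Suc_square)
   (auto elim!: eventually_mono)
qed (use L_pos M_bounds(1) in \<open>auto intro!: holomorphic_intros
 simp: powr_diff_def complex_nonpos_Reals_iff not_le less_le_trans[OF zero_less_one]\<close>)

lemma has_sum_M_powr:
 assumes "Re s > 1" shows "((\<lambda>k. complex_of_real (M k) powr (- s)) has_sum 2*zeta_sum s) UNIV"
proof -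
 note zeta = zeta_sum_has_sum[OF assms]
 have halves: "((\<lambda>k. complex_of_real (M k) powr (- s)) has_sum zeta_sum s) (range (\<lambda>n. 2*n))"
  "((\<lambda>k. complex_of_real (M k) powr (- s)) has_sum zeta_sum s) (range (\<lambda>n. 2*n + 1))"
  by (subst has_sum_reindex; use zeta in \<open>auto simp: inj_def o_def M_def\<close>)+
 have "UNIV = range (\<lambda>n::nat. 2*n) \<union> range (\<lambda>n. 2*n + 1)"
  using oddE evenE by (auto simp: image_iff) (metis Suc_eq_plus1 evenE oddE)
 moreover have "range (\<lambda>n::nat. 2*n) \<inter> range (\<lambda>n. 2*n + 1) = {}" by (auto, presburger)
 ultimately show ?thesis using has_sum_Un_disjoint[OF halves] by simp
qed

lemma has_sum_L_powr:
 assumes "Re s > 1" shows "((\<lambda>k. complex_of_real (L k) powr (- s)) has_sum diff_series s + 2*zeta_sum s) UNIV"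
 using has_sum_add[OF has_sum_powr_diff[of s] has_sum_M_powr[OF assms]] by (simp add: powr_diff_def)

lemma diff_series_neg_even:
 "diff_series (- of_nat (2*m)) = complex_of_real (\<Sum>k. L k^(2*m) - M k^(2*m))" "summable (\<lambda>k. L k^(2*m) - M k^(2*m))"
proof -
 have "powr_diff (- of_nat (2*m)) k = complex_of_real (L k^(2*m) - M k^(2*m))" for k
  using L_pos[of k] M_bounds(1)[of k] by (simp add: powr_diff_def powr_nat' del: of_nat_mult)
 hence eq: "powr_diff (- of_nat (2*m)) = (\<lambda>k. complex_of_real (L k^(2*m) - M k^(2*m)))" ..
 show s: "summable (\<lambda>k. L k^(2*m) - M k^(2*m))"
  using summable_norm_cancel[OF powr_diff_summable[of "- of_nat (2*m)"]] unfolding eq by (simp only: summable_of_real_iff)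
 show "diff_series (- of_nat (2*m)) = complex_of_real (\<Sum>k. L k^(2*m) - M k^(2*m))"
  unfolding diff_series_def eq by (rule suminf_of_real[OF s, symmetric])
qed

end

text \<open>The value \<open>zeta b s\<close> is a definite description, so both existence and uniqueness of the
 continuation are needed; uniqueness is the identity theorem on \<open>U - {1}\<close>.\<close>

lemma zeta_eqI:
 assumes G: "G holomorphic_on - {1}" "\<And>s. Re s > 1 \<Longrightarrow> G s = zeta_series b s" and s: "s \<noteq> 1"
 shows "zeta b s = G s"
 unfolding zeta_def
proof (rule the_equality)
 show "\<exists>U f. open U \<and> connected U \<and> {s. Re s > 1} \<subseteq> U \<and> s \<in> U \<and> f holomorphic_on U \<and>
  (\<forall>s. Re s > 1 \<longrightarrow> f s = zeta_series b s) \<and> f s = G s"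
  using G s by (intro exI[of _ "- {1}"] exI[of _ G]) (auto intro!: connected_punctured_universe)
next
 fix z assume "\<exists>U f. open U \<and> connected U \<and> {s. Re s > 1} \<subseteq> U \<and> s \<in> U \<and> f holomorphic_on U \<and>
  (\<forall>s. Re s > 1 \<longrightarrow> f s = zeta_series b s) \<and> f s = z"
 then obtain U f where U: "open U" "connected U" "{s. Re s > 1} \<subseteq> U" "s \<in> U" "f holomorphic_on U"
  "\<And>s. Re s > 1 \<Longrightarrow> f s = zeta_series b s" "f s = z" by blast
 have "f s = G s"
 proof (rule analytic_continuation_open[of "{s. Re s > 1}" "U - {1}" f G])
  show "open {s. Re s > 1}" by (rule open_halfspace_Re_gt)
  show "open (U - {1})" using U(1) by auto
  have "(2::complex) \<in> {s. Re s > 1}" by simp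
  thus "{s. Re s > 1} \<noteq> {}" by blast
  show "connected (U - {1})" by (rule connected_open_delete) (use U in auto)
  show "{s. Re s > 1} \<subseteq> U - {1}" using U(3) by auto
  show "f holomorphic_on U - {1}" using U(5) holomorphic_on_subset by blast
  show "G holomorphic_on U - {1}" using G(1) by (rule holomorphic_on_subset) auto
 qed (use U G s in auto)
 thus "z = G s" using U(7) by simp
qed

lemma (in nearly_integral) zeta_neg_even:
 assumes b: "\<And>s. Re s > 1 \<Longrightarrow> zeta_series b s = (\<Sum>\<^sub>\<infinity>k. complex_of_real (L k) powr (- s))" and m: "m \<ge> 1"
 shows "zeta b (- of_nat (2*m)) = complex_of_real (\<Sum>k. L k^(2*m) - M k^(2*m))"
proof -
 define G where "G s = diff_series s + 2*(xi s/(s - 1))" for s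
 have "(- of_nat (2*m) :: complex) \<noteq> 1" by (simp add: complex_eq_iff)
 hence "zeta b (- of_nat (2*m)) = G (- of_nat (2*m))"
 proof (intro zeta_eqI)
  show "G holomorphic_on - {1}" unfolding G_def
   using diff_series_holomorphic xi_holomorphic by (auto intro!: holomorphic_intros intro: holomorphic_on_subset)
  show "G s = zeta_series b s" if "Re s > 1" for s
  proof -
   have "s \<noteq> 1" using that by auto
   thus ?thesis using b[OF that] has_sum_L_powr[OF that] xi_eq_zeta_sum[OF that] by (simp add: G_def has_sum_iff)
  qed
 qed auto
 thus ?thesis unfolding G_def diff_series_neg_even(1) xi_neg_even[OF m] by simp
qed

section \<open>Bounds on derivatives\<close>

lemma vder_mult:
 fixes f g :: "real \<Rightarrow> complex"
 assumes "smooth f" "smooth g"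
 shows "vder (\<lambda>t. f t * g t) = (\<lambda>t. f t * vder g t + vder f t * g t)"
 by (intro vder_eqI has_vector_derivative_mult smooth_has_vder assms)

lemma vders_add:
 assumes "smooth f" "smooth g"
 shows "(vder ^^ p) (\<lambda>t. f t + g t) = (\<lambda>t. (vder ^^ p) f t + (vder ^^ p) g t)"
 by (induction p) (auto simp: smooth_add(2) smooth_vders assms)

lemma vders_mult_Suc:
 fixes f g :: "real \<Rightarrow> complex"
 assumes "smooth f" "smooth g"
 shows "(vder ^^ Suc p) (\<lambda>t. f t * g t) = (\<lambda>t. (vder ^^ p) (\<lambda>t. f t * vder g t) t + (vder ^^ p) (\<lambda>t. vder f t * g t) t)"
 unfolding vders_Suc vder_mult[OF assms]
 by (rule vders_add) (intro smooth_mult_complex smooth_vder assms)+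

lemma norm_vders_mult_le:
 fixes f g :: "real \<Rightarrow> complex"
 assumes "smooth f" "smooth g" "\<And>i t. i \<le> q \<Longrightarrow> norm ((vder ^^ i) f t) \<le> B" "\<And>i t. i \<le> q \<Longrightarrow> norm ((vder ^^ i) g t) \<le> B'"
 shows "norm ((vder ^^ q) (\<lambda>t. f t*g t) t) \<le> 2^q*(B*B')"
 using assms
proof (induction q arbitrary: f g)
 case 0
 have "norm (f t) \<le> B" "norm (g t) \<le> B'" using 0(3,4)[of 0 t] by auto
 thus ?case by (simp add: norm_mult mult_mono')
next
 case (Suc q)
 have "norm ((vder ^^ q) (\<lambda>t. f t * vder g t) t) \<le> 2^q * (B * B')"
  by (rule Suc.IH) (use Suc.prems(3) Suc.prems(4)[of "Suc _"] in \<open>auto intro: smooth_vder Suc.prems simp flip: vders_Suc\<close>)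
 moreover have "norm ((vder ^^ q) (\<lambda>t. vder f t*g t) t) \<le> 2^q*(B*B')"
  by (rule Suc.IH) (use Suc.prems(3)[of "Suc _"] Suc.prems(4) in \<open>auto intro: smooth_vder Suc.prems simp flip: vders_Suc\<close>)
 ultimately show ?case unfolding vders_mult_Suc[OF Suc.prems(1,2)]
  using norm_triangle_ineq[of "(vder ^^ q) (\<lambda>t. f t * vder g t) t" "(vder ^^ q) (\<lambda>t. vder f t * g t) t"] by simp
qed

lemma vder_reciprocal:
 fixes f g :: "real \<Rightarrow> complex"
 assumes f: "smooth f" and g: "smooth g" and fg: "\<And>t. f t*g t = 1"
 shows "vder g = (\<lambda>t. - vder f t*(g t*g t))"
proof
 fix t
 have "vder (\<lambda>t. f t*g t) = (\<lambda>_. 0)" unfolding fg by (rule vder_eqI) simp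
 hence "f t * vder g t + vder f t * g t = 0" unfolding vder_mult[OF f g] by meson
 hence "g t * (f t * vder g t + vder f t * g t) = 0" by simp
 hence "(f t * g t) * vder g t + vder f t * (g t * g t) = 0" by (simp add: algebra_simps)
 thus "vder g t = - vder f t*(g t*g t)" unfolding fg by (simp add: eq_neg_iff_add_eq_0)
qed

definition vders_le :: "nat \<Rightarrow> real \<Rightarrow> (real \<Rightarrow> 'a::real_normed_vector) \<Rightarrow> bool" where
 "vders_le q B f \<longleftrightarrow> (\<forall>i\<le>q. \<forall>t. norm ((vder ^^ i) f t) \<le> B)"

lemma vders_le_mono: "vders_le q B f \<Longrightarrow> r \<le> q \<Longrightarrow> vders_le r B f"
 by (auto simp: vders_le_def)

lemma vders_le_vder: "vders_le (Suc q) B f \<Longrightarrow> vders_le q B (vder f)"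
 unfolding vders_le_def vders_Suc[symmetric] by (metis Suc_le_mono)

lemma vders_le_mult:
 fixes f g :: "real \<Rightarrow> complex"
 assumes "smooth f" "smooth g" "vders_le q B f" "vders_le q B' g"
 shows "vders_le q (2^q*(B*B')) (\<lambda>t. f t*g t)"
 unfolding vders_le_def
proof (intro allI impI)
 fix i t assume i: "i \<le> q"
 have "B*B' \<ge> 0"
  using assms(3,4) norm_ge_zero order_trans unfolding vders_le_def by (metis le0 mult_nonneg_nonneg)
 have "norm ((vder ^^ i) (\<lambda>t. f t*g t) t) \<le> 2^i*(B*B')"
  by (rule norm_vders_mult_le) (use assms i in \<open>auto simp: vders_le_def\<close>)
 also have "... \<le> 2^q*(B*B')" using i \<open>B*B' \<ge> 0\<close> by (intro mult_right_mono power_increasing) auto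
 finally show "norm ((vder ^^ i) (\<lambda>t. f t*g t) t) \<le> 2^q*(B*B')" .
qed

definition reciprocal_pair :: "real \<Rightarrow> (real \<Rightarrow> complex) \<Rightarrow> (real \<Rightarrow> complex) \<Rightarrow> bool" where
 "reciprocal_pair \<delta> f g \<longleftrightarrow> smooth f \<and> smooth g \<and> (\<forall>t. f t*g t = 1) \<and> (\<forall>t. norm (f t) \<ge> \<delta>)"

lemma vders_le_reciprocal:
 assumes \<delta>: "\<delta> > 0"
 shows "\<exists>B'. \<forall>f g. reciprocal_pair \<delta> f g \<and> vders_le q B f \<longrightarrow> vders_le q B' g"
proof (induction q)
 case 0
 have "norm (g t) \<le> 1/\<delta>" if "f t*g t = 1" "norm (f t) \<ge> \<delta>" for f g :: "real \<Rightarrow> complex" and t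
 proof -
  have "\<delta>*norm (g t) \<le> norm (f t)*norm (g t)" using that(2) by (intro mult_right_mono) auto
  also have "... = 1" using that(1) by (metis norm_mult norm_one)
  finally show ?thesis using \<delta> by (simp add: field_simps)
 qed
 thus ?case by (intro exI[of _ "1/\<delta>"]) (simp add: vders_le_def reciprocal_pair_def, blast)
next
 case (Suc q)
 then obtain B' where B': "\<And>f g. reciprocal_pair \<delta> f g \<Longrightarrow> vders_le q B f \<Longrightarrow> vders_le q B' g" by blast
 define D where "D = 2^q*(B*(2^q*(B'*B')))"
 have "vders_le (Suc q) (max B' D) g" if pair: "reciprocal_pair \<delta> f g" and B: "vders_le (Suc q) B f" for f g
 proof -
  have f: "smooth f" and g: "smooth g" and fg: "\<And>t. f t*g t = 1" using pair by (auto simp: reciprocal_pair_def)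
  have g_le: "vders_le q B' g" using B'[OF pair] vders_le_mono[OF B] by auto
  have "(vder ^^ j) (\<lambda>t. - vder f t) = (\<lambda>t. - (vder ^^ Suc j) f t)" for j
   unfolding vders_Suc by (rule vders_bounded_linear[OF bounded_linear_minus[OF bounded_linear_ident] smooth_vder[OF f]])
  hence "vders_le q B (\<lambda>t. - vder f t)" using B by (auto simp: vders_le_def simp del: funpow.simps)
  hence "vders_le q D (\<lambda>t. - vder f t*(g t*g t))" unfolding D_def
   by (intro vders_le_mult smooth_uminus smooth_vder smooth_mult_complex f g g_le)
  also have "(\<lambda>t. - vder f t*(g t*g t)) = vder g" by (rule vder_reciprocal[OF f g fg, symmetric])
  finally have "norm ((vder ^^ Suc q) g t) \<le> D" for t unfolding vders_Suc by (simp add: vders_le_def)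
  thus ?thesis using g_le unfolding vders_le_def le_Suc_eq by (auto simp: le_max_iff_disj)
 qed
 thus ?case by blast
qed

lemma circle_smooth_vders_le:
 assumes "circle_smooth f" shows "\<exists>B. vders_le q B f"
proof (induction q)
 case 0
 show ?case using circle_smooth_bounded[OF assms] unfolding vders_le_def by (metis funpow_0 le_zero_eq)
next
 case (Suc q)
 then obtain B where B: "vders_le q B f" by blast
 obtain D where D: "\<And>t. norm ((vder ^^ Suc q) f t) \<le> D" using circle_smooth_bounded[OF circle_smooth_vders[OF assms]] by metis
 have "vders_le (Suc q) (max B D) f"
  using B D unfolding vders_le_def le_Suc_eq by (auto simp: le_max_iff_disj simp del: funpow.simps)
 thus ?case by blast
qed

context phase
begin

lemma circle_smooth_phase_deriv_iter: "circle_smooth F \<Longrightarrow> circle_smooth ((phase_deriv ^^ L) F)"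
 by (induction L) (auto intro: circle_smooth_phase_deriv)

lemma cf_phase_deriv_iter: "circle_smooth F \<Longrightarrow> cf ((phase_deriv ^^ L) F) n = (\<i> * of_int n)^L * cf F n"
 by (induction L) (auto simp: cf_phase_deriv circle_smooth_phase_deriv_iter)

lemma cf_decay_of_phase_deriv:
 assumes F: "circle_smooth F" and B: "\<And>t. norm ((phase_deriv ^^ L) F t) \<le> B"
 shows "of_int \<bar>n\<bar>^L*norm (cf F n) \<le> B"
 using norm_cf_le[OF circle_smooth_cont[OF circle_smooth_phase_deriv_iter[OF F]] B]
 by (simp add: cf_phase_deriv_iter[OF F] norm_mult norm_power)

lemma circle_smooth_inverse_rho: "circle_smooth (\<lambda>t. complex_of_real (1/\<rho> t))"
 by (intro circle_smooth_of_real circle_smooth_inverse circle_smooth_rho rho_pos)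

lemma reciprocal_pair_rho:
 assumes "\<And>t. \<rho> t \<ge> \<delta>"
 shows "reciprocal_pair \<delta> (\<lambda>t. complex_of_real (\<rho> t)) (\<lambda>t. complex_of_real (1/\<rho> t))"
 unfolding reciprocal_pair_def
 using assms rho_pos less_imp_neq[OF rho_pos] circle_smooth_inverse_rho circle_smooth_of_real[OF circle_smooth_rho]
 by (auto simp: less_imp_le abs_of_pos circle_smoothD(1) simp flip: of_real_mult)

end

lemma phase_deriv_iter_uniform_bound:
 assumes \<delta>: "\<delta> > 0"
 shows "\<exists>B. \<forall>s \<rho> F. phase s \<rho> \<and> circle_smooth F \<and> (\<forall>t. \<rho> t \<ge> \<delta>) \<and> vders_le (q + L) C (\<lambda>t. complex_of_real (\<rho> t)) \<and> vders_le (q + L) D F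
  \<longrightarrow> vders_le q B ((phase.phase_deriv \<rho> ^^ L) F)"
proof (induction L arbitrary: q)
 case 0
 show ?case by auto
next
 case (Suc L)
 obtain B where B: "\<And>s \<rho> F. phase s \<rho> \<and> circle_smooth F \<and> (\<forall>t. \<rho> t \<ge> \<delta>) \<and> vders_le (Suc q + L) C (\<lambda>t. complex_of_real (\<rho> t)) \<and>
  vders_le (Suc q + L) D F \<Longrightarrow> vders_le (Suc q) B ((phase.phase_deriv \<rho> ^^ L) F)"
  using Suc[of "Suc q"] by blast
 obtain B' where B': "\<And>f g. reciprocal_pair \<delta> f g \<Longrightarrow> vders_le q C f \<Longrightarrow> vders_le q B' g"
  using vders_le_reciprocal[OF \<delta>] by blast
 have "vders_le q (2^q*(B'*B)) ((phase.phase_deriv \<rho> ^^ Suc L) F)"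
  if P: "phase s \<rho>" and F: "circle_smooth F" and \<rho>: "\<And>t. \<rho> t \<ge> \<delta>"
   and C: "vders_le (q + Suc L) C (\<lambda>t. complex_of_real (\<rho> t))" and D: "vders_le (q + Suc L) D F" for s \<rho> F
 proof -
  interpret phase s \<rho> by (rule P)
  let ?G = "(phase_deriv ^^ L) F"
  have "vders_le q B' (\<lambda>t. complex_of_real (1/\<rho> t))" using B'[OF reciprocal_pair_rho[OF \<rho>]] vders_le_mono[OF C, of q] by simp
  moreover have "vders_le q B (vder ?G)" using P F \<rho> C D by (intro vders_le_vder B) auto
  ultimately have "vders_le q (2^q * (B' * B)) (\<lambda>t. complex_of_real (1/\<rho> t) * vder ?G t)"
   by (intro vders_le_mult circle_smoothD(1) circle_smooth_inverse_rho circle_smooth_vder circle_smooth_phase_deriv_iter F)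
  thus ?thesis by (simp add: phase_deriv_def[of ?G])
 qed
 thus ?case by blast
qed

section \<open>Fourier multipliers\<close>

global_interpretation fourier: phase "\<lambda>t. t" "\<lambda>_. 1"
 by unfold_locales (auto intro: circle_smooth_const)

lemma fcoeff_eq: "fcoeff u k = fourier.cf (\<lambda>t. of_real (u t)) k"
 by (simp add: fcoeff_def fourier.cf_def mean_def fourier.e_def scaleR_conv_of_real mult_ac)

lemma cf_vder: "circle_smooth F \<Longrightarrow> fourier.cf (vder F) k = \<i> * of_int k * fourier.cf F k"
 using fourier.cf_phase_deriv[of F k] by (simp add: fourier.phase_deriv_def)

lemma vders_cf: "circle_smooth F \<Longrightarrow> fourier.cf ((vder ^^ p) F) k = (\<i> * of_int k)^p * fourier.cf F k"
 by (induction p) (auto simp: cf_vder circle_smooth_vders)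

lemma vders_sup:
 assumes F: "circle_smooth F"
 shows "(\<lambda>k. of_int \<bar>k\<bar>^p*norm (fourier.cf F k)) summable_on UNIV"
  "norm ((vder ^^ p) F t) \<le> (\<Sum>\<^sub>\<infinity>k. of_int \<bar>k\<bar>^p*norm (fourier.cf F k))"
proof -
 show s: "(\<lambda>k. of_int \<bar>k\<bar>^p*norm (fourier.cf F k)) summable_on UNIV"
  using fourier.cf_summable[OF circle_smooth_vders[OF F], of p 0] by (simp add: vders_cf F norm_mult norm_power)
 show "norm ((vder ^^ p) F t) \<le> (\<Sum>\<^sub>\<infinity>k. of_int \<bar>k\<bar>^p*norm (fourier.cf F k))"
  by (rule norm_infsum_le[OF fourier.Fourier_inversion[OF circle_smooth_vders[OF F]] has_sum_infsum[OF s]])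
   (simp add: vders_cf F norm_mult norm_power)
qed

lemma Parseval_fourier:
 assumes "circle_smooth F" "continuous_on UNIV G" "periodic G"
 shows "((\<lambda>n. fourier.cf F n*cnj (fourier.cf G n)) has_sum mean (\<lambda>t. F t*cnj (G t))) UNIV"
 using fourier.Parseval[OF assms] by simp

definition fmult :: "(int \<Rightarrow> complex) \<Rightarrow> (real \<Rightarrow> complex) \<Rightarrow> real \<Rightarrow> complex" where
 "fmult \<sigma> F t = (\<Sum>\<^sub>\<infinity>k. \<sigma> k*fourier.cf F k*fourier.e k t)"

definition linear_growth :: "(int \<Rightarrow> complex) \<Rightarrow> bool" where
 "linear_growth \<sigma> \<longleftrightarrow> (\<forall>k. norm (\<sigma> k) \<le> wt k)"

lemma linear_growth_symbols [simp]:
 "linear_growth (\<lambda>k. of_int \<bar>k\<bar>)" "linear_growth (\<lambda>k. of_int (sgn k))" "linear_growth of_int"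
 by (auto simp: linear_growth_def wt_def sgn_if)

lemma rapid_series_fmult:
 assumes F: "circle_smooth F" and \<sigma>: "linear_growth \<sigma>"
 shows "fourier.rapid_series (\<lambda>k. \<sigma> k*fourier.cf F k) (fmult \<sigma> F)"
 unfolding fmult_def[abs_def]
proof (rule fourier.rapid_series_exists)
 fix L
 obtain C where C: "\<And>n. norm (fourier.cf F n)*wt n^Suc L \<le> C" using fourier.cf_decay[OF F] by blast
 have "norm (\<sigma> n*fourier.cf F n)*wt n^L \<le> C" for n
 proof -
  have "norm (\<sigma> n*fourier.cf F n)*wt n^L \<le> wt n*norm (fourier.cf F n)*wt n^L"
   using \<sigma> unfolding norm_mult linear_growth_def by (intro mult_right_mono) auto
  also have "... \<le> C" using C[of n] by (simp add: mult_ac)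
  finally show ?thesis .
 qed
 thus "\<exists>C. \<forall>n. norm (\<sigma> n*fourier.cf F n)*wt n^L \<le> C" by blast
qed

lemma fmult:
 assumes F: "circle_smooth F" and \<sigma>: "linear_growth \<sigma>"
 shows has_sum_fmult: "((\<lambda>k. \<sigma> k*fourier.cf F k*fourier.e k t) has_sum fmult \<sigma> F t) UNIV"
  and circle_smooth_fmult: "circle_smooth (fmult \<sigma> F)"
  and cf_fmult: "fourier.cf (fmult \<sigma> F) k = \<sigma> k*fourier.cf F k"
proof -
 note R = rapid_series_fmult[OF assms]
 show hs: "((\<lambda>k. \<sigma> k*fourier.cf F k*fourier.e k t) has_sum fmult \<sigma> F t) UNIV" for t
  using R unfolding fourier.rapid_series_def by blast
 show "circle_smooth (fmult \<sigma> F)" by (rule fourier.circle_smooth_rapid_series[OF R])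
 have "(\<lambda>k. norm (\<sigma> k*fourier.cf F k)) summable_on UNIV"
  by (rule fourier.rapid_summable) (use R in \<open>simp add: fourier.rapid_series_def\<close>)
 from fourier.cf_series[OF this hs] show "fourier.cf (fmult \<sigma> F) k = \<sigma> k*fourier.cf F k" .
qed

lemma fmult_eqI:
 assumes "circle_smooth G" "\<And>k. fourier.cf G k = \<sigma> k*fourier.cf F k"
 shows "fmult \<sigma> F t = G t"
 unfolding fmult_def using fourier.Fourier_inversion[OF assms(1), of t] by (simp add: assms(2) infsumI)

lemma fmult_cnj:
 assumes F: "circle_smooth F" and \<sigma>: "linear_growth \<sigma>" "\<And>k. \<sigma> (- k) = cnj (\<sigma> k)"
 shows "fmult \<sigma> (\<lambda>t. cnj (F t)) t = cnj (fmult \<sigma> F t)"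
proof (rule fmult_eqI)
 show "circle_smooth (\<lambda>t. cnj (fmult \<sigma> F t))" by (intro circle_smooth_intros circle_smooth_fmult F \<sigma>)
 show "fourier.cf (\<lambda>t. cnj (fmult \<sigma> F t)) k = \<sigma> k*fourier.cf (\<lambda>t. cnj (F t)) k" for k
  using \<sigma>(2)[of "- k"] by (simp add: fourier.cf_cnj circle_smooth_cont circle_smooth_fmult cf_fmult F \<sigma>(1))
qed

lemma fmult_linear:
 assumes F: "circle_smooth F" "circle_smooth G" and \<sigma>: "linear_growth \<sigma>"
 shows "fmult \<sigma> (\<lambda>t. c*F t + d*G t) t = c*fmult \<sigma> F t + d*fmult \<sigma> G t"
proof (rule fmult_eqI)
 show "circle_smooth (\<lambda>t. c*fmult \<sigma> F t + d*fmult \<sigma> G t)" by (intro circle_smooth_intros circle_smooth_fmult assms)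
 show "fourier.cf (\<lambda>t. c*fmult \<sigma> F t + d*fmult \<sigma> G t) k = \<sigma> k*fourier.cf (\<lambda>t. c*F t + d*G t) k" for k
  by (simp add: fourier.cf_add fourier.cf_cmult circle_smooth_cont circle_smooth_fmult cf_fmult continuous_intros
   assms algebra_simps)
qed

lemma fmult_cmult: "circle_smooth F \<Longrightarrow> linear_growth \<sigma> \<Longrightarrow> fmult \<sigma> (\<lambda>t. c*F t) t = c*fmult \<sigma> F t"
 using fmult_linear[of F F \<sigma> c 0 t] by simp

abbreviation Lam :: "(real \<Rightarrow> complex) \<Rightarrow> real \<Rightarrow> complex" where "Lam \<equiv> fmult (\<lambda>k. of_int \<bar>k\<bar>)"

definition lam :: "(real \<Rightarrow> real) \<Rightarrow> real \<Rightarrow> real" where "lam f t = Re (Lam (\<lambda>t. of_real (f t)) t)"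

lemma Lambda_eq: "Lambda u t = Lam (\<lambda>t. of_real (u t)) t"
 by (simp add: Lambda_def fmult_def fcoeff_eq fourier.e_def)

lemma Lam_of_real:
 assumes "circle_smooth f" shows "Lam (\<lambda>t. of_real (f t)) t = of_real (lam f t)"
proof -
 have "Lam (\<lambda>t. cnj (of_real (f t))) t = cnj (Lam (\<lambda>t. of_real (f t)) t)"
  by (rule fmult_cnj) (auto intro: circle_smooth_of_real assms)
 hence "Lam (\<lambda>t. of_real (f t)) t \<in> \<real>" by (simp add: Reals_cnj_iff)
 thus ?thesis by (simp add: lam_def)
qed

lemma circle_smooth_lam [circle_smooth_intros]: "circle_smooth f \<Longrightarrow> circle_smooth (lam f)"
 unfolding lam_def[abs_def] by (intro circle_smooth_intros circle_smooth_fmult) auto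

lemma lam_Re:
 assumes F: "circle_smooth F" shows "lam (\<lambda>t. Re (F t)) t = Re (Lam F t)"
proof -
 have "Lam (\<lambda>t. (1/2)*F t + (1/2)*cnj (F t)) t = (1/2)*Lam F t + (1/2)*Lam (\<lambda>t. cnj (F t)) t"
  by (intro fmult_linear circle_smooth_intros F) auto
 also have "Lam (\<lambda>t. cnj (F t)) t = cnj (Lam F t)" by (rule fmult_cnj[OF F]) auto
 also have "(\<lambda>t. (1/2)*F t + (1/2)*cnj (F t)) = (\<lambda>t. complex_of_real (Re (F t)))"
  by (auto simp: complex_eq_iff)
 finally show ?thesis by (simp add: lam_def)
qed

lemma has_sum_mean_lam:
 assumes f: "circle_smooth f" and g: "circle_smooth g"
 shows "((\<lambda>n. of_int \<bar>n\<bar>*fcoeff f n*cnj (fcoeff g n)) has_sum of_real (mean (\<lambda>t. lam f t*g t))) UNIV"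
proof -
 have "((\<lambda>n. fourier.cf (\<lambda>t. of_real (lam f t)) n*cnj (fcoeff g n)) has_sum
   mean (\<lambda>t. of_real (lam f t)*cnj (of_real (g t)))) UNIV" unfolding fcoeff_eq
  by (rule Parseval_fourier; intro circle_smooth_cont circle_smoothD(2) circle_smooth_intros f g)
 also have "mean (\<lambda>t. of_real (lam f t)*cnj (of_real (g t))) = complex_of_real (mean (\<lambda>t. lam f t*g t))"
  using mean_of_real[of "\<lambda>t. lam f t*g t"] by (simp add: continuous_intros circle_smooth_cont circle_smooth_lam f g)
 finally show ?thesis
  unfolding ext[OF Lam_of_real[OF f], symmetric] cf_fmult[OF circle_smooth_of_real[OF f] linear_growth_symbols(1)]
  by (simp add: fcoeff_eq)
qed

lemma lam_sym:
 assumes f: "circle_smooth f" and g: "circle_smooth g"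
 shows "mean (\<lambda>t. lam f t*g t) = mean (\<lambda>t. f t*lam g t)"
proof -
 have "((\<lambda>n. cnj (of_int \<bar>n\<bar>*fcoeff g n*cnj (fcoeff f n))) has_sum cnj (of_real (mean (\<lambda>t. lam g t*f t)))) UNIV"
  unfolding has_sum_cnj_iff by (rule has_sum_mean_lam[OF g f])
 hence "((\<lambda>n. of_int \<bar>n\<bar>*fcoeff f n*cnj (fcoeff g n)) has_sum of_real (mean (\<lambda>t. lam g t*f t))) UNIV"
  by (simp add: mult_ac)
 from has_sum_unique[OF has_sum_mean_lam[OF f g] this] show ?thesis by (simp add: mult.commute)
qed

lemma lam_nonneg:
 assumes f: "circle_smooth f"
 shows "mean (\<lambda>t. lam f t*f t) \<ge> 0" "mean (\<lambda>t. lam f t*f t) = 0 \<Longrightarrow> \<exists>c. \<forall>t. f t = c"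
proof -
 have "of_int \<bar>n\<bar>*fcoeff f n*cnj (fcoeff f n) = of_real (of_int \<bar>n\<bar>*(norm (fcoeff f n))^2)" for n
  by (simp only: of_real_mult complex_norm_square of_real_of_int_eq mult.assoc)
 hence series: "((\<lambda>n. of_int \<bar>n\<bar>*(norm (fcoeff f n))^2) has_sum mean (\<lambda>t. lam f t*f t)) UNIV"
  using has_sum_mean_lam[OF f f] by (simp only: has_sum_of_real_iff)
 show "mean (\<lambda>t. lam f t*f t) \<ge> 0" by (rule has_sum_nonneg[OF series]) auto
 assume "mean (\<lambda>t. lam f t*f t) = 0"
 hence "of_int \<bar>n\<bar>*(norm (fcoeff f n))^2 = 0" for n using nonneg_has_sum_le_0D[OF series, of n] by auto
 hence "fcoeff f n = 0" if "n \<noteq> 0" for n using that by force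
 hence "((\<lambda>n. fcoeff f n*fourier.e n t) has_sum fcoeff f 0) UNIV" for t
  using has_sum_single[of 0 "\<lambda>n. fcoeff f n*fourier.e n t"] by simp
 hence "complex_of_real (f t) = fcoeff f 0" for t
  using has_sum_unique[OF fourier.Fourier_inversion[OF circle_smooth_of_real[OF f]]] unfolding fcoeff_eq by blast
 hence "f t = Re (fcoeff f 0)" for t by (metis Re_complex_of_real)
 thus "\<exists>c. \<forall>t. f t = c" by blast
qed

lemma has_sum_pairing:
 fixes X Y :: "int \<Rightarrow> real"
 assumes X: "(X has_sum S) UNIV" and Y: "Y summable_on UNIV" and pairs: "\<And>n. Y n + Y (- n) = X n + X (- n)"
 shows "(Y has_sum S) UNIV"
proof -
 have "((\<lambda>n. X n + X (- n)) has_sum S + S) UNIV" by (intro has_sum_add X) (simp add: has_sum_uminus_int X)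
 moreover have "((\<lambda>n. Y n + Y (- n)) has_sum infsum Y UNIV + infsum Y UNIV) UNIV"
  using Y by (intro has_sum_add) (simp_all add: has_sum_uminus_int)
 ultimately have "S + S = infsum Y UNIV + infsum Y UNIV" unfolding pairs using has_sum_unique by blast
 thus ?thesis using Y by simp
qed

section \<open>The operator \<open>a \<Lambda>\<close> in the basis adapted to \<open>a\<close>\<close>

locale speed =
 fixes a :: "real \<Rightarrow> real"
 assumes a_smooth: "smooth_S a" and a_pos: "\<And>t. a t > 0" and a_int: "integral {0..2*pi} (\<lambda>t. 1/a t) = 2*pi"
begin

definition \<rho> :: "real \<Rightarrow> real" where "\<rho> t = 1/a t"

definition s :: "real \<Rightarrow> real" where
 "s t = (if t \<ge> 0 then integral {0..t} \<rho> else - integral {t..0} \<rho>)"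

lemma circle_smooth_a [circle_smooth_intros]: "circle_smooth a" using a_smooth by (simp add: smooth_S_iff)

lemma circle_smooth_rho: "circle_smooth \<rho>"
 using circle_smooth_inverse[OF circle_smooth_a a_pos] by (simp add: \<rho>_def[abs_def])

lemma a_rho: "a t*\<rho> t = 1" "\<rho> t*a t = 1" "a t*x*\<rho> t = x"
 using a_pos[of t] by (auto simp: \<rho>_def)

lemma continuous_a [continuous_intros]: "continuous_on S a" by (rule circle_smooth_cont[OF circle_smooth_a])

lemma s_deriv: "(s has_vector_derivative \<rho> t) (at t)"
proof -
 define A where "A = \<bar>t\<bar> + 1"
 have int: "\<rho> integrable_on {x..y}" for x y by (rule integrable_continuous_real[OF circle_smooth_cont[OF circle_smooth_rho]])
 have eq: "s u = integral {-A..u} \<rho> - integral {-A..0} \<rho>" if "u \<in> {-A..A}" for u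
 proof (cases "u \<ge> 0")
  case True
  have "integral {-A..0} \<rho> + integral {0..u} \<rho> = integral {-A..u} \<rho>"
   using True by (intro Henstock_Kurzweil_Integration.integral_combine int) (auto simp: A_def)
  thus ?thesis using True by (simp add: s_def)
 next
  case False
  have "integral {-A..u} \<rho> + integral {u..0} \<rho> = integral {-A..0} \<rho>"
   using False that by (intro Henstock_Kurzweil_Integration.integral_combine int) auto
  thus ?thesis using False by (simp add: s_def)
 qed
 have "((\<lambda>u. integral {-A..u} \<rho>) has_vector_derivative \<rho> t) (at t within {-A..A})"
  by (rule integral_has_vector_derivative[OF circle_smooth_cont[OF circle_smooth_rho]]) (auto simp: A_def)
 hence "((\<lambda>u. integral {-A..u} \<rho>) has_vector_derivative \<rho> t) (at t)"
  by (subst (asm) at_within_interior) (auto simp: A_def)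
 from has_vector_derivative_diff[OF this has_vector_derivative_const[of "integral {-A..0} \<rho>"]]
 have "((\<lambda>u. integral {-A..u} \<rho> - integral {-A..0} \<rho>) has_vector_derivative \<rho> t) (at t)" by simp
 thus ?thesis
 proof (rule has_vector_derivative_transform_within_open[of _ _ _ "{-A<..<A}"])
  show "t \<in> {-A<..<A}" by (auto simp: A_def)
  show "integral {-A..u} \<rho> - integral {-A..0} \<rho> = s u" if "u \<in> {-A<..<A}" for u
   using eq[of u] that by simp
 qed simp
qed

lemma s_shift: "s (t + 2*pi) = s t + 2*pi"
proof -
 have "((\<lambda>t. s (t + 2*pi) - s t) has_vector_derivative 0) (at t)" for t
 proof -
  have "((s \<circ> (\<lambda>t. t + 2*pi)) has_vector_derivative 1 *\<^sub>R \<rho> (t + 2*pi)) (at t)"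
   by (rule vector_diff_chain_at) (auto intro!: derivative_eq_intros s_deriv)
  from has_vector_derivative_diff[OF this s_deriv[of t]] show ?thesis
   using circle_smoothD(2)[OF circle_smooth_rho] by (simp add: o_def periodic_def)
 qed
 hence "s (t + 2*pi) - s t = s (0 + 2*pi) - s 0"
  using has_vector_derivative_zero_constant[of UNIV "\<lambda>t. s (t + 2*pi) - s t"] by (metis UNIV_I convex_UNIV)
 also have "... = 2*pi" using a_int by (simp add: s_def \<rho>_def[abs_def])
 finally show ?thesis by simp
qed

sublocale ph: phase s \<rho>
 by unfold_locales (use circle_smooth_rho a_pos s_deriv s_shift in \<open>auto simp: \<rho>_def\<close>)

subsection \<open>Non-stationary phase\<close>

text \<open>The product of \<open>e n\<close> for the phases \<open>s\<close> and \<open>t\<close> is a single exponential with frequency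
 \<open>n + k\<close> for the interpolated phase below with \<open>x = n/(n + k)\<close>, and for \<open>0 \<le> x \<le> 1\<close> these phases
 obey uniform bounds.\<close>

definition s_mix :: "real \<Rightarrow> real \<Rightarrow> real" where "s_mix x t = x * s t + (1 - x) * t"

definition \<rho>_mix :: "real \<Rightarrow> real \<Rightarrow> real" where "\<rho>_mix x t = x*\<rho> t + (1 - x)"

lemma phase_mix:
 assumes "x \<in> {0..1}" shows "phase (s_mix x) (\<rho>_mix x)"
proof
 show "circle_smooth (\<rho>_mix x)"
  unfolding \<rho>_mix_def[abs_def] by (intro circle_smooth_intros ph.circle_smooth_rho)
 show "\<rho>_mix x t > 0" for t
  using assms ph.rho_pos[of t] by (cases "x = 0") (auto simp: \<rho>_mix_def intro: add_pos_nonneg)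
 show "(s_mix x has_vector_derivative \<rho>_mix x t) (at t)" for t
  unfolding s_mix_def[abs_def] \<rho>_mix_def has_real_derivative_iff_has_vector_derivative[symmetric]
  by (auto intro!: derivative_eq_intros simp: s_deriv has_real_derivative_iff_has_vector_derivative)
 show "s_mix x (t + 2*pi) = s_mix x t + 2*pi" for t unfolding s_mix_def s_shift by (simp add: algebra_simps)
qed

lemma mix_uniform_bounds:
 obtains \<delta> B where "\<delta> > 0" "\<And>x t. x \<in> {0..1} \<Longrightarrow> \<rho>_mix x t \<ge> \<delta>"
  "\<And>x. x \<in> {0..1} \<Longrightarrow> vders_le q B (\<lambda>t. complex_of_real (\<rho>_mix x t))"
proof -
 obtain D where D: "D \<ge> 0" "\<And>t. norm (a t) \<le> D" using circle_smooth_bounded[OF circle_smooth_a] by blast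
 obtain B where B: "vders_le q B (\<lambda>t. complex_of_real (\<rho> t))"
  using circle_smooth_vders_le[OF circle_smooth_of_real[OF ph.circle_smooth_rho]] by blast
 have rho_ge: "\<rho> t \<ge> 1/(D + 1)" for t
  unfolding \<rho>_def using D(2)[of t] a_pos[of t] by (intro frac_le) auto
 have "\<rho>_mix x t \<ge> 1/(D + 1)" if "x \<in> {0..1}" for x t
 proof -
  have "x*(1/(D + 1)) + (1 - x)*(1/(D + 1)) \<le> x*\<rho> t + (1 - x)*1"
   using that D(1) by (intro add_mono mult_left_mono rho_ge) auto
  moreover have "x*(1/(D + 1)) + (1 - x)*(1/(D + 1)) = 1/(D + 1)" by (simp only: distrib_right[symmetric]) simp
  ultimately show ?thesis by (simp add: \<rho>_mix_def)
 qed
 moreover have "vders_le q (B + 1) (\<lambda>t. complex_of_real (\<rho>_mix x t))" if x: "x \<in> {0..1}" for x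
  unfolding vders_le_def
 proof (intro allI impI)
  fix i t assume i: "i \<le> q"
  let ?\<rho>x = "\<lambda>t. complex_of_real (\<rho>_mix x t)" and ?x\<rho> = "\<lambda>t. complex_of_real x * of_real (\<rho> t)"
   and ?c = "\<lambda>_. complex_of_real (1 - x)"
  have const: "norm ((vder ^^ i) ?c t) \<le> 1"
  proof (cases i)
   case (Suc j)
   have "vder (\<lambda>_. c) = (\<lambda>_. 0)" for c :: complex by (rule vder_eqI) simp
   hence "(vder ^^ i) ?c = (\<lambda>_. 0)" unfolding Suc by (induction j) simp_all
   thus ?thesis by simp
  qed (use x in \<open>simp del: of_real_diff\<close>)
  have sum_eq: "(vder ^^ i) ?\<rho>x
    = (\<lambda>t. (vder ^^ i) ?x\<rho> t + (vder ^^ i) ?c t)" unfolding \<rho>_mix_def of_real_add of_real_mult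
   by (intro vders_add smooth_cmult(1) circle_smoothD(1) circle_smooth_of_real ph.circle_smooth_rho smooth_const)
  have scale_eq: "(vder ^^ i) ?x\<rho> = (\<lambda>t. of_real x*(vder ^^ i) (\<lambda>t. of_real (\<rho> t)) t)"
   by (intro vders_bounded_linear bounded_linear_mult_right circle_smoothD(1) circle_smooth_of_real ph.circle_smooth_rho)
  have "x*norm ((vder ^^ i) (\<lambda>t. complex_of_real (\<rho> t)) t) \<le> 1*B"
   using B i x by (intro mult_mono) (auto simp: vders_le_def)
  thus "norm ((vder ^^ i) ?\<rho>x t) \<le> B + 1"
   unfolding sum_eq scale_eq using x const by (intro order_trans[OF norm_triangle_ineq] add_mono) (simp_all add: norm_mult)
 qed
 ultimately show ?thesis using that[of "1/(D + 1)" "B + 1"] D(1) by simp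
qed

definition U :: "int \<Rightarrow> int \<Rightarrow> complex" where "U n k = fourier.cf (ph.e n) k"

lemma U_eq_mix:
 assumes x: "x \<in> {0..1}" and n: "of_int n = x * of_int N"
 shows "U n (n - N) = phase.cf (s_mix x) (\<rho>_mix x) (\<lambda>t. complex_of_real (1/\<rho>_mix x t)) (- N)"
proof -
 interpret mix: phase "s_mix x" "\<rho>_mix x" by (rule phase_mix[OF x])
 have "ph.e n t*fourier.e (N - n) t = mix.e N t" for t
  by (simp add: fourier.e_def ph.e_def mix.e_def cis_mult s_mix_def n algebra_simps)
 moreover have "\<rho>_mix x t \<noteq> 0" for t using mix.rho_pos[of t] by simp
 ultimately show ?thesis unfolding U_def fourier.cf_def mix.cf_def by (intro mean_cong) simp
qed

lemma U_decay: "\<exists>C. \<forall>n k. n \<ge> 0 \<longrightarrow> k \<ge> 0 \<longrightarrow> n + k > 0 \<longrightarrow> norm (U n (- k)) * of_int (n + k)^L \<le> C"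
proof -
 obtain \<delta> B where \<delta>: "\<delta> > 0" "\<And>x t. x \<in> {0..1} \<Longrightarrow> \<rho>_mix x t \<ge> \<delta>"
  "\<And>x. x \<in> {0..1} \<Longrightarrow> vders_le L B (\<lambda>t. complex_of_real (\<rho>_mix x t))" using mix_uniform_bounds by blast
 obtain D where D: "\<And>f g. reciprocal_pair \<delta> f g \<Longrightarrow> vders_le L B f \<Longrightarrow> vders_le L D g"
  using vders_le_reciprocal[OF \<delta>(1)] by blast
 obtain C where C: "\<And>s \<rho> F. phase s \<rho> \<and> circle_smooth F \<and> (\<forall>t. \<rho> t \<ge> \<delta>) \<and> vders_le (0 + L) B (\<lambda>t. complex_of_real (\<rho> t)) \<and>
  vders_le (0 + L) D F \<Longrightarrow> vders_le 0 C ((phase.phase_deriv \<rho> ^^ L) F)"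
  using phase_deriv_iter_uniform_bound[OF \<delta>(1)] by blast
 have "norm (U n (- k)) * of_int (n + k)^L \<le> C" if nk: "n \<ge> 0" "k \<ge> 0" "n + k > 0" for n k
 proof -
  define N where "N = n + k"
  define x where "x = real_of_int n/of_int N"
  have N: "N > 0" "of_int n = x * of_int N" "- k = n - N" and x: "x \<in> {0..1}"
   using nk by (auto simp: x_def N_def simp del: of_int_add)
  interpret mix: phase "s_mix x" "\<rho>_mix x" by (rule phase_mix[OF x])
  let ?F = "\<lambda>t. complex_of_real (1/\<rho>_mix x t)"
  have "vders_le L D ?F" by (rule D[OF mix.reciprocal_pair_rho[OF \<delta>(2)[OF x]] \<delta>(3)[OF x]])
  hence "vders_le 0 C ((mix.phase_deriv ^^ L) ?F)"
   using C[of "s_mix x" "\<rho>_mix x" ?F] mix.phase_axioms mix.circle_smooth_inverse_rho \<delta>(2,3)[OF x] by simp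
  hence "of_int \<bar>- N\<bar>^L*norm (mix.cf ?F (- N)) \<le> C"
   by (intro mix.cf_decay_of_phase_deriv mix.circle_smooth_inverse_rho) (simp add: vders_le_def)
  thus ?thesis using N(1) unfolding N(3) U_eq_mix[OF x N(2)] N_def[symmetric] by (simp add: mult.commute)
 qed
 thus ?thesis by blast
qed

definition remainder :: "int \<Rightarrow> real \<Rightarrow> complex" where
 "remainder n t = Lam (ph.e n) t - of_int \<bar>n\<bar> * of_real (\<rho> t) * ph.e n t"

lemma circle_smooth_remainder: "circle_smooth (remainder n)"
 unfolding remainder_def[abs_def]
 by (intro circle_smooth_intros circle_smooth_fmult ph.circle_smooth_rho linear_growth_symbols)

lemma continuous_remainder [continuous_intros]: "continuous_on S (remainder n)"
 by (rule circle_smooth_cont[OF circle_smooth_remainder])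

lemma remainder_minus: "remainder (- n) t = cnj (remainder n t)"
proof -
 have "Lam (\<lambda>t. cnj (ph.e n t)) t = cnj (Lam (ph.e n) t)" by (intro fmult_cnj ph.circle_smooth_e) auto
 thus ?thesis by (simp add: remainder_def)
qed

text \<open>For \<open>n \<ge> 0\<close> the operator \<open>\<Lambda>\<close> differs from \<open>D\<close> only on the rapidly decaying negative modes of \<open>e n\<close>.\<close>

lemma has_sum_remainder:
 assumes n: "n \<ge> 0"
 shows "((\<lambda>k. of_int (\<bar>k\<bar> - k)*U n k*fourier.e k t) has_sum remainder n t) UNIV"
proof -
 have "((\<lambda>k. \<i> * of_int k * U n k * fourier.e k t) has_sum vder (ph.e n) t) UNIV"
  using fourier.Fourier_inversion[OF circle_smooth_vder[OF ph.circle_smooth_e[of n]], of t]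
  unfolding U_def cf_vder[OF ph.circle_smooth_e] .
 from has_sum_cmult_right[OF this[unfolded ph.vder_e], of "\<i>"]
 have "((\<lambda>k. - (of_int k * U n k * fourier.e k t)) has_sum - (of_int n * of_real (\<rho> t) * ph.e n t)) UNIV"
  by (simp add: mult.assoc)
 from has_sum_add[OF has_sum_fmult[OF ph.circle_smooth_e[of n] linear_growth_symbols(1), of t] this] show ?thesis
  using n by (simp add: remainder_def U_def algebra_simps)
qed

lemma remainder_decay: "\<exists>C\<ge>0. \<forall>n t. norm (remainder n t) \<le> C/wt n^L"
proof -
 obtain C where C: "\<And>n k. n \<ge> 0 \<Longrightarrow> k \<ge> 0 \<Longrightarrow> n + k > 0 \<Longrightarrow> norm (U n (- k)) * of_int (n + k)^(L + 3) \<le> C"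
  using U_decay by blast
 have C_ge: "C \<ge> 0" using C[of 1 0] by (rule order_trans[rotated]) auto
 have nonneg: "norm (remainder n t) \<le> 8*C*wt_sum/wt n^L" if n: "n \<ge> 0" for n t
 proof -
  have "norm (of_int (\<bar>k\<bar> - k)*U n k*fourier.e k t) \<le> (8*C/wt n^L)*(1/wt k^2)" for k
  proof (cases "k \<ge> 0")
   case True
   thus ?thesis using C_ge by simp
  next
   case False
   define p where "p = - k"
   define x where "x = real_of_int (n + p)"
   have p: "p \<ge> 1" "k = - p" using False by (auto simp: p_def)
   hence x: "wt n \<le> x" "wt k \<le> 1 + x" "real_of_int p \<le> x" using n by (auto simp: wt_def x_def)
   have "wt n^L*(of_int p*wt k^2) \<le> x^L*(x*(2*x)^2)"
    using x p n by (intro mult_mono power_mono) (auto simp: wt_def x_def)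
   also have "... = 4*x^(L + 3)" by (simp add: power_add power3_eq_cube power2_eq_square)
   finally have "norm (U n (- p))*(wt n^L*(of_int p*wt k^2)) \<le> norm (U n (- p))*(4*x^(L + 3))"
    by (intro mult_left_mono) auto
   also have "... \<le> 4*C" using C[of n p] p n by (simp add: x_def)
   finally show ?thesis using p by (simp add: norm_mult field_simps)
  qed
  from norm_infsum_le[OF has_sum_remainder[OF n] has_sum_wt this] show ?thesis by simp
 qed
 have "norm (remainder n t) \<le> 8*C*wt_sum/wt n^L" for n t
  using nonneg[of n t] nonneg[of "- n" t] remainder_minus[of n t] by (cases "n \<ge> 0") auto
 thus ?thesis using C_ge wt_sum_nonneg by (intro exI[of _ "8*C*wt_sum"]) auto
qed
end

context speed
begin

subsection \<open>The real basis\<close>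

text \<open>The functions \<open>cos (n * s t) + sin (n * s t)\<close>, for positive and negative \<open>n\<close> alike, form an
 orthonormal basis; no case distinction on the sign of \<open>n\<close> is needed.\<close>

definition cas :: "int \<Rightarrow> real \<Rightarrow> real" where "cas n t = Re (ph.e n t) + Im (ph.e n t)"

lemma cas_eq: "cas n t = Re ((1 - \<i>)*ph.e n t)" by (simp add: cas_def)

lemma of_real_cas: "complex_of_real (cas n t) = (1 - \<i>)/2*ph.e n t + (1 + \<i>)/2*ph.e (- n) t"
 by (simp add: cas_def complex_eq_iff field_simps flip: ph.cnj_e)

lemma circle_smooth_cas [circle_smooth_intros]: "circle_smooth (cas n)"
 unfolding cas_eq[abs_def] by (intro circle_smooth_intros)

lemma continuous_cas [continuous_intros]: "continuous_on S (cas n)"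
 by (rule circle_smooth_cont[OF circle_smooth_cas])

lemma cas_bound: "\<bar>cas n t\<bar> \<le> 2"
 using abs_Re_le_cmod[of "ph.e n t"] abs_Im_le_cmod[of "ph.e n t"] by (simp add: cas_def)

lemma lam_cas: "lam (cas n) t = Re ((1 - \<i>)*Lam (ph.e n) t)"
proof -
 have "lam (cas n) t = Re (Lam (\<lambda>t. (1 - \<i>)*ph.e n t) t)"
  unfolding cas_eq[abs_def] by (intro lam_Re circle_smooth_intros)
 thus ?thesis by (simp only: fmult_cmult[OF ph.circle_smooth_e linear_growth_symbols(1)])
qed

definition cas_remainder :: "int \<Rightarrow> real \<Rightarrow> real" where
 "cas_remainder n t = lam (cas n) t - of_int \<bar>n\<bar>*\<rho> t*cas n t"

lemma cas_remainder_eq: "cas_remainder n t = Re ((1 - \<i>)*remainder n t)"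
 by (simp add: cas_remainder_def lam_cas remainder_def cas_def algebra_simps)

lemma circle_smooth_cas_remainder: "circle_smooth (cas_remainder n)"
 unfolding cas_remainder_def[abs_def] by (intro circle_smooth_intros ph.circle_smooth_rho)

lemma continuous_cas_remainder [continuous_intros]: "continuous_on S (cas_remainder n)"
 by (rule circle_smooth_cont[OF circle_smooth_cas_remainder])

lemma cas_remainder_decay: "\<exists>C\<ge>0. \<forall>n t. \<bar>cas_remainder n t\<bar> \<le> C/wt n^L"
proof -
 obtain C where C: "C \<ge> 0" "\<And>n t. norm (remainder n t) \<le> C/wt n^L" using remainder_decay by blast
 have "\<bar>cas_remainder n t\<bar> \<le> (2*C)/wt n^L" for n t
  using C(2)[of n t] abs_Re_le_cmod[of "remainder n t"] abs_Im_le_cmod[of "remainder n t"]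
  by (simp add: cas_remainder_eq)
 thus ?thesis using C(1) by (intro exI[of _ "2*C"]) auto
qed

definition coef :: "int \<Rightarrow> (real \<Rightarrow> real) \<Rightarrow> real" where "coef n f = mean (\<lambda>t. f t*cas n t*\<rho> t)"

abbreviation cf_real :: "(real \<Rightarrow> real) \<Rightarrow> int \<Rightarrow> complex" where "cf_real f \<equiv> ph.cf (\<lambda>t. complex_of_real (f t))"

lemma cf_real_minus: "continuous_on UNIV f \<Longrightarrow> cf_real f (- n) = cnj (cf_real f n)"
 using ph.cf_cnj[of "\<lambda>t. of_real (f t)" "- n"] by (simp add: continuous_intros)

lemma coef_cf:
 assumes f: "continuous_on UNIV f" shows "coef n f = Re (cf_real f n) - Im (cf_real f n)"
proof -
 have "coef n f = mean (\<lambda>t. Re ((1 + \<i>) * (of_real (f t) * ph.e (- n) t * of_real (\<rho> t))))"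
  unfolding coef_def by (rule mean_cong) (simp add: cas_def algebra_simps flip: ph.cnj_e)
 also have "... = Re ((1 + \<i>)*cf_real f n)" unfolding ph.cf_def
  by (subst mean_bounded_linear[OF bounded_linear_Re], intro continuous_intros f, subst mean_cmult)
   (intro continuous_intros f, rule refl)
 finally show ?thesis by simp
qed

lemma coef_rapid:
 assumes f: "circle_smooth f" shows "\<exists>C\<ge>0. \<forall>n. \<bar>coef n f\<bar> \<le> C/wt n^L"
proof -
 obtain C where C: "C \<ge> 0" "\<And>n. norm (cf_real f n)*wt n^L \<le> C" using ph.cf_decay[OF circle_smooth_of_real[OF f]] by blast
 have "\<bar>coef n f\<bar> \<le> (2*C)/wt n^L" for n
 proof -
  have "\<bar>coef n f\<bar>*wt n^L \<le> (2*norm (cf_real f n))*wt n^L"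
   using abs_Re_le_cmod[of "cf_real f n"] abs_Im_le_cmod[of "cf_real f n"]
   unfolding coef_cf[OF circle_smooth_cont[OF f]] by (intro mult_right_mono) auto
  hence "\<bar>coef n f\<bar>*wt n^L \<le> 2*C" using C(2)[of n] by linarith
  thus ?thesis by (simp add: pos_le_divide_eq)
 qed
 thus ?thesis using C(1) by (intro exI[of _ "2*C"]) auto
qed

lemma coef_summable:
 assumes "circle_smooth f" "circle_smooth g" shows "(\<lambda>n. coef n f*coef n g) summable_on UNIV"
proof -
 obtain C D where C: "C \<ge> 0" "\<And>n. \<bar>coef n f\<bar> \<le> C/wt n^2" "\<And>n. \<bar>coef n g\<bar> \<le> D/wt n^0"
  using coef_rapid[OF assms(1), of 2] coef_rapid[OF assms(2), of 0] by blast
 have "\<bar>coef n f*coef n g\<bar> \<le> (C*D)*(1/wt n^2)" for n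
  using mult_mono[OF C(2) C(3), of n n] C(1) by (simp add: abs_mult)
 thus ?thesis by (rule wt_dominated(1))
qed

lemma Parseval_real:
 assumes f: "circle_smooth f" and g: "circle_smooth g"
 shows "((\<lambda>n. coef n f*coef n g) has_sum mean (\<lambda>t. f t*g t*\<rho> t)) UNIV"
proof (rule has_sum_pairing[OF _ coef_summable[OF f g]])
 let ?f = "cf_real f" and ?g = "cf_real g"
 have cont: "continuous_on UNIV f" "continuous_on UNIV g" using f g circle_smooth_cont by auto
 have "((\<lambda>n. ?f n * cnj (?g n)) has_sum mean (\<lambda>t. of_real (f t) * cnj (of_real (g t)) * of_real (\<rho> t))) UNIV"
  by (rule ph.Parseval; intro circle_smooth_cont circle_smoothD(2) circle_smooth_intros f g)
 also have "mean (\<lambda>t. of_real (f t) * cnj (of_real (g t)) * of_real (\<rho> t)) = complex_of_real (mean (\<lambda>t. f t * g t * \<rho> t))"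
  using mean_of_real[of "\<lambda>t. f t*g t*\<rho> t"] by (simp add: continuous_intros cont)
 finally show "((\<lambda>n. Re (?f n*cnj (?g n))) has_sum mean (\<lambda>t. f t*g t*\<rho> t)) UNIV"
  using has_sum_Re by fastforce
 show "coef n f*coef n g + coef (- n) f*coef (- n) g = Re (?f n*cnj (?g n)) + Re (?f (- n)*cnj (?g (- n)))" for n
  by (simp add: coef_cf cont cf_real_minus algebra_simps)
qed

lemma coef_eq_0_imp:
 assumes f: "circle_smooth f" and zero: "\<And>n. coef n f = 0" shows "f t = 0"
proof -
 have "cf_real f n = 0" for n
  using zero[of n] zero[of "- n"] circle_smooth_cont[OF f] by (simp add: coef_cf cf_real_minus complex_eq_iff)
 from ph.cf_eq_0_imp[OF circle_smooth_of_real[OF f] this] show ?thesis by simp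
qed

lemma coef_cas: "coef n (cas m) = (if m = n then 1 else 0)"
proof -
 have "cf_real (cas m) n = (1 - \<i>)/2*ph.cf (ph.e m) n + (1 + \<i>)/2*ph.cf (ph.e (- m)) n"
  unfolding of_real_cas by (subst ph.cf_add; (intro continuous_intros)?; subst (1 2) ph.cf_cmult; (intro continuous_intros)?; rule refl)
 thus ?thesis by (auto simp: coef_cf continuous_cas ph.cf_e)
qed

lemma coef_a_mult: "coef n (\<lambda>t. a t*f t) = mean (\<lambda>t. cas n t*f t)"
 unfolding coef_def
proof (rule mean_cong)
 show "a t*f t*cas n t*\<rho> t = cas n t*f t" for t using a_rho(3)[of t "cas n t*f t"] by (simp only: mult_ac)
qed

lemma coef_linear: "continuous_on UNIV f \<Longrightarrow> continuous_on UNIV g \<Longrightarrow> coef n (\<lambda>t. f t - x*g t) = coef n f - x*coef n g"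
proof -
 assume f: "continuous_on UNIV f" and g: "continuous_on UNIV g"
 have "coef n (\<lambda>t. f t - x*g t) = mean (\<lambda>t. f t*cas n t*\<rho> t - x*(g t*cas n t*\<rho> t))"
  unfolding coef_def by (rule mean_cong) (simp add: algebra_simps)
 also have "... = coef n f - x*coef n g" unfolding coef_def
  by (subst mean_diff; (intro continuous_intros f g)?; subst mean_cmult; (intro continuous_intros g)?; rule refl)
 finally show ?thesis .
qed

lemma series_real:
 assumes x: "\<And>L. \<exists>C. \<forall>n. \<bar>x n\<bar>*wt n^L \<le> C"
 shows "\<exists>v. circle_smooth v \<and> (\<forall>n. coef n v = x n)"
proof -
 define d where "d n = Complex ((x n + x (- n))/2) ((x (- n) - x n)/2)" for n
 have "\<exists>C. \<forall>n. norm (d n)*wt n^L \<le> C" for L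
 proof -
  obtain C where C: "\<And>n. \<bar>x n\<bar>*wt n^L \<le> C" using x by blast
  have "norm (d n)*wt n^L \<le> C + C" for n
  proof -
   have "\<bar>(p + q)/2\<bar> + \<bar>(q - p)/2\<bar> \<le> \<bar>p\<bar> + \<bar>q\<bar>" for p q :: real by (auto simp: abs_if field_simps)
   hence "norm (d n) \<le> \<bar>x n\<bar> + \<bar>x (- n)\<bar>" using cmod_le[of "d n"] unfolding d_def complex.sel by (rule order_trans[rotated])
   hence "norm (d n)*wt n^L \<le> (\<bar>x n\<bar> + \<bar>x (- n)\<bar>)*wt n^L" by (intro mult_right_mono) auto
   thus ?thesis using C[of n] C[of "- n"] by (simp add: distrib_right)
  qed
  thus ?thesis by blast
 qed
 define F where "F t = (\<Sum>\<^sub>\<infinity>n. d n*ph.e n t)" for t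
 have F: "ph.rapid_series d F" unfolding F_def[abs_def] by (rule ph.rapid_series_exists) fact
 have smooth_F: "circle_smooth F" by (rule ph.circle_smooth_rapid_series[OF F])
 have cf_F: "ph.cf F n = d n" for n
  by (rule ph.cf_series[OF ph.rapid_summable]) (use F in \<open>auto simp: ph.rapid_series_def\<close>)
 have "cnj (F t) - F t = 0" for t
 proof (rule ph.cf_eq_0_imp)
  show "ph.cf (\<lambda>t. cnj (F t) - F t) n = 0" for n
   using circle_smooth_cont[OF smooth_F] by (simp add: ph.cf_diff ph.cf_cnj cf_F continuous_intros d_def complex_eq_iff add_divide_distrib diff_divide_distrib)
 qed (intro circle_smooth_intros smooth_F)
 hence "(\<lambda>t. complex_of_real (Re (F t))) = F" by (auto simp: fun_eq_iff complex_eq_iff)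
 moreover have v: "circle_smooth (\<lambda>t. Re (F t))" by (intro circle_smooth_intros smooth_F)
 ultimately have "coef n (\<lambda>t. Re (F t)) = x n" for n
  by (simp add: coef_cf circle_smooth_cont cf_F d_def field_simps)
 thus ?thesis using v by blast
qed

definition R :: "int \<Rightarrow> int \<Rightarrow> real" where "R n m = mean (\<lambda>t. cas n t*cas_remainder m t)"

lemma mean_lam_cas:
 assumes f: "continuous_on UNIV f"
 shows "mean (\<lambda>t. f t*lam (cas n) t) = of_int \<bar>n\<bar>*coef n f + mean (\<lambda>t. f t*cas_remainder n t)"
proof -
 have "mean (\<lambda>t. f t*lam (cas n) t) = mean (\<lambda>t. of_int \<bar>n\<bar>*(f t*cas n t*\<rho> t) + f t*cas_remainder n t)"
  by (rule mean_cong) (simp add: cas_remainder_def algebra_simps)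
 also have "... = of_int \<bar>n\<bar>*coef n f + mean (\<lambda>t. f t*cas_remainder n t)" unfolding coef_def
  by (subst mean_add; (intro continuous_intros f)?; subst mean_cmult; (intro continuous_intros f)?; rule refl)
 finally show ?thesis .
qed

lemma mean_cas_lam_cas: "mean (\<lambda>t. cas n t*lam (cas m) t) = (if n = m then of_int \<bar>m\<bar> else 0) + R n m"
 by (simp add: mean_lam_cas continuous_cas coef_cas R_def)

lemma R_sym: "R n m = R m n"
proof -
 have "mean (\<lambda>t. cas n t*lam (cas m) t) = mean (\<lambda>t. cas m t*lam (cas n) t)"
  using lam_sym[OF circle_smooth_cas[of n] circle_smooth_cas[of m]] by (simp add: mult.commute)
 thus ?thesis unfolding mean_cas_lam_cas by (auto split: if_splits)
qed

lemma rapid_R: "rapid R"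
 unfolding rapid_def
proof
 fix L
 obtain C where C: "C \<ge> 0" "\<And>m t. \<bar>cas_remainder m t\<bar> \<le> C/wt m^(2*L)" using cas_remainder_decay by blast
 have "\<bar>R n m\<bar> \<le> 2*(C/wt m^(2*L))" for n m unfolding R_def real_norm_def[symmetric]
 proof (rule norm_mean_le)
  show "norm (cas n t*cas_remainder m t) \<le> 2*(C/wt m^(2*L))" for t
   using cas_bound C by (simp only: real_norm_def abs_mult) (intro mult_mono, auto)
 qed (intro continuous_intros)
 hence column: "\<bar>R n m\<bar>*wt m^(2*L) \<le> 2*C" for n m by (simp add: pos_le_divide_eq)
 have "\<bar>R n m\<bar>*(wt n^L*wt m^L) \<le> 2*C" for n m
 proof (rule power2_le_imp_le)
  have "(\<bar>R n m\<bar>*(wt n^L*wt m^L))^2 = (\<bar>R m n\<bar>*wt n^(2*L))*(\<bar>R n m\<bar>*wt m^(2*L))"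
   unfolding R_sym[of m n] power_mult_distrib power_even_eq power2_eq_square by (simp only: mult_ac)
  also have "... \<le> (2*C)*(2*C)" using C(1) by (intro mult_mono column) auto
  finally show "(\<bar>R n m\<bar>*(wt n^L*wt m^L))^2 \<le> (2*C)^2" by (simp add: power2_eq_square)
 qed (use C in simp)
 thus "\<exists>C. \<forall>n m. \<bar>R n m\<bar> \<le> C/(wt n^L*wt m^L)" by (auto simp: pos_le_divide_eq)
qed

lemma matrix_lam:
 assumes v: "circle_smooth v"
 shows "mean (\<lambda>t. cas n t*lam v t) = of_int \<bar>n\<bar>*coef n v + matvec R (\<lambda>m. coef m v) n"
proof -
 have "mean (\<lambda>t. cas n t*lam v t) = mean (\<lambda>t. v t*lam (cas n) t)"
  using lam_sym[OF v circle_smooth_cas[of n]] by (simp add: mult.commute)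
 also have "... = of_int \<bar>n\<bar>*coef n v + mean (\<lambda>t. v t*cas_remainder n t)"
  by (rule mean_lam_cas[OF circle_smooth_cont[OF v]])
 also have "mean (\<lambda>t. v t*cas_remainder n t) = matvec R (\<lambda>m. coef m v) n"
 proof -
  have "((\<lambda>m. coef m v * coef m (\<lambda>t. a t * cas_remainder n t)) has_sum mean (\<lambda>t. v t * (a t * cas_remainder n t) * \<rho> t)) UNIV"
   by (intro Parseval_real v circle_smooth_intros circle_smooth_cas_remainder)
  moreover have "v t*(a t*cas_remainder n t)*\<rho> t = v t*cas_remainder n t" for t
   using a_rho(3)[of t "v t*cas_remainder n t"] by (simp only: mult_ac)
  ultimately have "((\<lambda>m. R n m*coef m v) has_sum mean (\<lambda>t. v t*cas_remainder n t)) UNIV"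
   by (simp only: coef_a_mult R_def[symmetric] R_sym[of n] mult.commute[of "coef _ v"])
  thus ?thesis unfolding matvec_def by (simp add: has_sum_iff)
 qed
 finally show ?thesis .
qed

end

locale speed_spectrum = speed a + rs: rapid_spectrum "speed.R a" u l for a u l
begin

definition phi :: "nat \<Rightarrow> real \<Rightarrow> real" where
 "phi k = (SOME f. circle_smooth f \<and> (\<forall>n. coef n f = rs.U k n))"

lemma circle_smooth_phi: "circle_smooth (phi k)" and coef_phi: "coef n (phi k) = rs.U k n"
 using someI_ex[OF series_real[of "rs.U k", OF rs.U_rapid]] unfolding phi_def by blast+

lemma continuous_phi [continuous_intros]: "continuous_on S (phi k)"
 by (rule circle_smooth_cont[OF circle_smooth_phi])

lemma lam_phi: "lam (phi k) t = l k*(\<rho> t*phi k t)"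
proof -
 define f where "f t = a t*lam (phi k) t - l k*phi k t" for t
 have "f t = 0"
 proof (rule coef_eq_0_imp[of f])
  show "circle_smooth f" unfolding f_def[abs_def] by (intro circle_smooth_intros circle_smooth_phi)
  fix n
  have "coef n f = coef n (\<lambda>t. a t*lam (phi k) t) - l k*coef n (phi k)"
   unfolding f_def by (intro coef_linear circle_smooth_cont circle_smooth_intros circle_smooth_phi)
  also have "coef n (\<lambda>t. a t*lam (phi k) t) = rs.A (rs.U k) n"
   unfolding coef_a_mult matrix_lam[OF circle_smooth_phi] by (simp add: coef_phi rs.A_def)
  finally show "coef n f = 0" by (simp add: coef_phi rs.A_U)
 qed
 hence "\<rho> t*(a t*lam (phi k) t) = \<rho> t*(l k*phi k t)" by (simp add: f_def)
 thus ?thesis using a_rho(2)[of t] by (simp only: mult.assoc[symmetric]) (simp add: mult_ac)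
qed

definition phi_coef :: "(real \<Rightarrow> real) \<Rightarrow> nat \<Rightarrow> real" where "phi_coef f k = mean (\<lambda>t. f t*phi k t*\<rho> t)"

lemma has_sum_phi_coef: "circle_smooth f \<Longrightarrow> ((\<lambda>n. coef n f*rs.U k n) has_sum phi_coef f k) UNIV"
 using Parseval_real[OF _ circle_smooth_phi[of k], of f] by (simp add: coef_phi phi_coef_def)

lemma Parseval_phi:
 assumes f: "circle_smooth f"
 shows "(\<lambda>k. (phi_coef f k)^2) sums mean (\<lambda>t. f t*f t*\<rho> t)"
proof -
 obtain C where C: "\<And>n. \<bar>coef n f\<bar> \<le> C/wt n^2" using coef_rapid[OF f] by blast
 note y = ell2_half_if_decay[of "\<lambda>n. coef n f", OF C]
 have "inner (ell2 (\<lambda>n. coef n f)) (u k) = phi_coef f k" for k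
  using has_sum_phi_coef[OF f, of k] by (simp add: inner_ell2_def y(1) rs.U_def has_sum_iff)
 moreover have "(norm (ell2 (\<lambda>n. coef n f)))^2 = mean (\<lambda>t. f t*f t*\<rho> t)"
  using has_sum_unique[OF has_sum_norm_square[of "ell2 (\<lambda>n. coef n f)"]] Parseval_real[OF f f]
  by (simp add: y(1) power2_eq_square)
 ultimately show ?thesis using rs.Parseval_eigenbasis[OF y(2)] by simp
qed

lemma phi_coef_eq_0_imp:
 assumes f: "circle_smooth f" and zero: "\<And>k. phi_coef f k = 0" shows "f t = 0"
proof (rule coef_eq_0_imp[OF f])
 fix n
 have "mean (\<lambda>t. f t*f t*\<rho> t) = 0" using Parseval_phi[OF f] zero by (simp add: sums_iff)
 hence "((\<lambda>n. coef n f*coef n f) has_sum 0) UNIV" using Parseval_real[OF f f] by simp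
 thus "coef n f = 0" using nonneg_has_sum_le_0D[of "\<lambda>n. coef n f*coef n f" UNIV 0 n] by auto
qed

lemma phi_coef_phi: "phi_coef (phi j) k = (if j = k then 1 else 0)"
 using has_sum_phi_coef[OF circle_smooth_phi[of j], of k] rs.orthonormal[of j k]
 by (simp add: coef_phi inner_ell2_def rs.U_def has_sum_iff)

lemma phi_coef_sum:
 assumes "\<And>i. i < n \<Longrightarrow> circle_smooth (f i)"
 shows "phi_coef (\<lambda>t. \<Sum>i<n. d i*f i t) k = (\<Sum>i<n. d i*phi_coef (f i) k)"
proof -
 have "phi_coef (\<lambda>t. \<Sum>i<n. d i*f i t) k = mean (\<lambda>t. \<Sum>i<n. d i*(f i t*phi k t*\<rho> t))"
  unfolding phi_coef_def by (rule mean_cong) (simp add: sum_distrib_right sum_distrib_left mult_ac)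
 also have "... = (\<Sum>i<n. d i*phi_coef (f i) k)" unfolding phi_coef_def using assms circle_smooth_cont
  by (subst mean_sum) (auto intro!: continuous_intros sum.cong mean_cmult)
 finally show ?thesis .
qed

lemma mean_lam_phi:
 assumes f: "circle_smooth f" shows "mean (\<lambda>t. f t*lam (phi k) t) = l k*phi_coef f k"
proof -
 have "mean (\<lambda>t. f t*lam (phi k) t) = mean (\<lambda>t. l k*(f t*phi k t*\<rho> t))"
  by (rule mean_cong) (simp add: lam_phi mult_ac)
 thus ?thesis unfolding phi_coef_def by (simp add: mean_cmult continuous_intros circle_smooth_cont[OF f])
qed

lemma phi_coef_eigenvector:
 assumes f: "circle_smooth f" "\<And>t. lam f t = x*(\<rho> t*f t)"
 shows "(x - l k)*phi_coef f k = 0"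
proof -
 have "mean (\<lambda>t. lam f t*phi k t) = mean (\<lambda>t. x*(f t*phi k t*\<rho> t))"
  by (rule mean_cong) (simp add: f(2) mult_ac)
 also have "... = x*phi_coef f k" unfolding phi_coef_def by (intro mean_cmult continuous_intros circle_smooth_cont f)
 finally have "x*phi_coef f k = l k*phi_coef f k"
  using lam_sym[OF f(1) circle_smooth_phi[of k]] mean_lam_phi[OF f(1), of k] by linarith
 thus ?thesis by (simp add: left_diff_distrib)
qed

lemma l_nonneg: "l k \<ge> 0" and phi_const_if: "l k = 0 \<Longrightarrow> \<exists>x. \<forall>t. phi k t = x"
proof -
 have "mean (\<lambda>t. lam (phi k) t*phi k t) = l k"
  using mean_lam_phi[OF circle_smooth_phi[of k], of k] by (simp add: phi_coef_phi mult.commute)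
 with lam_nonneg[OF circle_smooth_phi[of k]] show "l k \<ge> 0" "l k = 0 \<Longrightarrow> \<exists>x. \<forall>t. phi k t = x" by auto
qed

lemma l_0: "l 0 = 0" and l_pos: "k \<ge> 1 \<Longrightarrow> l k > 0"
proof -
 have "\<exists>k. l k = 0"
 proof (rule ccontr)
  assume "\<not> (\<exists>k. l k = 0)"
  moreover have "Lam (\<lambda>_. 1) t = 0" for t by (rule fmult_eqI) (auto intro: circle_smooth_const simp: fourier.cf_const)
  hence "lam (\<lambda>_. 1) t = 0*(\<rho> t*1)" for t by (simp add: lam_def)
  ultimately have "phi_coef (\<lambda>_. 1) k = 0" for k
   using phi_coef_eigenvector[OF circle_smooth_const, of 1 0 k] by auto
  from phi_coef_eq_0_imp[OF circle_smooth_const this] show False by simp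
 qed
 then obtain k0 where "l k0 = 0" by blast
 thus l_0: "l 0 = 0" using incseqD[OF rs.incseq_l, of 0 k0] l_nonneg[of 0] by simp
 assume k: "k \<ge> 1"
 show "l k > 0"
 proof (rule ccontr)
  assume "\<not> l k > 0"
  hence "l k = 0" using l_nonneg[of k] by simp
  then obtain x y where xy: "\<And>t. phi k t = x" "\<And>t. phi 0 t = y" using phi_const_if[of k] phi_const_if[OF l_0] by blast
  have "mean (\<lambda>t. x*y*\<rho> t) = x*y" for x y
   using mean_cmult[of \<rho> "x*y"] ph.mean_rho by (simp add: continuous_intros)
  hence "x*y = 0" "x*x = 1" "y*y = 1"
   using phi_coef_phi[of k 0] phi_coef_phi[of k k] phi_coef_phi[of 0 0] k by (auto simp: phi_coef_def xy)
  thus False by (auto simp: mult_eq_0_iff)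
 qed
qed

lemma sqrt_a_pos: "sqrt (a t) > 0" using a_pos by simp

lemma circle_smooth_sqrt_a [circle_smooth_intros]: "circle_smooth (\<lambda>t. sqrt (a t))"
 by (rule circle_smooth_sqrt[OF circle_smooth_a a_pos])

lemma eigfun_iff:
 "eigfun a x w \<longleftrightarrow> circle_smooth w \<and> (\<exists>t. w t \<noteq> 0) \<and>
  (\<forall>t. lam (\<lambda>t. sqrt (a t)*w t) t = x*(\<rho> t*(sqrt (a t)*w t)))"
proof -
 have "(complex_of_real (sqrt (a t))*Lambda (\<lambda>x. sqrt (a x)*w x) t = complex_of_real (x*w t))
  \<longleftrightarrow> lam (\<lambda>t. sqrt (a t)*w t) t = x*(\<rho> t*(sqrt (a t)*w t))" if w: "circle_smooth w" for t
 proof -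
  define q where "q = sqrt (a t)"
  have q: "q > 0" "\<rho> t*(q*w t) = (1/q)*w t"
   using sqrt_a_pos[of t] a_pos[of t] by (auto simp: q_def \<rho>_def real_div_sqrt field_simps)
  have "complex_of_real q*Lambda (\<lambda>x. sqrt (a x)*w x) t = complex_of_real (q*lam (\<lambda>t. sqrt (a t)*w t) t)"
   unfolding Lambda_eq Lam_of_real[OF circle_smooth_mult_real[OF circle_smooth_sqrt_a w]] by (rule of_real_mult[symmetric])
  hence "(complex_of_real q*Lambda (\<lambda>x. sqrt (a x)*w x) t = complex_of_real (x*w t))
   \<longleftrightarrow> q*lam (\<lambda>t. sqrt (a t)*w t) t = x*w t" by (simp only: of_real_eq_iff)
  also have "... \<longleftrightarrow> lam (\<lambda>t. sqrt (a t)*w t) t = x*((1/q)*w t)" using q(1) by (auto simp: field_simps)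
  finally show ?thesis unfolding q(2)[symmetric] by (simp only: q_def)
 qed
 thus ?thesis unfolding eigfun_def smooth_S_iff by auto
qed

lemma eigfun_circle_smooth: "eigfun a x w \<Longrightarrow> circle_smooth (\<lambda>t. sqrt (a t)*w t)"
 unfolding eigfun_iff by (intro circle_smooth_intros) auto

definition eigenfunction :: "nat \<Rightarrow> real \<Rightarrow> real" where "eigenfunction k t = phi k t*(1/sqrt (a t))"

lemma sqrt_eigenfunction: "sqrt (a t)*eigenfunction k t = phi k t"
 using sqrt_a_pos[of t] by (simp add: eigenfunction_def)

lemma eigfun_eigenfunction: "eigfun a (l k) (eigenfunction k)"
proof -
 have "circle_smooth (eigenfunction k)" unfolding eigenfunction_def[abs_def]
  by (intro circle_smooth_intros circle_smooth_phi circle_smooth_inverse sqrt_a_pos)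
 moreover have "\<exists>t. eigenfunction k t \<noteq> 0"
 proof (rule ccontr)
  assume "\<not> (\<exists>t. eigenfunction k t \<noteq> 0)"
  hence "phi k t = 0" for t using sqrt_eigenfunction[of t k] by simp
  thus False using phi_coef_phi[of k k] by (simp add: phi_coef_def)
 qed
 ultimately show ?thesis unfolding eigfun_iff sqrt_eigenfunction using lam_phi by auto
qed

lemma eigfun_phi_coef:
 assumes "eigfun a x w" "l k \<noteq> x" shows "phi_coef (\<lambda>t. sqrt (a t)*w t) k = 0"
 using phi_coef_eigenvector[OF eigfun_circle_smooth[OF assms(1)], of x k] assms unfolding eigfun_iff by auto

lemma finite_multiplicity: "finite {k. l k = x}"
proof -
 obtain N where "x < real N" using reals_Archimedean2 by blast
 hence "{k. l k = x} \<subseteq> rs.low N" by (auto simp: rs.low_def)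
 thus ?thesis using rs.finite_low finite_subset by blast
qed

lemma lin_indep_eigenfunctions:
 assumes h: "inj_on h {..<n}" shows "lin_indep_fun n (\<lambda>i. eigenfunction (h i))"
 unfolding lin_indep_fun_def
proof (intro allI impI)
 fix d :: "nat \<Rightarrow> real" and j
 assume d: "\<forall>t. (\<Sum>i<n. d i*eigenfunction (h i) t) = 0" and j: "j < n"
 have "(\<Sum>i<n. d i*phi (h i) t) = sqrt (a t)*(\<Sum>i<n. d i*eigenfunction (h i) t)" for t
  unfolding sum_distrib_left by (intro sum.cong) (auto simp: sqrt_eigenfunction[symmetric] mult_ac)
 hence "0 = phi_coef (\<lambda>t. \<Sum>i<n. d i*phi (h i) t) (h j)" using d by (simp add: phi_coef_def)
 also have "... = (\<Sum>i<n. if i = j then d i else 0)"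
  unfolding phi_coef_sum[OF circle_smooth_phi] using h j by (intro sum.cong) (auto simp: phi_coef_phi inj_on_def)
 also have "... = d j" using j by simp
 finally show "d j = 0" by simp
qed

lemma multiplicity_bound:
 assumes w: "\<And>i. i < n \<Longrightarrow> eigfun a x (w i)" and indep: "lin_indep_fun n w"
 shows "n \<le> card {k. l k = x}"
proof (rule ccontr)
 let ?K = "{k. l k = x}"
 define f where "f i t = sqrt (a t)*w i t" for i t
 have f: "circle_smooth (f i)" if "i < n" for i using eigfun_circle_smooth[OF w[OF that]] by (simp add: f_def[abs_def])
 assume "\<not> n \<le> card ?K"
 then obtain d where d: "\<exists>i<n. d i \<noteq> 0" "\<forall>k\<in>?K. (\<Sum>i<n. d i*phi_coef (f i) k) = 0"
  using nontrivial_relation_exists[OF finite_multiplicity[of x], of "{..<n}" "\<lambda>i. phi_coef (f i)"] by auto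
 have "(\<Sum>i<n. d i*f i t) = 0" for t
 proof (rule phi_coef_eq_0_imp[of "\<lambda>t. \<Sum>i<n. d i*f i t"])
  show "circle_smooth (\<lambda>t. \<Sum>i<n. d i*f i t)" using f by (auto intro!: circle_smooth_intros)
  show "phi_coef (\<lambda>t. \<Sum>i<n. d i*f i t) k = 0" for k
  proof -
   have "(\<Sum>i<n. d i*phi_coef (f i) k) = 0"
    using d(2) eigfun_phi_coef[OF w, of _ k] by (cases "k \<in> ?K") (auto simp: f_def[abs_def] intro!: sum.neutral)
   thus ?thesis using phi_coef_sum[of n f d k] f by simp
  qed
 qed
 moreover have "(\<Sum>i<n. d i*f i t) = sqrt (a t)*(\<Sum>i<n. d i*w i t)" for t
  unfolding f_def sum_distrib_left by (intro sum.cong) auto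
 ultimately have "(\<Sum>i<n. d i*w i t) = 0" for t using sqrt_a_pos[of t] by (metis less_irrefl mult_eq_0_iff)
 hence "\<forall>i<n. d i = 0" using indep unfolding lin_indep_fun_def by blast
 thus False using d(1) by auto
qed

lemma eig_mult_eq: "eig_mult a x = card {k. l k = x}"
 unfolding eig_mult_def
proof (rule Greatest_equality)
 obtain h where h: "bij_betw h {0..<card {k. l k = x}} {k. l k = x}"
  using ex_bij_betw_nat_finite[OF finite_multiplicity] by blast
 have "eigfun a x (eigenfunction (h i))" if "i < card {k. l k = x}" for i
  using eigfun_eigenfunction[of "h i"] h that by (auto simp: bij_betw_def)
 moreover have "lin_indep_fun (card {k. l k = x}) (\<lambda>i. eigenfunction (h i))"
  using h by (intro lin_indep_eigenfunctions) (simp add: bij_betw_def lessThan_atLeast0)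
 ultimately show "\<exists>w. (\<forall>i<card {k. l k = x}. eigfun a x (w i)) \<and> lin_indep_fun (card {k. l k = x}) w"
  by (intro exI[of _ "\<lambda>i. eigenfunction (h i)"] conjI allI impI)
qed (use multiplicity_bound in blast)

lemma is_eig_iff: "is_eig a x \<longleftrightarrow> (\<exists>k. l k = x)"
proof
 assume "is_eig a x"
 then obtain w where w: "eigfun a x w" by (auto simp: is_eig_def)
 show "\<exists>k. l k = x"
 proof (rule ccontr)
  assume "\<not> (\<exists>k. l k = x)"
  hence "phi_coef (\<lambda>t. sqrt (a t)*w t) k = 0" for k using eigfun_phi_coef[OF w] by blast
  hence "sqrt (a t)*w t = 0" for t by (rule phi_coef_eq_0_imp[OF eigfun_circle_smooth[OF w]])
  hence "w t = 0" for t using sqrt_a_pos[of t] by (metis less_irrefl mult_eq_0_iff)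
  thus False using w unfolding eigfun_iff by blast
 qed
qed (use eigfun_eigenfunction in \<open>auto simp: is_eig_def\<close>)

sublocale ni: nearly_integral "\<lambda>k. l (Suc k)"
proof
 show "0 < l (Suc k)" for k by (rule l_pos) simp
 fix j
 obtain C where C: "\<And>k. \<bar>l k - rs.\<mu> k\<bar>*real (Suc k)^j \<le> C" using rs.l_near_mu by blast
 have "\<bar>l (Suc k) - real ((k + 2) div 2)\<bar>*real (Suc k)^j \<le> C" for k
 proof -
  have "\<bar>l (Suc k) - real ((k + 2) div 2)\<bar>*real (Suc k)^j \<le> \<bar>l (Suc k) - real ((k + 2) div 2)\<bar>*real (Suc (Suc k))^j"
   by (intro mult_left_mono power_mono) auto
  also have "... \<le> C" using C[of "Suc k"] by (simp add: rs.\<mu>_def)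
  finally show ?thesis .
 qed
 thus "\<exists>C. \<forall>k. \<bar>l (Suc k) - real ((k + 2) div 2)\<bar>*real (Suc k)^j \<le> C" by blast
qed

lemma zeta_series_eq:
 assumes z: "Re z > 1"
 shows "zeta_series a z = (\<Sum>\<^sub>\<infinity>k. of_real (l (Suc k)) powr (- z))"
proof -
 define S where "S = {x. x > 0 \<and> is_eig a x}"
 define Z where "Z = (\<Sum>\<^sub>\<infinity>k. complex_of_real (l (Suc k)) powr (- z))"
 define f where "f x = complex_of_real x powr (- z)" for x
 have "((\<lambda>k. f (l (Suc k))) has_sum Z) UNIV"
  using ni.has_sum_L_powr[OF z] unfolding Z_def f_def by (auto simp: has_sum_iff)
 hence "((\<lambda>k. f (l k)) has_sum Z) (range Suc)" by (subst has_sum_reindex) (auto simp: o_def)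
 also have "range Suc = {k. l k > 0}"
 proof -
  have "k \<in> range Suc \<longleftrightarrow> l k > 0" for k using l_pos[of k] l_0 by (cases k) auto
  thus ?thesis by auto
 qed
 finally have positive: "((\<lambda>k. f (l k)) has_sum Z) {k. l k > 0}" .
 have bij: "bij_betw snd (Sigma S (\<lambda>x. {k. l k = x})) {k. l k > 0}"
  by (rule bij_betwI[of _ _ _ "\<lambda>k. (l k, k)"]) (auto simp: S_def is_eig_iff)
 have "((\<lambda>p. f (l (snd p))) has_sum Z) (Sigma S (\<lambda>x. {k. l k = x}))"
  using positive has_sum_reindex_bij_betw[OF bij, of "\<lambda>k. f (l k)"] by blast
 hence "((\<lambda>x. of_nat (eig_mult a x)*f x) has_sum Z) S"
 proof (rule has_sum_SigmaD)
  fix x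
  have "((\<lambda>k. f (l (snd (x, k)))) has_sum (\<Sum>k\<in>{k. l k = x}. f x)) {k. l k = x}"
   by (rule has_sum_finiteI) (auto simp: finite_multiplicity)
  thus "((\<lambda>k. f (l (snd (x, k)))) has_sum of_nat (eig_mult a x)*f x) {k. l k = x}" by (simp add: eig_mult_eq)
 qed
 thus ?thesis unfolding zeta_series_def S_def f_def Z_def by (simp add: has_sum_iff)
qed

lemma norm_column_eq: "(norm (rs.column n))^2 = mean (\<lambda>t. a t*(lam (cas n) t)^2)"
proof -
 let ?f = "\<lambda>t. a t*lam (cas n) t"
 have f: "circle_smooth ?f" by (intro circle_smooth_intros)
 have "coef m ?f = coord (rs.column n) m" for m
  unfolding coef_a_mult mean_cas_lam_cas rs.coord_column R_sym[of m n] by simp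
 hence "(norm (rs.column n))^2 = mean (\<lambda>t. ?f t*?f t*\<rho> t)"
  using has_sum_unique[OF has_sum_norm_square[of "rs.column n"]] Parseval_real[OF f f] by (simp add: power2_eq_square)
 also have "... = mean (\<lambda>t. a t*(lam (cas n) t)^2)"
 proof (rule mean_cong)
  show "?f t*?f t*\<rho> t = a t*(lam (cas n) t)^2" for t
   using a_rho(3)[of t "a t*(lam (cas n) t)^2"] by (simp only: power2_eq_square mult_ac)
 qed
 finally show ?thesis .
qed

lemma zeta_ge_trace:
 "real (Suc p)*(\<Sum>\<^sub>\<infinity>n. (of_int n)^(2*p)*rs.excess n) \<le> Re (zeta a (- of_nat (2*Suc p)))"
proof -
 define S where "S = (\<Sum>k. l (Suc k)^(2*Suc p) - ni.M k^(2*Suc p))"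
 have zeta: "zeta a (- of_nat (2*Suc p)) = of_real S"
  unfolding S_def by (rule ni.zeta_neg_even[OF zeta_series_eq]) auto
 have "(\<lambda>k. l (Suc k)^(2*Suc p) - ni.M k^(2*Suc p)) sums S"
  unfolding S_def by (rule summable_sums[OF ni.diff_series_neg_even(2)])
 moreover have "ni.M k = rs.\<mu> (Suc k)" for k by (simp add: ni.M_def rs.\<mu>_def)
 moreover have "l 0^(2*Suc p) - rs.\<mu> 0^(2*Suc p) = 0" by (simp add: l_0 rs.\<mu>_def)
 ultimately have "(\<lambda>k. l k^(2*Suc p) - rs.\<mu> k^(2*Suc p)) sums S"
  using sums_Suc_iff[of "\<lambda>k. l k^(2*Suc p) - rs.\<mu> k^(2*Suc p)" S] by simp
 from rs.trace_lower_bound[OF this] show ?thesis by (simp only: zeta Re_complex_of_real)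
qed

end

context speed
begin

lemma U_summable: "(\<lambda>k. norm (U n k)*wt k^L) summable_on UNIV"
 unfolding U_def by (rule fourier.cf_summable[OF ph.circle_smooth_e])

lemma cf_remainder:
 assumes n: "n \<ge> 0" shows "fourier.cf (remainder n) k = of_int (\<bar>k\<bar> - k)*U n k"
proof (rule fourier.cf_series[OF _ has_sum_remainder[OF n]])
 show "(\<lambda>k. norm (of_int (\<bar>k\<bar> - k)*U n k)) summable_on UNIV"
 proof (rule summable_on_comparison_test[OF summable_on_cmult_right[OF U_summable[of n 1], of 2]])
  fix k
  have "\<bar>real_of_int (\<bar>k\<bar> - k)\<bar>*norm (U n k) \<le> 2*wt k*norm (U n k)"
   by (intro mult_right_mono) (auto simp: wt_def)
  thus "norm (of_int (\<bar>k\<bar> - k)*U n k) \<le> 2*(norm (U n k)*wt k^1)"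
   by (simp only: norm_mult norm_of_int power_one_right mult_ac)
 qed auto
qed

definition W :: "int \<Rightarrow> real" where "W n = mean (\<lambda>t. Re (remainder n t*cnj (ph.e n t)))"

definition Q :: "int \<Rightarrow> real" where "Q n = mean (\<lambda>t. a t*(norm (remainder n t))^2)"

lemma has_sum_W:
 assumes n: "n \<ge> 0" shows "((\<lambda>k. of_int (\<bar>k\<bar> - k)*(norm (U n k))^2) has_sum W n) UNIV"
proof -
 have "fourier.cf (remainder n) k*cnj (U n k) = of_real (of_int (\<bar>k\<bar> - k)*(norm (U n k))^2)" for k
  unfolding cf_remainder[OF n] by (simp only: of_real_mult complex_norm_square of_real_of_int_eq mult.assoc)
 hence "((\<lambda>k. complex_of_real (of_int (\<bar>k\<bar> - k)*(norm (U n k))^2)) has_sum mean (\<lambda>t. remainder n t*cnj (ph.e n t))) UNIV"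
  using Parseval_fourier[OF circle_smooth_remainder circle_smooth_cont circle_smoothD(2), OF ph.circle_smooth_e ph.circle_smooth_e, of n n]
  by (simp only: U_def)
 from has_sum_Re[OF this] have "((\<lambda>k. of_int (\<bar>k\<bar> - k)*(norm (U n k))^2) has_sum Re (mean (\<lambda>t. remainder n t*cnj (ph.e n t)))) UNIV"
  by (simp only: Re_complex_of_real)
 also have "Re (mean (\<lambda>t. remainder n t*cnj (ph.e n t))) = W n"
  unfolding W_def by (rule mean_bounded_linear[OF bounded_linear_Re, symmetric]) (intro continuous_intros)
 finally show ?thesis .
qed

lemma W_nonneg: "n \<ge> 0 \<Longrightarrow> W n \<ge> 0" by (rule has_sum_nonneg[OF has_sum_W]) auto

lemma Q_nonneg: "Q n \<ge> 0"
 unfolding Q_def by (rule mean_nonneg) (auto intro!: continuous_intros simp: less_imp_le a_pos)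

lemma lam_cas_square_sum:
 assumes n: "n \<ge> 0"
 shows "a t*(lam (cas n) t)^2 + a t*(lam (cas (- n)) t)^2
  = 2 * (a t * (norm (remainder n t))^2) + 4 * of_int n * Re (remainder n t * cnj (ph.e n t)) + 2 * (of_int n)^2 * \<rho> t"
proof -
 have square: "(norm (x + of_real y*z))^2 = (norm x)^2 + 2*y*Re (x*cnj z) + y^2*(norm z)^2" for x z :: complex and y :: real
  by (simp only: cmod_power2) (simp add: power2_eq_square algebra_simps)
 have Lam: "Lam (ph.e n) t = remainder n t + of_real (of_int n*\<rho> t)*ph.e n t" using n by (simp add: remainder_def)
 have "Lam (ph.e (- n)) t = cnj (Lam (ph.e n) t)"
  using fmult_cnj[OF ph.circle_smooth_e[of n] linear_growth_symbols(1), of t] by simp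
 hence "(lam (cas n) t)^2 + (lam (cas (- n)) t)^2 = 2*(norm (Lam (ph.e n) t))^2"
  unfolding lam_cas cmod_power2 by (simp add: power2_eq_square algebra_simps)
 also have "(norm (Lam (ph.e n) t))^2
   = (norm (remainder n t))^2 + 2*(of_int n*\<rho> t)*Re (remainder n t*cnj (ph.e n t)) + (of_int n*\<rho> t)^2"
  unfolding Lam square[of _ _ "ph.e n t"] by simp
 finally have "a t*((lam (cas n) t)^2 + (lam (cas (- n)) t)^2) = 2*(a t*(norm (remainder n t))^2)
   + 4 * of_int n * (a t * Re (remainder n t * cnj (ph.e n t)) * \<rho> t) + 2 * (of_int n)^2 * (a t * \<rho> t * \<rho> t)"
  by (simp only: power2_eq_square algebra_simps)
 thus ?thesis by (simp only: a_rho distrib_left)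
qed

lemma mean_lam_cas_square_sum:
 assumes n: "n \<ge> 0"
 shows "mean (\<lambda>t. a t*(lam (cas n) t)^2) + mean (\<lambda>t. a t*(lam (cas (- n)) t)^2)
  = 2 * (of_int n)^2 + 2 * (Q n + 2 * of_int n * W n)"
proof -
 have lam_cont: "continuous_on UNIV (lam (cas n))" for n by (intro circle_smooth_cont circle_smooth_intros)
 have "mean (\<lambda>t. a t*(lam (cas n) t)^2) + mean (\<lambda>t. a t*(lam (cas (- n)) t)^2)
   = mean (\<lambda>t. 2 * (a t * (norm (remainder n t))^2) + 4 * of_int n * Re (remainder n t * cnj (ph.e n t)) + 2 * (of_int n)^2 * \<rho> t)"
  unfolding lam_cas_square_sum[OF n, symmetric] by (rule mean_add[symmetric]) (intro continuous_intros lam_cont)+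
 also have "... = 2 * Q n + 4 * of_int n * W n + 2 * (of_int n)^2 * mean \<rho>" unfolding Q_def W_def
  by (subst mean_add; (intro continuous_intros)?; subst mean_add; (intro continuous_intros)?;
   (subst mean_cmult; (intro continuous_intros)?)+; rule refl)
 finally show ?thesis using ph.mean_rho by simp
qed

theorem zeta_lower_finite:
 assumes A: "finite A" "\<And>n. n \<in> A \<Longrightarrow> n \<ge> 1"
 shows "2 * real (Suc p) * (\<Sum>n\<in>A. (of_int n)^(2 * p) * (Q n + 2 * of_int n * W n)) \<le> Re (zeta a (- of_nat (2 * Suc p)))"
proof -
 interpret rp: rapid_perturbation R using R_sym rapid_R by unfold_locales
 obtain u l where ul: "eigenbasis ell2_half rp.q u l" using rp.q_eigenbasis by blast
 interpret speed_spectrum a u l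
  by (intro speed_spectrum.intro rapid_spectrum.intro speed_axioms rp.rapid_perturbation_axioms ul)
 define f where "f n = (of_int n)^(2*p)*rs.excess n" for n
 have f: "(f has_sum infsum f UNIV) UNIV" unfolding f_def[abs_def] by (rule has_sum_infsum[OF rs.excess_summable])
 have pair: "f n + f (- n) = 2 * ((of_int n)^(2 * p) * (Q n + 2 * of_int n * W n))" if "n \<ge> 0" for n
 proof -
  have "f n + f (- n) = (of_int n)^(2*p)*(rs.excess n + rs.excess (- n))"
   by (simp add: f_def power_minus_even distrib_left)
  also have "rs.excess n + rs.excess (- n) = 2 * (Q n + 2 * of_int n * W n)"
   using mean_lam_cas_square_sum[OF that] by (simp add: rs.excess_def norm_column_eq)
  finally show ?thesis by simp
 qed
 have pair_nonneg: "f n + f (- n) \<ge> 0" for n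
 proof -
  have "f n + f (- n) = f \<bar>n\<bar> + f (- \<bar>n\<bar>)" by (cases "n \<ge> 0") auto
  thus ?thesis using pair[of "\<bar>n\<bar>"] Q_nonneg[of "\<bar>n\<bar>"] W_nonneg[of "\<bar>n\<bar>"]
   by (simp del: of_int_abs add: zero_le_mult_iff add_nonneg_nonneg mult_nonneg_nonneg)
 qed
 have "(\<Sum>n\<in>A. f n + f (- n)) + (\<Sum>n\<in>uminus ` A. f n + f (- n)) = (\<Sum>n\<in>A \<union> uminus ` A. f n + f (- n))"
 proof (rule sum.union_disjoint[symmetric])
  have False if "x \<in> A" "- x \<in> A" for x using A(2)[OF that(1)] A(2)[OF that(2)] by simp
  thus "A \<inter> uminus ` A = {}" by auto
 qed (use A in auto)
 also have "... \<le> infsum f UNIV + infsum f UNIV"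
  by (rule finite_sum_le_has_sum[OF has_sum_add[OF f has_sum_uminus_int[THEN iffD2, OF f]]]) (use A pair_nonneg in auto)
 also have "(\<Sum>n\<in>uminus ` A. f n + f (- n)) = (\<Sum>n\<in>A. f n + f (- n))" by (subst sum.reindex) (auto simp: add.commute)
 finally have "(\<Sum>n\<in>A. f n + f (- n)) \<le> infsum f UNIV" by linarith
 moreover define S where "S = (\<Sum>n\<in>A. (of_int n)^(2 * p) * (Q n + 2 * of_int n * W n))"
 have "(\<Sum>n\<in>A. f n + f (- n)) = 2*S"
  unfolding S_def sum_distrib_left by (intro sum.cong refl pair) (use A in force)
 ultimately have "real (Suc p)*(2*S) \<le> real (Suc p)*infsum f UNIV" by (intro mult_left_mono) auto
 also have "... \<le> Re (zeta a (- of_nat (2*Suc p)))" unfolding f_def[abs_def] by (rule zeta_ge_trace)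
 finally show ?thesis unfolding S_def[symmetric] by (simp only: mult.assoc mult.left_commute)
qed

end

section \<open>Mean squares of derivatives\<close>

definition mean_sq :: "(real \<Rightarrow> complex) \<Rightarrow> real" where "mean_sq f = mean (\<lambda>t. (norm (f t))^2)"

lemma mean_sq_nonneg: "continuous_on UNIV f \<Longrightarrow> mean_sq f \<ge> 0"
 unfolding mean_sq_def by (rule mean_nonneg) (auto intro!: continuous_intros)

lemma norm_add_square_le: "(norm (x + y))^2 \<le> 2*(norm x)^2 + 2*(norm y)^2"
proof -
 have "(norm (x + y))^2 \<le> (norm x + norm y)^2" by (intro power_mono norm_triangle_ineq) auto
 also have "... \<le> 2*(norm x)^2 + 2*(norm y)^2"
  using sum_squares_bound[of "norm x" "norm y"] by (simp add: power2_eq_square algebra_simps)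
 finally show ?thesis .
qed

lemma mean_sq_add:
 assumes "continuous_on UNIV f" "continuous_on UNIV g"
 shows "mean_sq (\<lambda>t. f t + g t) \<le> 2*mean_sq f + 2*mean_sq g"
proof -
 have "mean_sq (\<lambda>t. f t + g t) \<le> mean (\<lambda>t. 2*(norm (f t))^2 + 2*(norm (g t))^2)"
  unfolding mean_sq_def by (rule mean_mono) (intro continuous_intros assms norm_add_square_le)+
 also have "... = 2*mean_sq f + 2*mean_sq g" unfolding mean_sq_def
  by (subst mean_add; (intro continuous_intros assms)?; (subst mean_cmult; (intro continuous_intros assms)?)+; rule refl)
 finally show ?thesis .
qed

lemma mean_sq_vders_mult:
 assumes "smooth f" "smooth g" "vders_le p B f"
 shows "mean_sq ((vder ^^ p) (\<lambda>t. f t*g t)) \<le> 4^p*B^2*(\<Sum>i\<le>p. mean_sq ((vder ^^ i) g))"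
 using assms
proof (induction p arbitrary: f g)
 case 0
 have cont: "continuous_on UNIV f" "continuous_on UNIV g" using 0 smooth_cont by auto
 have "mean_sq (\<lambda>t. f t*g t) \<le> mean (\<lambda>t. B^2*(norm (g t))^2)" unfolding mean_sq_def
 proof (rule mean_mono)
  fix t
  have "norm (f t) \<le> B" using 0(3) by (simp add: vders_le_def)
  hence "(norm (f t))^2 \<le> B^2" by (intro power_mono) auto
  thus "(norm (f t*g t))^2 \<le> B^2*(norm (g t))^2" by (simp add: norm_mult power_mult_distrib mult_right_mono)
 qed (intro continuous_intros cont)+
 also have "... = B^2*mean_sq g" unfolding mean_sq_def by (rule mean_cmult) (intro continuous_intros cont)
 finally show ?case by simp
next
 case (Suc p)
 let ?S = "\<Sum>i\<le>Suc p. mean_sq ((vder ^^ i) g)"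
 have nonneg: "mean_sq ((vder ^^ i) g) \<ge> 0" for i
  using smooth_vders[OF Suc.prems(2)] smooth_cont by (blast intro: mean_sq_nonneg)
 have "mean_sq ((vder ^^ p) (\<lambda>t. f t * vder g t)) \<le> 4^p * B^2 * (\<Sum>i\<le>p. mean_sq ((vder ^^ i) (vder g)))"
  by (rule Suc.IH) (use Suc.prems in \<open>auto intro: smooth_vder vders_le_mono\<close>)
 also have "(\<Sum>i\<le>p. mean_sq ((vder ^^ i) (vder g))) \<le> ?S"
 proof -
  have "(\<Sum>i\<le>p. mean_sq ((vder ^^ i) (vder g))) = (\<Sum>i\<in>Suc ` {..p}. mean_sq ((vder ^^ i) g))"
   unfolding vders_Suc[symmetric] by (subst sum.reindex) auto
  also have "... \<le> ?S" by (rule sum_mono2) (auto simp: nonneg)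
  finally show ?thesis .
 qed
 finally have left_le: "mean_sq ((vder ^^ p) (\<lambda>t. f t * vder g t)) \<le> 4^p * B^2 * ?S"
  by (simp add: mult_left_mono)
 have "mean_sq ((vder ^^ p) (\<lambda>t. vder f t*g t)) \<le> 4^p*B^2*(\<Sum>i\<le>p. mean_sq ((vder ^^ i) g))"
  by (rule Suc.IH) (use Suc.prems in \<open>auto intro: smooth_vder vders_le_vder\<close>)
 also have "... \<le> 4^p*B^2*?S" by (intro mult_left_mono sum_mono2) (auto simp: nonneg)
 finally have right_le: "mean_sq ((vder ^^ p) (\<lambda>t. vder f t*g t)) \<le> 4^p*B^2*?S" .
 have "mean_sq ((vder ^^ Suc p) (\<lambda>t. f t*g t))
   \<le> 2 * mean_sq ((vder ^^ p) (\<lambda>t. f t * vder g t)) + 2 * mean_sq ((vder ^^ p) (\<lambda>t. vder f t * g t))"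
  unfolding vders_mult_Suc[OF Suc.prems(1,2)]
  by (rule mean_sq_add) (intro smooth_cont smooth_vders smooth_mult_complex smooth_vder Suc.prems)+
 also have "... \<le> 4^Suc p*B^2*?S" using left_le right_le by simp
 finally show ?case .
qed

lemma Bessel_vders:
 assumes F: "circle_smooth F" and J: "finite J"
 shows "(\<Sum>j\<in>J. of_int \<bar>j\<bar>^(2*p)*(norm (fourier.cf F j))^2) \<le> mean_sq ((vder ^^ p) F)"
 using fourier.Bessel[OF circle_smooth_cont[OF circle_smooth_vders[OF F, of p]] J]
 by (simp add: vders_cf F norm_mult norm_power power_mult_distrib mean_sq_def mult.commute flip: power_mult)

primrec sobolev_const :: "real \<Rightarrow> real \<Rightarrow> nat \<Rightarrow> real" where
 "sobolev_const B0 B 0 = B0"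
| "sobolev_const B0 B (Suc p) = (1 + 4^p * B^2 * real (Suc p)) * sobolev_const B0 B p"

lemma sobolev_const_nonneg: "B0 \<ge> 0 \<Longrightarrow> sobolev_const B0 B p \<ge> 0"
 by (induction p) auto

context phase
begin

definition trig_sum :: "int set \<Rightarrow> (int \<Rightarrow> complex) \<Rightarrow> real \<Rightarrow> complex" where
 "trig_sum A h t = (\<Sum>n\<in>A. h n*e n t)"

lemma circle_smooth_trig_sum: "circle_smooth (trig_sum A h)"
 unfolding trig_sum_def[abs_def] by (intro circle_smooth_intros circle_smooth_e)

lemma vder_trig_sum: "finite A \<Longrightarrow> vder (trig_sum A h) = (\<lambda>t. of_real (\<rho> t) * trig_sum A (\<lambda>n. \<i> * of_int n * h n) t)"
 unfolding trig_sum_def[abs_def]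
 by (subst smooth_sum(2)) (auto intro!: circle_smoothD(1) circle_smooth_intros circle_smooth_e
  simp: sum_distrib_left smooth_cmult(2)[OF circle_smoothD(1)[OF circle_smooth_e]] vder_e mult_ac)

end

context speed
begin

lemma mean_sq_trig_sum:
 assumes B0: "\<And>t. a t \<le> B0" and A: "finite A"
 shows "mean_sq (ph.trig_sum A h) \<le> B0*(\<Sum>n\<in>A. (norm (h n))^2)"
proof -
 have cont: "continuous_on UNIV (ph.trig_sum A h)" by (rule circle_smooth_cont[OF ph.circle_smooth_trig_sum])
 have "mean_sq (ph.trig_sum A h) \<le> mean (\<lambda>t. B0*((norm (ph.trig_sum A h t))^2*\<rho> t))" unfolding mean_sq_def
 proof (rule mean_mono)
  fix t
  have "1 \<le> B0*\<rho> t" using mult_right_mono[OF B0[of t], of "\<rho> t"] ph.rho_pos[of t] a_rho(1)[of t] by simp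
  thus "(norm (ph.trig_sum A h t))^2 \<le> B0*((norm (ph.trig_sum A h t))^2*\<rho> t)"
   using mult_left_mono[of 1 "B0*\<rho> t" "(norm (ph.trig_sum A h t))^2"] by (simp add: mult_ac)
 qed (intro continuous_intros cont)+
 also have "... = B0*mean (\<lambda>t. (norm (ph.trig_sum A h t))^2*\<rho> t)" by (intro mean_cmult continuous_intros cont)
 finally show ?thesis using ph.Parseval_trig_sum[OF A] by (simp add: ph.trig_sum_def)
qed

lemma sum_norm_derivative_coeffs_le:
 assumes A: "\<And>n. n \<in> A \<Longrightarrow> n \<ge> 1" and j: "j < i"
 shows "(\<Sum>n\<in>A. (of_int n)^(2 * j) * (norm (\<i> * of_int n * h n))^2) \<le> (\<Sum>n\<in>A. (of_int n)^(2 * i) * (norm (h n))^2)"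
proof (rule sum_mono)
 fix n assume "n \<in> A"
 hence n: "(of_int n :: real) \<ge> 1" using A[of n] by simp
 have "(of_int n)^(2 * j) * (norm (\<i> * of_int n * h n))^2 = (of_int n)^(2 * j + 2) * (norm (h n))^2"
  by (simp add: norm_mult power_mult_distrib power2_eq_square)
 also have "... \<le> (of_int n)^(2*i)*(norm (h n))^2" using n j by (intro mult_right_mono power_increasing) auto
 finally show "(of_int n)^(2 * j) * (norm (\<i> * of_int n * h n))^2 \<le> (of_int n)^(2 * i) * (norm (h n))^2" .
qed

lemma mean_sq_vders_trig_sum:
 assumes B0: "\<And>t. a t \<le> B0" and B: "\<And>j. j < p \<Longrightarrow> vders_le j B (\<lambda>t. complex_of_real (\<rho> t))"
  and A: "finite A" "\<And>n. n \<in> A \<Longrightarrow> n \<ge> 1" and i: "i \<le> p"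
 shows "mean_sq ((vder ^^ i) (ph.trig_sum A h)) \<le> sobolev_const B0 B p*(\<Sum>n\<in>A. (of_int n)^(2*i)*(norm (h n))^2)"
 using B i
proof (induction p arbitrary: i h)
 case 0
 thus ?case using mean_sq_trig_sum[OF B0 A(1), of h] by simp
next
 case (Suc p)
 have const: "sobolev_const B0 B p \<ge> 0" using B0[of 0] a_pos[of 0] by (intro sobolev_const_nonneg) linarith
 define S where "S = (\<Sum>n\<in>A. (of_int n)^(2*i)*(norm (h n))^2)"
 have S: "S \<ge> 0" unfolding S_def by (intro sum_nonneg mult_nonneg_nonneg) (auto simp: zero_le_even_power)
 show ?case
 proof (cases "i \<le> p")
  case True
  have "mean_sq ((vder ^^ i) (ph.trig_sum A h)) \<le> sobolev_const B0 B p*S"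
   unfolding S_def by (rule Suc.IH) (use Suc.prems True in auto)
  also have "... \<le> sobolev_const B0 B (Suc p)*S"
   using mult_right_mono[of 1 "1 + 4^p*B^2*real (Suc p)" "sobolev_const B0 B p"] const S
   by (intro mult_right_mono) auto
  finally show ?thesis by (simp add: S_def)
 next
  case False
  hence i: "i = Suc p" using Suc.prems by simp
  define \<psi> where "\<psi> = ph.trig_sum A (\<lambda>n. \<i> * of_int n * h n)"
  have "(vder ^^ i) (ph.trig_sum A h) = (vder ^^ p) (\<lambda>t. of_real (\<rho> t)*\<psi> t)"
   unfolding i vders_Suc ph.vder_trig_sum[OF A(1)] \<psi>_def ..
  hence "mean_sq ((vder ^^ i) (ph.trig_sum A h)) \<le> 4^p*B^2*(\<Sum>j\<le>p. mean_sq ((vder ^^ j) \<psi>))"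
   using mean_sq_vders_mult[OF circle_smoothD(1) circle_smoothD(1), OF circle_smooth_of_real ph.circle_smooth_trig_sum,
    OF ph.circle_smooth_rho, of p B] Suc.prems(1) by (simp add: \<psi>_def)
  also have "(\<Sum>j\<le>p. mean_sq ((vder ^^ j) \<psi>)) \<le> (\<Sum>j\<le>p. sobolev_const B0 B p*S)"
  proof (rule sum_mono)
   fix j assume j: "j \<in> {..p}"
   have "mean_sq ((vder ^^ j) \<psi>) \<le> sobolev_const B0 B p * (\<Sum>n\<in>A. (of_int n)^(2 * j) * (norm (\<i> * of_int n * h n))^2)"
    unfolding \<psi>_def by (rule Suc.IH) (use Suc.prems j in auto)
   also have "... \<le> sobolev_const B0 B p*S"
    unfolding S_def using j i by (intro mult_left_mono sum_norm_derivative_coeffs_le A const) auto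
   finally show "mean_sq ((vder ^^ j) \<psi>) \<le> sobolev_const B0 B p*S" .
  qed
  also have "... = real (Suc p)*(sobolev_const B0 B p*S)" by simp
  finally have "mean_sq ((vder ^^ i) (ph.trig_sum A h)) \<le> 4^p*B^2*(real (Suc p)*(sobolev_const B0 B p*S))"
   by (simp add: mult_left_mono)
  also have "... \<le> sobolev_const B0 B (Suc p)*S" using const S by (simp add: algebra_simps)
  finally show ?thesis by (simp add: S_def)
 qed
qed

end

section \<open>A lower bound for the speed\<close>

definition sobolev :: "(real \<Rightarrow> real) \<Rightarrow> nat \<Rightarrow> real" where
 "sobolev a N = (\<Sum>\<^sub>\<infinity>k. of_int \<bar>k\<bar>^(2*N + 3)*(norm (fcoeff a k))^2)"

lemma sobolev_summable:
 assumes a: "circle_smooth a"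
 shows "(\<lambda>k. of_int \<bar>k\<bar>^L*(norm (fcoeff a k))^2) summable_on UNIV"
proof -
 obtain C where C: "\<And>k. norm (fcoeff a k)*wt k^0 \<le> C"
  using fourier.cf_decay[OF circle_smooth_of_real[OF a]] unfolding fcoeff_eq by blast
 have s: "(\<lambda>k. C*(of_int \<bar>k\<bar>^L*norm (fcoeff a k))) summable_on UNIV"
  using vders_sup(1)[OF circle_smooth_of_real[OF a], of L] unfolding fcoeff_eq by (rule summable_on_cmult_right)
 show ?thesis
 proof (rule summable_on_comparison_test[OF s])
  fix k
  have "of_int \<bar>k\<bar>^L*(norm (fcoeff a k)*norm (fcoeff a k)) \<le> of_int \<bar>k\<bar>^L*(C*norm (fcoeff a k))"
   using C[of k] by (intro mult_left_mono mult_right_mono) auto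
  thus "of_int \<bar>k\<bar>^L*(norm (fcoeff a k))^2 \<le> C*(of_int \<bar>k\<bar>^L*norm (fcoeff a k))"
   by (simp add: power2_eq_square mult_ac)
 qed auto
qed

lemma fcoeff_minus: "continuous_on UNIV a \<Longrightarrow> fcoeff a (- k) = cnj (fcoeff a k)"
 unfolding fcoeff_eq using fourier.cf_cnj[of "\<lambda>t. of_real (a t)" "- k"] by (auto intro!: continuous_intros)

lemma sum_inverse_square:
 assumes "K \<ge> 1" shows "(\<Sum>k\<in>{int K<..int K + int n}. 1/(of_int k)^2) \<le> 1/real K - 1/real (K + n)"
proof (induction n)
 case (Suc n)
 have "{int K<..int K + int (Suc n)} = insert (int (K + Suc n)) {int K<..int K + int n}" by auto
 hence "(\<Sum>k\<in>{int K<..int K + int (Suc n)}. 1/(of_int k)^2)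
   = 1/(real (K + Suc n))^2 + (\<Sum>k\<in>{int K<..int K + int n}. 1/(of_int k)^2)"
  by (simp del: of_nat_add of_nat_Suc)
 also have "1/(real (K + Suc n))^2 \<le> 1/real (K + n) - 1/real (K + Suc n)"
 proof -
  define x where "x = real (K + n)"
  have x: "x > 0" "real (K + Suc n) = x + 1" using assms by (auto simp: x_def)
  have "1/x - 1/(x + 1) = 1/(x*(x + 1))" using x by (simp add: field_simps)
  also have "... \<ge> 1/(x + 1)^2" using x by (intro divide_left_mono) (auto simp: power2_eq_square)
  finally show ?thesis unfolding x(2) x_def .
 qed
 finally show ?case using Suc by simp
qed (use assms in simp)

lemma harmonic_dyadic: "(\<Sum>k\<in>{1..2^i::int}. 1/of_int k) \<le> 1 + real i"
proof (induction i)
 case (Suc i)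
 have "{1..2^Suc i::int} = {1..2^i} \<union> {2^i<..2^Suc i}" by auto
 hence "(\<Sum>k\<in>{1..2^Suc i::int}. 1/real_of_int k) = (\<Sum>k\<in>{1..2^i::int}. 1/of_int k) + (\<Sum>k\<in>{2^i<..2^Suc i::int}. 1/of_int k)"
  by (subst sum.union_disjoint[symmetric]) auto
 also have "(\<Sum>k\<in>{2^i<..2^Suc i::int}. 1/real_of_int k) \<le> (\<Sum>k\<in>{2^i<..2^Suc i::int}. 1/2^i)"
 proof (rule sum_mono)
  fix k :: int assume "k \<in> {2^i<..2^Suc i}"
  hence "real_of_int (2^i) \<le> of_int k" by (simp only: of_int_le_iff) simp
  thus "1/real_of_int k \<le> 1/2^i" by (intro divide_left_mono mult_pos_pos) (auto intro: less_le_trans[of 0 "2^i"])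
 qed
 also have "... = 1" by simp
 finally show ?case using Suc by simp
qed simp

definition dyadic_bound :: "nat \<Rightarrow> int \<Rightarrow> real" where
 "dyadic_bound i k = (if of_int k \<le> (2::real)^i then 1/(of_int k*2^i) else 4/(of_int k)^2)"

lemma sum_dyadic_bound: "(\<Sum>k\<in>{1..int n}. dyadic_bound i k) \<le> (5 + real i)/2^i"
proof -
 obtain q :: int where q: "q = 2^i" "q \<ge> 1" using one_le_power[of "2::int" i] by simp
 have q_eq: "real_of_int q = 2^i" "int (2^i) = q" by (simp_all add: q(1))
 let ?tail = "{q<..q + int n}"
 have "(\<Sum>k\<in>{1..int n}. dyadic_bound i k) \<le> (\<Sum>k\<in>{1..q} \<union> ?tail. dyadic_bound i k)"
  by (rule sum_mono2) (use q(2) in \<open>auto simp: dyadic_bound_def\<close>)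
 also have "... = (\<Sum>k\<in>{1..q}. dyadic_bound i k) + (\<Sum>k\<in>?tail. dyadic_bound i k)"
  by (rule sum.union_disjoint) auto
 also have "(\<Sum>k\<in>{1..q}. dyadic_bound i k) = (1/2^i)*(\<Sum>k\<in>{1..q}. 1/of_int k)"
  unfolding sum_distrib_left by (intro sum.cong) (auto simp: dyadic_bound_def simp flip: q_eq(1))
 also have "... \<le> (1/2^i)*(1 + real i)" unfolding q(1) by (intro mult_left_mono harmonic_dyadic) auto
 also have "(\<Sum>k\<in>?tail. dyadic_bound i k) = 4*(\<Sum>k\<in>?tail. 1/(of_int k)^2)"
  unfolding sum_distrib_left by (intro sum.cong) (auto simp: dyadic_bound_def simp flip: q_eq(1))
 also have "... \<le> 4*(1/2^i)"
  using sum_inverse_square[of "2^i" n, unfolded q_eq(2)] by (intro mult_left_mono) (auto intro: order_trans)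
 finally show ?thesis by (simp add: add_divide_distrib)
qed

lemma norm_e_diff_le: "norm (fourier.e k x - fourier.e k y) \<le> of_int \<bar>k\<bar>*\<bar>x - y\<bar>" "norm (fourier.e k x - fourier.e k y) \<le> 2"
proof -
 have "norm (fourier.e k x - fourier.e k y) \<le> of_int \<bar>k\<bar>*norm (x - y)"
 proof (rule differentiable_bound[of UNIV])
  fix t
  show "(fourier.e k has_derivative (\<lambda>h. h *\<^sub>R (\<i> * of_int k * of_real 1 * fourier.e k t))) (at t within UNIV)"
   using fourier.has_vder_e[of k t] by (simp add: has_vector_derivative_def)
  show "onorm (\<lambda>h. h *\<^sub>R (\<i> * of_int k * of_real 1 * fourier.e k t)) \<le> of_int \<bar>k\<bar>"
   by (rule onorm_le) (simp add: norm_mult)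
 qed auto
 thus "norm (fourier.e k x - fourier.e k y) \<le> of_int \<bar>k\<bar>*\<bar>x - y\<bar>" by simp
 show "norm (fourier.e k x - fourier.e k y) \<le> 2" using norm_triangle_ineq4[of "fourier.e k x" "fourier.e k y"] by simp
qed

lemma modulus_summand_bound:
 fixes b \<theta> :: real
 assumes k: "k \<ge> 1" and \<theta>: "0 \<le> \<theta>" "\<theta> \<le> of_int k/2^i" "\<theta> \<le> 2"
 shows "2*(\<theta>*b) \<le> of_int k^3*b^2/2^i + dyadic_bound i k"
proof -
 define K where "K = (2::real)^i"
 define x where "x = real_of_int k"
 define p where "p = x^3/K"
 have pos: "K > 0" "x \<ge> 1" "p > 0" using k by (auto simp: K_def x_def p_def)
 have "0 \<le> (p*b - \<theta>)^2/p" using pos by simp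
 also have "... = p*b^2 - 2*(\<theta>*b) + \<theta>^2/p" using pos by (simp add: field_simps power2_eq_square)
 finally have "2*(\<theta>*b) \<le> x^3*b^2/K + \<theta>^2*K/x^3" by (simp add: p_def)
 also have "\<theta>^2*K/x^3 \<le> dyadic_bound i k"
 proof (cases "x \<le> K")
  case True
  have "\<theta>^2*K/x^3 \<le> (x/K)^2*K/x^3"
   using pos \<theta> by (intro divide_right_mono mult_right_mono power_mono) (auto simp: x_def K_def)
  also have "... = 1/(x*K)" using pos by (simp add: field_simps power2_eq_square power3_eq_cube)
  finally show ?thesis using True by (simp add: dyadic_bound_def x_def K_def)
 next
  case False
  have "\<theta>^2*K/x^3 \<le> 2^2*x/x^3" using pos \<theta> False by (intro divide_right_mono mult_mono power_mono) auto
  also have "... = 4/x^2" using pos by (simp add: field_simps power2_eq_square power3_eq_cube)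
  finally show ?thesis using False by (simp add: dyadic_bound_def x_def K_def)
 qed
 finally show ?thesis by (simp add: x_def K_def)
qed

context speed
begin

lemma norm_fcoeff_minus: "norm (fcoeff a (- k)) = norm (fcoeff a k)"
 by (simp add: fcoeff_minus continuous_a)

lemma sobolev_positive_half:
 "2*(\<Sum>k\<in>{1..int n}. of_int k^(2*N + 3)*(norm (fcoeff a k))^2) \<le> sobolev a N"
proof -
 let ?g = "\<lambda>k. of_int \<bar>k\<bar>^(2*N + 3)*(norm (fcoeff a k))^2"
 have "2*(\<Sum>k\<in>{1..int n}. of_int k^(2*N + 3)*(norm (fcoeff a k))^2) = (\<Sum>k\<in>{- int n..int n}. ?g k)"
  unfolding sum_symmetric[OF of_nat_0_le_iff] sum_distrib_left
  by (simp add: norm_fcoeff_minus power_0_left) (intro sum.cong, auto simp: mult_ac)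
 also have "... \<le> sobolev a N"
  unfolding sobolev_def by (rule finite_sum_le_infsum[OF sobolev_summable[OF circle_smooth_a]]) auto
 finally show ?thesis .
qed

lemma modulus_of_continuity:
 assumes H: "sobolev a 0 \<le> H" and xy: "\<bar>x - y\<bar> \<le> 1/2^i"
 shows "\<bar>a x - a y\<bar> \<le> (H + 5 + real i)/2^i"
proof -
 let ?S = "\<lambda>n. \<Sum>k\<in>{- int n..int n}. fcoeff a k*(fourier.e k x - fourier.e k y)"
 let ?b = "\<lambda>k. norm (fcoeff a k)"
 define \<theta> where "\<theta> k = norm (fourier.e k x - fourier.e k y)" for k
 have inv: "((\<lambda>k. fcoeff a k*fourier.e k t) has_sum of_real (a t)) UNIV" for t
  unfolding fcoeff_eq by (rule fourier.Fourier_inversion[OF circle_smooth_of_real[OF circle_smooth_a]])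
 have "((\<lambda>k. fcoeff a k * fourier.e k x + (- 1) * (fcoeff a k * fourier.e k y)) has_sum (of_real (a x) + (- 1) * of_real (a y))) UNIV"
  by (intro has_sum_add has_sum_cmult_right inv)
 hence lim: "?S \<longlonglongrightarrow> of_real (a x - a y)"
  using tendsto_symmetric_sum by (fastforce simp: algebra_simps)
 have \<theta>_minus: "\<theta> (- k) = \<theta> k" for k unfolding \<theta>_def by (metis complex_cnj_diff complex_mod_cnj fourier.cnj_e)
 have \<theta>_le: "\<theta> k \<le> of_int k/2^i" if "k \<ge> 1" for k
  using norm_e_diff_le(1)[of k x y] mult_left_mono[OF xy, of "of_int k"] that by (simp add: \<theta>_def)
 have "norm (?S n) \<le> (H + 5 + real i)/2^i" for n
 proof -
  have "norm (?S n) \<le> (\<Sum>k\<in>{- int n..int n}. \<theta> k*?b k)"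
   by (rule order_trans[OF norm_sum]) (simp add: norm_mult mult.commute \<theta>_def)
  also have "... = (\<Sum>k\<in>{1..int n}. 2*(\<theta> k*?b k))"
   unfolding sum_symmetric[OF of_nat_0_le_iff] by (simp add: \<theta>_minus norm_fcoeff_minus) (simp add: \<theta>_def)
  also have "... \<le> (\<Sum>k\<in>{1..int n}. of_int k^3*(?b k)^2/2^i + dyadic_bound i k)"
   using \<theta>_le norm_e_diff_le(2) by (intro sum_mono modulus_summand_bound) (auto simp: \<theta>_def)
  also have "... = (\<Sum>k\<in>{1..int n}. of_int k^3*(?b k)^2)/2^i + (\<Sum>k\<in>{1..int n}. dyadic_bound i k)"
   by (simp add: sum_divide_distrib sum.distrib)
  also have "... \<le> H/2^i + (5 + real i)/2^i"
  proof (intro add_mono sum_dyadic_bound divide_right_mono)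
   have "0 \<le> (\<Sum>k\<in>{1..int n}. of_int k^3*(?b k)^2)" by (intro sum_nonneg) auto
   thus "(\<Sum>k\<in>{1..int n}. of_int k^3*(?b k)^2) \<le> H" using sobolev_positive_half[where n = n and N = 0] H by simp
  qed auto
  finally show ?thesis by (simp add: add_divide_distrib)
 qed
 hence "norm (complex_of_real (a x - a y)) \<le> (H + 5 + real i)/2^i"
  by (intro tendsto_upperbound[OF tendsto_norm[OF lim]]) auto
 thus ?thesis by (simp only: norm_of_real)
qed

text \<open>If \<open>a t\<close> were tiny, the phase \<open>s\<close> would grow by the divergent harmonic amount below on the
 dyadic intervals to the right of \<open>t\<close>, but its total growth over a period is only \<open>2\<pi>\<close>.\<close>

lemma phase_growth_dyadic:
 assumes H: "sobolev a 0 \<le> H" "H \<ge> 0" and small: "a t \<le> 1/2^i"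
 shows "(1/2)*(1/(H + 6 + real i)) \<le> s (t + 1/2^i) - s (t + 1/2^Suc i)"
proof -
 have "t + 1/2^Suc i < t + 1/2^i" by (simp add: field_simps)
 moreover have "(s has_real_derivative \<rho> x) (at x)" for x
  using s_deriv by (simp add: has_real_derivative_iff_has_vector_derivative)
 ultimately obtain z where z: "t + 1/2^Suc i < z" "z < t + 1/2^i"
  "s (t + 1/2^i) - s (t + 1/2^Suc i) = (t + 1/2^i - (t + 1/2^Suc i))*\<rho> z"
  using MVT2[of "t + 1/2^Suc i" "t + 1/2^i" s \<rho>] by blast
 have "z > t" using z(1) by (rule less_trans[rotated]) simp
 hence "\<bar>z - t\<bar> \<le> 1/2^i" using z by simp
 from modulus_of_continuity[OF H(1) this] small have "a z \<le> (H + 6 + real i)/2^i" by (simp add: add_divide_distrib)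
 hence "1/((H + 6 + real i)/2^i) \<le> \<rho> z" unfolding \<rho>_def using a_pos[of z] H(2) by (intro divide_left_mono) auto
 hence "(1/2^Suc i)*(2^i/(H + 6 + real i)) \<le> (1/2^Suc i)*\<rho> z" by (intro mult_left_mono) auto
 moreover have "t + 1/2^i - (t + 1/2^Suc i) = (1::real)/2^Suc i" by (simp add: field_simps)
 ultimately show ?thesis using z(3) by simp
qed

lemma speed_lower:
 assumes H: "sobolev a 0 \<le> H" "H \<ge> 0" and I: "(\<Sum>i\<le>I. 1/(H + 6 + real i)) > 4*pi"
 shows "a t > 1/2^I"
proof (rule ccontr)
 assume "\<not> a t > 1/2^I"
 moreover have "(1::real)/2^I \<le> 1/2^i" if "i \<le> I" for i using that by (intro divide_left_mono power_increasing) auto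
 ultimately have small: "a t \<le> 1/2^i" if "i \<le> I" for i using that by fastforce
 have "(\<Sum>i\<le>I. (1/2)*(1/(H + 6 + real i))) \<le> (\<Sum>i\<le>I. s (t + 1/2^i) - s (t + 1/2^Suc i))"
  by (intro sum_mono phase_growth_dyadic H small) auto
 also have "... = s (t + 1/2^0) - s (t + 1/2^Suc I)" by (rule sum_telescope)
 also have "... \<le> s (t + 2*pi) - s t"
 proof -
  have "t + 1 < t + 2*pi" using pi_gt3 by simp
  hence "s (t + 1) < s (t + 2*pi)" by (rule ph.s_mono)
  moreover have "s t < s (t + 1/2^Suc I)" by (rule ph.s_mono) simp
  ultimately show ?thesis by simp
 qed
 also have "... = 2*pi" by (simp add: s_shift)
 finally show False using I unfolding sum_distrib_left[symmetric] by linarith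
qed

end

lemma shifted_harmonic_unbounded: "\<exists>I. (\<Sum>i\<le>I. inverse (real (i + q))) > C"
proof (rule ccontr)
 assume "\<not> (\<exists>I. (\<Sum>i\<le>I. inverse (real (i + q))) > C)"
 hence bound: "(\<Sum>i\<le>I. inverse (real (i + q))) \<le> C" for I by (simp add: not_less)
 have "(\<Sum>i<I. inverse (real (i + q))) \<le> C" for I by (rule order_trans[OF sum_mono2 bound[of I]]) auto
 hence "summable (\<lambda>n. inverse (real (n + q)))" by (intro summableI_nonneg_bounded[of _ C]) auto
 thus False
  using not_summable_harmonic[where 'a = real] summable_iff_shift[of "\<lambda>n. inverse (real n)" q] by simp
qed

lemma speed_lower_bound: "\<exists>\<delta>>0. \<forall>a. speed a \<longrightarrow> sobolev a 0 \<le> H \<longrightarrow> (\<forall>t. a t \<ge> \<delta>)"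
proof -
 define H' where "H' = max H 0"
 obtain q :: nat where q: "H' + 6 \<le> real q" using real_arch_simple by blast
 obtain I where "(\<Sum>i\<le>I. inverse (real (i + q))) > 4*pi" using shifted_harmonic_unbounded by blast
 also have "(\<Sum>i\<le>I. inverse (real (i + q))) \<le> (\<Sum>i\<le>I. 1/(H' + 6 + real i))"
 proof (rule sum_mono)
  fix i
  have "0 < H' + 6 + real i" by (simp add: H'_def add_pos_nonneg max_def)
  thus "inverse (real (i + q)) \<le> 1/(H' + 6 + real i)"
   using q unfolding inverse_eq_divide by (intro divide_left_mono) auto
 qed
 finally have "a t \<ge> 1/2^I" if "speed a" "sobolev a 0 \<le> H" for a t
  using speed.speed_lower[OF that(1), of H' I t] that(2) by (simp add: H'_def less_imp_le)
 thus ?thesis by (intro exI[of _ "1/2^I"]) auto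
qed

section \<open>Zeta values control Sobolev norms\<close>

lemma has_sum_fold:
 fixes f :: "int \<Rightarrow> 'a::banach"
 assumes f: "(f has_sum S) UNIV" and zero: "f 0 = 0"
 shows "((\<lambda>n. f n + f (- n)) has_sum S) {1..}"
proof -
 have s: "f summable_on A" for A using f summable_on_subset_banach[of f UNIV A] by (auto simp: has_sum_iff)
 have "S = infsum f {1..} + infsum f (- {1..})" using infsum_split[OF s, of "{1..}"] f by (simp add: infsumI)
 also have "infsum f (- {1..}) = infsum f (uminus ` {1..})"
 proof (rule infsum_cong_neutral)
  fix k :: int assume "k \<in> - {1..} - uminus ` {1..}"
  hence "k = 0" by auto
  thus "f k = 0" using zero by simp
 qed auto
 finally have S: "S = infsum f {1..} + infsum f (uminus ` {1..})" .
 have "((\<lambda>n. f (- n)) has_sum infsum f (uminus ` {1..})) {1..}"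
  using has_sum_reindex[of uminus "{1..}" f "infsum f (uminus ` {1..})"] s by (simp add: o_def)
 thus ?thesis unfolding S using s by (intro has_sum_add) auto
qed

lemma has_sum_positive:
 fixes f :: "int \<Rightarrow> complex"
 shows "(f has_sum S) UNIV \<Longrightarrow> (\<And>n. n < 1 \<Longrightarrow> f n = 0) \<Longrightarrow> (f has_sum S) {1..}"
 by (rule has_sum_cong_neutral[THEN iffD1, rotated 3]) auto

context speed
begin

lemma U_minus: "U (- n) k = cnj (U n (- k))"
 unfolding U_def using fourier.cf_cnj[of "ph.e n" k] by (simp add: continuous_intros)

lemma norm_U_le: "norm (U n k) \<le> 1"
 unfolding U_def fourier.cf_def by (rule norm_mean_le) (auto intro!: continuous_intros simp: norm_mult)

lemma U_Parseval: "((\<lambda>n. cnj (U n (- j))*U n k) has_sum fcoeff a (j + k)) UNIV"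
proof -
 define F where "F k t = of_real (a t)*fourier.e k t" for k t
 have F: "circle_smooth (F k)" for k unfolding F_def[abs_def] by (intro circle_smooth_intros)
 have a_rho_of_real: "of_real (a t) * of_real (\<rho> t) = (1::complex)" for t using a_rho(1)[of t] by (metis of_real_1 of_real_mult)
 have cf_F: "ph.cf (F k) n = cnj (U n k)" for k n
 proof -
  have "ph.cf (F k) n = mean (\<lambda>t. of_real (a t) * of_real (\<rho> t) * cnj (ph.e n t * fourier.e (- k) t))"
   unfolding ph.cf_def F_def by (rule mean_cong) (simp add: mult_ac)
  also have "... = cnj (U n k)" unfolding U_def fourier.cf_def a_rho_of_real
   by (subst mean_bounded_linear[OF bounded_linear_cnj, symmetric]) (auto intro!: continuous_intros)
  finally show ?thesis .
 qed
 have "mean (\<lambda>t. F (- j) t * cnj (F k t) * of_real (\<rho> t))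
   = mean (\<lambda>t. of_real (a t) * (of_real (a t) * of_real (\<rho> t)) * (fourier.e (- j) t * fourier.e (- k) t))"
  unfolding F_def by (rule mean_cong) (simp add: mult_ac)
 also have "... = fcoeff a (j + k)" unfolding a_rho_of_real fourier.e_mult fcoeff_eq fourier.cf_def by simp
 finally show ?thesis
  using ph.Parseval[OF F[of "- j"] circle_smooth_cont circle_smoothD(2), OF F F, of k] by (simp add: cf_F)
qed

lemma U_positive:
 assumes "j \<ge> 1"
 shows "((\<lambda>n. cnj (U n (- k))*U n j + cnj (U n (- j))*U n k) has_sum fcoeff a (j + k)) {1..}"
proof -
 have "ph.e 0 = (\<lambda>_. 1)" by auto
 hence "U 0 (- j) = 0" using assms fourier.cf_const[of 1 "- j"] by (simp add: U_def)
 thus ?thesis using has_sum_fold[OF U_Parseval[of j k]] by (simp add: U_minus algebra_simps)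
qed

definition w :: "int \<Rightarrow> int \<Rightarrow> int \<Rightarrow> complex" where
 "w n j k = of_int j * of_int k * cnj (fcoeff a (j + k)) * (cnj (U n (- k)) * U n j)"

lemma w_bound: "\<exists>C. \<forall>n\<ge>1. \<forall>j\<ge>1. \<forall>k\<ge>1. norm (w n j k) \<le> C*(1/wt n^2*(1/wt j^2*(1/wt k^2)))"
proof -
 obtain C where C: "C \<ge> 0" "\<And>n. norm (fcoeff a n)*wt n^6 \<le> C"
  using fourier.cf_decay[OF circle_smooth_of_real[OF circle_smooth_a]] unfolding fcoeff_eq by blast
 obtain D where D: "\<And>n k. n \<ge> 0 \<Longrightarrow> k \<ge> 0 \<Longrightarrow> n + k > 0 \<Longrightarrow> norm (U n (- k)) * of_int (n + k)^2 \<le> D"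
  using U_decay by blast
 have "norm (w n j k) \<le> C*D*(1/wt n^2*(1/wt j^2*(1/wt k^2)))" if p: "n \<ge> 1" "j \<ge> 1" "k \<ge> 1" for n j k
 proof -
  have "norm (U n (- k)) * wt n^2 \<le> norm (U n (- k)) * of_int (n + k)^2"
   using p by (intro mult_left_mono power_mono) (auto simp: wt_def)
  also have "... \<le> D" using D[of n k] p by simp
  finally have U_le: "norm (U n (- k)) \<le> D/wt n^2" by (simp add: field_simps)
  have "norm (fcoeff a (j + k))*(wt j^3*wt k^3) \<le> norm (fcoeff a (j + k))*(wt (j + k)^3*wt (j + k)^3)"
   using p by (intro mult_left_mono mult_mono power_mono) (auto simp: wt_def)
  also have "... \<le> C" using C(2)[of "j + k"] by (simp flip: power_add)
  finally have f_le: "norm (fcoeff a (j + k)) \<le> C/(wt j^3*wt k^3)" by (simp add: field_simps)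
  have "norm (w n j k) = of_int j * of_int k * norm (fcoeff a (j + k)) * (norm (U n (- k)) * norm (U n j))"
   using p by (simp add: w_def norm_mult)
  also have "... \<le> wt j*wt k*(C/(wt j^3*wt k^3))*(D/wt n^2*1)"
   using p f_le U_le norm_U_le[of n j] C(1) order_trans[OF norm_ge_zero U_le]
   by (intro mult_mono) (auto simp: wt_def intro!: mult_nonneg_nonneg)
  also have "... = C*D*(1/wt n^2*(1/wt j^2*(1/wt k^2)))" by (simp add: field_simps power2_eq_square power3_eq_cube)
  finally show ?thesis .
 qed
 thus ?thesis by blast
qed

lemma w_summable: "(\<lambda>(n, j, k). w n j k) summable_on {1..} \<times> {1..} \<times> {1..}"
proof -
 obtain C where C: "\<And>n j k. n\<ge>1 \<Longrightarrow> j\<ge>1 \<Longrightarrow> k\<ge>1 \<Longrightarrow> norm (w n j k) \<le> C*(1/wt n^2*(1/wt j^2*(1/wt k^2)))"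
  using w_bound by blast
 have wt_on: "(\<lambda>n. 1/wt n^2) summable_on {1..}" using summable_on_wt[of 1] by simp
 have "(\<lambda>(n, p). 1/wt n^2*(case p of (j, k) \<Rightarrow> 1/wt j^2*(1/wt k^2))) summable_on {1..} \<times> ({1..} \<times> {1..})"
  by (intro summable_on_Times_product wt_on) auto
 from summable_on_cmult_right[OF this, of C]
 have "(\<lambda>p. norm (case p of (n, j, k) \<Rightarrow> w n j k)) summable_on {1..} \<times> {1..} \<times> {1..}"
  by (rule summable_on_comparison_test) (use C in \<open>auto simp: mult_ac\<close>)
 thus ?thesis by (rule abs_summable_summable)
qed

lemma w_slice_summable:
 assumes "n \<ge> 1" shows "(\<lambda>(j, k). w n j k) summable_on {1..} \<times> {1..}"
 using summable_on_SigmaD1[OF w_summable, of n] assms by (simp add: case_prod_unfold)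

text \<open>\<open>\<Lambda>e\<^sub>n = p + r/2\<close> splits into positive and negative frequencies, and the sum below is the mean of \<open>a p cnj(r)/2\<close>.\<close>

definition pos_part :: "int \<Rightarrow> real \<Rightarrow> complex" where
 "pos_part n t = Lam (ph.e n) t - (1/2)*remainder n t"

lemma circle_smooth_pos_part: "circle_smooth (pos_part n)"
 unfolding pos_part_def[abs_def]
 by (intro circle_smooth_intros circle_smooth_fmult circle_smooth_remainder linear_growth_symbols)

lemma cf_pos_part:
 assumes n: "n \<ge> 0" shows "fourier.cf (pos_part n) k = of_int (\<bar>k\<bar> + k)*U n k/2"
proof -
 have "fourier.cf (pos_part n) k = fourier.cf (Lam (ph.e n)) k - (1/2)*fourier.cf (remainder n) k"
  unfolding pos_part_def fourier.cf_cmult[OF continuous_remainder, symmetric]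
  by (intro fourier.cf_diff continuous_intros circle_smooth_cont circle_smooth_fmult ph.circle_smooth_e linear_growth_symbols)
 thus ?thesis unfolding cf_fmult[OF ph.circle_smooth_e linear_growth_symbols(1)] cf_remainder[OF n]
  by (simp add: U_def[symmetric] field_simps)
qed

lemma has_sum_w_inner:
 assumes n: "n \<ge> 1" and j: "j \<ge> 1"
 shows "((\<lambda>k. w n j k) has_sum fourier.cf (pos_part n) j*mean (\<lambda>t. fourier.e j t*(of_real (a t)*cnj (remainder n t)))/2) {1..}"
proof -
 define F where "F t = fourier.e j t * of_real (a t)" for t
 have F: "circle_smooth F" unfolding F_def[abs_def] by (intro circle_smooth_intros)
 let ?g = "\<lambda>i. cnj (fcoeff a (j + i))*(of_int (\<bar>i\<bar> + i)*cnj (U n (- i)))"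
 have "((\<lambda>i. fourier.cf F (- i)*cnj (fourier.cf (remainder n) (- i))) has_sum mean (\<lambda>t. F t*cnj (remainder n t))) UNIV"
  using Parseval_fourier[OF F continuous_remainder circle_smoothD(2)[OF circle_smooth_remainder], of n]
   has_sum_uminus_int[of "\<lambda>i. fourier.cf F i*cnj (fourier.cf (remainder n) i)"] by simp
 moreover have "fourier.cf F (- i)*cnj (fourier.cf (remainder n) (- i))
   = ?g i" for i using fcoeff_minus[OF continuous_a, of "j + i"] n
  by (simp add: F_def[abs_def] fourier.cf_e_mult cf_remainder fcoeff_eq[symmetric] minus_diff_commute)
 ultimately have "(?g has_sum mean (\<lambda>t. F t*cnj (remainder n t))) {1..}" by (intro has_sum_positive) auto
 from has_sum_cmult_right[OF this, of "fourier.cf (pos_part n) j/2"]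
 have "((\<lambda>i. fourier.cf (pos_part n) j/2*(?g i)) has_sum
  fourier.cf (pos_part n) j*mean (\<lambda>t. fourier.e j t*(of_real (a t)*cnj (remainder n t)))/2) {1..}"
  by (simp add: F_def mult.assoc)
 thus ?thesis by (rule has_sum_cong[THEN iffD1, rotated]) (use j n in \<open>auto simp: cf_pos_part w_def\<close>)
qed

lemma Re_mean_pos_part:
 assumes n: "n \<ge> 0"
 shows "Re (mean (\<lambda>t. pos_part n t * (of_real (a t) * cnj (remainder n t)))) = (Q n + 2 * of_int n * W n)/2"
proof -
 let ?f = "\<lambda>t. pos_part n t*(of_real (a t)*cnj (remainder n t))"
 have pointwise: "Re (?f t)
   = of_int n*Re (remainder n t*cnj (ph.e n t)) + (1/2)*(a t*(norm (remainder n t))^2)" for t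
 proof -
  have "pos_part n t = of_real (of_int n*\<rho> t)*ph.e n t + (1/2)*remainder n t"
   using n by (simp add: pos_part_def remainder_def algebra_simps)
  hence "Re (?f t)
   = of_int n*(a t*Re (remainder n t*cnj (ph.e n t))*\<rho> t) + (1/2)*(a t*(norm (remainder n t))^2)"
   unfolding cmod_power2 by (simp add: power2_eq_square algebra_simps del: ph.cnj_e)
  thus ?thesis by (simp only: a_rho)
 qed
 have "Re (mean ?f)
   = mean (\<lambda>t. Re (?f t))" by (rule mean_bounded_linear[OF bounded_linear_Re, symmetric])
   (intro continuous_intros circle_smooth_cont circle_smooth_pos_part)
 also have "... = of_int n*W n + (1/2)*Q n" unfolding pointwise W_def Q_def
  by (subst mean_add; (intro continuous_intros)?; (subst mean_cmult; (intro continuous_intros)?)+; rule refl)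
 finally show ?thesis by simp
qed

lemma w_slice:
 assumes n: "n \<ge> 1"
 shows "\<exists>g. ((\<lambda>(j, k). w n j k) has_sum g) ({1..} \<times> {1..}) \<and> Re g = (Q n + 2 * of_int n * W n)/4"
proof -
 define G where "G t = of_real (a t)*cnj (remainder n t)" for t
 have G: "circle_smooth G" unfolding G_def[abs_def] by (intro circle_smooth_intros circle_smooth_remainder)
 let ?c = "\<lambda>j. fourier.cf (pos_part n) j*mean (\<lambda>t. fourier.e j t*G t)/2"
 have outer: "(?c has_sum mean (\<lambda>t. pos_part n t*G t)/2) {1..}"
 proof (rule has_sum_positive)
  have "(\<lambda>k. norm (fourier.cf (pos_part n) k)) summable_on UNIV"
   using fourier.cf_summable[OF circle_smooth_pos_part, of _ 0] by simp
  from has_sum_cmult_left[OF fourier.mean_series[OF this fourier.Fourier_inversion[OF circle_smooth_pos_part]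
   circle_smooth_cont[OF G] circle_smoothD(2)[OF G]], of "1/2"]
  show "(?c has_sum mean (\<lambda>t. pos_part n t*G t)/2) UNIV" by simp
 qed (use n in \<open>simp add: cf_pos_part\<close>)
 obtain g where g: "((\<lambda>(j, k). w n j k) has_sum g) ({1..} \<times> {1..})"
  using w_slice_summable[OF n] unfolding summable_on_def by blast
 have "(?c has_sum g) {1..}"
  by (rule has_sum_SigmaD[OF g]) (use has_sum_w_inner[OF n] in \<open>auto simp: G_def\<close>)
 hence "g = mean (\<lambda>t. pos_part n t*G t)/2" using outer has_sum_unique by blast
 hence "Re g = (Q n + 2 * of_int n * W n)/4" using Re_mean_pos_part[of n] n by (simp only: G_def) simp
 thus ?thesis using g by blast
qed

definition w_sym :: "int \<Rightarrow> int \<Rightarrow> int \<Rightarrow> complex" where "w_sym n j k = w n j k + w n k j"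

lemma w_sym_summable: "(\<lambda>(n, j, k). w_sym n j k) summable_on {1..} \<times> {1..} \<times> {1..}"
proof -
 have "bij_betw (\<lambda>(n, j, k). (n, k, j)) ({1..} \<times> {1..} \<times> {1..}) ({1..} \<times> {1..} \<times> {1::int..})"
  by (rule bij_betwI[of _ _ _ "\<lambda>(n, j, k). (n, k, j)"]) auto
 from summable_on_add[OF w_summable summable_on_reindex_bij_betw[OF this, THEN iffD2, OF w_summable]] show ?thesis by (simp add: w_sym_def case_prod_unfold)
qed

lemma has_sum_w_sym_n:
 assumes "j \<ge> 1"
 shows "((\<lambda>n. w_sym n j k) has_sum complex_of_real (of_int j * of_int k * (norm (fcoeff a (j + k)))^2)) {1..}"
proof -
 have "((\<lambda>n. of_int j * of_int k * cnj (fcoeff a (j + k)) * (cnj (U n (- k)) * U n j + cnj (U n (- j)) * U n k))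
  has_sum of_int j * of_int k * cnj (fcoeff a (j + k)) * fcoeff a (j + k)) {1..}"
  by (intro has_sum_cmult_right U_positive assms)
 also have "of_int j * of_int k * cnj (fcoeff a (j + k)) * fcoeff a (j + k)
   = complex_of_real (of_int j * of_int k * (norm (fcoeff a (j + k)))^2)"
  by (simp only: of_real_mult complex_norm_square of_real_of_int_eq mult_ac)
 finally show ?thesis
  by (simp add: w_sym_def w_def distrib_left add.commute[of k j] mult.commute[of "of_int k" "of_int j"] del: of_real_mult of_real_power)
qed

lemma has_sum_w_sym_slice:
 assumes n: "n \<ge> 1"
 shows "\<exists>g. ((\<lambda>(j, k). w_sym n j k) has_sum g) ({1..} \<times> {1..}) \<and> Re g = (Q n + 2 * of_int n * W n)/2"
proof -
 obtain g where g: "((\<lambda>(j, k). w n j k) has_sum g) ({1..} \<times> {1..})" "Re g = (Q n + 2 * of_int n * W n)/4"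
  using w_slice[OF n] by blast
 have "((\<lambda>(j, k). w n k j) has_sum g) ({1..} \<times> {1..})"
  using g(1) has_sum_swap[of "\<lambda>(j, k). w n j k" "{1..}" "{1..}"] by simp
 from has_sum_add[OF g(1) this] show ?thesis
  using g(2) by (intro exI[of _ "g + g"]) (simp add: w_sym_def case_prod_unfold)
qed

lemma quadratic_bound_first:
 assumes J: "finite J" "J \<subseteq> {1..} \<times> {1..}"
 shows "(\<Sum>(j, k)\<in>J. of_int j * of_int k * (norm (fcoeff a (j + k)))^2) \<le> Re (zeta a (- of_nat (2 * Suc 0)))/4"
proof -
 obtain S where S: "((\<lambda>(n, j, k). w_sym n j k) has_sum S) ({1..} \<times> ({1..} \<times> {1..}))"
  using w_sym_summable by (auto simp: summable_on_def)
 obtain g where g: "\<And>n. n \<ge> 1 \<Longrightarrow> ((\<lambda>(j, k). w_sym n j k) has_sum g n) ({1..} \<times> {1..})"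
  "\<And>n. n \<ge> 1 \<Longrightarrow> Re (g n) = (Q n + 2 * of_int n * W n)/2" using has_sum_w_sym_slice by metis
 have "(g has_sum S) {1..}" by (rule has_sum_SigmaD[OF S]) (use g(1) in \<open>auto simp: case_prod_unfold\<close>)
 from has_sum_Re[OF this] have ReS: "((\<lambda>n. (Q n + 2 * of_int n * W n)/2) has_sum Re S) {1..}"
  by (rule has_sum_cong[THEN iffD1, rotated]) (simp add: g(2))
 have "((\<lambda>(p, n). w_sym n (fst p) (snd p)) has_sum S) (({1..} \<times> {1..}) \<times> {1..})"
  using S by (subst (asm) has_sum_swap) (simp add: case_prod_unfold)
 hence "((\<lambda>p. complex_of_real (of_int (fst p) * of_int (snd p) * (norm (fcoeff a (fst p + snd p)))^2)) has_sum S) ({1..} \<times> {1..})"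
  by (rule has_sum_SigmaD) (use has_sum_w_sym_n in auto)
 from has_sum_Re[OF this]
 have "((\<lambda>(j, k). of_int j * of_int k * (norm (fcoeff a (j + k)))^2) has_sum Re S) ({1..} \<times> {1..})"
  by (simp add: case_prod_unfold)
 hence "(\<Sum>(j, k)\<in>J. of_int j * of_int k * (norm (fcoeff a (j + k)))^2) \<le> Re S"
  by (rule finite_sum_le_has_sum) (use J in auto)
 also have "Re S \<le> Re (zeta a (- of_nat (2*Suc 0)))/4"
 proof (rule has_sum_le_finite_sums[OF ReS])
  fix A :: "int set" assume "finite A" "A \<subseteq> {1..}"
  thus "(\<Sum>n\<in>A. (Q n + 2 * of_int n * W n)/2) \<le> Re (zeta a (- of_nat (2 * Suc 0)))/4"
   using zeta_lower_finite[of A 0] by (auto simp: sum_divide_distrib[symmetric])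
 qed
 finally show ?thesis .
qed

end

text \<open>For \<open>p \<ge> 1\<close> the same expansion is truncated to \<open>n \<le> P\<close>; Bessel's inequality in \<open>j\<close>, the Sobolev bound
 in \<open>n\<close> and the definition of \<open>Q\<close> control the truncations uniformly in \<open>P\<close>.\<close>

locale speed_bounds = speed +
 fixes \<delta> B0 B :: real and p :: nat
 assumes \<delta>_pos: "\<delta> > 0" and a_ge: "\<And>t. \<delta> \<le> a t" and a_le: "\<And>t. a t \<le> B0"
  and rho_vders: "\<And>j. j < p \<Longrightarrow> vders_le j B (\<lambda>t. complex_of_real (\<rho> t))" and p_pos: "p \<ge> 1"
begin

definition trunc :: "nat \<Rightarrow> int \<Rightarrow> int \<Rightarrow> complex" where
 "trunc P k j = (\<Sum>n\<in>{1..int P}. cnj (U n (- k))*U n j)"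

definition M :: real where "M = sobolev_const B0 B p"

definition Z :: real where "Z = Re (zeta a (- of_nat (2*Suc p)))"

lemma M_nonneg: "M \<ge> 0" unfolding M_def using a_le[of 0] a_pos[of 0] by (intro sobolev_const_nonneg) linarith

lemma trunc_row_bound:
 "(\<Sum>j\<in>{1..K}. (of_int j)^(2*p)*(norm (trunc P k j))^2) \<le> M*(\<Sum>n\<in>{1..int P}. (of_int n)^(2*p)*(norm (U n (- k)))^2)"
proof -
 let ?f = "ph.trig_sum {1..int P} (\<lambda>n. cnj (U n (- k)))"
 have "fourier.cf ?f j = mean (\<lambda>t. \<Sum>n\<in>{1..int P}. cnj (U n (- k)) * (ph.e n t * fourier.e (- j) t * of_real 1))" for j
  unfolding fourier.cf_def ph.trig_sum_def by (rule mean_cong) (simp add: sum_distrib_right mult.assoc)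
 also have "... j = trunc P k j" for j unfolding trunc_def U_def fourier.cf_def
  by (subst mean_sum) (auto intro!: continuous_intros sum.cong mean_cmult simp del: of_real_1)
 finally have "(\<Sum>j\<in>{1..K}. (of_int j)^(2*p)*(norm (trunc P k j))^2) = (\<Sum>j\<in>{1..K}. of_int \<bar>j\<bar>^(2*p)*(norm (fourier.cf ?f j))^2)"
  by (intro sum.cong) auto
 also have "... \<le> mean_sq ((vder ^^ p) ?f)" by (rule Bessel_vders[OF ph.circle_smooth_trig_sum]) simp
 also have "... \<le> M*(\<Sum>n\<in>{1..int P}. (of_int n)^(2*p)*(norm (cnj (U n (- k))))^2)"
  unfolding M_def by (rule mean_sq_vders_trig_sum[OF a_le rho_vders]) auto
 finally show ?thesis by simp
qed

lemma U_column_bound: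
 assumes n: "n \<ge> 0" shows "(\<Sum>k\<in>{1..K}. (of_int k)^2*(norm (U n (- k)))^2) \<le> Q n/(4*\<delta>)"
proof -
 have "4*(\<Sum>k\<in>{1..K}. (of_int k)^2*(norm (U n (- k)))^2) = (\<Sum>k\<in>uminus ` {1..K}. (norm (fourier.cf (remainder n) k))^2)"
  unfolding sum_distrib_left by (subst sum.reindex) (auto intro!: sum.cong simp: cf_remainder[OF n] norm_mult power_mult_distrib)
 also have "... \<le> mean (\<lambda>t. (norm (remainder n t))^2*1)" by (rule fourier.Bessel[OF continuous_remainder]) simp
 finally have "\<delta>*(4*(\<Sum>k\<in>{1..K}. (of_int k)^2*(norm (U n (- k)))^2)) \<le> \<delta>*mean (\<lambda>t. (norm (remainder n t))^2)"
  using \<delta>_pos by (intro mult_left_mono) auto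
 also have "... = mean (\<lambda>t. \<delta>*(norm (remainder n t))^2)" by (intro mean_cmult[symmetric] continuous_intros)
 also have "... \<le> Q n" unfolding Q_def by (rule mean_mono) (auto intro!: continuous_intros mult_right_mono a_ge)
 finally show ?thesis using \<delta>_pos by (simp add: field_simps)
qed

lemma sum_Q_le: "(\<Sum>n\<in>{1..int P}. (of_int n)^(2*p)*Q n) \<le> Z"
proof -
 define Y where "Y = (\<Sum>n\<in>{1..int P}. (of_int n)^(2 * p) * (Q n + 2 * of_int n * W n))"
 have "(\<Sum>n\<in>{1..int P}. (of_int n)^(2*p)*Q n) \<le> Y" unfolding Y_def
  by (intro sum_mono mult_left_mono) (auto simp: W_nonneg zero_le_even_power)
 also have "0 \<le> Y" unfolding Y_def by (intro sum_nonneg mult_nonneg_nonneg add_nonneg_nonneg Q_nonneg W_nonneg) auto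
 hence "1*Y \<le> (2*real (Suc p))*Y" by (intro mult_right_mono) auto
 also have "... \<le> Z" unfolding Y_def Z_def by (rule zeta_lower_finite) auto
 finally show ?thesis by simp
qed

definition T :: "nat \<Rightarrow> int \<Rightarrow> int \<Rightarrow> real" where
 "T P k j = (of_int k)^2*((of_int j)^(2*p)*(norm (trunc P k j))^2)"

lemma T_nonneg: "T P k j \<ge> 0" by (simp add: T_def zero_le_even_power)

lemma T_total_bound: "(\<Sum>k\<in>{1..K}. \<Sum>j\<in>{1..K}. T P k j) \<le> M/(4*\<delta>)*Z"
proof -
 let ?n = "\<lambda>n. (of_int n :: real)^(2*p)"
 have "(\<Sum>k\<in>{1..K}. \<Sum>j\<in>{1..K}. T P k j) = (\<Sum>k\<in>{1..K}. (of_int k)^2*(\<Sum>j\<in>{1..K}. ?n j*(norm (trunc P k j))^2))"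
  by (simp add: T_def sum_distrib_left)
 also have "... \<le> (\<Sum>k\<in>{1..K}. (of_int k)^2*(M*(\<Sum>n\<in>{1..int P}. ?n n*(norm (U n (- k)))^2)))"
  by (intro sum_mono mult_left_mono trunc_row_bound) auto
 also have "... = M*(\<Sum>k\<in>{1..K}. \<Sum>n\<in>{1..int P}. ?n n*((of_int k)^2*(norm (U n (- k)))^2))"
  by (simp add: sum_distrib_left mult_ac)
 also have "... = M*(\<Sum>n\<in>{1..int P}. ?n n*(\<Sum>k\<in>{1..K}. (of_int k)^2*(norm (U n (- k)))^2))"
  by (subst sum.swap) (simp add: sum_distrib_left)
 also have "... \<le> M*(\<Sum>n\<in>{1..int P}. ?n n*(Q n/(4*\<delta>)))"
  using M_nonneg by (intro mult_left_mono sum_mono U_column_bound) (auto simp: zero_le_even_power)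
 also have "... = M/(4*\<delta>)*(\<Sum>n\<in>{1..int P}. ?n n*Q n)" by (simp add: sum_distrib_left mult_ac)
 also have "... \<le> M/(4*\<delta>)*Z" using M_nonneg \<delta>_pos by (intro mult_left_mono sum_Q_le) auto
 finally show ?thesis .
qed

lemma trunc_summand_bound:
 assumes "1 \<le> j" "j \<le> k"
 shows "(of_int k)^2*(of_int j)^(2*p)*(norm (trunc P k j + trunc P j k))^2 \<le> 2*T P k j + 2*T P j k"
proof -
 define W where "W = (of_int k :: real)^2*(of_int j)^(2*p)"
 have W: "W \<ge> 0" by (simp add: W_def zero_le_even_power)
 obtain q where q: "p = Suc q" using p_pos by (cases p) auto
 have "((of_int j)^2*(of_int k)^2)*(real_of_int j)^(2*q) \<le> ((of_int j)^2*(of_int k)^2)*(of_int k)^(2*q)"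
  using assms by (intro mult_left_mono power_mono) auto
 hence W_le: "W \<le> (of_int j)^2*(of_int k)^(2*p)" by (simp add: W_def q power_add power2_eq_square mult_ac)
 have "W*(norm (trunc P k j + trunc P j k))^2 \<le> W*(2*(norm (trunc P k j))^2 + 2*(norm (trunc P j k))^2)"
  using W by (intro mult_left_mono norm_add_square_le)
 also have "... = 2*T P k j + 2*(W*(norm (trunc P j k))^2)" by (simp add: T_def W_def algebra_simps)
 also have "... \<le> 2*T P k j + 2*((of_int j)^2*(of_int k)^(2*p)*(norm (trunc P j k))^2)"
  by (intro add_mono mult_left_mono mult_right_mono W_le) auto
 finally show ?thesis by (simp add: T_def W_def)
qed

lemma quadratic_bound_higher:
 assumes J: "J \<subseteq> {(j, k). 1 \<le> j \<and> j \<le> k \<and> k \<le> K}"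
 shows "(\<Sum>(j, k)\<in>J. (of_int k)^2*(of_int j)^(2*p)*(norm (fcoeff a (j + k)))^2) \<le> M/\<delta>*Z"
proof (rule tendsto_upperbound)
 let ?S = "\<lambda>P. \<Sum>(j, k)\<in>J. (of_int k)^2*(of_int j)^(2*p)*(norm (trunc P k j + trunc P j k))^2"
 have J': "J \<subseteq> {1..K} \<times> {1..K}" using J by auto
 show "?S
  \<longlonglongrightarrow> (\<Sum>(j, k)\<in>J. (of_int k)^2*(of_int j)^(2*p)*(norm (fcoeff a (j + k)))^2)"
  unfolding case_prod_unfold
 proof (intro tendsto_sum tendsto_mult tendsto_const tendsto_power tendsto_norm)
  fix x assume "x \<in> J"
  hence "fst x \<ge> 1" using J by auto
  from tendsto_positive_sum[OF U_positive[OF this, of "snd x"]]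
  show "(\<lambda>P. trunc P (snd x) (fst x) + trunc P (fst x) (snd x)) \<longlonglongrightarrow> fcoeff a (fst x + snd x)"
   by (simp add: trunc_def sum.distrib)
 qed
 have "?S P \<le> M/\<delta>*Z" for P
 proof -
  have "?S P
    \<le> (\<Sum>(j, k)\<in>J. 2*T P k j + 2*T P j k)" using J by (intro sum_mono) (auto intro: trunc_summand_bound)
  also have "... \<le> (\<Sum>(j, k)\<in>{1..K} \<times> {1..K}. 2*T P k j + 2*T P j k)"
   by (rule sum_mono2[OF _ J']) (auto simp: T_nonneg)
  also have "... = 2*(\<Sum>j\<in>{1..K}. \<Sum>k\<in>{1..K}. T P k j) + 2*(\<Sum>j\<in>{1..K}. \<Sum>k\<in>{1..K}. T P j k)"
   by (simp add: sum.cartesian_product[symmetric] sum.distrib sum_distrib_left)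
  also have "(\<Sum>j\<in>{1..K}. \<Sum>k\<in>{1..K}. T P k j) = (\<Sum>k\<in>{1..K}. \<Sum>j\<in>{1..K}. T P k j)" by (rule sum.swap)
  also have "2*... + 2*(\<Sum>j\<in>{1..K}. \<Sum>k\<in>{1..K}. T P j k) \<le> 4*(M/(4*\<delta>)*Z)" using T_total_bound[of P K] by simp
  finally show ?thesis by simp
 qed
 thus "\<forall>\<^sub>F P in sequentially. ?S P \<le> M/\<delta>*Z" by simp
qed simp

end

context speed
begin

lemma norm_fcoeff_le: "norm (fcoeff a k) \<le> Re (fcoeff a 0)"
proof -
 have "norm (integral {0..2*pi} (\<lambda>t. complex_of_real (a t)*cis (- (of_int k*t)))) \<le> integral {0..2*pi} a"
  by (rule integral_norm_bound_integral)
   (auto intro!: integrable_continuous_real continuous_intros simp: norm_mult a_pos less_imp_le)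
 moreover have "fcoeff a 0 = of_real (integral {0..2*pi} a/(2*pi))"
  using mean_of_real[OF continuous_a] by (simp add: fcoeff_eq fourier.cf_def mean_def scaleR_conv_of_real)
 ultimately show ?thesis by (simp add: fcoeff_def norm_divide divide_right_mono)
qed

end

lemma weighted_AM_GM:
 fixes b :: real
 assumes x: "x \<ge> 1" and \<epsilon>: "\<epsilon> > 0" and i: "i \<le> N" and b: "b \<ge> 0"
 shows "x^i*b \<le> x^(2*N + 3)*b^2/\<epsilon> + \<epsilon>*(4*(1/(1 + x)^2))"
proof -
 have "0 \<le> (x^(i + 1)*b - \<epsilon>/x)^2/\<epsilon>" using \<epsilon> by simp
 also have "... = (x^(i + 1)*b)^2/\<epsilon> - 2*(x^i*b) + \<epsilon>*(1/x)^2"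
  using x \<epsilon> by (simp add: power2_eq_square field_simps)
 finally have "2*(x^i*b) \<le> (x^(i + 1)*b)^2/\<epsilon> + \<epsilon>*(1/x)^2" by simp
 also have "(x^(i + 1)*b)^2 = x^(2*i + 2)*b^2"
  by (simp add: power_mult_distrib power_mult[symmetric] distrib_right mult.commute[of i 2] del: power_Suc)
 also have ".../\<epsilon> \<le> x^(2*N + 3)*b^2/\<epsilon>"
  using x \<epsilon> i by (intro divide_right_mono mult_right_mono power_increasing) auto
 also have "(1/x)^2 \<le> 4*(1/(1 + x)^2)"
 proof -
  have "(1 + x)^2 \<le> (2*x)^2" using x by (intro power_mono) auto
  thus ?thesis using x by (simp add: power_divide field_simps)
 qed
 finally have "2*(x^i*b) \<le> x^(2*N + 3)*b^2/\<epsilon> + \<epsilon>*(4*(1/(1 + x)^2))" using \<epsilon> by simp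
 moreover have "0 \<le> x^i*b" using x b by simp
 ultimately show ?thesis by linarith
qed

context speed
begin

definition osc :: "nat \<Rightarrow> int \<Rightarrow> real" where
 "osc i k = (if k = 0 then 0 else of_int \<bar>k\<bar>^i*norm (fcoeff a k))"

lemma osc_bound:
 assumes i: "i \<le> N" and \<epsilon>: "\<epsilon> > 0"
 shows "osc i summable_on UNIV" "infsum (osc i) UNIV \<le> sobolev a N/\<epsilon> + \<epsilon>*(4*wt_sum)"
proof -
 show s: "osc i summable_on UNIV"
  using vders_sup(1)[OF circle_smooth_of_real[OF circle_smooth_a], of i, folded fcoeff_eq]
  by (rule summable_on_comparison_test) (auto simp: osc_def)
 have sob: "((\<lambda>k. of_int \<bar>k\<bar>^(2*N + 3)*(norm (fcoeff a k))^2/\<epsilon>) has_sum sobolev a N/\<epsilon>) UNIV"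
  using has_sum_cmult_left[OF has_sum_infsum[OF sobolev_summable[OF circle_smooth_a, of "2*N + 3"]], of "1/\<epsilon>"]
  by (simp add: sobolev_def)
 show "infsum (osc i) UNIV \<le> sobolev a N/\<epsilon> + \<epsilon>*(4*wt_sum)"
 proof (rule has_sum_mono[OF has_sum_infsum[OF s]])
  show "((\<lambda>k. of_int \<bar>k\<bar>^(2*N + 3)*(norm (fcoeff a k))^2/\<epsilon> + \<epsilon>*4*(1/wt k^2)) has_sum sobolev a N/\<epsilon> + \<epsilon>*(4*wt_sum)) UNIV"
   using has_sum_add[OF sob has_sum_wt[of "\<epsilon>*4"]] by (simp only: mult.assoc)
  show "osc i k \<le> of_int \<bar>k\<bar>^(2*N + 3)*(norm (fcoeff a k))^2/\<epsilon> + \<epsilon>*4*(1/wt k^2)" for k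
   using weighted_AM_GM[of "of_int \<bar>k\<bar>" \<epsilon> i N "norm (fcoeff a k)"] i \<epsilon> by (auto simp: osc_def wt_def)
 qed
qed

lemma vders_le_sobolev:
 "vders_le N (Re (fcoeff a 0) + sobolev a N + 4*wt_sum) (\<lambda>t. complex_of_real (a t))"
 unfolding vders_le_def
proof (intro allI impI)
 fix i t assume i: "i \<le> N"
 note v = vders_sup[OF circle_smooth_of_real[OF circle_smooth_a], of i, folded fcoeff_eq]
 note W = osc_bound[OF i zero_less_one]
 have zero: "((\<lambda>k::int. if k = 0 then Re (fcoeff a 0) else 0) has_sum Re (fcoeff a 0)) UNIV"
  by (rule has_sum_finite_neutralI[of "{0}"]) auto
 have "(\<Sum>\<^sub>\<infinity>k. of_int \<bar>k\<bar>^i*norm (fcoeff a k)) \<le> Re (fcoeff a 0) + infsum (osc i) UNIV"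
 proof (rule has_sum_mono[OF has_sum_infsum[OF v(1)] has_sum_add[OF zero has_sum_infsum[OF W(1)]]])
  show "of_int \<bar>k\<bar>^i*norm (fcoeff a k) \<le> (if k = 0 then Re (fcoeff a 0) else 0) + osc i k" for k
   using norm_fcoeff_le[of 0] order_trans[OF norm_ge_zero norm_fcoeff_le] by (auto simp: osc_def power_0_left)
 qed
 thus "norm ((vder ^^ i) (\<lambda>t. complex_of_real (a t)) t) \<le> Re (fcoeff a 0) + sobolev a N + 4*wt_sum"
  using v(2)[of t] W(2) by linarith
qed

lemma sobolev_mono: "M \<le> N \<Longrightarrow> sobolev a M \<le> sobolev a N"
 unfolding sobolev_def
proof (rule infsum_mono[OF sobolev_summable[OF circle_smooth_a] sobolev_summable[OF circle_smooth_a]], rule mult_right_mono)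
 fix k :: int assume "M \<le> N"
 thus "(of_int \<bar>k\<bar> :: real)^(2*M + 3) \<le> of_int \<bar>k\<bar>^(2*N + 3)"
  by (cases "k = 0") (simp_all add: power_increasing power_0_left)
qed simp

lemma sobolev_le_positive_half:
 assumes S: "\<And>K. (\<Sum>k\<in>{2..K}. of_int k^(2*N + 3)*(norm (fcoeff a k))^2) \<le> S"
 shows "sobolev a N \<le> 2*((Re (fcoeff a 0))^2 + S)"
 unfolding sobolev_def
proof (rule infsum_le_finite_sums[OF sobolev_summable[OF circle_smooth_a]])
 fix F :: "int set" assume F: "finite F"
 let ?g = "\<lambda>k. of_int \<bar>k\<bar>^(2*N + 3)*(norm (fcoeff a k))^2"
 define K where "K = Max (insert 1 (abs ` F))"
 have K: "1 \<le> K" "\<And>k. k \<in> F \<Longrightarrow> \<bar>k\<bar> \<le> K" using F by (auto simp: K_def)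
 have "(\<Sum>k\<in>F. ?g k) \<le> (\<Sum>k\<in>{-K..K}. ?g k)" by (rule sum_mono2) (use K(2) in force)+
 also have "... = 2*(\<Sum>k\<in>{1..K}. ?g k)"
  using K(1) by (simp add: sum_symmetric norm_fcoeff_minus power_0_left sum_distrib_left mult_ac)
 also have "{1..K} = insert 1 {2..K}" using K(1) by auto
 hence "(\<Sum>k\<in>{1..K}. ?g k) = (norm (fcoeff a 1))^2 + (\<Sum>k\<in>{2..K}. of_int k^(2*N + 3)*(norm (fcoeff a k))^2)" by simp
 also have "... \<le> (Re (fcoeff a 0))^2 + S" by (intro add_mono power_mono norm_fcoeff_le S) auto
 finally show "(\<Sum>k\<in>F. ?g k) \<le> 2*((Re (fcoeff a 0))^2 + S)" by simp
qed

end

definition near_diagonal :: "int \<Rightarrow> (int \<times> int) set" where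
 "near_diagonal K = {(j, k). 1 \<le> j \<and> j \<le> k \<and> k \<le> K \<and> k \<le> 3*j}"

lemma finite_near_diagonal: "finite (near_diagonal K)"
 by (rule finite_subset[of _ "{1..K} \<times> {1..K}"]) (auto simp: near_diagonal_def)

lemma sum_le_near_diagonal:
 fixes h :: "int \<Rightarrow> real"
 assumes h: "\<And>k. h k \<ge> 0"
 shows "(\<Sum>k\<in>{2..K}. of_int k*h k) \<le> 8*(\<Sum>(j, k)\<in>near_diagonal K. h (j + k))"
proof -
 define I where "I k = {(k + 3) div 4..k div 2}" for k :: int
 have "(\<Sum>k\<in>{2..K}. of_int k*h k) \<le> (\<Sum>k\<in>{2..K}. 8*(\<Sum>j\<in>I k. h k))"
 proof (rule sum_mono)
  fix k assume k: "k \<in> {2..K}"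
  hence "k \<le> 8*(k div 2 + 1 - (k + 3) div 4)" by auto
  also have "... = 8*int (card (I k))" using k by (auto simp: I_def)
  finally have "of_int k \<le> 8*real (card (I k))" by (metis of_int_le_iff of_int_mult of_int_numeral of_int_of_nat_eq)
  from mult_right_mono[OF this h[of k]] show "of_int k*h k \<le> 8*(\<Sum>j\<in>I k. h k)" by simp
 qed
 also have "... = 8*(\<Sum>(k, j)\<in>Sigma {2..K} I. h k)"
  by (subst sum.Sigma[symmetric]) (auto simp: I_def sum_distrib_left)
 also have "(\<Sum>(k, j)\<in>Sigma {2..K} I. h k) = (\<Sum>(j, k)\<in>(\<lambda>(k, j). (j, k - j)) ` Sigma {2..K} I. h (j + k))"
  by (subst sum.reindex) (auto simp: inj_on_def intro!: sum.cong)
 also have "... \<le> (\<Sum>(j, k)\<in>near_diagonal K. h (j + k))"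
 proof (rule sum_mono2[OF finite_near_diagonal])
  show "(\<lambda>(k, j). (j, k - j)) ` Sigma {2..K} I \<subseteq> near_diagonal K" by (auto simp: near_diagonal_def I_def)
 qed (auto simp: h)
 finally show ?thesis by simp
qed

lemma (in speed) sobolev_le_near_diagonal:
 assumes c0: "Re (fcoeff a 0) \<le> c0"
  and weight: "\<And>j k. 1 \<le> j \<Longrightarrow> of_int (j + k) \<le> 4*real_of_int j \<Longrightarrow> of_int (j + k) \<le> 4*real_of_int k \<Longrightarrow>
   (of_int (j + k))^(2*N + 2) \<le> D*weight j k"
  and S: "\<And>K. (\<Sum>(j, k)\<in>near_diagonal K. weight j k*(norm (fcoeff a (j + k)))^2) \<le> S" and D: "D \<ge> 0"
 shows "sobolev a N \<le> 2*(c0^2 + 8*(D*S))"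
proof -
 have "sobolev a N \<le> 2*((Re (fcoeff a 0))^2 + 8*(D*S))"
 proof (rule sobolev_le_positive_half)
  fix K
  let ?h = "\<lambda>k. (of_int k)^(2*N + 2)*(norm (fcoeff a k))^2"
  have "?h k \<ge> 0" for k by (intro mult_nonneg_nonneg zero_le_even_power) auto
  hence "(\<Sum>k\<in>{2..K}. of_int k*?h k) \<le> 8*(\<Sum>(j, k)\<in>near_diagonal K. ?h (j + k))" by (rule sum_le_near_diagonal)
  also have "(\<Sum>(j, k)\<in>near_diagonal K. ?h (j + k)) \<le> (\<Sum>(j, k)\<in>near_diagonal K. D*(weight j k*(norm (fcoeff a (j + k)))^2))"
  proof (rule sum_mono, clarify)
   fix j k assume "(j, k) \<in> near_diagonal K"
   hence "1 \<le> j" "of_int (j + k) \<le> 4*real_of_int j" "of_int (j + k) \<le> 4*real_of_int k"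
    unfolding near_diagonal_def by auto
   from mult_right_mono[OF weight[OF this], of "(norm (fcoeff a (j + k)))^2"]
   show "?h (j + k) \<le> D*(weight j k*(norm (fcoeff a (j + k)))^2)" by (simp only: mult.assoc zero_le_power2)
  qed
  also have "... \<le> D*S" using mult_left_mono[OF S[of K] D] by (simp add: sum_distrib_left case_prod_unfold)
  finally show "(\<Sum>k\<in>{2..K}. of_int k^(2*N + 3)*(norm (fcoeff a k))^2) \<le> 8*(D*S)"
   by (simp add: eval_nat_numeral mult_ac)
 qed
 also have "(Re (fcoeff a 0))^2 \<le> c0^2"
  using c0 norm_fcoeff_le[of 0] norm_ge_zero[of "fcoeff a 0"] by (intro power_mono) linarith+
 finally show ?thesis by simp
qed

lemma (in speed) sobolev_base_bound:
 assumes c0: "Re (fcoeff a 0) \<le> c0"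
 shows "sobolev a 0 \<le> 2*(c0^2 + 8*(16*(Re (zeta a (- of_nat (2*Suc 0)))/4)))"
proof (rule sobolev_le_near_diagonal[OF c0, where weight = "\<lambda>j k. of_int j * of_int k"])
 show "(of_int (j + k))^(2 * 0 + 2) \<le> 16 * (real_of_int j * of_int k)"
  if "1 \<le> j" "of_int (j + k) \<le> 4*real_of_int j" "of_int (j + k) \<le> 4*real_of_int k" for j k
 proof -
  have "real_of_int (j + k) * of_int (j + k) \<le> (4 * of_int j) * (4 * of_int k)" using that by (intro mult_mono) auto
  thus ?thesis by (simp add: power2_eq_square)
 qed
qed (intro quadratic_bound_first finite_near_diagonal, auto simp: near_diagonal_def)

lemma (in speed_bounds) sobolev_step_bound:
 assumes c0: "Re (fcoeff a 0) \<le> c0"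
 shows "sobolev a p \<le> 2*(c0^2 + 8*(4^(2*p + 2)*(M/\<delta>*Z)))"
proof (rule sobolev_le_near_diagonal[OF c0, where weight = "\<lambda>j k. (of_int k)^2*(of_int j)^(2*p)"])
 show "(of_int (j + k))^(2*p + 2) \<le> 4^(2*p + 2)*((real_of_int k)^2*(of_int j)^(2*p))"
  if "1 \<le> j" "of_int (j + k) \<le> 4*real_of_int j" "of_int (j + k) \<le> 4*real_of_int k" for j k
 proof -
  have "(of_int (j + k))^(2 * p + 2) \<le> (4 * real_of_int j)^(2 * p) * (4 * of_int k)^2"
   unfolding power_add using that by (intro mult_mono power_mono) auto
  thus ?thesis by (simp add: power_mult_distrib power_add mult_ac)
 qed
 show "(\<Sum>(j, k)\<in>near_diagonal K. (of_int k)^2*(of_int j)^(2*p)*(norm (fcoeff a (j + k)))^2) \<le> M/\<delta>*Z" for K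
  by (rule quadratic_bound_higher[of _ K]) (auto simp: near_diagonal_def)
qed simp

theorem zeta_controls_sobolev:
 "\<exists>B. \<forall>a. speed a \<longrightarrow> Re (fcoeff a 0) \<le> c0 \<longrightarrow> (\<forall>i\<le>N. Re (zeta a (- of_nat (2*Suc i))) \<le> c i) \<longrightarrow> sobolev a N \<le> B"
proof (induction N)
 case 0
 have "sobolev a 0 \<le> 2*(c0^2 + 8*(16*(c 0/4)))"
  if "speed a" "Re (fcoeff a 0) \<le> c0" "Re (zeta a (- of_nat (2*Suc 0))) \<le> c 0" for a
  using speed.sobolev_base_bound[OF that(1,2)] that(3) by simp
 thus ?case by auto
next
 case (Suc N)
 then obtain H where H: "\<And>a. speed a \<Longrightarrow> Re (fcoeff a 0) \<le> c0 \<Longrightarrow> (\<forall>i\<le>N. Re (zeta a (- of_nat (2*Suc i))) \<le> c i) \<Longrightarrow>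
  sobolev a N \<le> H" by blast
 obtain \<delta> where \<delta>: "\<delta> > 0" "\<And>a t. speed a \<Longrightarrow> sobolev a 0 \<le> H \<Longrightarrow> a t \<ge> \<delta>" using speed_lower_bound by blast
 define D where "D = c0 + H + 4*wt_sum"
 obtain B where B: "\<And>f g. reciprocal_pair \<delta> f g \<Longrightarrow> vders_le N D f \<Longrightarrow> vders_le N B g"
  using vders_le_reciprocal[OF \<delta>(1)] by blast
 define E where "E = 2*(c0^2 + 8*(4^(2*Suc N + 2)*(sobolev_const D B (Suc N)/\<delta>*c (Suc N))))"
 have "sobolev a (Suc N) \<le> E"
  if a: "speed a" "Re (fcoeff a 0) \<le> c0" "\<forall>i\<le>Suc N. Re (zeta a (- of_nat (2*Suc i))) \<le> c i" for a
 proof -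
  interpret speed a by (rule a(1))
  have HN: "sobolev a N \<le> H" using a by (intro H) auto
  have a_ge: "\<delta> \<le> a t" for t using \<delta>(2)[OF a(1)] HN sobolev_mono[of 0 N] by simp
  have D: "vders_le N D (\<lambda>t. complex_of_real (a t))"
  proof (unfold vders_le_def, intro allI impI)
   fix i t assume "i \<le> N"
   hence "norm ((vder ^^ i) (\<lambda>t. complex_of_real (a t)) t) \<le> Re (fcoeff a 0) + sobolev a N + 4*wt_sum"
    using vders_le_sobolev unfolding vders_le_def by blast
   thus "norm ((vder ^^ i) (\<lambda>t. complex_of_real (a t)) t) \<le> D" using HN a(2) unfolding D_def by linarith
  qed
  hence "norm (complex_of_real (a t)) \<le> D" for t unfolding vders_le_def by (metis funpow_0 le0)
  hence a_le: "a t \<le> D" for t using abs_ge_self[of "a t"] order_trans by fastforce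
  have "complex_of_real (a t) * of_real (\<rho> t) = 1" "\<delta> \<le> norm (complex_of_real (a t))" for t
   using a_rho(1)[of t] a_ge[of t] a_pos[of t] by (simp_all flip: of_real_mult)
  hence "reciprocal_pair \<delta> (\<lambda>t. complex_of_real (a t)) (\<lambda>t. complex_of_real (\<rho> t))"
   by (simp add: reciprocal_pair_def circle_smoothD(1) circle_smooth_of_real circle_smooth_a ph.circle_smooth_rho)
  from B[OF this D] have "vders_le N B (\<lambda>t. complex_of_real (\<rho> t))" .
  then interpret speed_bounds a \<delta> D B "Suc N"
   by unfold_locales (use \<delta>(1) a_ge a_le vders_le_mono less_Suc_eq_le in auto)
  have "2*(c0^2 + 8*(4^(2*Suc N + 2)*(M/\<delta>*Z))) \<le> E"
   unfolding E_def M_def[symmetric] using M_nonneg \<delta>(1) a(3) by (intro mult_left_mono add_left_mono) (auto simp: Z_def)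
  with sobolev_step_bound[OF a(2)] show ?thesis by linarith
 qed
 thus ?case by blast
qed

section \<open>Absolutely convergent Fourier series\<close>

lemma norm_vders_le_Cm_norm:
 assumes u: "circle_smooth u" and j: "j \<le> m"
 shows "\<bar>(vder ^^ j) u x\<bar> \<le> Cm_norm m u"
proof -
 let ?S = "\<lambda>j. SUP x\<in>{0..2*pi}. \<bar>(vder ^^ j) u x\<bar>"
 have upper: "\<bar>(vder ^^ j) u x\<bar> \<le> ?S j" if "x \<in> {0..2*pi}" for x j
 proof (rule cSUP_upper[OF that])
  obtain B where "\<And>t. norm ((vder ^^ j) u t) \<le> B" using circle_smooth_bounded[OF circle_smooth_vders[OF u]] by blast
  thus "bdd_above ((\<lambda>x. \<bar>(vder ^^ j) u x\<bar>) ` {0..2*pi})" by (intro bdd_aboveI2[of _ _ B]) simp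
 qed
 have "0 \<le> ?S j" for j using upper[of 0 j] by (rule order_trans[rotated]) auto
 hence "?S j \<le> Cm_norm m u" unfolding Cm_norm_def deriv_eq_vder using j by (intro member_le_sum) auto
 moreover obtain y n where "0 \<le> y" "y < 2*pi" "x = y + 2*pi * of_int n" by (rule periodic_reduce)
 ultimately show ?thesis
  using upper[of y j] periodic_int[OF circle_smoothD(2)[OF circle_smooth_vders[OF u, of j]], of y n] by force
qed

lemma norm_le_Cm_norm: "circle_smooth u \<Longrightarrow> \<bar>u x\<bar> \<le> Cm_norm m u"
 using norm_vders_le_Cm_norm[of u 0 m x] by simp

lemma Cm_norm_nonneg: "circle_smooth u \<Longrightarrow> 0 \<le> Cm_norm m u"
 using order_trans[OF abs_ge_zero norm_le_Cm_norm] .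

lemma Cm_norm_le:
 assumes "\<And>j x. j \<le> m \<Longrightarrow> \<bar>(vder ^^ j) u x\<bar> \<le> B"
 shows "Cm_norm m u \<le> real (Suc m)*B"
proof -
 have "Cm_norm m u \<le> (\<Sum>j\<le>m. B)"
  unfolding Cm_norm_def deriv_eq_vder by (intro sum_mono cSUP_least) (auto intro: assms)
 thus ?thesis by simp
qed

lemma norm_fcoeff_le_Cm_norm:
 assumes u: "circle_smooth u"
 shows "norm (fcoeff u k) \<le> 2^m*Cm_norm m u/wt k^m"
proof -
 have bound: "of_int \<bar>k\<bar>^j*norm (fcoeff u k) \<le> Cm_norm m u" if "j \<le> m" for j
 proof -
  have "of_int \<bar>k\<bar>^j*norm (fcoeff u k) = norm (fourier.cf ((vder ^^ j) (\<lambda>t. complex_of_real (u t))) k)"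
   by (simp add: vders_cf circle_smooth_of_real u norm_mult norm_power fcoeff_eq)
  also have "(vder ^^ j) (\<lambda>t. complex_of_real (u t)) = (\<lambda>t. of_real ((vder ^^ j) u t))"
   by (rule vders_bounded_linear[OF bounded_linear_of_real circle_smoothD(1)[OF u]])
  also have "norm (fourier.cf (\<lambda>t. complex_of_real ((vder ^^ j) u t)) k) \<le> Cm_norm m u"
   by (rule fourier.norm_cf_le)
    (auto intro!: continuous_intros circle_smooth_cont circle_smooth_vders u simp: norm_vders_le_Cm_norm[OF u that])
  finally show ?thesis .
 qed
 have "wt k^m*norm (fcoeff u k) \<le> 2^m*Cm_norm m u"
 proof (cases "k = 0")
  case True
  hence "wt k^m*norm (fcoeff u k) \<le> 1*Cm_norm m u" using bound[of 0] by (simp add: wt_def)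
  also have "... \<le> 2^m*Cm_norm m u" using Cm_norm_nonneg[OF u] by (intro mult_right_mono) auto
  finally show ?thesis .
 next
  case False
  have "wt k^m * norm (fcoeff u k) \<le> (2 * of_int \<bar>k\<bar>)^m * norm (fcoeff u k)"
   using wt_le_double_abs[OF False] by (intro mult_right_mono power_mono) auto
  also have "... = 2^m*(of_int \<bar>k\<bar>^m*norm (fcoeff u k))" by (simp add: power_mult_distrib)
  also have "... \<le> 2^m*Cm_norm m u" by (intro mult_left_mono bound) auto
  finally show ?thesis .
 qed
 thus ?thesis by (simp add: pos_le_divide_eq mult.commute)
qed

definition wiener :: "nat \<Rightarrow> (real \<Rightarrow> complex) \<Rightarrow> real" where
 "wiener m F = (\<Sum>\<^sub>\<infinity>k. wt k^m*norm (fourier.cf F k))"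

lemma has_sum_wiener: "circle_smooth F \<Longrightarrow> ((\<lambda>k. wt k^m*norm (fourier.cf F k)) has_sum wiener m F) UNIV"
 unfolding wiener_def using fourier.cf_summable[of F m] by (intro has_sum_infsum) (simp add: mult.commute)

lemma wiener_nonneg: "0 \<le> wiener m F"
 unfolding wiener_def by (rule infsum_nonneg) simp

lemma wiener_mono: "circle_smooth F \<Longrightarrow> m \<le> n \<Longrightarrow> wiener m F \<le> wiener n F"
 by (rule has_sum_mono[OF has_sum_wiener has_sum_wiener]) (auto intro!: mult_right_mono wt_power_mono)

lemma wiener_linear:
 assumes "circle_smooth F" "circle_smooth G"
 shows "wiener m (\<lambda>t. c*F t + d*G t) \<le> norm c*wiener m F + norm d*wiener m G"
proof (rule has_sum_mono[OF has_sum_wiener has_sum_add[OF has_sum_cmult_right[OF has_sum_wiener] has_sum_cmult_right[OF has_sum_wiener]]])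
 show "wt k^m*norm (fourier.cf (\<lambda>t. c*F t + d*G t) k)
  \<le> norm c*(wt k^m*norm (fourier.cf F k)) + norm d*(wt k^m*norm (fourier.cf G k))" for k
  using mult_left_mono[OF norm_triangle_ineq[of "c*fourier.cf F k" "d*fourier.cf G k"], of "wt k^m"]
  by (simp add: fourier.cf_add fourier.cf_cmult circle_smooth_cont continuous_intros assms norm_mult algebra_simps)
qed (intro circle_smooth_intros assms)+

lemma wiener_sum:
 assumes "finite I" "\<And>i. i \<in> I \<Longrightarrow> circle_smooth (F i)"
 shows "wiener m (\<lambda>t. \<Sum>i\<in>I. c i*F i t) \<le> (\<Sum>i\<in>I. norm (c i)*wiener m (F i))"
 using assms
proof (induction I rule: finite_induct)
 case empty
 show ?case by (simp add: wiener_def fourier.cf_const)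
next
 case (insert x I)
 let ?G = "\<lambda>t. \<Sum>i\<in>I. c i*F i t"
 have "wiener m (\<lambda>t. c x*F x t + 1*?G t) \<le> norm (c x)*wiener m (F x) + norm (1 :: complex)*wiener m ?G"
  using insert by (intro wiener_linear circle_smooth_intros) auto
 thus ?case using insert by simp
qed

lemma cf_mult:
 assumes F: "circle_smooth F" and G: "circle_smooth G"
 shows "((\<lambda>k. fourier.cf F k*fourier.cf G (n - k)) has_sum fourier.cf (\<lambda>t. F t*G t) n) UNIV"
proof -
 define H where "H = (\<lambda>t. fourier.e n t*cnj (G t))"
 have H: "circle_smooth H" unfolding H_def by (intro circle_smooth_intros G)
 have "fourier.cf H k = cnj (fourier.cf G (n - k))" for k
  unfolding H_def fourier.cf_e_mult using fourier.cf_cnj[OF circle_smooth_cont[OF G], of "k - n"] by simp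
 moreover have "mean (\<lambda>t. F t*cnj (H t)) = fourier.cf (\<lambda>t. F t*G t) n"
  unfolding fourier.cf_def H_def by (rule mean_cong) simp
 ultimately show ?thesis using Parseval_fourier[OF F circle_smooth_cont[OF H] circle_smoothD(2)[OF H]] by simp
qed

lemma has_sum_convolution:
 fixes f g :: "int \<Rightarrow> real"
 assumes f: "(f has_sum a) UNIV" "\<And>k. f k \<ge> 0" and g: "(g has_sum b) UNIV" "\<And>k. g k \<ge> 0"
 shows "(\<lambda>k. f k*g (n - k)) summable_on UNIV" "((\<lambda>n. \<Sum>\<^sub>\<infinity>k. f k*g (n - k)) has_sum a*b) UNIV"
proof -
 have "(\<lambda>(k, l). f k*g l) summable_on UNIV \<times> UNIV"
  by (rule summable_on_Times_product) (use f g in \<open>auto simp: summable_on_def\<close>)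
 then obtain S where S: "((\<lambda>(k, l). f k*g l) has_sum S) (UNIV \<times> UNIV)" unfolding summable_on_def by blast
 have "((\<lambda>k. f k*b) has_sum S) UNIV" by (rule has_sum_SigmaD[OF S]) (use has_sum_cmult_right[OF g(1)] in auto)
 hence S_eq: "S = a*b" using has_sum_cmult_left[OF f(1)] has_sum_unique by blast
 have "bij_betw (\<lambda>(n, k). (k, n - k)) (UNIV \<times> UNIV) (UNIV \<times> (UNIV :: int set))"
  by (rule bij_betwI[of _ _ _ "\<lambda>(k, l). (k + l, k)"]) auto
 from has_sum_reindex_bij_betw[OF this, of "\<lambda>(k, l). f k*g l" S]
 have T: "((\<lambda>(n, k). f k*g (n - k)) has_sum S) (UNIV \<times> UNIV)" using S by (simp add: case_prod_unfold)
 show s: "(\<lambda>k. f k*g (n - k)) summable_on UNIV" for n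
  using summable_on_SigmaD1[OF has_sum_imp_summable[OF T]] by auto
 show "((\<lambda>n. \<Sum>\<^sub>\<infinity>k. f k*g (n - k)) has_sum a*b) UNIV"
  unfolding S_eq[symmetric] by (rule has_sum_SigmaD[OF T]) (use s in auto)
qed

lemma wt_submultiplicative: "wt (k + l) \<le> wt k*wt l"
proof -
 have "1 + \<bar>k + l\<bar> \<le> (1 + \<bar>k\<bar>)*(1 + \<bar>l\<bar>)"
  using abs_triangle_ineq[of k l] mult_nonneg_nonneg[of "\<bar>k\<bar>" "\<bar>l\<bar>"] unfolding distrib_left distrib_right by linarith
 thus ?thesis unfolding wt_def of_int_mult[symmetric] of_int_le_iff .
qed

lemma wiener_mult:
 assumes F: "circle_smooth F" and G: "circle_smooth G"
 shows "wiener m (\<lambda>t. F t*G t) \<le> wiener m F*wiener m G"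
proof -
 define f g where "f k = wt k^m*norm (fourier.cf F k)" and "g k = wt k^m*norm (fourier.cf G k)" for k
 have f: "(f has_sum wiener m F) UNIV" "\<And>k. f k \<ge> 0" and g: "(g has_sum wiener m G) UNIV" "\<And>k. g k \<ge> 0"
  unfolding f_def[abs_def] g_def[abs_def] using has_sum_wiener F G by auto
 note conv = has_sum_convolution[OF f g]
 show ?thesis
 proof (rule has_sum_mono[OF has_sum_wiener[OF circle_smooth_mult_complex[OF F G]] conv(2)])
  fix n
  have "norm (of_real (wt n^m)*fourier.cf (\<lambda>t. F t*G t) n) \<le> (\<Sum>\<^sub>\<infinity>k. f k*g (n - k))"
  proof (rule norm_infsum_le[OF has_sum_cmult_right[OF cf_mult[OF F G]] has_sum_infsum[OF conv(1)]])
   fix k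
   have "wt n^m \<le> (wt k*wt (n - k))^m" using wt_submultiplicative[of k "n - k"] by (intro power_mono) auto
   from mult_right_mono[OF this, of "norm (fourier.cf F k)*norm (fourier.cf G (n - k))"]
   show "norm (of_real (wt n^m)*(fourier.cf F k*fourier.cf G (n - k))) \<le> f k*g (n - k)"
    by (simp add: f_def g_def norm_mult norm_power power_mult_distrib mult_ac)
  qed
  thus "wt n^m*norm (fourier.cf (\<lambda>t. F t*G t) n) \<le> (\<Sum>\<^sub>\<infinity>k. f k*g (n - k))" by (simp add: norm_mult norm_power)
 qed
qed

lemma wiener_fmult:
 assumes F: "circle_smooth F" and \<sigma>: "linear_growth \<sigma>"
 shows "wiener m (fmult \<sigma> F) \<le> wiener (Suc m) F"
proof (rule has_sum_mono[OF has_sum_wiener[OF circle_smooth_fmult[OF assms]] has_sum_wiener[OF F]])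
 show "wt k^m*norm (fourier.cf (fmult \<sigma> F) k) \<le> wt k^Suc m*norm (fourier.cf F k)" for k
  using \<sigma> mult_right_mono[of "norm (\<sigma> k)" "wt k" "wt k^m*norm (fourier.cf F k)"]
  by (simp add: cf_fmult[OF assms] norm_mult linear_growth_def mult_ac)
qed

lemma Cm_norm_le_wiener:
 assumes u: "circle_smooth u"
 shows "Cm_norm m u \<le> real (Suc m)*wiener m (\<lambda>t. of_real (u t))"
proof (rule Cm_norm_le)
 fix j x assume j: "j \<le> m"
 note F = circle_smooth_of_real[OF u]
 have "\<bar>(vder ^^ j) u x\<bar> = norm ((vder ^^ j) (\<lambda>t. complex_of_real (u t)) x)"
  by (simp add: vders_bounded_linear[OF bounded_linear_of_real circle_smoothD(1)[OF u]])
 also have "... \<le> (\<Sum>\<^sub>\<infinity>k. of_int \<bar>k\<bar>^j*norm (fourier.cf (\<lambda>t. complex_of_real (u t)) k))" by (rule vders_sup(2)[OF F])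
 also have "... \<le> wiener m (\<lambda>t. of_real (u t))"
 proof (rule has_sum_mono[OF has_sum_infsum[OF vders_sup(1)[OF F]] has_sum_wiener[OF F]], rule mult_right_mono)
  fix k
  have "of_int \<bar>k\<bar>^j \<le> wt k^j" by (intro power_mono) (auto simp: wt_def)
  also have "... \<le> wt k^m" by (rule wt_power_mono[OF j])
  finally show "of_int \<bar>k\<bar>^j \<le> wt k^m" .
 qed simp
 finally show "\<bar>(vder ^^ j) u x\<bar> \<le> wiener m (\<lambda>t. of_real (u t))" .
qed

lemma norm_fmult_le_Cm_norm:
 assumes u: "circle_smooth u" and \<sigma>: "linear_growth \<sigma>"
 shows "norm (fmult \<sigma> (\<lambda>t. of_real (u t)) t) \<le> 8*wt_sum*Cm_norm 3 u"
proof -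
 have "norm (fmult \<sigma> (\<lambda>t. of_real (u t)) t) \<le> 8*Cm_norm 3 u*wt_sum"
 proof (rule norm_infsum_le[OF has_sum_fmult[OF circle_smooth_of_real[OF u] \<sigma>] has_sum_wt])
  fix k
  have "norm (\<sigma> k)*norm (fcoeff u k) \<le> wt k*(2^3*Cm_norm 3 u/wt k^3)"
   using \<sigma> by (intro mult_mono norm_fcoeff_le_Cm_norm u) (auto simp: linear_growth_def)
  thus "norm (\<sigma> k*fourier.cf (\<lambda>t. of_real (u t)) k*fourier.e k t) \<le> 8*Cm_norm 3 u*(1/wt k^2)"
   by (simp add: norm_mult fcoeff_eq[symmetric] power2_eq_square power3_eq_cube)
 qed
 thus ?thesis by (simp add: mult_ac)
qed

section \<open>Differentiation along the flow\<close>

lemma circle_smooth_quotient: "circle_smooth u \<Longrightarrow> circle_smooth v \<Longrightarrow> circle_smooth (\<lambda>t. (u t - v t)/c)"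
 for c :: real
 by (intro circle_smooth_bounded_linear[OF bounded_linear_divide] circle_smooth_diff)

lemma tau_derivsD:
 assumes "tau_derivs alpha dalpha"
 shows "dalpha 0 = alpha" "\<tau> \<ge> 0 \<Longrightarrow> circle_smooth (dalpha k \<tau>)"
 using assms by (auto simp: tau_derivs_def smooth_S_iff)

lemma tau_derivs_functional:
 fixes T :: "(real \<Rightarrow> real) \<Rightarrow> 'b::real_normed_vector"
 assumes td: "tau_derivs alpha dalpha" and \<tau>: "\<tau> \<ge> 0"
  and linear: "\<And>u v c. circle_smooth u \<Longrightarrow> circle_smooth v \<Longrightarrow> T (\<lambda>t. (u t - v t)/c) = (T u - T v) /\<^sub>R c"
  and bounded: "\<And>u. circle_smooth u \<Longrightarrow> norm (T u) \<le> C*Cm_norm m u"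
 shows "((\<lambda>\<tau>. T (dalpha k \<tau>)) has_vector_derivative T (dalpha (Suc k) \<tau>)) (at \<tau> within {0..})"
 unfolding has_vector_derivative_iff_quotient
proof -
 note d = tau_derivsD(2)[OF td]
 define N where "N h = Cm_norm m (\<lambda>t. (dalpha k (\<tau> + h) t - dalpha k \<tau> t)/h - dalpha (Suc k) \<tau> t)" for h
 have "filterlim (\<lambda>x. x - \<tau>) (at 0 within {h. \<tau> + h \<ge> 0}) (at \<tau> within {0..})"
  unfolding filterlim_at by (auto simp: eventually_at_filter intro!: tendsto_eq_intros)
 moreover have "(N \<longlongrightarrow> 0) (at 0 within {h. \<tau> + h \<ge> 0})" using td \<tau> by (auto simp: tau_derivs_def N_def[abs_def])
 ultimately have "((\<lambda>x. N (x - \<tau>)) \<longlongrightarrow> 0) (at \<tau> within {0..})" by (rule filterlim_compose[rotated])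
 hence lim: "((\<lambda>x. C*N (x - \<tau>)) \<longlongrightarrow> 0) (at \<tau> within {0..})" by (rule tendsto_mult_right_zero)
 have bound: "norm ((T (dalpha k x) - T (dalpha k \<tau>)) /\<^sub>R (x - \<tau>) - T (dalpha (Suc k) \<tau>)) \<le> C*N (x - \<tau>)" if x: "x \<ge> 0" for x
 proof -
  define q where "q t = (dalpha k x t - dalpha k \<tau> t)/(x - \<tau>)" for t
  have q: "circle_smooth q" unfolding q_def[abs_def] by (intro circle_smooth_quotient d x \<tau>)
  have "(T (dalpha k x) - T (dalpha k \<tau>)) /\<^sub>R (x - \<tau>) = T q"
   unfolding q_def[abs_def] by (rule linear[OF d[OF x] d[OF \<tau>], symmetric])
  also have "T q - T (dalpha (Suc k) \<tau>) = T (\<lambda>t. q t - dalpha (Suc k) \<tau> t)"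
   using linear[OF q d[OF \<tau>, of "Suc k"], of 1] by simp
  also have "norm ... \<le> C*Cm_norm m (\<lambda>t. q t - dalpha (Suc k) \<tau> t)"
   by (intro bounded circle_smooth_diff q d \<tau>)
  finally show ?thesis by (simp add: N_def q_def)
 qed
 show "((\<lambda>x. (T (dalpha k x) - T (dalpha k \<tau>)) /\<^sub>R (x - \<tau>)) \<longlongrightarrow> T (dalpha (Suc k) \<tau>)) (at \<tau> within {0..})"
  by (rule Lim_transform_bound[THEN LIM_zero_cancel, OF _ lim])
   (auto simp: eventually_at_filter intro!: always_eventually order_trans[OF bound])
qed

lemma fcoeff_quotient:
 assumes "circle_smooth u" "circle_smooth v"
 shows "fcoeff (\<lambda>t. (u t - v t)/c) k = (fcoeff u k - fcoeff v k) /\<^sub>R c"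
proof -
 have cont: "continuous_on UNIV (\<lambda>t. complex_of_real (u t))" "continuous_on UNIV (\<lambda>t. complex_of_real (v t))"
  by (intro circle_smooth_cont circle_smooth_of_real assms)+
 have "fcoeff (\<lambda>t. (u t - v t)/c) k = fourier.cf (\<lambda>t. (1/of_real c)*(of_real (u t) - of_real (v t))) k"
  by (simp add: fcoeff_eq)
 also have "... = (1/of_real c)*(fcoeff u k - fcoeff v k)"
  unfolding fcoeff_eq using cont by (subst fourier.cf_cmult) (auto intro!: continuous_intros simp: fourier.cf_diff)
 finally show ?thesis by (simp add: scaleR_conv_of_real divide_inverse)
qed

lemma continuous_on_apply_bcontfun_Times:
 fixes F :: "'a::metric_space \<Rightarrow> 'b::metric_space \<Rightarrow>\<^sub>C 'c::metric_space"
 assumes F: "continuous_on A F"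
 shows "continuous_on (A \<times> UNIV) (\<lambda>(x, t). apply_bcontfun (F x) t)"
 unfolding continuous_on_iff
proof clarify
 fix x t and e :: real assume x: "x \<in> A" and e: "e > 0"
 obtain d where d: "d > 0" "\<And>y. y \<in> A \<Longrightarrow> dist y x < d \<Longrightarrow> dist (F y) (F x) < e/2"
  using F x e unfolding continuous_on_iff by (metis half_gt_zero)
 obtain d' where d': "d' > 0" "\<And>s. dist s t < d' \<Longrightarrow> dist (apply_bcontfun (F x) s) (apply_bcontfun (F x) t) < e/2"
  using continuous_on_apply_bcontfun[of UNIV "F x"] e unfolding continuous_on_iff by (metis UNIV_I half_gt_zero)
 have "dist (apply_bcontfun (F y) s) (apply_bcontfun (F x) t) < e"
  if y: "y \<in> A" and near: "dist (y, s) (x, t) < min d d'" for y s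
 proof -
  have "dist (F y) (F x) < e/2" "dist (apply_bcontfun (F x) s) (apply_bcontfun (F x) t) < e/2"
   using d(2)[OF y] d'(2)[of s] near dist_fst_le[of "(y, s)" "(x, t)"] dist_snd_le[of "(y, s)" "(x, t)"] by auto
  thus ?thesis
   using dist_bounded[of "F y" s "F x"] dist_triangle[of "apply_bcontfun (F y) s" "apply_bcontfun (F x) t" "apply_bcontfun (F x) s"]
   by linarith
 qed
 thus "\<exists>d>0. \<forall>p\<in>A \<times> UNIV. dist p (x, t) < d \<longrightarrow>
   dist (case p of (x, t) \<Rightarrow> apply_bcontfun (F x) t) (apply_bcontfun (F x) t) < e"
  using d(1) d'(1) by (intro exI[of _ "min d d'"]) auto
qed

lemma tau_derivs_continuous:
 assumes td: "tau_derivs alpha dalpha"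
 shows "continuous_on ({0..} \<times> UNIV) (\<lambda>(\<tau>, t). dalpha k \<tau> t)"
proof -
 have apply_eq: "apply_bcontfun (Bcontfun u) = u" if "circle_smooth u" for u :: "real \<Rightarrow> real"
  by (rule circle_smooth_bounded[OF that])
   (auto intro!: Bcontfun_inverse bcontfun_normI circle_smooth_cont[OF that])
 have "continuous_on {0..} (\<lambda>\<tau>. Bcontfun (dalpha k \<tau>))"
 proof (rule continuous_on_vector_derivative, rule tau_derivs_functional[OF td])
  show "Bcontfun (\<lambda>t. (u t - v t)/c) = (Bcontfun u - Bcontfun v) /\<^sub>R c" if "circle_smooth u" "circle_smooth v" for u v c
   using that by (intro bcontfun_eqI) (simp add: apply_eq circle_smooth_quotient, simp add: divide_inverse mult.commute)
  show "norm (Bcontfun u) \<le> 1*Cm_norm 0 u" if "circle_smooth u" for u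
   using norm_le_Cm_norm[OF that] by (intro norm_bound) (simp add: apply_eq that)
 qed simp
 from continuous_on_apply_bcontfun_Times[OF this] show ?thesis
  by (rule continuous_on_cong[OF refl, THEN iffD1, rotated]) (auto simp: apply_eq tau_derivsD(2)[OF td])
qed

section \<open>Positivity of the energy kernel\<close>

lemma Toeplitz_form:
 assumes b: "continuous_on UNIV b" and I: "finite I"
 shows "(\<Sum>p\<in>I. \<Sum>q\<in>I. fcoeff b (p - q)*Y q*cnj (Y p)) = of_real (mean (\<lambda>t. b t*(norm (\<Sum>q\<in>I. Y q*fourier.e q t))^2))"
proof -
 let ?y = "\<lambda>t. \<Sum>q\<in>I. Y q*fourier.e q t"
 have cf: "fourier.cf (\<lambda>t. of_real (b t)*?y t) p = (\<Sum>q\<in>I. fcoeff b (p - q)*Y q)" for p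
 proof -
  have "fourier.cf (\<lambda>t. of_real (b t) * ?y t) p = fourier.cf (\<lambda>t. \<Sum>q\<in>I. Y q * (fourier.e q t * of_real (b t))) p"
   by (simp add: sum_distrib_left mult_ac)
  also have "... = (\<Sum>q\<in>I. Y q*fcoeff b (p - q))"
   using b by (simp add: fourier.cf_sum fourier.cf_cmult fourier.cf_e_mult continuous_intros fcoeff_eq)
  finally show ?thesis by (simp add: mult.commute)
 qed
 have "of_real (mean (\<lambda>t. b t * (norm (?y t))^2)) = mean (\<lambda>t. of_real (b t) * ?y t * cnj (?y t) * of_real 1)"
  by (subst mean_of_real[symmetric], intro continuous_intros b, rule mean_cong)
   (simp only: of_real_mult complex_norm_square mult.assoc of_real_1 mult_1_right)
 also have "... = (\<Sum>p\<in>I. fourier.cf (\<lambda>t. of_real (b t)*?y t) p*cnj (Y p))"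
  by (rule fourier.mean_pairing_trig_sum) (intro continuous_intros b)
 finally show ?thesis by (simp add: cf sum_distrib_right)
qed

lemma Toeplitz_lower_bound:
 assumes b: "continuous_on UNIV b" "\<And>t. b t \<ge> \<delta>" and I: "finite I"
 shows "\<delta>*(\<Sum>q\<in>I. (norm (Y q))^2) \<le> Re (\<Sum>p\<in>I. \<Sum>q\<in>I. fcoeff b (p - q)*Y q*cnj (Y p))"
proof -
 let ?y = "\<lambda>t. \<Sum>q\<in>I. Y q*fourier.e q t"
 have "\<delta>*(\<Sum>q\<in>I. (norm (Y q))^2) = mean (\<lambda>t. \<delta>*(norm (?y t))^2)"
  using fourier.Parseval_trig_sum[OF I, of Y] by (simp add: mean_cmult continuous_intros)
 also have "... \<le> mean (\<lambda>t. b t*(norm (?y t))^2)"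
  by (intro mean_mono continuous_intros b mult_right_mono) auto
 finally show ?thesis unfolding Toeplitz_form[OF b(1) I] by simp
qed

lemma Schur_product_lower_bound:
 assumes b: "continuous_on UNIV b" "\<And>t. b t \<ge> \<delta>" and I: "finite I" and c: "\<And>i. i \<in> F \<Longrightarrow> c i \<ge> 0"
  and K: "\<And>p q. p \<in> I \<Longrightarrow> q \<in> I \<Longrightarrow> K p q = (\<Sum>i\<in>F. c i*y i p*y i q)"
 shows "\<delta>*(\<Sum>q\<in>I. K q q*(norm (A q))^2) \<le> (\<Sum>p\<in>I. \<Sum>q\<in>I. K p q*Re (fcoeff b (p - q)*A q*cnj (A p)))"
proof -
 let ?h = "\<lambda>p q. Re (fcoeff b (p - q)*A q*cnj (A p))"
 have Re_of_real_mult: "Re (of_real r*z) = r*Re z" for r z by simp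
 have "\<delta>*(\<Sum>q\<in>I. K q q*(norm (A q))^2) = (\<Sum>i\<in>F. c i*(\<delta>*(\<Sum>q\<in>I. (norm (of_real (y i q)*A q))^2)))"
  by (simp add: K norm_mult power_mult_distrib sum_distrib_left sum_distrib_right power2_eq_square mult_ac sum.swap[of _ I])
 also have "... \<le> (\<Sum>i\<in>F. c i*Re (\<Sum>p\<in>I. \<Sum>q\<in>I. fcoeff b (p - q)*(of_real (y i q)*A q)*cnj (of_real (y i p)*A p)))"
  by (intro sum_mono mult_left_mono c Toeplitz_lower_bound b I)
 also have "... = (\<Sum>i\<in>F. \<Sum>p\<in>I. \<Sum>q\<in>I. c i*y i p*y i q*?h p q)"
 proof (rule sum.cong[OF refl])
  fix i
  have "fcoeff b (p - q)*(of_real (y i q)*A q)*cnj (of_real (y i p)*A p)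
    = of_real (y i p*y i q)*(fcoeff b (p - q)*A q*cnj (A p))" for p q by (simp add: mult_ac)
  thus "c i*Re (\<Sum>p\<in>I. \<Sum>q\<in>I. fcoeff b (p - q)*(of_real (y i q)*A q)*cnj (of_real (y i p)*A p))
    = (\<Sum>p\<in>I. \<Sum>q\<in>I. c i*y i p*y i q*?h p q)"
   by (simp only: Re_sum Re_of_real_mult sum_distrib_left mult.assoc)
 qed
 also have "... = (\<Sum>p\<in>I. \<Sum>q\<in>I. \<Sum>i\<in>F. c i*y i p*y i q*?h p q)"
  by (subst sum.swap) (intro sum.cong refl sum.swap)
 also have "... = (\<Sum>p\<in>I. \<Sum>q\<in>I. K p q*?h p q)"
  by (intro sum.cong refl) (simp only: K sum_distrib_right)
 finally show ?thesis .
qed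

definition energy_weight :: "nat \<Rightarrow> int \<Rightarrow> real" where
 "energy_weight N n = (4 * of_int n^3 - of_int n) * of_int n^(2 * N)"

definition energy_kernel :: "nat \<Rightarrow> int \<Rightarrow> int \<Rightarrow> real" where
 "energy_kernel N p q = energy_weight N (min p q) * of_int (2 * max p q - min p q)"

lemma energy_weight_le: "n \<ge> 1 \<Longrightarrow> energy_weight N n \<le> 4 * of_int n^(2 * N + 3)"
 by (simp add: energy_weight_def power_add algebra_simps)

lemma energy_weight_ge:
 assumes "n \<ge> 1" shows "3 * of_int n^(2 * N + 3) \<le> energy_weight N n"
proof -
 have "real_of_int n^1 \<le> of_int n^3" using assms by (intro power_increasing) auto
 hence "3 * real_of_int n^3 * of_int n^(2 * N) \<le> (4 * of_int n^3 - of_int n) * of_int n^(2 * N)"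
  using assms by (intro mult_right_mono) auto
 thus ?thesis using assms by (simp add: energy_weight_def power_add mult_ac)
qed

lemma energy_weight_nonneg: "n \<ge> 0 \<Longrightarrow> energy_weight N n \<ge> 0"
 using energy_weight_ge[of n N] zero_le_power[of "real_of_int n" "2*N + 3"]
 by (cases "n = 0") (simp add: energy_weight_def, linarith)

text \<open>With \<open>x = 2q\<close> and \<open>n = y = 2p\<close> the sum is \<open>(4p\<^sup>3 - p) (2q - p) / 3\<close>, which is where the weights of the energy come from.\<close>

lemma sum_cubic: "12*(\<Sum>k<n. real k*(x - real k)*(y - real k))
  = 6*x*y*real n*(real n - 1) - 2*(x + y)*(real n - 1)*real n*(2*real n - 1) + 3*(real n)^2*(real n - 1)^2"
 by (induction n) (simp_all add: algebra_simps power2_eq_square)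

definition kernel_increment :: "nat \<Rightarrow> nat \<Rightarrow> real" where
 "kernel_increment N l = real (Suc l)^(2*N) - (if l = 0 then 0 else real l^(2*N))"

definition kernel_slope :: "nat \<times> nat \<Rightarrow> int \<Rightarrow> real" where
 "kernel_slope = (\<lambda>(k, l) p. if int k < 2*p \<and> int l < p then of_int (2*p) - real k else 0)"

lemma sum_kernel_increment: "n \<ge> 1 \<Longrightarrow> (\<Sum>l<n. kernel_increment N l) = real n^(2*N)"
 by (induction n rule: dec_induct) (auto simp: kernel_increment_def)

lemma kernel_increment_nonneg: "kernel_increment N l \<ge> 0"
 unfolding kernel_increment_def using power_mono[of "real l" "real (Suc l)" "2*N"] by auto

lemma energy_kernel_eq_sum:
 assumes "p \<in> {1..int P}" "q \<in> {1..int P}"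
 shows "energy_kernel N p q = (\<Sum>i\<in>{..<2*P} \<times> {..<P}.
  (3*real (fst i)*kernel_increment N (snd i))*kernel_slope i p*kernel_slope i q)"
 using assms
proof (induction p q rule: linorder_wlog)
 case (le p q)
 define m where "m = nat p"
 have m: "p = int m" "m \<ge> 1" "m \<le> P" using le by (auto simp: m_def)
 define f where "f k = 3*real k*((of_int (2*p) - real k)*(of_int (2*q) - real k))" for k
 have "4 * (\<Sum>k<2 * m. f k) = 12 * (\<Sum>k<2 * m. real k * (2 * of_int q - real k) * (2 * real m - real k))"
  by (simp add: f_def m(1) sum_distrib_left mult_ac)
 also have "... = 4 * ((4 * real m^3 - real m) * (2 * of_int q - real m))"
  unfolding sum_cubic by (simp add: algebra_simps power2_eq_square power3_eq_cube)
 finally have "energy_kernel N p q = (\<Sum>k<2*m. f k)*(\<Sum>l<m. kernel_increment N l)"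
  using le(1) m by (simp add: energy_kernel_def energy_weight_def sum_kernel_increment)
 also have "... = (\<Sum>(k, l)\<in>{..<2*m} \<times> {..<m}. f k*kernel_increment N l)"
  by (simp add: sum_product sum.cartesian_product)
 also have "... = (\<Sum>i\<in>{..<2*P} \<times> {..<P}. (3*real (fst i)*kernel_increment N (snd i))*kernel_slope i p*kernel_slope i q)"
  by (rule sum.mono_neutral_cong_left) (use le(1) m in \<open>auto simp: f_def kernel_slope_def split: if_splits\<close>)
 finally show ?case .
next
 case (sym p q)
 thus ?case by (simp add: energy_kernel_def min.commute max.commute mult_ac)
qed

lemma energy_kernel_lower_bound:
 assumes b: "continuous_on UNIV b" "\<And>t. b t \<ge> \<delta>" and \<delta>: "\<delta> \<ge> 0"
 shows "\<delta>*(\<Sum>q\<in>{1..int P}. energy_weight N q*(norm (A q))^2)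
  \<le> (\<Sum>p\<in>{1..int P}. \<Sum>q\<in>{1..int P}. energy_kernel N p q*Re (fcoeff b (p - q)*A q*cnj (A p)))"
proof -
 have "energy_weight N q \<le> energy_kernel N q q" if "q \<in> {1..int P}" for q
  using that mult_left_mono[of 1 "real_of_int q" "energy_weight N q"] by (simp add: energy_kernel_def energy_weight_nonneg)
 hence "\<delta>*(\<Sum>q\<in>{1..int P}. energy_weight N q*(norm (A q))^2) \<le> \<delta>*(\<Sum>q\<in>{1..int P}. energy_kernel N q q*(norm (A q))^2)"
  by (intro mult_left_mono sum_mono mult_right_mono \<delta>) auto
 also have "... \<le> (\<Sum>p\<in>{1..int P}. \<Sum>q\<in>{1..int P}. energy_kernel N p q*Re (fcoeff b (p - q)*A q*cnj (A p)))"
  by (rule Schur_product_lower_bound[OF b _ _ energy_kernel_eq_sum]) (auto simp: kernel_increment_nonneg)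
 finally show ?thesis .
qed

lemma nonincreasing_halfline:
 fixes f :: "real \<Rightarrow> real"
 assumes deriv: "\<And>x. x \<ge> 0 \<Longrightarrow> (f has_vector_derivative f' x) (at x within {0..})" "\<And>x. x \<ge> 0 \<Longrightarrow> f' x \<le> 0"
  and x: "x \<ge> 0"
 shows "f x \<le> f 0"
proof (cases "x = 0")
 case False
 have "\<exists>z\<in>{0<..<x}. f x - f 0 = (x - 0) *\<^sub>R f' z"
 proof (rule mvt_simple)
  fix y assume "0 \<le> y" "y \<le> x"
  thus "(f has_derivative (\<lambda>h. h *\<^sub>R f' y)) (at y within {0..x})"
   by (intro has_derivative_subset[OF deriv(1)[unfolded has_vector_derivative_def]]) auto
 qed (use x False in simp)
 then obtain z where "z > 0" "f x - f 0 = x*f' z" by auto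
 thus ?thesis using mult_nonneg_nonpos[OF x deriv(2)[of z]] by simp
qed simp

section \<open>The flow\<close>

abbreviation Hil :: "(real \<Rightarrow> complex) \<Rightarrow> real \<Rightarrow> complex" where "Hil \<equiv> fmult (\<lambda>k. of_int (sgn k))"

abbreviation Dif :: "(real \<Rightarrow> complex) \<Rightarrow> real \<Rightarrow> complex" where "Dif \<equiv> fmult of_int"

lemma Hilb_eq: "Hilb u t = Hil (\<lambda>t. of_real (u t)) t"
 by (simp add: Hilb_def fmult_def fcoeff_eq fourier.e_def)

lemma Dop_eq: "Dop u t = Dif (\<lambda>t. of_real (u t)) t"
 by (simp add: Dop_def fmult_def fcoeff_eq fourier.e_def)

lemma fmult_of_int_mult:
 assumes F: "circle_smooth F" and \<sigma>: "linear_growth \<sigma>"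
 shows "fmult (\<lambda>k. of_int k * \<sigma> k) F t = - \<i> * vder (fmult \<sigma> F) t"
proof (rule fmult_eqI)
 show "circle_smooth (\<lambda>t. - \<i> * vder (fmult \<sigma> F) t)" by (intro circle_smooth_intros circle_smooth_fmult assms)
 have "fourier.cf (\<lambda>t. - \<i> * vder (fmult \<sigma> F) t) k = - \<i> * (\<i> * of_int k * fourier.cf (fmult \<sigma> F) k)" for k
  by (subst fourier.cf_cmult) (simp_all add: circle_smooth_cont circle_smooth_vder circle_smooth_fmult assms cf_vder)
 thus "fourier.cf (\<lambda>t. - \<i> * vder (fmult \<sigma> F) t) k = of_int k * \<sigma> k * fourier.cf F k" for k
  by (simp add: cf_fmult assms flip: mult.assoc)
qed

lemma Dif_eq_vder:
 assumes "circle_smooth F" shows "Dif F t = - \<i> * vder F t"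
proof (rule fmult_eqI)
 show "circle_smooth (\<lambda>t. - \<i> * vder F t)" by (intro circle_smooth_intros assms)
 show "fourier.cf (\<lambda>t. - \<i> * vder F t) k = of_int k * fourier.cf F k" for k
  by (subst fourier.cf_cmult) (simp_all add: circle_smooth_cont circle_smooth_vder assms cf_vder flip: mult.assoc)
qed

lemma Lam_eq_vder_Hil: "circle_smooth F \<Longrightarrow> Lam F t = - \<i> * vder (Hil F) t"
 using fmult_of_int_mult[of F "\<lambda>k. of_int (sgn k)" t] by (simp add: abs_sgn mult.commute flip: of_int_mult)

locale flow =
 fixes alpha :: "real \<Rightarrow> real \<Rightarrow> real" and dalpha
 assumes td: "tau_derivs alpha dalpha" and pos: "\<And>\<tau> t. \<tau> \<ge> 0 \<Longrightarrow> alpha \<tau> t > 0"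
  and mean_inverse_0: "integral {0..2*pi} (\<lambda>t. 1/alpha 0 t) = 2*pi"
  and pde: "\<And>\<tau> t. \<tau> \<ge> 0 \<Longrightarrow> complex_of_real (dalpha 1 \<tau> t) =
   - complex_of_real (alpha \<tau> t)*Lambda (alpha \<tau>) t + Hilb (alpha \<tau>) t*Dop (alpha \<tau>) t"
begin

lemma dalpha_0: "dalpha 0 = alpha" by (rule tau_derivsD(1)[OF td])

lemma circle_smooth_dalpha: "\<tau> \<ge> 0 \<Longrightarrow> circle_smooth (dalpha k \<tau>)" by (rule tau_derivsD(2)[OF td])

lemma circle_smooth_alpha: "\<tau> \<ge> 0 \<Longrightarrow> circle_smooth (alpha \<tau>)" using circle_smooth_dalpha[of \<tau> 0] by (simp add: dalpha_0)

definition cdalpha :: "nat \<Rightarrow> real \<Rightarrow> real \<Rightarrow> complex" where "cdalpha k \<tau> t = of_real (dalpha k \<tau> t)"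

lemma circle_smooth_cdalpha: "\<tau> \<ge> 0 \<Longrightarrow> circle_smooth (cdalpha k \<tau>)"
 unfolding cdalpha_def[abs_def] by (intro circle_smooth_of_real circle_smooth_dalpha)

abbreviation "A \<tau> n \<equiv> fcoeff (alpha \<tau>) n"
abbreviation "A' \<tau> n \<equiv> fcoeff (dalpha 1 \<tau>) n"

lemma A_minus: "\<tau> \<ge> 0 \<Longrightarrow> A \<tau> (- n) = cnj (A \<tau> n)"
 by (intro fcoeff_minus circle_smooth_cont circle_smooth_alpha)

lemma cf_cdalpha: "fourier.cf (cdalpha 0 \<tau>) n = A \<tau> n" "fourier.cf (cdalpha 1 \<tau>) n = A' \<tau> n"
 by (simp_all add: cdalpha_def[abs_def] dalpha_0 fcoeff_eq)

text \<open>The right-hand side of the equation, polarised to a bilinear expression in the \<open>i\<close>-th and \<open>j\<close>-th derivatives.\<close>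

definition rhs :: "nat \<Rightarrow> nat \<Rightarrow> real \<Rightarrow> real \<Rightarrow> complex" where
 "rhs i j \<tau> t = (- 1)*(cdalpha i \<tau> t*Lam (cdalpha j \<tau>) t) + 1*(Hil (cdalpha i \<tau>) t*Dif (cdalpha j \<tau>) t)"

lemma cdalpha_1: "\<tau> \<ge> 0 \<Longrightarrow> cdalpha 1 \<tau> t = rhs 0 0 \<tau> t"
 using pde[of \<tau> t] by (simp add: rhs_def cdalpha_def[abs_def] dalpha_0 Lambda_eq Hilb_eq Dop_eq)

lemma circle_smooth_rhs: "\<tau> \<ge> 0 \<Longrightarrow> circle_smooth (rhs i j \<tau>)"
 unfolding rhs_def[abs_def] by (intro circle_smooth_intros circle_smooth_fmult circle_smooth_cdalpha linear_growth_symbols)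

lemma has_sum_A':
 assumes \<tau>: "\<tau> \<ge> 0"
 shows "((\<lambda>k. A \<tau> k * A \<tau> (n - k) * of_int (sgn k * (n - k) - \<bar>n - k\<bar>)) has_sum A' \<tau> n) UNIV"
proof -
 note u = circle_smooth_cdalpha[OF \<tau>, of 0]
 note s = u circle_smooth_fmult[OF u] linear_growth_symbols
 let ?L = "Lam (cdalpha 0 \<tau>)" and ?H = "Hil (cdalpha 0 \<tau>)" and ?D = "Dif (cdalpha 0 \<tau>)"
 have "A' \<tau> n = fourier.cf (rhs 0 0 \<tau>) n" unfolding cf_cdalpha(2)[symmetric] ext[OF cdalpha_1[OF \<tau>]] ..
 also have "... = (- 1)*fourier.cf (\<lambda>t. cdalpha 0 \<tau> t*?L t) n + 1*fourier.cf (\<lambda>t. ?H t*?D t) n"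
  unfolding rhs_def[abs_def] by (simp only: fourier.cf_add fourier.cf_cmult continuous_on_mult continuous_on_const circle_smooth_cont s)
 finally have "((\<lambda>k. (- 1)*(fourier.cf (cdalpha 0 \<tau>) k*fourier.cf ?L (n - k)) + 1*(fourier.cf ?H k*fourier.cf ?D (n - k)))
   has_sum A' \<tau> n) UNIV" by (auto intro!: has_sum_add has_sum_cmult_right cf_mult s simp only:)
 thus ?thesis by (rule has_sum_cong[THEN iffD1, rotated]) (simp add: cf_fmult[OF u] cf_cdalpha algebra_simps)
qed

text \<open>Only the terms with \<open>k \<le> 0\<close> or \<open>k > n\<close> survive; the terms for \<open>k = -j\<close> and \<open>k = n + j\<close> are combined.\<close>

lemma has_sum_A'_positive:
 assumes \<tau>: "\<tau> \<ge> 0" and n: "n \<ge> 0"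
 shows "((\<lambda>j. of_int (n + 2*j)*A \<tau> (n + j)*cnj (A \<tau> j)) has_sum - (A' \<tau> n + of_int n*A \<tau> 0*A \<tau> n)/2) {1..}"
proof -
 define f where "f k = A \<tau> k * A \<tau> (n - k) * of_int (sgn k * (n - k) - \<bar>n - k\<bar>)" for k
 have f: "(f has_sum A' \<tau> n) UNIV" unfolding f_def by (rule has_sum_A'[OF \<tau>])
 have s: "f summable_on B" for B using has_sum_imp_summable[OF f] summable_on_subset_banach by blast
 have "sum f {0..n} = (\<Sum>k\<in>{0..n}. if k = 0 then f 0 else 0)" by (rule sum.cong) (auto simp: f_def)
 hence middle: "infsum f {0..n} = f 0" using n by (simp add: infsum_finite)
 have "UNIV = {..-1} \<union> {0..n} \<union> {n+1..}" by auto
 hence "A' \<tau> n = infsum f ({..-1} \<union> {0..n} \<union> {n+1..})" using infsumI[OF f] by metis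
 also have "... = infsum f {..-1} + infsum f {0..n} + infsum f {n+1..}"
  using n by (subst infsum_Un_disjoint[OF s s], force, subst infsum_Un_disjoint[OF s s], auto)
 finally have total: "infsum f {..-1} + infsum f {n+1..} = A' \<tau> n - f 0" by (simp add: middle)
 have "bij_betw uminus {1::int..} {..-1}" "bij_betw (\<lambda>j. n + j) {1..} {n+1..}"
  by (rule bij_betwI[of _ _ _ uminus]; simp) (rule bij_betwI[of _ _ _ "\<lambda>k. k - n"]; simp)
 hence "((\<lambda>j. f (- j)) has_sum infsum f {..-1}) {1..}" "((\<lambda>j. f (n + j)) has_sum infsum f {n+1..}) {1..}"
  using has_sum_infsum[OF s] by (auto simp: has_sum_reindex_bij_betw)
 from has_sum_cmult_right[OF has_sum_add[OF this], of "- (1/2)"]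
 have "((\<lambda>j. - (1/2)*(f (- j) + f (n + j))) has_sum - (1/2)*(A' \<tau> n - f 0)) {1..}" unfolding total .
 also have "- (1/2)*(A' \<tau> n - f 0) = - (A' \<tau> n + of_int n*A \<tau> 0*A \<tau> n)/2" using n by (simp add: f_def algebra_simps)
 finally show ?thesis
 proof (rule has_sum_cong[THEN iffD1, rotated])
  fix j :: int assume "j \<in> {1..}"
  thus "- (1/2)*(f (- j) + f (n + j)) = of_int (n + 2*j)*A \<tau> (n + j)*cnj (A \<tau> j)"
   using n A_minus[OF \<tau>, of j] by (simp add: f_def algebra_simps)
 qed
qed

lemma fcoeff_has_derivative:
 "\<tau> \<ge> 0 \<Longrightarrow> ((\<lambda>\<tau>. fcoeff (dalpha k \<tau>) n) has_vector_derivative fcoeff (dalpha (Suc k) \<tau>) n) (at \<tau> within {0..})"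
 by (rule tau_derivs_functional[OF td, of \<tau> "\<lambda>u. fcoeff u n" 1 0])
  (use norm_fcoeff_le_Cm_norm[where m = 0] in \<open>auto simp: fcoeff_quotient\<close>)

lemma dalpha_has_derivative:
 "\<tau> \<ge> 0 \<Longrightarrow> ((\<lambda>\<tau>. dalpha k \<tau> t) has_vector_derivative dalpha (Suc k) \<tau> t) (at \<tau> within {0..})"
 by (rule tau_derivs_functional[OF td, of \<tau> "\<lambda>u. u t" 1 0]) (use norm_le_Cm_norm in \<open>auto simp: divide_inverse\<close>)

lemma mean_value_decreasing:
 assumes "\<tau> \<ge> 0" shows "Re (A \<tau> 0) \<le> Re (A 0 0)"
proof (rule nonincreasing_halfline[OF _ _ assms])
 fix x :: real assume x: "x \<ge> 0"
 show "((\<lambda>\<tau>. Re (A \<tau> 0)) has_vector_derivative Re (A' x 0)) (at x within {0..})"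
  using bounded_linear.has_vector_derivative[OF bounded_linear_Re fcoeff_has_derivative[OF x, of 0 0]]
  by (simp add: dalpha_0)
 have "0 \<le> Re (- (A' x 0 + of_int 0*A x 0*A x 0)/2)"
  by (rule has_sum_nonneg[OF has_sum_Re[OF has_sum_A'_positive[OF x order_refl]]]) (simp add: mult_nonneg_nonneg)
 thus "Re (A' x 0) \<le> 0" by simp
qed

text \<open>The integrand is the derivative of \<open>H\<alpha> / \<alpha>\<close>, since \<open>\<Lambda> = D H\<close>.\<close>

lemma mean_dalpha_quotient:
 assumes \<tau>: "\<tau> \<ge> 0"
 shows "mean (\<lambda>t. dalpha 1 \<tau> t/(alpha \<tau> t)^2) = 0"
proof -
 let ?q = "\<lambda>t. dalpha 1 \<tau> t/(alpha \<tau> t)^2"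
 define u where "u = cdalpha 0 \<tau>"
 define g where "g t = complex_of_real (1/alpha \<tau> t)" for t
 have u: "circle_smooth u" unfolding u_def by (rule circle_smooth_cdalpha[OF \<tau>])
 have H: "circle_smooth (Hil u)" by (simp add: circle_smooth_fmult u)
 have g: "circle_smooth g"
  unfolding g_def[abs_def] by (intro circle_smooth_of_real circle_smooth_inverse circle_smooth_alpha \<tau> pos)
 have ug: "u t*g t = 1" for t using pos[OF \<tau>, of t] by (simp add: u_def cdalpha_def g_def dalpha_0)
 have quotient: "complex_of_real (?q t) = \<i> * vder (\<lambda>t. Hil u t * g t) t" for t
 proof -
  have "complex_of_real (?q t) = cdalpha 1 \<tau> t*(g t*g t)" by (simp add: cdalpha_def g_def power2_eq_square)
  also have "... = - (u t*g t)*(Lam u t*g t) + Hil u t*Dif u t*(g t*g t)"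
   unfolding cdalpha_1[OF \<tau>] rhs_def u_def by (simp add: algebra_simps)
  also have "... = \<i>*(Hil u t*(- vder u t*(g t*g t)) + vder (Hil u) t*g t)"
   unfolding ug Lam_eq_vder_Hil[OF u] Dif_eq_vder[OF u] by (simp add: algebra_simps)
  also have "... = \<i> * vder (\<lambda>t. Hil u t * g t) t"
   unfolding vder_mult[OF circle_smoothD(1)[OF H] circle_smoothD(1)[OF g]]
    vder_reciprocal[OF circle_smoothD(1)[OF u] circle_smoothD(1)[OF g] ug] ..
  finally show ?thesis .
 qed
 note Hg = circle_smooth_mult_complex[OF H g]
 have "mean (vder (\<lambda>t. Hil u t*g t)) = 0"
  by (rule mean_derivative[OF smooth_has_vder[OF circle_smoothD(1)[OF Hg]] circle_smoothD(2)[OF Hg]])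
 hence "mean (\<lambda>t. complex_of_real (?q t)) = 0"
  unfolding quotient by (simp add: mean_cmult circle_smooth_cont circle_smooth_vder[OF Hg])
 moreover have "continuous_on UNIV ?q"
  by (intro continuous_intros circle_smooth_cont circle_smooth_dalpha circle_smooth_alpha \<tau>) (simp add: pos[OF \<tau>] less_imp_neq[symmetric])
 ultimately show ?thesis using mean_of_real by fastforce
qed

lemma mean_inverse_has_derivative:
 assumes \<tau>: "\<tau> \<ge> 0"
 shows "((\<lambda>\<tau>. mean (\<lambda>t. 1/alpha \<tau> t)) has_vector_derivative 0) (at \<tau> within {0..})"
proof -
 have nonzero: "alpha x t \<noteq> 0" if "x \<ge> 0" for x t using pos[OF that] by (simp add: less_imp_neq[symmetric])
 have cont: "continuous_on ({0..} \<times> cbox 0 (2*pi)) (\<lambda>(x, t). dalpha k x t)" for k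
  by (rule continuous_on_subset[OF tau_derivs_continuous[OF td]]) auto
 have "((\<lambda>x. integral (cbox 0 (2*pi)) (\<lambda>t. 1/alpha x t)) has_vector_derivative
   integral (cbox 0 (2*pi)) (\<lambda>t. - (dalpha 1 \<tau> t/(alpha \<tau> t)^2))) (at \<tau> within {0..})"
 proof (rule leibniz_rule_vector_derivative)
  fix x t :: real assume x: "x \<in> {0..}"
  have "((\<lambda>x. alpha x t) has_real_derivative dalpha 1 x t) (at x within {0..})"
   using dalpha_has_derivative[of x 0 t] x by (simp add: dalpha_0 has_real_derivative_iff_has_vector_derivative)
  from DERIV_inverse_fun[OF this nonzero]
  show "((\<lambda>x. 1/alpha x t) has_vector_derivative - (dalpha 1 x t/(alpha x t)^2)) (at x within {0..})"
   using x by (simp add: has_real_derivative_iff_has_vector_derivative[symmetric] divide_inverse power2_eq_square mult_ac)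
  show "(\<lambda>t. 1/alpha x t) integrable_on cbox 0 (2*pi)"
   using x by (intro integrable_continuous continuous_intros circle_smooth_cont circle_smooth_alpha) (auto simp: nonzero)
 next
  have "continuous_on ({0..} \<times> cbox 0 (2*pi)) (\<lambda>p. - ((\<lambda>(x, t). dalpha 1 x t) p/((\<lambda>(x, t). dalpha 0 x t) p)^2))"
   by (intro continuous_intros cont) (auto simp: dalpha_0 nonzero)
  thus "continuous_on ({0..} \<times> cbox 0 (2*pi)) (\<lambda>(x, t). - (dalpha 1 x t/(alpha x t)^2))"
   by (simp add: case_prod_unfold dalpha_0)
 qed (use \<tau> in auto)
 from bounded_linear.has_vector_derivative[OF bounded_linear_scaleR_right this, of "1/(2*pi)"]
 show ?thesis using mean_dalpha_quotient[OF \<tau>] by (simp add: mean_def)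
qed

lemma mean_inverse: "\<tau> \<ge> 0 \<Longrightarrow> mean (\<lambda>t. 1/alpha \<tau> t) = 1"
 using nonincreasing_halfline[OF mean_inverse_has_derivative, of \<tau>]
  nonincreasing_halfline[of "\<lambda>\<tau>. - mean (\<lambda>t. 1/alpha \<tau> t)" "\<lambda>_. 0" \<tau>]
  has_vector_derivative_minus[OF mean_inverse_has_derivative] mean_inverse_0
 by (auto simp: mean_def)

lemma speed_alpha: "\<tau> \<ge> 0 \<Longrightarrow> speed (alpha \<tau>)"
 using mean_inverse[of \<tau>] circle_smooth_alpha[of \<tau>] pos[of \<tau>] by unfold_locales (auto simp: mean_def field_simps smooth_S_iff)

end

section \<open>Dissipation of Sobolev energies\<close>

lemma energy_weight_Cm_norm:
 assumes u: "circle_smooth u"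
 shows "energy_weight N \<bar>n\<bar>*(norm (fcoeff u n))^2 \<le> 4*(2^(N + 3)*Cm_norm (N + 3) u)^2*(1/wt n^2)"
proof -
 have "energy_weight N \<bar>n\<bar> \<le> 4*wt n^(2*N + 4)"
 proof (cases "n = 0")
  case False
  have "energy_weight N \<bar>n\<bar> \<le> 4*wt n^(2*N + 3)"
   using False by (intro order_trans[OF energy_weight_le] mult_left_mono power_mono) (auto simp: wt_def)
  also have "... \<le> 4*wt n^(2*N + 4)" by (intro mult_left_mono wt_power_mono) auto
  finally show ?thesis .
 qed (simp add: energy_weight_def)
 hence "energy_weight N \<bar>n\<bar>*(norm (fcoeff u n))^2 \<le> 4*wt n^(2*N + 4)*(2^(N + 3)*Cm_norm (N + 3) u/wt n^(N + 3))^2"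
  by (intro mult_mono power_mono norm_fcoeff_le_Cm_norm u) auto
 also have "... = 4*(2^(N + 3)*Cm_norm (N + 3) u)^2*(wt n^(2*N + 4)/(wt n^(N + 3))^2)"
  by (simp only: power_divide times_divide_eq_right mult_ac)
 also have "(wt n^(N + 3))^2 = wt n^(2*N + 4)*wt n^2" by (simp flip: power_mult power_add) (simp add: algebra_simps)
 also have "wt n^(2*N + 4)/... = 1/wt n^2" by simp
 finally show ?thesis .
qed

text \<open>The real coefficients for the basis \<open>cas\<close> turn the energy into the square of a norm of \<open>ell2\<close>.\<close>

definition hartley :: "(real \<Rightarrow> real) \<Rightarrow> int \<Rightarrow> real" where "hartley u n = Re (fcoeff u n) + Im (fcoeff u n)"

definition energy_vec :: "nat \<Rightarrow> (real \<Rightarrow> real) \<Rightarrow> ell2" where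
 "energy_vec N u = ell2 (\<lambda>n. sqrt (energy_weight N \<bar>n\<bar>)*hartley u n)"

lemma energy_vec_term_le:
 assumes u: "circle_smooth u"
 shows "(sqrt (energy_weight N \<bar>n\<bar>)*hartley u n)^2 \<le> 8*(2^(N + 3)*Cm_norm (N + 3) u)^2*(1/wt n^2)"
proof -
 have "(hartley u n)^2 \<le> 2*(norm (fcoeff u n))^2"
  using sum_squares_bound[of "Re (fcoeff u n)" "Im (fcoeff u n)"] by (simp add: hartley_def cmod_power2 power2_sum)
 from mult_left_mono[OF this energy_weight_nonneg[of "\<bar>n\<bar>" N]]
 show ?thesis using energy_weight_Cm_norm[OF u, of N n] by (simp add: power_mult_distrib energy_weight_nonneg)
qed

lemma coord_energy_vec:
 assumes u: "circle_smooth u"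
 shows "coord (energy_vec N u) n = sqrt (energy_weight N \<bar>n\<bar>)*hartley u n"
proof -
 have "(\<lambda>n. (sqrt (energy_weight N \<bar>n\<bar>)*hartley u n)^2) summable_on UNIV"
  by (rule wt_dominated(1)[where c = "8*(2^(N + 3)*Cm_norm (N + 3) u)^2"]) (use energy_vec_term_le[OF u] in simp)
 thus ?thesis unfolding energy_vec_def by (simp add: coord_ell2)
qed

lemma norm_energy_vec_le:
 assumes u: "circle_smooth u"
 shows "norm (energy_vec N u) \<le> (sqrt (8*wt_sum)*2^(N + 3))*Cm_norm (N + 3) u"
proof (rule power2_le_imp_le)
 have "(norm (energy_vec N u))^2 \<le> 8*(2^(N + 3)*Cm_norm (N + 3) u)^2*wt_sum"
  by (rule has_sum_mono[OF has_sum_norm_square has_sum_wt]) (use energy_vec_term_le[OF u] coord_energy_vec[OF u] in simp)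
 also have "... = ((sqrt (8*wt_sum)*2^(N + 3))*Cm_norm (N + 3) u)^2" using wt_sum_nonneg by (simp add: power_mult_distrib)
 finally show "(norm (energy_vec N u))^2 \<le> ((sqrt (8*wt_sum)*2^(N + 3))*Cm_norm (N + 3) u)^2" .
qed (simp add: wt_sum_nonneg Cm_norm_nonneg[OF u])

lemma energy_vec_has_derivative:
 assumes "tau_derivs alpha dalpha" "\<tau> \<ge> 0"
 shows "((\<lambda>\<tau>. energy_vec N (dalpha k \<tau>)) has_vector_derivative energy_vec N (dalpha (Suc k) \<tau>)) (at \<tau> within {0..})"
proof (rule tau_derivs_functional[OF assms _ norm_energy_vec_le])
 fix u v :: "real \<Rightarrow> real" and c assume uv: "circle_smooth u" "circle_smooth v"
 show "energy_vec N (\<lambda>t. (u t - v t)/c) = (energy_vec N u - energy_vec N v) /\<^sub>R c" by (intro ell2_eqI)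
   (simp add: coord_energy_vec circle_smooth_quotient uv hartley_def fcoeff_quotient, simp add: algebra_simps)
qed

definition energy :: "nat \<Rightarrow> (real \<Rightarrow> real) \<Rightarrow> real" where
 "energy N u = (\<Sum>\<^sub>\<infinity>n\<in>{1..}. energy_weight N n*(norm (fcoeff u n))^2)"

lemma has_sum_energy_inner:
 assumes u: "circle_smooth u" and v: "circle_smooth v"
 shows "((\<lambda>n. energy_weight N n*Re (fcoeff u n*cnj (fcoeff v n))) has_sum inner (energy_vec N u) (energy_vec N v)/2) {1..}"
proof -
 let ?X = "\<lambda>n. coord (energy_vec N u) n*coord (energy_vec N v) n"
 have "?X 0 = 0" by (simp add: coord_energy_vec u v energy_weight_def)
 from has_sum_cmult_right[OF has_sum_fold[OF has_sum_inner this], of "1/2"]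
 have "((\<lambda>n. 1/2*(?X n + ?X (- n))) has_sum inner (energy_vec N u) (energy_vec N v)/2) {1..}" by simp
 thus ?thesis
 proof (rule has_sum_cong[THEN iffD1, rotated])
  fix n :: int assume "n \<in> {1..}"
  hence w: "sqrt (energy_weight N n) * sqrt (energy_weight N n) = energy_weight N n" by (simp add: energy_weight_nonneg)
  have "1/2*(?X n + ?X (- n))
    = (sqrt (energy_weight N \<bar>n\<bar>) * sqrt (energy_weight N \<bar>n\<bar>)) * Re (fcoeff u n * cnj (fcoeff v n))"
   by (simp add: coord_energy_vec u v hartley_def fcoeff_minus circle_smooth_cont algebra_simps)
  thus "1/2*(?X n + ?X (- n)) = energy_weight N n*Re (fcoeff u n*cnj (fcoeff v n))"
   using w \<open>n \<in> {1..}\<close> by simp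
 qed
qed

lemma energy:
 assumes u: "circle_smooth u"
 shows has_sum_energy: "((\<lambda>n. energy_weight N n*(norm (fcoeff u n))^2) has_sum energy N u) {1..}"
  and energy_eq_inner: "energy N u = inner (energy_vec N u) (energy_vec N u)/2"
proof -
 have "Re (z*cnj z) = (norm z)^2" for z by (simp add: complex_norm_square[symmetric] del: of_real_power)
 hence s: "((\<lambda>n. energy_weight N n*(norm (fcoeff u n))^2) has_sum inner (energy_vec N u) (energy_vec N u)/2) {1..}"
  using has_sum_energy_inner[OF u u, of N] by (simp only:)
 thus e: "energy N u = inner (energy_vec N u) (energy_vec N u)/2" unfolding energy_def by (rule infsumI)
 show "((\<lambda>n. energy_weight N n*(norm (fcoeff u n))^2) has_sum energy N u) {1..}" using s unfolding e .
qed

lemma energy_sobolev: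
 assumes u: "circle_smooth u"
 shows energy_le_sobolev: "energy N u \<le> 4 * sobolev u N" and sobolev_le_energy: "sobolev u N \<le> energy N u"
proof -
 have s: "((\<lambda>n. 2*(of_int n^(2*N + 3)*(norm (fcoeff u n))^2)) has_sum sobolev u N) {1..}"
  unfolding sobolev_def
  by (rule has_sum_cong[THEN iffD1, rotated, OF has_sum_fold[OF has_sum_infsum[OF sobolev_summable[OF u, of "2*N + 3"]]]])
   (auto simp: fcoeff_minus circle_smooth_cont u)
 have "energy N u \<le> 2 * sobolev u N"
 proof (rule has_sum_mono[OF has_sum_energy[OF u] has_sum_cmult_right[OF s]])
  show "energy_weight N n*(norm (fcoeff u n))^2 \<le> 2*(2*(of_int n^(2*N + 3)*(norm (fcoeff u n))^2))" if "n \<in> {1..}" for n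
   using mult_right_mono[OF energy_weight_le[of n N], of "(norm (fcoeff u n))^2"] that by (simp add: mult.assoc)
 qed
 moreover have "3/2 * sobolev u N \<le> energy N u"
 proof (rule has_sum_mono[OF has_sum_cmult_right[OF s] has_sum_energy[OF u]])
  show "3/2*(2*(of_int n^(2*N + 3)*(norm (fcoeff u n))^2)) \<le> energy_weight N n*(norm (fcoeff u n))^2" if "n \<in> {1..}" for n
   using mult_right_mono[OF energy_weight_ge[of n N], of "(norm (fcoeff u n))^2"] that by (simp add: mult_ac)
 qed
 moreover have "0 \<le> sobolev u N" by (rule has_sum_nonneg[OF s]) auto
 ultimately show "energy N u \<le> 4 * sobolev u N" "sobolev u N \<le> energy N u" by auto
qed

text \<open>The factor \<open>2\<close> for \<open>j > 0\<close> accounts for the two entries \<open>(q + j, q)\<close> and \<open>(q, q + j)\<close> of the kernel.\<close>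

definition energy_flux :: "nat \<Rightarrow> (real \<Rightarrow> real) \<Rightarrow> int \<times> int \<Rightarrow> real" where
 "energy_flux N u = (\<lambda>(q, j). (if j = 0 then 1 else 2) * energy_weight N q * of_int (q + 2 * j)
  * Re (fcoeff u (q + j)*cnj (fcoeff u j)*cnj (fcoeff u q)))"

lemma energy_flux_le:
 assumes C: "\<And>n. norm (fcoeff u n) \<le> C/wt n^(2*N + 6)" and q: "q \<ge> 1" and j: "j \<ge> 0"
 shows "\<bar>energy_flux N u (q, j)\<bar> \<le> 16*C^3*(1/wt q^2*(1/wt j^2))"
proof -
 define M where "M = 2*N + 6"
 let ?R = "Re (fcoeff u (q + j)*cnj (fcoeff u j)*cnj (fcoeff u q))" and ?K = "C*(C/wt j^M)*(C/wt q^M)"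
 have C_ge: "C \<ge> 0" using order_trans[OF norm_ge_zero C[of 0]] by (simp add: wt_def)
 have fcoeff_le: "norm (fcoeff u n) \<le> C" for n
  using C[of n] divide_left_mono[OF wt_power_ge_1[of n "2*N + 6"] C_ge] by (simp add: order_trans[rotated])
 have weight: "energy_weight N q \<le> 4*wt q^(2*N + 3)"
  using q by (intro order_trans[OF energy_weight_le] mult_left_mono power_mono) (auto simp: wt_def)
 have linear: "of_int (q + 2*j) \<le> 2*(wt q*wt j)"
  using q j mult_nonneg_nonneg[of "real_of_int q" "of_int j"] by (simp add: wt_def algebra_simps)
 have "\<bar>?R\<bar> \<le> norm (fcoeff u (q + j)*cnj (fcoeff u j)*cnj (fcoeff u q))" by (rule abs_Re_le_cmod)
 also have "... \<le> ?K" unfolding norm_mult complex_mod_cnj M_def using C C_ge fcoeff_le by (intro mult_mono) auto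
 finally have R: "\<bar>?R\<bar> \<le> ?K" .
 have "\<bar>energy_flux N u (q, j)\<bar> = (if j = 0 then 1 else 2) * energy_weight N q * of_int (q + 2 * j) * \<bar>?R\<bar>"
  using q j energy_weight_nonneg[of q N] by (simp add: energy_flux_def abs_mult del: times_complex.simps)
 also have "... \<le> 2*(4*wt q^(2*N + 3))*(2*(wt q*wt j))*?K"
  using q j C_ge by (intro mult_mono weight linear R mult_nonneg_nonneg) (auto simp: energy_weight_nonneg)
 also have "... = 16*C^3*(wt q^(2*N + 4)/wt q^M*(wt j/wt j^M))"
  by (simp add: power3_eq_cube power_add eval_nat_numeral mult_ac)
 also have "... \<le> 16*C^3*(1/wt q^2*(1/wt j^2))"
 proof (intro mult_left_mono mult_mono)
  show "wt q^(2*N + 4)/wt q^M \<le> 1/wt q^2" by (simp add: M_def field_simps flip: power_add)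
  have "wt j^3 \<le> wt j^M" by (rule wt_power_mono) (simp add: M_def)
  thus "wt j/wt j^M \<le> 1/wt j^2" by (simp add: field_simps power2_eq_square power3_eq_cube)
 qed (use C_ge in auto)
 finally show ?thesis .
qed

lemma energy_flux_summable:
 assumes u: "circle_smooth u"
 shows "energy_flux N u summable_on {1..} \<times> {0..}"
proof -
 define C where "C = 2^(2*N + 6)*Cm_norm (2*N + 6) u"
 have "(\<lambda>(q, j). 1/wt q^2*(1/wt j^2)) summable_on {1..} \<times> {0..}"
  by (rule summable_on_Times_product) (auto intro: summable_on_subset_banach[OF summable_wt])
 from summable_on_cmult_right[OF this, of "16*C^3"]
 have "(\<lambda>x. \<bar>energy_flux N u x\<bar>) summable_on {1..} \<times> {0..}"
 proof (rule summable_on_comparison_test)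
  fix x :: "int \<times> int" assume "x \<in> {1..} \<times> {0..}"
  thus "\<bar>energy_flux N u x\<bar> \<le> 16*C^3*(case x of (q, j) \<Rightarrow> 1/wt q^2*(1/wt j^2))"
   using energy_flux_le[of u C N "fst x" "snd x"] norm_fcoeff_le_Cm_norm[OF u] by (auto simp: C_def)
 qed simp
 thus ?thesis by (simp only: summable_on_abs_real_iff)
qed

definition triangle :: "nat \<Rightarrow> (int \<times> int) set" where
 "triangle P = {(q, j). 1 \<le> q \<and> 0 \<le> j \<and> q + j \<le> int P}"

lemma finite_triangle: "finite (triangle P)"
 by (rule finite_subset[of _ "{1..int P} \<times> {0..int P}"]) (auto simp: triangle_def)

lemma sum_square_eq_sum_triangle:
 fixes g :: "int \<Rightarrow> int \<Rightarrow> real"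
 shows "(\<Sum>p\<in>{1..int P}. \<Sum>q\<in>{1..int P}. g p q) = (\<Sum>(q, j)\<in>triangle P. if j = 0 then g q q else g (q + j) q + g q (q + j))"
proof -
 let ?lower = "{(p, q). 1 \<le> q \<and> q \<le> p \<and> p \<le> int P}" and ?upper = "{(p, q). 1 \<le> p \<and> p < q \<and> q \<le> int P}"
 have "finite ?lower" "finite ?upper" by (rule finite_subset[of _ "{1..int P} \<times> {1..int P}"]; auto)+
 moreover have "{1..int P} \<times> {1..int P} = ?lower \<union> ?upper" "?lower \<inter> ?upper = {}" by auto
 ultimately have "(\<Sum>p\<in>{1..int P}. \<Sum>q\<in>{1..int P}. g p q) = (\<Sum>(p, q)\<in>?lower. g p q) + (\<Sum>(p, q)\<in>?upper. g p q)"
  by (simp add: sum.cartesian_product sum.union_disjoint)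
 also have "(\<Sum>(p, q)\<in>?lower. g p q) = (\<Sum>(q, j)\<in>triangle P. g (q + j) q)"
  by (rule sum.reindex_bij_witness[of _ "\<lambda>(q, j). (q + j, q)" "\<lambda>(p, q). (q, p - q)"]) (auto simp: triangle_def)
 also have "(\<Sum>(p, q)\<in>?upper. g p q) = (\<Sum>(q, j)\<in>triangle P \<inter> {(q, j). j \<noteq> 0}. g q (q + j))"
  by (rule sum.reindex_bij_witness[of _ "\<lambda>(q, j). (q, q + j)" "\<lambda>(p, q). (p, q - p)"]) (auto simp: triangle_def)
 also have "... = (\<Sum>(q, j)\<in>triangle P. if j \<noteq> 0 then g q (q + j) else 0)"
  using finite_triangle[of P] by (subst sum.inter_restrict) (auto intro!: sum.cong)
 finally show ?thesis unfolding sum.distrib[symmetric] by (auto intro!: sum.cong)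
qed

lemma energy_flux_lower_bound:
 assumes u: "circle_smooth u" "\<And>t. u t \<ge> \<delta>" and \<delta>: "\<delta> \<ge> 0"
 shows "\<delta>*energy N u \<le> infsum (energy_flux N u) ({1..} \<times> {0..})"
proof (rule LIMSEQ_le)
 note cont = circle_smooth_cont[OF u(1)]
 show "(\<lambda>P. sum (energy_flux N u) (triangle P)) \<longlonglongrightarrow> infsum (energy_flux N u) ({1..} \<times> {0..})"
 proof (rule has_sum_exhaust[OF has_sum_infsum[OF energy_flux_summable[OF u(1)]] finite_triangle])
  fix x :: "int \<times> int" assume "x \<in> {1..} \<times> {0..}"
  thus "\<forall>\<^sub>F P in sequentially. x \<in> triangle P"
   using eventually_ge_nat_int[of "fst x + snd x"] by (auto simp: triangle_def elim: eventually_mono)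
 qed (auto simp: triangle_def)
 show "(\<lambda>P. \<delta>*(\<Sum>q\<in>{1..int P}. energy_weight N q*(norm (fcoeff u q))^2)) \<longlonglongrightarrow> \<delta>*energy N u"
  by (intro tendsto_mult_left tendsto_positive_sum has_sum_energy u)
 define g where "g p q = energy_kernel N p q*Re (fcoeff u (p - q)*fcoeff u q*cnj (fcoeff u p))" for p q
 have minus: "fcoeff u (- n) = cnj (fcoeff u n)" for n by (rule fcoeff_minus[OF cont])
 have "energy_flux N u (q, j) = (if j = 0 then g q q else g (q + j) q + g q (q + j))" if "q \<ge> 1" "j \<ge> 0" for q j
  using that minus[of j] by (auto simp: energy_flux_def g_def energy_kernel_def min_def max_def algebra_simps)
 hence "sum (energy_flux N u) (triangle P) = (\<Sum>p\<in>{1..int P}. \<Sum>q\<in>{1..int P}. g p q)" for P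
  unfolding sum_square_eq_sum_triangle by (auto intro!: sum.cong simp: triangle_def)
 thus "\<exists>P0. \<forall>P\<ge>P0. \<delta>*(\<Sum>q\<in>{1..int P}. energy_weight N q*(norm (fcoeff u q))^2) \<le> sum (energy_flux N u) (triangle P)"
  using energy_kernel_lower_bound[OF cont u(2) \<delta>, of N "fcoeff u"] unfolding g_def by simp
qed

context flow
begin

lemma energy_flux_slice:
 assumes \<tau>: "\<tau> \<ge> 0" and q: "q \<ge> 1"
 shows "((\<lambda>j. energy_flux N (alpha \<tau>) (q, j)) has_sum - (energy_weight N q*Re (A' \<tau> q*cnj (A \<tau> q)))) {0..}"
proof -
 let ?f = "\<lambda>j. energy_flux N (alpha \<tau>) (q, j)"
 let ?B = "of_real (2*energy_weight N q)*cnj (A \<tau> q)*(- (A' \<tau> q + of_int q*A \<tau> 0*A \<tau> q)/2)"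
 have "((\<lambda>j. of_real (2*energy_weight N q)*cnj (A \<tau> q)*(of_int (q + 2*j)*A \<tau> (q + j)*cnj (A \<tau> j))) has_sum ?B) {1..}"
  by (intro has_sum_cmult_right has_sum_A'_positive \<tau>) (use q in simp)
 from has_sum_Re[OF this] have "(?f has_sum Re ?B) {1..}"
  by (rule has_sum_cong[THEN iffD1, rotated]) (simp add: energy_flux_def algebra_simps)
 moreover have "{0..} = insert (0::int) {1..}" by auto
 ultimately have "(?f has_sum ?f 0 + Re ?B) {0..}" using has_sum_insert[of 0 "{1..}" ?f] by simp
 also have "?f 0 + Re ?B = - (energy_weight N q*Re (A' \<tau> q*cnj (A \<tau> q)))"
  using A_minus[OF \<tau>, of 0] by (simp add: energy_flux_def complex_eq_iff field_simps)
 finally show ?thesis .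
qed

lemma energy_has_derivative:
 assumes \<tau>: "\<tau> \<ge> 0"
 shows "((\<lambda>\<tau>. energy N (alpha \<tau>)) has_vector_derivative - 2*infsum (energy_flux N (alpha \<tau>)) ({1..} \<times> {0..})) (at \<tau> within {0..})"
proof -
 let ?v = "\<lambda>k \<tau>. energy_vec N (dalpha k \<tau>)"
 have "((\<lambda>q. - (energy_weight N q*Re (A' \<tau> q*cnj (A \<tau> q)))) has_sum infsum (energy_flux N (alpha \<tau>)) ({1..} \<times> {0..})) {1..}"
  by (rule has_sum_SigmaD[OF has_sum_infsum[OF energy_flux_summable[OF circle_smooth_alpha[OF \<tau>]]]])
   (use energy_flux_slice[OF \<tau>] in auto)
 moreover have "((\<lambda>q. - (energy_weight N q*Re (A' \<tau> q*cnj (A \<tau> q)))) has_sum - (inner (?v 1 \<tau>) (?v 0 \<tau>)/2)) {1..}"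
  using has_sum_energy_inner[OF circle_smooth_dalpha[OF \<tau>, of 1] circle_smooth_alpha[OF \<tau>], of N]
  by (simp add: has_sum_uminus dalpha_0)
 ultimately have flux: "- 2*infsum (energy_flux N (alpha \<tau>)) ({1..} \<times> {0..}) = inner (?v 1 \<tau>) (?v 0 \<tau>)"
  using has_sum_unique by fastforce
 have "((\<lambda>\<tau>. inner (?v 0 \<tau>) (?v 0 \<tau>)) has_vector_derivative inner (?v 0 \<tau>) (?v 1 \<tau>) + inner (?v 1 \<tau>) (?v 0 \<tau>)) (at \<tau> within {0..})"
  using bounded_bilinear.has_vector_derivative[OF bounded_bilinear_inner energy_vec_has_derivative[OF td \<tau>] energy_vec_has_derivative[OF td \<tau>]]
  by simp
 from bounded_linear.has_vector_derivative[OF bounded_linear_divide this, of 2]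
 have "((\<lambda>\<tau>. inner (?v 0 \<tau>) (?v 0 \<tau>)/2) has_vector_derivative inner (?v 1 \<tau>) (?v 0 \<tau>)) (at \<tau> within {0..})"
  by (simp add: inner_commute)
 thus ?thesis unfolding flux
  by (rule has_vector_derivative_transform[rotated 2]) (use \<tau> in \<open>auto simp: energy_eq_inner circle_smooth_alpha dalpha_0\<close>)
qed

theorem energy_decay:
 assumes \<delta>: "\<And>\<tau> t. \<tau> \<ge> 0 \<Longrightarrow> alpha \<tau> t \<ge> \<delta>" "\<delta> \<ge> 0" and \<tau>: "\<tau> \<ge> 0"
 shows "energy N (alpha \<tau>) \<le> exp (- 2*\<delta>*\<tau>)*energy N (alpha 0)"
proof -
 define flux where "flux x = infsum (energy_flux N (alpha x)) ({1..} \<times> {0..})" for x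
 have "energy N (alpha \<tau>)*exp (2*\<delta>*\<tau>) \<le> energy N (alpha 0)*exp (2*\<delta>*0)"
 proof (rule nonincreasing_halfline[OF _ _ \<tau>])
  fix x :: real assume x: "x \<ge> 0"
  have "((\<lambda>x. exp (2*\<delta>*x)) has_real_derivative exp (2*\<delta>*x)*(2*\<delta>)) (at x within {0..})"
   by (auto intro!: derivative_eq_intros)
  hence "((\<lambda>x. exp (2*\<delta>*x)) has_vector_derivative exp (2*\<delta>*x)*(2*\<delta>)) (at x within {0..})"
   by (simp add: has_real_derivative_iff_has_vector_derivative)
  from has_vector_derivative_mult[OF energy_has_derivative[OF x] this]
  show "((\<lambda>\<tau>. energy N (alpha \<tau>)*exp (2*\<delta>*\<tau>)) has_vector_derivative
    energy N (alpha x)*(exp (2*\<delta>*x)*(2*\<delta>)) + - 2*flux x*exp (2*\<delta>*x)) (at x within {0..})"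
   unfolding flux_def .
  have "\<delta>*energy N (alpha x) \<le> flux x"
   unfolding flux_def by (rule energy_flux_lower_bound[OF circle_smooth_alpha[OF x] \<delta>(1)[OF x] \<delta>(2)])
  hence "2*exp (2*\<delta>*x)*(\<delta>*energy N (alpha x)) \<le> 2*exp (2*\<delta>*x)*flux x" by (intro mult_left_mono) auto
  thus "energy N (alpha x)*(exp (2*\<delta>*x)*(2*\<delta>)) + - 2*flux x*exp (2*\<delta>*x) \<le> 0" by (simp add: algebra_simps)
 qed
 thus ?thesis by (simp add: exp_minus field_simps)
qed

end

section \<open>Higher derivatives along the flow\<close>

lemma Leibniz_shift:
 fixes T :: "nat \<Rightarrow> nat \<Rightarrow> complex"
 shows "(\<Sum>i\<le>k. of_nat (k choose i)*(T (Suc i) (k - i) + T i (Suc (k - i)))) = (\<Sum>i\<le>Suc k. of_nat (Suc k choose i)*T i (Suc k - i))"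
proof -
 have "(\<Sum>i\<le>k. of_nat (k choose i)*T i (Suc (k - i))) = (\<Sum>i\<le>Suc k. of_nat (k choose i)*T i (Suc k - i))"
  by (simp add: Suc_diff_le binomial_eq_0)
 also have "... = T 0 (Suc k) + (\<Sum>i\<le>k. of_nat (k choose Suc i)*T (Suc i) (k - i))" by (subst sum.atMost_Suc_shift) simp
 finally have "(\<Sum>i\<le>k. of_nat (k choose i)*(T (Suc i) (k - i) + T i (Suc (k - i))))
   = T 0 (Suc k) + (\<Sum>i\<le>k. of_nat (Suc k choose Suc i)*T (Suc i) (k - i))"
  by (simp add: distrib_left distrib_right sum.distrib)
 thus ?thesis by (subst sum.atMost_Suc_shift) simp
qed

context flow
begin

lemma cdalpha_has_derivative:
 "\<tau> \<ge> 0 \<Longrightarrow> ((\<lambda>\<tau>. cdalpha k \<tau> t) has_vector_derivative cdalpha (Suc k) \<tau> t) (at \<tau> within {0..})"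
 unfolding cdalpha_def by (rule bounded_linear.has_vector_derivative[OF bounded_linear_of_real dalpha_has_derivative])

lemma fmult_cdalpha_has_derivative:
 assumes \<tau>: "\<tau> \<ge> 0" and \<sigma>: "linear_growth \<sigma>"
 shows "((\<lambda>\<tau>. fmult \<sigma> (cdalpha k \<tau>) t) has_vector_derivative fmult \<sigma> (cdalpha (Suc k) \<tau>) t) (at \<tau> within {0..})"
 unfolding cdalpha_def[abs_def]
proof (rule tau_derivs_functional[OF td \<tau> _ norm_fmult_le_Cm_norm[OF _ \<sigma>]])
 fix u v :: "real \<Rightarrow> real" and c assume uv: "circle_smooth u" "circle_smooth v"
 let ?\<Phi> = "\<lambda>u. fmult \<sigma> (\<lambda>t. complex_of_real (u t)) t"
 have "?\<Phi> (\<lambda>t. (u t - v t)/c) = fmult \<sigma> (\<lambda>t. of_real (1/c) * of_real (u t) + of_real (- 1/c) * of_real (v t)) t"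
  by (rule arg_cong[of _ _ "\<lambda>F. fmult \<sigma> F t"]) (simp add: fun_eq_iff diff_divide_distrib)
 also have "... = of_real (1/c)*?\<Phi> u + of_real (- 1/c)*?\<Phi> v"
  by (intro fmult_linear circle_smooth_of_real uv \<sigma>)
 finally show "?\<Phi> (\<lambda>t. (u t - v t)/c) = (?\<Phi> u - ?\<Phi> v) /\<^sub>R c"
  by (simp add: scaleR_conv_of_real divide_inverse algebra_simps)
qed

lemma rhs_has_derivative:
 assumes \<tau>: "\<tau> \<ge> 0"
 shows "((\<lambda>\<tau>. rhs i j \<tau> t) has_vector_derivative rhs (Suc i) j \<tau> t + rhs i (Suc j) \<tau> t) (at \<tau> within {0..})"
proof -
 note d = fmult_cdalpha_has_derivative[OF \<tau>, of _ _ t] linear_growth_symbols cdalpha_has_derivative[OF \<tau>, of _ t]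
 have "((\<lambda>\<tau>. - (cdalpha i \<tau> t*Lam (cdalpha j \<tau>) t) + Hil (cdalpha i \<tau>) t*Dif (cdalpha j \<tau>) t) has_vector_derivative
   - (cdalpha i \<tau> t*Lam (cdalpha (Suc j) \<tau>) t + cdalpha (Suc i) \<tau> t*Lam (cdalpha j \<tau>) t)
   + (Hil (cdalpha i \<tau>) t*Dif (cdalpha (Suc j) \<tau>) t + Hil (cdalpha (Suc i) \<tau>) t*Dif (cdalpha j \<tau>) t)) (at \<tau> within {0..})"
  by (intro has_vector_derivative_add has_vector_derivative_minus has_vector_derivative_mult d)
 thus ?thesis by (simp add: rhs_def algebra_simps)
qed

lemma cdalpha_Suc: "\<tau> \<ge> 0 \<Longrightarrow> cdalpha (Suc k) \<tau> t = (\<Sum>i\<le>k. of_nat (k choose i)*rhs i (k - i) \<tau> t)"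
proof (induction k arbitrary: \<tau>)
 case 0
 thus ?case using cdalpha_1[OF 0, of t] by simp
next
 case (Suc k)
 have "((\<lambda>\<tau>. cdalpha (Suc k) \<tau> t) has_vector_derivative
   (\<Sum>i\<le>k. of_nat (k choose i)*(rhs (Suc i) (k - i) \<tau> t + rhs i (Suc (k - i)) \<tau> t))) (at \<tau> within {0..})"
 proof (rule has_vector_derivative_transform)
  show "((\<lambda>\<tau>. \<Sum>i\<le>k. of_nat (k choose i)*rhs i (k - i) \<tau> t) has_vector_derivative
    (\<Sum>i\<le>k. of_nat (k choose i)*(rhs (Suc i) (k - i) \<tau> t + rhs i (Suc (k - i)) \<tau> t))) (at \<tau> within {0..})"
   by (intro has_vector_derivative_sum bounded_linear.has_vector_derivative[OF bounded_linear_mult_right]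
    rhs_has_derivative Suc.prems)
 qed (use Suc in auto)
 moreover have "at \<tau> within {0..} \<noteq> bot"
 proof -
  have "{\<tau><..} \<subseteq> {0..}" using Suc.prems by auto
  from at_le[OF this, of \<tau>] show ?thesis using trivial_limit_at_right_real[of \<tau>] bot_unique by metis
 qed
 ultimately show ?case
  using cdalpha_has_derivative[OF Suc.prems, of "Suc k" t] unfolding Leibniz_shift[of k "\<lambda>i j. rhs i j \<tau> t"]
  by (blast intro: vector_derivative_unique_within)
qed

lemma wiener_rhs:
 assumes \<tau>: "\<tau> \<ge> 0"
 shows "wiener m (rhs i j \<tau>) \<le> 2*(wiener (Suc m) (cdalpha i \<tau>)*wiener (Suc m) (cdalpha j \<tau>))"
proof -
 note s = circle_smooth_cdalpha[OF \<tau>] circle_smooth_fmult linear_growth_symbols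
 let ?L = "\<lambda>t. cdalpha i \<tau> t*Lam (cdalpha j \<tau>) t" and ?H = "\<lambda>t. Hil (cdalpha i \<tau>) t*Dif (cdalpha j \<tau>) t"
 let ?W = "wiener (Suc m) (cdalpha i \<tau>)*wiener (Suc m) (cdalpha j \<tau>)"
 have "wiener m ?L \<le> wiener m (cdalpha i \<tau>)*wiener m (Lam (cdalpha j \<tau>))" by (intro wiener_mult s)
 also have "... \<le> ?W" by (intro mult_mono wiener_mono wiener_fmult wiener_nonneg s) simp
 finally have Lam: "wiener m ?L \<le> ?W" .
 have "wiener m ?H \<le> wiener m (Hil (cdalpha i \<tau>))*wiener m (Dif (cdalpha j \<tau>))" by (intro wiener_mult s)
 also have "... \<le> ?W" by (intro mult_mono wiener_fmult wiener_nonneg s)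
 finally have Hil: "wiener m ?H \<le> ?W" .
 have "wiener m (rhs i j \<tau>) \<le> norm (- 1 :: complex)*wiener m ?L
   + norm (1 :: complex)*wiener m ?H" unfolding rhs_def[abs_def] by (intro wiener_linear circle_smooth_mult_complex s)
 thus ?thesis using Lam Hil by simp
qed

end

lemma wiener_cdalpha_bound:
 "\<exists>C. \<forall>alpha dalpha. flow alpha dalpha \<longrightarrow> (\<forall>\<tau>\<ge>0. wiener (k + m) (flow.cdalpha dalpha 0 \<tau>) \<le> B)
  \<longrightarrow> (\<forall>\<tau>\<ge>0. wiener m (flow.cdalpha dalpha k \<tau>) \<le> C)"
proof (induction k arbitrary: m rule: less_induct)
 case (less k)
 show ?case
 proof (cases k)
  case 0 thus ?thesis by auto
 next
  case (Suc l)
  have "\<forall>i. \<exists>C. i \<le> l \<longrightarrow> (\<forall>alpha dalpha. flow alpha dalpha \<longrightarrow> (\<forall>\<tau>\<ge>0. wiener (i + Suc m) (flow.cdalpha dalpha 0 \<tau>) \<le> B)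
    \<longrightarrow> (\<forall>\<tau>\<ge>0. wiener (Suc m) (flow.cdalpha dalpha i \<tau>) \<le> C))"
   using less.IH[of _ "Suc m"] by (simp add: Suc less_Suc_eq_le)
  then obtain C where C: "\<And>i alpha dalpha \<tau>. i \<le> l \<Longrightarrow> flow alpha dalpha
    \<Longrightarrow> (\<forall>\<tau>\<ge>0. wiener (i + Suc m) (flow.cdalpha dalpha 0 \<tau>) \<le> B) \<Longrightarrow> \<tau> \<ge> 0 \<Longrightarrow> wiener (Suc m) (flow.cdalpha dalpha i \<tau>) \<le> C i"
   by metis
  let ?C = "\<Sum>i\<le>l. real (l choose i)*(2*(C i*C (l - i)))"
  have "wiener m (flow.cdalpha dalpha k \<tau>) \<le> ?C"
   if f: "flow alpha dalpha" and B: "\<forall>\<tau>\<ge>0. wiener (k + m) (flow.cdalpha dalpha 0 \<tau>) \<le> B" and \<tau>: "\<tau> \<ge> 0" for alpha dalpha \<tau>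
  proof -
   interpret flow alpha dalpha by (rule f)
   have "wiener (i + Suc m) (cdalpha 0 x) \<le> wiener (k + m) (cdalpha 0 x)" if "i \<le> l" "x \<ge> 0" for i x
    using that by (intro wiener_mono circle_smooth_cdalpha) (simp_all add: Suc)
   hence lower: "wiener (Suc m) (cdalpha i \<tau>) \<le> C i" if "i \<le> l" for i
    using C[OF that f _ \<tau>] B that by (meson order_trans)
   have Leibniz: "cdalpha k \<tau> = (\<lambda>t. \<Sum>i\<le>l. of_nat (l choose i)*rhs i (l - i) \<tau> t)"
    unfolding Suc by (rule ext) (rule cdalpha_Suc[OF \<tau>])
   have "wiener m (cdalpha k \<tau>) \<le> (\<Sum>i\<le>l. norm (of_nat (l choose i) :: complex)*wiener m (rhs i (l - i) \<tau>))"
    unfolding Leibniz by (intro wiener_sum circle_smooth_rhs \<tau>) simp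
   also have "... \<le> (\<Sum>i\<le>l. norm (of_nat (l choose i) :: complex)*(2*(C i*C (l - i))))"
    by (intro sum_mono mult_left_mono order_trans[OF wiener_rhs[OF \<tau>]] mult_mono lower wiener_nonneg
     order_trans[OF wiener_nonneg lower]) auto
   finally show ?thesis by simp
  qed
  thus ?thesis by (intro exI[of _ ?C]) blast
 qed
qed

section \<open>Uniform bounds and convergence\<close>

context speed
begin

lemma wiener_le_sobolev:
 assumes cf: "\<And>k. fourier.cf F k = fcoeff a k - (if k = 0 then z else 0)" and F: "circle_smooth F"
  and m: "m \<le> N" and \<epsilon>: "\<epsilon> > 0"
 shows "wiener m F \<le> norm (fcoeff a 0 - z) + 2^m*(sobolev a N/\<epsilon> + \<epsilon>*(4*wt_sum))"
proof -
 note osc = osc_bound[OF m \<epsilon>]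
 have zero: "((\<lambda>k::int. if k = 0 then norm (fcoeff a 0 - z) else 0) has_sum norm (fcoeff a 0 - z)) UNIV"
  by (rule has_sum_finite_neutralI[of "{0}"]) auto
 have "wiener m F \<le> norm (fcoeff a 0 - z) + 2^m*infsum (osc m) UNIV"
 proof (rule has_sum_mono[OF has_sum_wiener[OF F] has_sum_add[OF zero has_sum_cmult_right[OF has_sum_infsum[OF osc(1)]]]])
  fix k
  show "wt k^m * norm (fourier.cf F k) \<le> (if k = 0 then norm (fcoeff a 0 - z) else 0) + 2^m * osc m k"
  proof (cases "k = 0")
   case False
   have "wt k^m * norm (fcoeff a k) \<le> (2 * of_int \<bar>k\<bar>)^m * norm (fcoeff a k)"
    using wt_le_double_abs[OF False] by (intro mult_right_mono power_mono) auto
   thus ?thesis using False by (simp add: cf osc_def power_mult_distrib mult.assoc)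
  qed (simp add: cf osc_def wt_def)
 qed
 also have "... \<le> norm (fcoeff a 0 - z) + 2^m*(sobolev a N/\<epsilon> + \<epsilon>*(4*wt_sum))" by (intro add_mono mult_left_mono osc) auto
 finally show ?thesis .
qed

lemma fcoeff_0_real: "fcoeff a 0 = of_real (Re (fcoeff a 0))"
 using fcoeff_minus[OF continuous_a, of 0] by (simp add: complex_eq_iff)

lemma lower_bound_le_1:
 assumes "\<And>t. m \<le> a t" shows "m \<le> 1"
proof -
 have "m*\<rho> t \<le> 1" for t
  using mult_right_mono[OF assms[of t] less_imp_le[OF ph.rho_pos[of t]]] a_rho(1)[of t] by simp
 hence "mean (\<lambda>t. m*\<rho> t) \<le> mean (\<lambda>_. 1)" by (intro mean_mono continuous_intros)
 thus ?thesis by (simp add: mean_cmult continuous_intros ph.mean_rho)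
qed

lemma upper_bound_ge_1:
 assumes "\<And>t. a t \<le> M" shows "1 \<le> M"
proof -
 have "1 \<le> M*\<rho> t" for t
  using mult_right_mono[OF assms[of t] less_imp_le[OF ph.rho_pos[of t]]] a_rho(1)[of t] by simp
 hence "mean (\<lambda>_. 1) \<le> mean (\<lambda>t. M*\<rho> t)" by (intro mean_mono continuous_intros)
 thus ?thesis by (simp add: mean_cmult continuous_intros ph.mean_rho)
qed

text \<open>The speed oscillates about its mean by at most the bound, and \<open>1\<close> lies between its extreme values.\<close>

lemma norm_fcoeff_0_diff_1_le:
 assumes \<epsilon>: "\<epsilon> > 0"
 shows "norm (fcoeff a 0 - 1) \<le> sobolev a N/\<epsilon> + \<epsilon>*(4*wt_sum)"
proof -
 define G where "G = sobolev a N/\<epsilon> + \<epsilon>*(4*wt_sum)"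
 define x where "x = Re (fcoeff a 0)"
 note osc = osc_bound[of 0 N, OF le0 \<epsilon>]
 have "\<bar>a t - x\<bar> \<le> G" for t
 proof -
  have "((\<lambda>k. fcoeff a k*fourier.e k t) has_sum of_real (a t)) UNIV"
   unfolding fcoeff_eq by (rule fourier.Fourier_inversion[OF circle_smooth_of_real[OF circle_smooth_a]])
  moreover have "((\<lambda>k::int. if k = 0 then - fcoeff a 0 else 0) has_sum - fcoeff a 0) UNIV"
   by (rule has_sum_finite_neutralI[of "{0}"]) auto
  ultimately have "((\<lambda>k. fcoeff a k*fourier.e k t + (if k = 0 then - fcoeff a 0 else 0)) has_sum of_real (a t) + - fcoeff a 0) UNIV"
   by (rule has_sum_add)
  hence "norm (of_real (a t) + - fcoeff a 0) \<le> infsum (osc 0) UNIV"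
   by (rule norm_infsum_le[OF _ has_sum_infsum[OF osc(1)]]) (simp add: osc_def norm_mult)
  also have "... \<le> G" unfolding G_def by (rule osc(2))
  also have "of_real (a t) + - fcoeff a 0 = complex_of_real (a t - x)" using fcoeff_0_real by (simp add: x_def)
  finally show ?thesis by (simp only: norm_of_real)
 qed
 hence "x - G \<le> a t" "a t \<le> x + G" for t by (simp_all add: abs_le_iff algebra_simps)
 hence "\<bar>x - 1\<bar> \<le> G" using lower_bound_le_1[of "x - G"] upper_bound_ge_1[of "x + G"] by auto
 moreover have "fcoeff a 0 - 1 = of_real (x - 1)" using fcoeff_0_real by (simp add: x_def)
 ultimately show ?thesis by (simp only: norm_of_real G_def)
qed

lemma Cm_norm_diff_1_le:
 assumes \<epsilon>: "\<epsilon> > 0"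
 shows "Cm_norm m (\<lambda>t. a t - 1) \<le> real (Suc m)*((1 + 2^m)*(sobolev a m/\<epsilon> + \<epsilon>*(4*wt_sum)))"
proof -
 let ?F = "\<lambda>t. complex_of_real (a t - 1)"
 have s: "circle_smooth (\<lambda>t. a t - 1)" by (intro circle_smooth_intros circle_smooth_a)
 have "fourier.cf ?F k = fcoeff a k - (if k = 0 then 1 else 0)" for k
  unfolding fcoeff_eq by (simp add: fourier.cf_diff fourier.cf_const continuous_intros continuous_a)
 from wiener_le_sobolev[OF this circle_smooth_of_real[OF s] order_refl \<epsilon>, of m]
 have "wiener m ?F \<le> (1 + 2^m)*(sobolev a m/\<epsilon> + \<epsilon>*(4*wt_sum))"
  using norm_fcoeff_0_diff_1_le[OF \<epsilon>, of m] unfolding distrib_right mult_1 by linarith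
 hence "real (Suc m)*wiener m ?F \<le> real (Suc m)*((1 + 2^m)*(sobolev a m/\<epsilon> + \<epsilon>*(4*wt_sum)))"
  by (intro mult_left_mono) auto
 with Cm_norm_le_wiener[OF s, of m] show ?thesis by linarith
qed

end

context flow
begin

lemma sobolev_decay:
 assumes "\<And>\<tau> t. \<tau> \<ge> 0 \<Longrightarrow> alpha \<tau> t \<ge> \<delta>" "\<delta> \<ge> 0" "\<tau> \<ge> 0"
 shows "sobolev (alpha \<tau>) N \<le> 4 * sobolev (alpha 0) N * exp (- 2 * \<delta> * \<tau>)"
proof -
 have "sobolev (alpha \<tau>) N \<le> energy N (alpha \<tau>)" by (intro sobolev_le_energy circle_smooth_alpha assms)
 also have "... \<le> exp (- 2*\<delta>*\<tau>)*energy N (alpha 0)" by (rule energy_decay[OF assms])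
 also have "... \<le> exp (- 2 * \<delta> * \<tau>) * (4 * sobolev (alpha 0) N)"
  by (intro mult_left_mono energy_le_sobolev circle_smooth_alpha) auto
 finally show ?thesis by (simp add: mult_ac)
qed

lemma sobolev_le_initial: "\<tau> \<ge> 0 \<Longrightarrow> sobolev (alpha \<tau>) N \<le> 4 * sobolev (alpha 0) N"
 using sobolev_decay[of 0 \<tau> N] pos by (simp add: less_imp_le)

theorem converges_to_1: "((\<lambda>\<tau>. Cm_norm m (\<lambda>t. alpha \<tau> t - 1)) \<longlongrightarrow> 0) at_top"
proof -
 obtain \<delta> where "\<delta> > 0" "\<And>a t. speed a \<Longrightarrow> sobolev a 0 \<le> 4 * sobolev (alpha 0) 0 \<Longrightarrow> a t \<ge> \<delta>"
  using speed_lower_bound by blast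
 hence \<delta>: "\<delta> > 0" "\<And>\<tau> t. \<tau> \<ge> 0 \<Longrightarrow> alpha \<tau> t \<ge> \<delta>" using speed_alpha sobolev_le_initial by blast+
 define S where "S = 4 * sobolev (alpha 0) m + 4 * wt_sum"
 define Q where "Q = real (Suc m)*((1 + 2^m)*S)"
 have bound: "norm (Cm_norm m (\<lambda>t. alpha \<tau> t - 1)) \<le> Q*exp (- \<delta>*\<tau>)" if \<tau>: "\<tau> \<ge> 0" for \<tau>
 proof -
  define \<epsilon> where "\<epsilon> = exp (- \<delta>*\<tau>)"
  have \<epsilon>: "\<epsilon> > 0" and square: "exp (- 2*\<delta>*\<tau>) = \<epsilon>*\<epsilon>" by (simp_all add: \<epsilon>_def flip: exp_add)
  have "sobolev (alpha \<tau>) m/\<epsilon> \<le> 4 * sobolev (alpha 0) m * (\<epsilon> * \<epsilon>)/\<epsilon>"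
   using sobolev_decay[OF \<delta>(2) less_imp_le[OF \<delta>(1)] \<tau>, of m] \<epsilon> unfolding square by (intro divide_right_mono) auto
  hence "sobolev (alpha \<tau>) m/\<epsilon> + \<epsilon>*(4*wt_sum) \<le> S*\<epsilon>" using \<epsilon> by (simp add: S_def algebra_simps)
  hence "real (Suc m)*((1 + 2^m)*(sobolev (alpha \<tau>) m/\<epsilon> + \<epsilon>*(4*wt_sum))) \<le> Q*\<epsilon>"
   unfolding Q_def mult.assoc by (intro mult_left_mono) auto
  moreover have "circle_smooth (\<lambda>t. alpha \<tau> t - 1)" by (intro circle_smooth_intros circle_smooth_alpha \<tau>)
  ultimately show ?thesis
   using speed.Cm_norm_diff_1_le[OF speed_alpha[OF \<tau>] \<epsilon>, of m] Cm_norm_nonneg by (fastforce simp: \<epsilon>_def)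
 qed
 have "((\<lambda>\<tau>. Q*exp (- \<delta>*\<tau>)) \<longlongrightarrow> 0) at_top" using \<delta>(1) by real_asymp
 thus ?thesis by (intro Lim_null_comparison[OF eventually_mono[OF eventually_ge_at_top[of 0] bound]]) simp_all
qed

end

definition derivative_bound :: "nat \<Rightarrow> nat \<Rightarrow> (nat \<Rightarrow> real) \<Rightarrow> real \<Rightarrow> bool" where
 "derivative_bound k m c B \<longleftrightarrow> (\<forall>alpha dalpha. flow alpha dalpha \<longrightarrow> Re (fcoeff (alpha 0) 0) \<le> c 0 \<longrightarrow>
  (\<forall>i\<le>k + m. Re (zeta (alpha 0) (- of_nat (2*Suc i))) \<le> c (i + 2)) \<longrightarrow> (\<forall>\<tau>\<ge>0. Cm_norm m (dalpha k \<tau>) \<le> B))"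

lemma derivative_bound_exists: "\<exists>B. derivative_bound k m c B"
proof -
 define N where "N = k + m"
 obtain H where H: "\<And>a. speed a \<Longrightarrow> Re (fcoeff a 0) \<le> c 0 \<Longrightarrow> (\<forall>i\<le>N. Re (zeta a (- of_nat (2*Suc i))) \<le> c (i + 2)) \<Longrightarrow> sobolev a N \<le> H"
  using zeta_controls_sobolev[of "c 0" N "\<lambda>i. c (i + 2)"] by blast
 define B where "B = c 0 + 2^N*(4*H + 4*wt_sum)"
 obtain C where C: "\<And>alpha dalpha \<tau>. flow alpha dalpha \<Longrightarrow> (\<forall>\<tau>\<ge>0. wiener N (flow.cdalpha dalpha 0 \<tau>) \<le> B)
   \<Longrightarrow> \<tau> \<ge> 0 \<Longrightarrow> wiener m (flow.cdalpha dalpha k \<tau>) \<le> C"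
  using wiener_cdalpha_bound[of k m B] unfolding N_def by blast
 have "Cm_norm m (dalpha k \<tau>) \<le> real (Suc m)*C"
  if f: "flow alpha dalpha" and c0: "Re (fcoeff (alpha 0) 0) \<le> c 0"
   and zeta: "\<forall>i\<le>k + m. Re (zeta (alpha 0) (- of_nat (2*Suc i))) \<le> c (i + 2)" and \<tau>: "\<tau> \<ge> 0" for alpha dalpha \<tau>
 proof -
  interpret flow alpha dalpha by (rule f)
  have initial: "sobolev (alpha 0) N \<le> H" using c0 zeta by (intro H speed_alpha) (auto simp: N_def)
  have "wiener N (cdalpha 0 x) \<le> B" if x: "x \<ge> 0" for x
  proof -
   interpret s: speed "alpha x" by (rule speed_alpha[OF x])
   have "wiener N (cdalpha 0 x) \<le> norm (fcoeff (alpha x) 0 - 0) + 2^N*(sobolev (alpha x) N/1 + 1*(4*wt_sum))"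
    by (rule s.wiener_le_sobolev[OF _ circle_smooth_cdalpha[OF x] order_refl]) (auto simp: cf_cdalpha)
   also have "norm (fcoeff (alpha x) 0 - 0) \<le> c 0" using s.norm_fcoeff_le[of 0] mean_value_decreasing[OF x] c0 by simp
   also have "2^N*(sobolev (alpha x) N/1 + 1*(4*wt_sum)) \<le> 2^N*(4*H + 4*wt_sum)"
    using sobolev_le_initial[OF x, of N] initial by (intro mult_left_mono) auto
   finally show ?thesis by (simp add: B_def)
  qed
  hence "real (Suc m)*wiener m (cdalpha k \<tau>) \<le> real (Suc m)*C" by (intro mult_left_mono C[OF f _ \<tau>]) auto
  thus ?thesis using Cm_norm_le_wiener[OF circle_smooth_dalpha[OF \<tau>, of k], of m] unfolding cdalpha_def[abs_def] by linarith
 qed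
 thus ?thesis unfolding derivative_bound_def by blast
qed

lemma derivative_bound_cong:
 "\<forall>i\<le>k + m + 2. c i = c' i \<Longrightarrow> derivative_bound k m c = derivative_bound k m c'"
 by (auto simp: derivative_bound_def fun_eq_iff)

theorem theorem6p3:
  "(\<exists>C :: nat \<Rightarrow> nat \<Rightarrow> (nat \<Rightarrow> real) \<Rightarrow> real.
      (\<forall>k m c c'. (\<forall>i\<le>k+m+2. c i = c' i) \<longrightarrow> C k m c = C k m c') \<and>
      (\<forall>a alpha dalpha c.
         smooth_S a \<and> (\<forall>t. a t > 0) \<and> integral {0..2*pi} (\<lambda>t. 1 / a t) = 2*pi \<and>
         tau_derivs alpha dalpha \<and> alpha 0 = a \<and> (\<forall>\<tau>\<ge>0. \<forall>t. alpha \<tau> t > 0) \<and>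
         (\<forall>\<tau>\<ge>0. \<forall>t. complex_of_real (dalpha 1 \<tau> t) =
             - complex_of_real (alpha \<tau> t) * Lambda (alpha \<tau>) t + Hilb (alpha \<tau>) t * Dop (alpha \<tau>) t) \<and>
         (\<forall>i. c i > 0) \<and> Re (fcoeff a 0) \<le> c 0 \<and> Re (zeta a (-1)) \<le> c 1 \<and>
         (\<forall>m\<ge>1. Re (zeta a (- of_nat (2*m))) \<le> c (m+1))
         \<longrightarrow> (\<forall>k m \<tau>. \<tau> \<ge> 0 \<longrightarrow> Cm_norm m (dalpha k \<tau>) \<le> C k m c))) \<and>
   (\<forall>a alpha dalpha.
         smooth_S a \<and> (\<forall>t. a t > 0) \<and> integral {0..2*pi} (\<lambda>t. 1 / a t) = 2*pi \<and>
         tau_derivs alpha dalpha \<and> alpha 0 = a \<and> (\<forall>\<tau>\<ge>0. \<forall>t. alpha \<tau> t > 0) \<and>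
         (\<forall>\<tau>\<ge>0. \<forall>t. complex_of_real (dalpha 1 \<tau> t) =
             - complex_of_real (alpha \<tau> t) * Lambda (alpha \<tau>) t + Hilb (alpha \<tau>) t * Dop (alpha \<tau>) t)
         \<longrightarrow> (\<forall>m. ((\<lambda>\<tau>. Cm_norm m (\<lambda>t. alpha \<tau> t - 1)) \<longlongrightarrow> 0) at_top))"
proof -
 define C where "C k m c = (SOME B. derivative_bound k m c B)" for k m c
 have C: "derivative_bound k m c (C k m c)" for k m c unfolding C_def by (rule someI_ex[OF derivative_bound_exists])
 show ?thesis
 proof (intro conjI exI[of _ C] allI impI, goal_cases)
  case (1 k m c c')
  thus ?case unfolding C_def using derivative_bound_cong[of k m c c'] by simp
 next
  case (2 a alpha dalpha c k m \<tau>)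
  hence "flow alpha dalpha" "Re (fcoeff (alpha 0) 0) \<le> c 0" "\<tau> \<ge> 0" unfolding flow_def by auto
  moreover have "Re (zeta (alpha 0) (- of_nat (2*m))) \<le> c (m + 1)" if "m \<ge> 1" for m using 2 that by auto
  from this[of "Suc _"] have "\<forall>i\<le>k + m. Re (zeta (alpha 0) (- of_nat (2*Suc i))) \<le> c (i + 2)" by simp
  ultimately show ?case using C[of k m c] unfolding derivative_bound_def by blast
 next
  case (3 a alpha dalpha m)
  hence "flow alpha dalpha" unfolding flow_def by auto
  thus ?case by (rule flow.converges_to_1)
 qed
qed

end
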